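(* Assume that $\lambda<0$, and let $U_+$ denote the unique ground state solution of $(P_\lambda)$. Then: 1. $(P_\lambda)$ has at most one positive solution (a solution $u$ with $u>0$ in $\Omega$), and if a positive solution exists it is $U_+$. 2. If $\Omega_a^+:=\{x\in\Omega:a(x)>0\}$ is connected, then $U_+$ is the unique nontrivial solution of $(P_\lambda)$.
   Context: Setting: $\Omega\subset\mathbb{R}^N$ ($N\ge 1$) is a smooth bounded domain, $1<q<p$, $\lambda\in\mathbb{R}$, and $a\in C(\overline\Omega)$ changes sign. Fix one of two boundary conditions: Dirichlet ($\mathbf{B}u=u$), with $X=W_0^{1,p}(\Omega)$, or Neumann ($\mathbf{B}u=\partial_\nu u$), with $X=W^{1,p}(\Omega)$; the result holds in both cases. The problem $(P_\lambda)$ is $$-\Delta_p u=\lambda u^{p-1}+a(x)u^{q-1}\ \text{ in }\Omega,\qquad u\ge 0\ \text{ in }\Omega,\qquad \mathbf{B}u=0\ \text{ on }\partial\Omega .$$ Its energy functional is $I_\lambda(u)=\int_\Omega\left(\frac1p|\nabla u|^p-\frac{\lambda}{p}|u|^p-\frac1q a(x)|u|^q\right)$ for $u\in X$. A solution of $(P_\lambda)$ is a nonnegative critical point $u\in X$ of $I_\lambda$, i.e. $u\ge0$ and $\int_\Omega|\nabla u|^{p-2}\nabla u\cdot\nabla\phi=\int_\Omega(\lambda u^{p-1}+a u^{q-1})\phi$ for all $\phi\in X$; such solutions belong to $C^{1,\alpha}(\overline\Omega)$ for some $\alpha\in(0,1)$, so pointwise statements refer to the continuous representative. A ground state solution is a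 solution $u$ such that $I_\lambda(u)\le I_\lambda(v)$ for every solution $v$ of $(P_\lambda)$. For $\lambda<0$ the problem $(P_\lambda)$ has exactly one ground state solution, denoted $U_+$; it is the unique nonnegative global minimizer of $I_\lambda$. *)

theory Defs
  imports "HOL-Analysis.Analysis"
begin

section \<open>Smooth functions and smooth bounded domains\<close>

text \<open>\<open>Ck_on k S f\<close> is meant for open \<open>S\<close>.\<close>

primrec Ck_on :: "nat \<Rightarrow> 'a::euclidean_space set \<Rightarrow> ('a \<Rightarrow> real) \<Rightarrow> bool" where
  "Ck_on 0 S f \<longleftrightarrow> continuous_on S f"
| "Ck_on (Suc k) S f \<longleftrightarrow>
     (\<forall>x\<in>S. f differentiable (at x)) \<and> (\<forall>v. Ck_on k S (\<lambda>x. frechet_derivative f (at x) v))"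

definition smooth_on :: "'a::euclidean_space set \<Rightarrow> ('a \<Rightarrow> real) \<Rightarrow> bool" where
  "smooth_on S f \<longleftrightarrow> (\<forall>k. Ck_on k S f)"

text \<open>The set lies, near each boundary point, strictly on one side of the graph of a smooth
  function: with \<open>e\<close> as the last coordinate direction, the remaining coordinates of \<open>x\<close> are
  those of its projection \<open>x - (x \<bullet> e) *\<^sub>R e\<close> onto the hyperplane orthogonal to \<open>e\<close>.\<close>

definition smooth_boundary :: "'a::euclidean_space set \<Rightarrow> bool" where
  "smooth_boundary \<Omega> \<longleftrightarrow>
     (\<forall>z \<in> frontier \<Omega>. \<exists>r>0. \<exists>e \<gamma>. norm e = 1 \<and> smooth_on UNIV \<gamma> \<and>
        \<Omega> \<inter> ball z r = {x \<in> ball z r. x \<bullet> e > \<gamma> (x - (x \<bullet> e) *\<^sub>R e)})"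

definition smooth_bounded_domain :: "'a::euclidean_space set \<Rightarrow> bool" where
  "smooth_bounded_domain \<Omega> \<longleftrightarrow>
     open \<Omega> \<and> connected \<Omega> \<and> \<Omega> \<noteq> {} \<and> bounded \<Omega> \<and> smooth_boundary \<Omega>"

section \<open>Sobolev spaces\<close>

text \<open>Elements of function spaces are represented by total functions of which only the values
  on \<open>\<Omega>\<close>, up to Lebesgue null sets, matter. Two representatives denote the same element iff
  they agree almost everywhere on \<open>\<Omega>\<close>.\<close>

definition test_functions :: "'a::euclidean_space set \<Rightarrow> ('a \<Rightarrow> real) set" where
  "test_functions \<Omega> =
     {\<phi>. smooth_on UNIV \<phi> \<and> compact (closure {x. \<phi> x \<noteq> 0}) \<and> closure {x. \<phi> x \<noteq> 0} \<subseteq> \<Omega>}"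

definition locally_integrable ::
  "'a::euclidean_space set \<Rightarrow> ('a \<Rightarrow> 'b::{banach, second_countable_topology}) \<Rightarrow> bool" where
  "locally_integrable \<Omega> f \<longleftrightarrow> (\<forall>K. compact K \<and> K \<subseteq> \<Omega> \<longrightarrow> integrable (lebesgue_on K) f)"

definition Lp_space ::
  "'a::euclidean_space set \<Rightarrow> real \<Rightarrow> ('a \<Rightarrow> 'b::{real_normed_vector, second_countable_topology}) set"
  where
  "Lp_space \<Omega> p = {f. f \<in> borel_measurable (lebesgue_on \<Omega>) \<and>
                     integrable (lebesgue_on \<Omega>) (\<lambda>x. norm (f x) powr p)}"

definition has_weak_gradient ::
  "'a::euclidean_space set \<Rightarrow> ('a \<Rightarrow> real) \<Rightarrow> ('a \<Rightarrow> 'a) \<Rightarrow> bool" where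
  "has_weak_gradient \<Omega> u G \<longleftrightarrow> locally_integrable \<Omega> u \<and> locally_integrable \<Omega> G \<and>
     (\<forall>\<phi> \<in> test_functions \<Omega>. \<forall>i \<in> Basis.
        (LINT x|lebesgue_on \<Omega>. u x * frechet_derivative \<phi> (at x) i) =
        - (LINT x|lebesgue_on \<Omega>. (G x \<bullet> i) * \<phi> x))"

text \<open>A weak gradient is unique up to null sets, so the choice is immaterial under integrals.\<close>

definition weak_gradient :: "'a::euclidean_space set \<Rightarrow> ('a \<Rightarrow> real) \<Rightarrow> 'a \<Rightarrow> 'a" where
  "weak_gradient \<Omega> u = (SOME G. has_weak_gradient \<Omega> u G)"

definition W1p :: "'a::euclidean_space set \<Rightarrow> real \<Rightarrow> ('a \<Rightarrow> real) set" where
  "W1p \<Omega> p = {u \<in> Lp_space \<Omega> p. \<exists>G \<in> Lp_space \<Omega> p. has_weak_gradient \<Omega> u G}"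

definition W1p_norm :: "'a::euclidean_space set \<Rightarrow> real \<Rightarrow> ('a \<Rightarrow> real) \<Rightarrow> real" where
  "W1p_norm \<Omega> p u =
     ((LINT x|lebesgue_on \<Omega>. \<bar>u x\<bar> powr p) +
      (LINT x|lebesgue_on \<Omega>. norm (weak_gradient \<Omega> u x) powr p)) powr (1 / p)"

definition W1p_0 :: "'a::euclidean_space set \<Rightarrow> real \<Rightarrow> ('a \<Rightarrow> real) set" where
  "W1p_0 \<Omega> p =
     {u \<in> W1p \<Omega> p. \<forall>\<epsilon>>0. \<exists>\<phi> \<in> test_functions \<Omega>. W1p_norm \<Omega> p (\<lambda>x. u x - \<phi> x) < \<epsilon>}"

section \<open>The boundary value problem\<close>

datatype boundary_condition = Dirichlet | Neumann

fun energy_space :: "boundary_condition \<Rightarrow> 'a::euclidean_space set \<Rightarrow> real \<Rightarrow> ('a \<Rightarrow> real) set" where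
  "energy_space Dirichlet \<Omega> p = W1p_0 \<Omega> p"
| "energy_space Neumann \<Omega> p = W1p \<Omega> p"

definition energy ::
  "'a::euclidean_space set \<Rightarrow> real \<Rightarrow> real \<Rightarrow> real \<Rightarrow> ('a \<Rightarrow> real) \<Rightarrow> ('a \<Rightarrow> real) \<Rightarrow> real" where
  "energy \<Omega> p q l a u =
     (LINT x|lebesgue_on \<Omega>. (1 / p) * norm (weak_gradient \<Omega> u x) powr p
        - (l / p) * \<bar>u x\<bar> powr p - (1 / q) * a x * \<bar>u x\<bar> powr q)"

text \<open>Where the weak gradient vanishes, \<open>|\<nabla>u|\<^sup>p\<^sup>-\<^sup>2 \<nabla>u\<close> is \<open>0\<close>, also for \<open>p < 2\<close>.\<close>

definition is_solution ::
  "boundary_condition \<Rightarrow> 'a::euclidean_space set \<Rightarrow> real \<Rightarrow> real \<Rightarrow> real \<Rightarrow> ('a \<Rightarrow> real) \<Rightarrow>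
   ('a \<Rightarrow> real) \<Rightarrow> bool" where
  "is_solution bc \<Omega> p q l a u \<longleftrightarrow>
     u \<in> energy_space bc \<Omega> p \<and> (AE x in lebesgue_on \<Omega>. u x \<ge> 0) \<and>
     (\<forall>\<phi> \<in> energy_space bc \<Omega> p.
        (LINT x|lebesgue_on \<Omega>. norm (weak_gradient \<Omega> u x) powr (p - 2) *
            (weak_gradient \<Omega> u x \<bullet> weak_gradient \<Omega> \<phi> x)) =
        (LINT x|lebesgue_on \<Omega>. (l * u x powr (p - 1) + a x * u x powr (q - 1)) * \<phi> x))"

text \<open>Positivity holds at every point of \<open>\<Omega>\<close> and refers to the continuous representative \<open>w\<close>.\<close>

definition positive_solution ::
  "boundary_condition \<Rightarrow> 'a::euclidean_space set \<Rightarrow> real \<Rightarrow> real \<Rightarrow> real \<Rightarrow> ('a \<Rightarrow> real) \<Rightarrow>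
   ('a \<Rightarrow> real) \<Rightarrow> bool" where
  "positive_solution bc \<Omega> p q l a u \<longleftrightarrow> is_solution bc \<Omega> p q l a u \<and>
     (\<exists>w. continuous_on (closure \<Omega>) w \<and> (AE x in lebesgue_on \<Omega>. u x = w x) \<and> (\<forall>x\<in>\<Omega>. w x > 0))"

definition nontrivial_solution ::
  "boundary_condition \<Rightarrow> 'a::euclidean_space set \<Rightarrow> real \<Rightarrow> real \<Rightarrow> real \<Rightarrow> ('a \<Rightarrow> real) \<Rightarrow>
   ('a \<Rightarrow> real) \<Rightarrow> bool" where
  "nontrivial_solution bc \<Omega> p q l a u \<longleftrightarrow>
     is_solution bc \<Omega> p q l a u \<and> \<not> (AE x in lebesgue_on \<Omega>. u x = 0)"

definition ground_state_solution ::
  "boundary_condition \<Rightarrow> 'a::euclidean_space set \<Rightarrow> real \<Rightarrow> real \<Rightarrow> real \<Rightarrow> ('a \<Rightarrow> real) \<Rightarrow>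
   ('a \<Rightarrow> real) \<Rightarrow> bool" where
  "ground_state_solution bc \<Omega> p q l a u \<longleftrightarrow> is_solution bc \<Omega> p q l a u \<and>
     (\<forall>v. is_solution bc \<Omega> p q l a v \<longrightarrow> energy \<Omega> p q l a u \<le> energy \<Omega> p q l a v)"

end

theory Submission
  imports Defs
begin

text \<open>
  For a solution \<open>u\<close> put \<open>H(u) = \<integral> |\<nabla>u|\<^sup>p - \<lambda> |u|\<^sup>p\<close>; then \<open>H(u) = \<integral> a u\<^sup>q\<close> and
  \<open>I(u) = - (1/q - 1/p) H(u)\<close>. If \<open>u\<close> vanishes at most where \<open>a \<le> 0\<close>, testing its equation with
  \<open>v\<^sup>q / u\<^sup>q\<^sup>-\<^sup>1\<close> and using Picone's inequality and Young's inequality gives \<open>H(v) \<le> H(u)\<close> for every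
  solution \<open>v\<close>, with equality only for \<open>v = u\<close>. A ground state maximizes \<open>H\<close> among solutions, so it is equal
  to every such \<open>u\<close>. If \<open>{a > 0}\<close> is connected, the strong maximum principle, in its almost everywhere form,
  shows that every nontrivial solution is of this kind. The ground state is nontrivial because \<open>I\<close>
  attains its negative minimum: \<open>I\<close> is convex along \<open>((u\<^sup>q + v\<^sup>q)/2)\<^sup>1\<^sup>/\<^sup>q\<close>, which makes minimizing
  sequences converge strongly, without any compact embedding.
\<close>

text \<open>Solutions are handled as mere Sobolev functions, so all statements are made almost
  everywhere, and \<open>v^q / u^(q-1)\<close> is no admissible test function: \<open>u\<close> may
  vanish and \<open>v\<close> may be unbounded. Both defects are repaired by replacing
  \<open>u\<close> with \<open>u + e\<close> and truncating \<open>v\<close>; the limit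
  \<open>e -> 0\<close> is taken under dominated integrals. On \<open>{u = 0}\<close> the
  regularized terms are 0 while the limit should contain \<open>a v^q\<close>; there the sign
  \<open>a <= 0\<close> settles the inequality. Young's inequality with weights (p-q)/p and q/p
  gives H(v) <= (p-q)/p H(u) + q/p H(v), whence H(v) <= H(u). The sign \<lambda> < 0 makes the
  zero-order part of H positive: this yields v = u in the equality case, and coercivity of I also
  under the Neumann condition. The test functions are compositions f(u, v) of two functions of X
  with bounded derivative of f, so a chain rule in two variables, proved by difference quotients, is
  the central tool. For the Dirichlet condition each composition must in addition be approximated by
  test functions, and real powers force the approximants of u and v to be nonnegative.\<close>

text \<open>The unqualified names denote the facts on Henstock-Kurzweil integrals.\<close>

lemmas B_integrable_bound = Bochner_Integration.integrable_bound
  and B_integral_cong = Bochner_Integration.integral_cong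
  and B_integral_diff = Bochner_Integration.integral_diff
  and B_integrable_diff = Bochner_Integration.integrable_diff
  and B_integrable_add = Bochner_Integration.integrable_add
  and B_integral_add = Bochner_Integration.integral_add
  and B_integral_nonneg = Bochner_Integration.integral_nonneg
  and B_integral_mono = Bochner_Integration.integral_mono

section \<open>Smooth functions\<close>

lemma frechet_derivative_eqI:
  "(f has_derivative f') (at x) ==> frechet_derivative f (at x) v = f' v"
  by (metis frechet_derivative_at)

lemma Ck_on_frechet_derivative:
  "Ck_on (Suc k) S f ==> Ck_on k S (%x. frechet_derivative f (at x) v)"
  by (simp only: Ck_on.simps)

lemma Ck_on_continuous: "Ck_on k S f ==> continuous_on S f"
proof (cases k)
  case (Suc j)
  assume "Ck_on k S f"
  then have "\<forall>x\<in>S. f differentiable (at x within S)"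
    using Suc by (auto intro: differentiable_at_withinI)
  then show ?thesis
    by (meson differentiable_imp_continuous_on differentiable_on_def)
qed simp

lemma Ck_on_Suc_imp: "Ck_on (Suc k) S f ==> Ck_on k S f"
proof (induction k arbitrary: f)
  case 0
  then show ?case using Ck_on_continuous by fastforce
next
  case (Suc k)
  then show ?case by (simp del: Ck_on.simps(2) add: Ck_on.simps(2)[of "Suc k"] Ck_on.simps(2)[of k S f])
qed

lemma Ck_on_const: "Ck_on k UNIV (%x. c)"
  by (induction k arbitrary: c) (auto simp: frechet_derivative_eqI[OF has_derivative_const])

text \<open>An explicit derivative replaces \<open>frechet_derivative\<close>, which is defined by
  choice; the closure properties below go through this rule.\<close>

lemma Ck_on_SucI:
  assumes "!!x. (f has_derivative (%v. f' v x)) (at x)" and "!!v. Ck_on k UNIV (f' v)"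
  shows "Ck_on (Suc k) UNIV f"
proof -
  have "frechet_derivative f (at x) v = f' v x" for x v
    using assms(1)[of x] by (rule frechet_derivative_eqI)
  moreover have "f differentiable (at x)" for x
    using assms(1) unfolding differentiable_def by blast
  ultimately show ?thesis using assms(2) by simp
qed

lemma Ck_on_has_derivative:
  "Ck_on (Suc k) UNIV f ==> (f has_derivative (%v. frechet_derivative f (at x) v)) (at x)"
  using frechet_derivative_works[of f "at x"] by simp

lemma Ck_on_inner: "Ck_on k UNIV (%x. x \<bullet> v)"
proof (cases k)
  case (Suc j)
  have "((%x. x \<bullet> v) has_derivative (%w. w \<bullet> v)) (at x)" for x
    by (auto intro!: derivative_eq_intros)
  then show ?thesis
    unfolding Suc by (rule Ck_on_SucI) (rule Ck_on_const)
qed (simp add: continuous_on_inner)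

lemma Ck_on_add: "Ck_on k UNIV f ==> Ck_on k UNIV g ==> Ck_on k UNIV (%x. f x + g x)"
proof (induction k arbitrary: f g)
  case 0
  then show ?case by (simp add: continuous_on_add)
next
  case (Suc k)
  have 2: "Ck_on k UNIV (%x. frechet_derivative f (at x) v)"
     "Ck_on k UNIV (%x. frechet_derivative g (at x) v)" for v
    by (intro Ck_on_frechet_derivative Suc.prems)+
  have "((%x. f x + g x) has_derivative
      (%v. frechet_derivative f (at x) v + frechet_derivative g (at x) v)) (at x)" for x
    by (intro has_derivative_add Ck_on_has_derivative[OF Suc.prems(1)] Ck_on_has_derivative[OF Suc.prems(2)])
  then show ?case
    by (rule Ck_on_SucI) (intro Suc.IH 2)
qed

lemma Ck_on_mult: "Ck_on k UNIV f ==> Ck_on k UNIV g ==> Ck_on k UNIV (%x. f x * g x)"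
proof (induction k arbitrary: f g)
  case 0
  then show ?case by (simp add: continuous_on_mult)
next
  case (Suc k)
  have 1: "Ck_on k UNIV f" "Ck_on k UNIV g" using Suc.prems by (auto intro: Ck_on_Suc_imp simp del: Ck_on.simps)
  have 2: "Ck_on k UNIV (%x. frechet_derivative f (at x) v)"
     "Ck_on k UNIV (%x. frechet_derivative g (at x) v)" for v
    by (intro Ck_on_frechet_derivative Suc.prems)+
  have "((%x. f x * g x) has_derivative
      (%v. f x * frechet_derivative g (at x) v + frechet_derivative f (at x) v * g x)) (at x)" for x
    by (intro has_derivative_mult Ck_on_has_derivative[OF Suc.prems(1)] Ck_on_has_derivative[OF Suc.prems(2)])
  then show ?case
    by (rule Ck_on_SucI) (intro Ck_on_add Suc.IH 1 2)
qed

text \<open>The outer function comes as the whole sequence \<open>d\<close> of its derivatives, and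
  the claim is made for every \<open>j\<close>, because differentiating \<open>d j (f x)\<close>
  produces \<open>d (Suc j) (f x)\<close>. The set \<open>J\<close> contains the values of
  \<open>f\<close>, so that functions smooth only on part of the line, such as powers on the
  positive half-line, are covered.\<close>

lemma Ck_on_compose:
  fixes f :: "'a::euclidean_space => real" and d :: "nat => real => real"
  assumes d: "!!j y. y \<in> J ==> (d j has_real_derivative d (Suc j) y) (at y)"
  shows "(!!x. f x \<in> J) ==> Ck_on k UNIV f ==> Ck_on k UNIV (%x. d j (f x))"
proof (induction k arbitrary: f j)
  case 0
  have "isCont (d j) y" if "y \<in> J" for y using d[OF that] by (rule DERIV_isCont)
  moreover have "isCont f x" for x using 0 by (simp add: continuous_on_eq_continuous_at)
  ultimately have "isCont (%x. d j (f x)) x" for x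
    using 0(1) isCont_o2 by blast
  then show ?case by (simp add: continuous_on_eq_continuous_at)
next
  case (Suc k)
  have *: "Ck_on k UNIV (%x. frechet_derivative f (at x) v)" for v
    by (intro Ck_on_frechet_derivative Suc.prems)
  have "((%x. d j (f x)) has_derivative (%v. d (Suc j) (f x) * frechet_derivative f (at x) v)) (at x)" for x
    using has_derivative_compose[OF Ck_on_has_derivative[OF Suc.prems(2)], of "d j" "(*) (d (Suc j) (f x))" x]
      d[OF Suc.prems(1), of j x]
    by (simp add: has_field_derivative_def)
  then show ?case
    by (rule Ck_on_SucI[where f' = "%v x. d (Suc j) (f x) * frechet_derivative f (at x) v"])
      (rule Ck_on_mult[OF Suc.IH[OF Suc.prems(1) Ck_on_Suc_imp[OF Suc.prems(2)]] *])
qed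

lemma smooth_on_const: "smooth_on UNIV (%x. c)"
  and smooth_on_inner: "smooth_on UNIV (%x. x \<bullet> v)"
  and smooth_on_add: "smooth_on UNIV f ==> smooth_on UNIV g ==> smooth_on UNIV (%x. f x + g x)"
  and smooth_on_mult: "smooth_on UNIV f ==> smooth_on UNIV g ==> smooth_on UNIV (%x. f x * g x)"
  by (auto simp: smooth_on_def Ck_on_const Ck_on_inner Ck_on_add Ck_on_mult)

lemma smooth_on_uminus: "smooth_on UNIV f ==> smooth_on UNIV (%x. - f x)"
  using smooth_on_mult[OF smooth_on_const[of "-1"]] by simp

lemma smooth_on_diff: "smooth_on UNIV f ==> smooth_on UNIV g ==> smooth_on UNIV (%x. f x - g x)"
  using smooth_on_add[OF _ smooth_on_uminus] by force

lemma smooth_on_prod: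
  "finite I ==> (!!i. i \<in> I ==> smooth_on UNIV (f i)) ==> smooth_on UNIV (%x. \<Prod>i\<in>I. f i x)"
  by (induction I rule: finite_induct) (auto intro: smooth_on_const smooth_on_mult)

lemma smooth_on_power: "smooth_on UNIV f ==> smooth_on UNIV (%x. f x ^ n)"
  by (induction n) (auto intro: smooth_on_const smooth_on_mult)

lemma smooth_on_compose:
  assumes "!!j y. y \<in> J ==> (d j has_real_derivative d (Suc j) y) (at y)"
    and "!!x. f x \<in> J" and "smooth_on UNIV f"
  shows "smooth_on UNIV (%x. d j (f x))"
  using assms Ck_on_compose[of J d f] by (simp add: smooth_on_def)

lemma smooth_on_exp: "smooth_on UNIV f ==> smooth_on UNIV (%x. exp (f x))"
  by (rule smooth_on_compose[where d = "%j. exp" and J = UNIV])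
    (auto intro!: derivative_eq_intros)

lemma smooth_on_powr:
  assumes "!!x. f x > 0" and "smooth_on UNIV f"
  shows "smooth_on UNIV (%x. f x powr r)"
proof -
  have "smooth_on UNIV (%x. (\<Prod>i<(0::nat). r - real i) * f x powr (r - real 0))"
  proof (rule smooth_on_compose[where d = "%j y. (\<Prod>i<j. r - real i) * y powr (r - real j)" and J = "{0<..}"])
    fix j and y :: real assume "y \<in> {0<..}"
    then show "((%y. (\<Prod>i<j. r - real i) * y powr (r - real j)) has_real_derivative
         (\<Prod>i<Suc j. r - real i) * y powr (r - real (Suc j))) (at y)"
      by (auto intro!: derivative_eq_intros simp: algebra_simps)
  qed (use assms in auto)
  then show ?thesis by simp
qed

lemma smooth_on_translation:
  assumes "smooth_on UNIV f" shows "smooth_on UNIV (%x. f (x + c))"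
proof -
  have "Ck_on k UNIV f ==> Ck_on k UNIV (%x. f (x + c))" for k
  proof (induction k arbitrary: f)
    case 0
    then show ?case
      by (simp add: continuous_on_compose2[of UNIV f] continuous_on_add)
  next
    case (Suc k)
    have "((%x. f (x + c)) has_derivative (%v. frechet_derivative f (at (x + c)) v)) (at x)" for x
      using has_derivative_compose[of "%x. x + c" "%v. v" x UNIV f, OF _ Ck_on_has_derivative[OF Suc.prems]]
        has_derivative_add_const[OF has_derivative_ident, of c "at x"] by simp
    moreover have "Ck_on k UNIV (%x. frechet_derivative f (at x) v)" for v
      by (intro Ck_on_frechet_derivative Suc.prems)
    ultimately show ?case
      by (intro Ck_on_SucI[where f' = "%v x. frechet_derivative f (at (x + c)) v"] Suc.IH)
  qed
  then show ?thesis using assms by (simp add: smooth_on_def)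
qed

lemma smooth_on_has_derivative:
  "smooth_on UNIV f ==> (f has_derivative (%v. frechet_derivative f (at x) v)) (at x)"
  unfolding smooth_on_def using Ck_on_has_derivative by blast

lemma smooth_on_continuous: "smooth_on UNIV f ==> continuous_on UNIV f"
  unfolding smooth_on_def using Ck_on_continuous by blast

lemma smooth_on_continuous_derivative:
  "smooth_on UNIV f ==> continuous_on UNIV (%x. frechet_derivative f (at x) v)"
  unfolding smooth_on_def using Ck_on_continuous Ck_on_frechet_derivative by blast

section \<open>Bump functions\<close>

text \<open>The functions P(1/t) exp(-1/t) for t > 0, continued by 0, form a family that contains
  exp(-1/t) and is closed under differentiation: P is sent to X^2 (P - P'). Indexing by the
  polynomial lists all derivatives at once.\<close>

definition flat_derivative :: "real poly => real => real" where
  "flat_derivative P t = (if t > 0 then poly P (1 / t) * exp (- (1 / t)) else 0)"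

lemma tendsto_poly_div_exp_0: "((%x::real. poly P x / exp x) \<longlongrightarrow> 0) at_top"
proof -
  have "((%x. \<Sum>i\<le>degree P. coeff P i * (x ^ i / exp x)) \<longlongrightarrow> (\<Sum>i\<le>degree P. coeff P i * 0)) at_top"
    by (intro tendsto_intros tendsto_power_div_exp_0)
  then show ?thesis by (simp add: poly_altdef sum_divide_distrib)
qed

lemma DERIV_flat_derivative:
  "(flat_derivative P has_real_derivative flat_derivative ([:0, 0, 1:] * (P - pderiv P)) t) (at t)"
proof (cases "t = 0")
  case False
  show ?thesis
  proof (cases "t > 0")
    case True
    have "((%t. poly P (1 / t) * exp (- (1 / t))) has_real_derivative
        flat_derivative ([:0, 0, 1:] * (P - pderiv P)) t) (at t)"
      using True by (auto intro!: derivative_eq_intros poly_DERIV[THEN DERIV_chain2]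
          simp: flat_derivative_def field_simps power2_eq_square)
    then show ?thesis
      by (rule has_field_derivative_transform_within_open[where S = "{0<..}"])
        (use True in \<open>auto simp: flat_derivative_def\<close>)
  next
    case neg: False
    have "((%t. 0) has_real_derivative flat_derivative ([:0, 0, 1:] * (P - pderiv P)) t) (at t)"
      using neg by (simp add: flat_derivative_def)
    then show ?thesis
      by (rule has_field_derivative_transform_within_open[where S = "{..<0}"])
        (use neg False in \<open>auto simp: flat_derivative_def\<close>)
  qed
next
  case True
  have "((%y. (flat_derivative P y - flat_derivative P 0) / (y - 0)) \<longlongrightarrow> 0) (at_right 0)"
  proof -
    \<comment> \<open>The difference quotient at 0 is (1/y) P(1/y) exp(-1/y);
      \<open>pCons 0 P\<close> is the polynomial X P, and exponential decay beats it.\<close>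
    have "((%y::real. poly (pCons 0 P) (inverse y) / exp (inverse y)) \<longlongrightarrow> 0) (at_right 0)"
      by (rule filterlim_compose[OF tendsto_poly_div_exp_0 filterlim_inverse_at_top_right])
    then show ?thesis
      by (rule Lim_transform_eventually)
        (auto simp: flat_derivative_def eventually_at_filter exp_minus field_simps)
  qed
  moreover have "((%y. (flat_derivative P y - flat_derivative P 0) / (y - 0)) \<longlongrightarrow> 0) (at_left 0)"
    by (rule tendsto_eventually) (auto simp: flat_derivative_def eventually_at_filter)
  ultimately have "((%y. (flat_derivative P y - flat_derivative P 0) / (y - 0)) \<longlongrightarrow> 0) (at 0)"
    by (simp add: filterlim_at_split)
  then show ?thesis
    using True by (simp add: has_field_derivative_iff flat_derivative_def)
qed

lemma smooth_on_flat:
  assumes "smooth_on UNIV f" shows "smooth_on UNIV (%x. flat_derivative 1 (f x))"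
proof -
  define D where "D j = ((%P. [:0, 0, 1:] * (P - pderiv P)) ^^ j) (1 :: real poly)" for j
  have "smooth_on UNIV (%x. flat_derivative (D 0) (f x))"
  proof (rule smooth_on_compose[where d = "%j. flat_derivative (D j)" and J = UNIV])
    show "(flat_derivative (D j) has_real_derivative flat_derivative (D (Suc j)) y) (at y)" for j y
      using DERIV_flat_derivative[of "D j" y] by (simp only: D_def funpow.simps o_apply)
  qed (use assms in auto)
  then show ?thesis by (simp add: D_def)
qed

text \<open>A product of one-dimensional flat functions. Positivity exactly on the open box matters:
  it lets 1 - exp(-n \<phi>) tend to the indicator of the box, and gives cutoffs a positive infimum
  on closed balls inside the box.\<close>

lemma exists_bump_box:
  fixes a b :: "'a::euclidean_space"
  obtains \<phi> :: "'a => real" where "smooth_on UNIV \<phi>" "!!x. \<phi> x >= 0" "!!x. \<phi> x > 0 \<longleftrightarrow> x \<in> box a b"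
proof -
  let ?h = "flat_derivative 1"
  have h: "?h t >= 0" "?h t > 0 \<longleftrightarrow> t > 0" for t
    by (auto simp: flat_derivative_def)
  define \<phi> :: "'a => real" where "\<phi> x = (\<Prod>i\<in>Basis. ?h (x \<bullet> i - a \<bullet> i) * ?h (b \<bullet> i - x \<bullet> i))" for x
  have "smooth_on UNIV \<phi>"
    unfolding \<phi>_def
    by (intro smooth_on_prod smooth_on_mult smooth_on_flat smooth_on_diff smooth_on_inner
        smooth_on_const finite_Basis)
  moreover have "\<phi> x >= 0" for x
    unfolding \<phi>_def by (intro prod_nonneg mult_nonneg_nonneg h ballI)
  moreover have "\<phi> x > 0 \<longleftrightarrow> x \<in> box a b" for x
  proof
    assume "x \<in> box a b"
    then show "\<phi> x > 0"
      unfolding \<phi>_def by (intro prod_pos mult_pos_pos) (auto simp: h mem_box)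
  next
    assume "\<phi> x > 0"
    then have "\<phi> x ~= 0" by simp
    then have "?h (x \<bullet> i - a \<bullet> i) ~= 0 \<and> ?h (b \<bullet> i - x \<bullet> i) ~= 0" if "i \<in> Basis" for i
      using that unfolding \<phi>_def prod_zero_iff[OF finite_Basis] by force
    then have "x \<bullet> i - a \<bullet> i > 0 \<and> b \<bullet> i - x \<bullet> i > 0" if "i \<in> Basis" for i
      using that by (metis flat_derivative_def)
    then show "x \<in> box a b"
      by (simp add: mem_box)
  qed
  ultimately show ?thesis using that by blast
qed

section \<open>Test functions\<close>

lemma test_functions_supportI:
  assumes "smooth_on UNIV \<phi>" and "{x. \<phi> x ~= 0} \<subseteq> K" and "compact K" and "K \<subseteq> \<Omega>"
  shows "\<phi> \<in> test_functions \<Omega>"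
proof -
  have "closure {x. \<phi> x ~= 0} \<subseteq> K"
    using assms by (simp add: closure_minimal compact_imp_closed)
  moreover from this have "compact (closure {x. \<phi> x ~= 0})"
    using assms(3) by (metis closed_closure compact_Int_closed inf.absorb_iff2)
  ultimately show ?thesis using assms by (auto simp: test_functions_def)
qed

lemma test_functionsD:
  assumes "\<phi> \<in> test_functions \<Omega>"
  shows "smooth_on UNIV \<phi>" "compact (closure {x. \<phi> x ~= 0})" "closure {x. \<phi> x ~= 0} \<subseteq> \<Omega>"
  using assms by (auto simp: test_functions_def)

lemma test_functions_zero_outside:
  assumes "\<phi> \<in> test_functions \<Omega>" and "x \<notin> closure {x. \<phi> x ~= 0}"
  shows "\<phi> x = 0" "frechet_derivative \<phi> (at x) v = 0"
proof -
  have zero: "\<phi> y = 0" if "y \<notin> closure {x. \<phi> x ~= 0}" for y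
    using that closure_subset[of "{x. \<phi> x ~= 0}"] by auto
  show "\<phi> x = 0" using assms(2) by (rule zero)
  have "(\<phi> has_derivative (%v. 0)) (at x)"
  proof (rule has_derivative_transform_within_open[OF has_derivative_const[of 0]])
    show "open (- closure {x. \<phi> x ~= 0})" by (intro open_Compl closed_closure)
    show "x \<in> - closure {x. \<phi> x ~= 0}" using assms(2) by (simp only: Compl_iff not_False_eq_True)
    show "0 = \<phi> y" if "y \<in> - closure {x. \<phi> x ~= 0}" for y
      using zero[OF ComplD[OF that]] by (rule sym)
  qed
  then show "frechet_derivative \<phi> (at x) v = 0"
    by (rule frechet_derivative_eqI)
qed

lemma test_functions_mono: "\<phi> \<in> test_functions Q ==> Q \<subseteq> \<Omega> ==> \<phi> \<in> test_functions \<Omega>"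
  by (auto simp: test_functions_def)

lemma bounded_if_zero_outside_compact:
  fixes f :: "'a::topological_space => real"
  assumes "continuous_on UNIV f" and "compact K" and "!!x. x \<notin> K ==> f x = 0"
  obtains B where "B > 0" "!!x. \<bar>f x\<bar> <= B"
proof -
  have "bounded (f ` K)"
    using assms by (meson compact_continuous_image compact_imp_bounded continuous_on_subset subset_UNIV)
  then obtain B where "B > 0" "!!x. x \<in> K ==> \<bar>f x\<bar> <= B"
    by (auto simp: bounded_pos)
  with assms(3) have "\<bar>f x\<bar> <= B" for x by (cases "x \<in> K") simp_all
  with \<open>B > 0\<close> show ?thesis by (rule that)
qed

lemma test_functions_bounded:
  assumes "\<phi> \<in> test_functions \<Omega>"
  obtains B where "B > 0" "!!x. \<bar>\<phi> x\<bar> <= B"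
  by (rule bounded_if_zero_outside_compact[OF smooth_on_continuous[OF test_functionsD(1)[OF assms]]
        test_functionsD(2)[OF assms] test_functions_zero_outside(1)[OF assms]]) (auto intro: that)

lemma test_functions_bounded_derivative:
  assumes "\<phi> \<in> test_functions \<Omega>"
  obtains B where "B > 0" "!!x. \<bar>frechet_derivative \<phi> (at x) v\<bar> <= B"
  by (rule bounded_if_zero_outside_compact[OF smooth_on_continuous_derivative[OF test_functionsD(1)[OF assms], of v]
        test_functionsD(2)[OF assms] test_functions_zero_outside(2)[OF assms]]) (auto intro: that)

lemma smooth_on_borel_measurable [measurable]:
  assumes "smooth_on UNIV \<phi>"
  shows "\<phi> \<in> borel_measurable borel" "(%x. frechet_derivative \<phi> (at x) v) \<in> borel_measurable borel"
  by (intro borel_measurable_continuous_onI smooth_on_continuous smooth_on_continuous_derivative assms)+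

lemma test_functions_translation:
  assumes "\<phi> \<in> test_functions Q" and "!!x. x \<in> Q ==> x + c \<in> \<Omega>"
  shows "(%x. \<phi> (x - c)) \<in> test_functions \<Omega>"
proof (rule test_functions_supportI)
  show "smooth_on UNIV (%x. \<phi> (x - c))"
    using smooth_on_translation[OF test_functionsD(1)[OF assms(1)], of "- c"] by simp
  let ?K = "(%x. x + c) ` closure {x. \<phi> x ~= 0}"
  show "{x. \<phi> (x - c) ~= 0} \<subseteq> ?K"
  proof
    fix x assume "x \<in> {x. \<phi> (x - c) ~= 0}"
    then have "x - c \<in> closure {x. \<phi> x ~= 0}"
      using closure_subset[of "{x. \<phi> x ~= 0}"] by blast
    then have "(x - c) + c \<in> ?K" by (rule imageI)
    then show "x \<in> ?K" by simp
  qed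
  show "compact ?K"
    by (intro compact_continuous_image test_functionsD[OF assms(1)] continuous_intros)
  show "?K \<subseteq> \<Omega>"
    using assms test_functionsD(3)[OF assms(1)] by blast
qed

lemma frechet_derivative_translation:
  assumes "smooth_on UNIV \<phi>"
  shows "frechet_derivative (%x. \<phi> (x - c)) (at x) v = frechet_derivative \<phi> (at (x - c)) v"
proof -
  have "((%x. \<phi> (x - c)) has_derivative (%v. frechet_derivative \<phi> (at (x - c)) v)) (at x)"
    using has_derivative_compose[of "%x. x - c" "%v. v" x UNIV \<phi>, OF _ smooth_on_has_derivative[OF assms]]
      has_derivative_add_const[OF has_derivative_ident, of "- c" "at x"] by simp
  then show ?thesis by (rule frechet_derivative_eqI)
qed

lemma test_functions_mult:
  assumes "smooth_on UNIV f" "\<phi> \<in> test_functions \<Omega>"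
  shows "(%x. f x * \<phi> x) \<in> test_functions \<Omega>"
proof (rule test_functions_supportI)
  show "{x. f x * \<phi> x ~= 0} \<subseteq> closure {x. \<phi> x ~= 0}"
    using closure_subset[of "{x. \<phi> x ~= 0}"] by auto
qed (use test_functionsD[OF assms(2)] in \<open>simp_all add: smooth_on_mult assms(1)\<close>)

lemma test_functions_line_integral:
  assumes "smooth_on UNIV \<phi>"
  shows "(LINT t|lborel. indicator {0..1} t * frechet_derivative \<phi> (at (x + t *\<^sub>R e)) e) = \<phi> (x + e) - \<phi> x"
proof -
  have "(LINT t|lborel. indicator {0..1} t *\<^sub>R frechet_derivative \<phi> (at (x + t *\<^sub>R e)) e) =
      \<phi> (x + 1 *\<^sub>R e) - \<phi> (x + 0 *\<^sub>R e)"
  proof (rule integral_FTC_atLeastAtMost)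
    fix t :: real
    have "((%t. \<phi> (x + t *\<^sub>R e)) has_derivative (%s. frechet_derivative \<phi> (at (x + t *\<^sub>R e)) (s *\<^sub>R e))) (at t within {0..1})"
      by (rule has_derivative_compose[where f = "%t. x + t *\<^sub>R e", OF _ smooth_on_has_derivative[OF assms]])
        (auto intro!: derivative_eq_intros)
    moreover have "linear (frechet_derivative \<phi> (at (x + t *\<^sub>R e)))"
      using smooth_on_has_derivative[OF assms] has_derivative_bounded_linear bounded_linear.linear by blast
    ultimately show "((%t. \<phi> (x + t *\<^sub>R e)) has_vector_derivative frechet_derivative \<phi> (at (x + t *\<^sub>R e)) e) (at t within {0..1})"
      by (simp add: has_vector_derivative_def linear_scale)
  next
    show "continuous_on {0..1} (%t. frechet_derivative \<phi> (at (x + t *\<^sub>R e)) e)"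
      by (rule continuous_on_compose2[OF smooth_on_continuous_derivative[OF assms]])
        (auto intro!: continuous_intros)
  qed simp
  then show ?thesis by simp
qed

section \<open>The fundamental lemma of the calculus of variations\<close>

text \<open>Test functions reach the indicators of boxes by dominated convergence. Boxes are stable
  under intersection and generate the Borel sets, so the integral of g over every Borel part of the
  box vanishes, and g is 0 as a density.\<close>

lemma AE_eq_0_on_box:
  fixes g :: "'a::euclidean_space => real"
  assumes g: "integrable lborel (%x. indicator (cbox a b) x * g x)"
    and null: "!!\<phi>. smooth_on UNIV \<phi> ==> {x. \<phi> x ~= 0} \<subseteq> cbox a b ==> (\<integral>x. g x * \<phi> x \<partial>lborel) = 0"
  shows "AE x in lborel. x \<in> box a b --> g x = 0"
proof -
  let ?g = "%x. indicator (box a b) x * g x"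
  have sub: "box a b \<subseteq> cbox a b" by (rule box_subset_cbox)
  have gm: "?g \<in> borel_measurable lborel"
  proof -
    have "(%x. indicator (box a b) x * (indicator (cbox a b) x * g x)) \<in> borel_measurable lborel"
      using borel_measurable_integrable[OF g] by measurable
    moreover have "(%x. indicator (box a b) x * (indicator (cbox a b) x * g x)) = ?g"
      using sub by (auto simp: fun_eq_iff split: split_indicator)
    ultimately show ?thesis by simp
  qed
  have gi: "integrable lborel ?g"
  proof (rule B_integrable_bound[OF g gm], intro AE_I2)
    show "norm (?g x) <= norm (indicator (cbox a b) x * g x)" for x
      using sub by (cases "x \<in> box a b") (simp_all add: subsetD)
  qed
  have box0: "(\<integral>x. indicator (box c d) x * ?g x \<partial>lborel) = 0" for c d
  proof -
    obtain e f where ef: "box a b \<inter> box c d = box e f" by (rule that[OF box_Int_box])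
    show ?thesis
    proof (cases "box e f = {}")
      case True
      then have "indicator (box c d) x * ?g x = 0" for x
        using ef by (auto split: split_indicator)
      then show ?thesis by (simp only: Bochner_Integration.integral_zero)
    next
      case False
      obtain \<phi> :: "'a => real" where \<phi>: "smooth_on UNIV \<phi>" "!!x. \<phi> x >= 0" "!!x. \<phi> x > 0 \<longleftrightarrow> x \<in> box e f"
        by (rule exists_bump_box[of e f]) auto
      have efs: "box e f \<subseteq> box a b" using ef by blast
      \<comment> \<open>Smooth, between 0 and 1, zero off the box, and increasing to 1 on
        it.\<close>
      let ?\<psi> = "%n x. 1 - exp (- (real n * \<phi> x))"
      have \<psi>: "smooth_on UNIV (?\<psi> n)" for n
        by (intro smooth_on_diff smooth_on_exp smooth_on_uminus smooth_on_mult smooth_on_const \<phi>(1))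
      have \<phi>0: "\<phi> x = 0" if "x \<notin> box e f" for x using \<phi>(2)[of x] \<phi>(3)[of x] that by simp
      have "(%n. \<integral>x. ?g x * ?\<psi> n x \<partial>lborel) \<longlonglongrightarrow> (\<integral>x. indicator (box c d) x * ?g x \<partial>lborel)"
      proof (rule integral_dominated_convergence[where w = "%x. \<bar>?g x\<bar>"])
        show "(%x. indicator (box c d) x * ?g x) \<in> borel_measurable lborel"
          using gm by measurable
        show "integrable lborel (%x. \<bar>?g x\<bar>)" using gi by (rule integrable_abs)
        show "(%x. ?g x * ?\<psi> n x) \<in> borel_measurable lborel" for n
          using gm smooth_on_borel_measurable(1)[OF \<psi>[of n]] by measurable
        show "AE x in lborel. (%n. ?g x * ?\<psi> n x) \<longlonglongrightarrow> indicator (box c d) x * ?g x"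
        proof (intro AE_I2)
          fix x :: 'a
          show "(%n. ?g x * ?\<psi> n x) \<longlonglongrightarrow> indicator (box c d) x * ?g x"
          proof (cases "x \<in> box e f")
            case True
            then have "\<phi> x > 0" using \<phi>(3) by simp
            have "filterlim (%n. real n * \<phi> x) at_top sequentially"
              by (rule filterlim_at_top_mult_tendsto_pos[OF tendsto_const \<open>\<phi> x > 0\<close> filterlim_real_sequentially])
            then have "(%n. exp (- (real n * \<phi> x))) \<longlonglongrightarrow> 0"
              by (intro filterlim_compose[OF exp_at_bot] filterlim_compose[OF filterlim_uminus_at_bot_at_top])
            then have "(%n. ?g x * ?\<psi> n x) \<longlonglongrightarrow> ?g x * (1 - 0)" by (intro tendsto_intros)
            then show ?thesis using True ef by (auto split: split_indicator)
          next
            case False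
            then have "indicator (box c d) x * ?g x = 0" using ef by (auto split: split_indicator)
            moreover have "?g x * ?\<psi> n x = 0" for n using \<phi>0[OF False] by simp
            ultimately show ?thesis by (simp only: tendsto_const)
          qed
        qed
        show "AE x in lborel. norm (?g x * ?\<psi> n x) <= \<bar>?g x\<bar>" for n
        proof (intro AE_I2)
          fix x
          have "0 <= ?\<psi> n x" "?\<psi> n x <= 1" using \<phi>(2)[of x] by auto
          then show "norm (?g x * ?\<psi> n x) <= \<bar>?g x\<bar>"
            by (simp add: abs_mult mult_left_le del: mult_eq_0_iff)
        qed
      qed
      moreover have "(\<integral>x. ?g x * ?\<psi> n x \<partial>lborel) = 0" for n
      proof -
        have eq: "?g x * ?\<psi> n x = g x * ?\<psi> n x" for x
          using \<phi>0[of x] efs by (auto split: split_indicator)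
        have "{x. ?\<psi> n x ~= 0} \<subseteq> cbox a b"
          using \<phi>0 efs sub by fastforce
        then show ?thesis unfolding eq by (rule null[OF \<psi>])
      qed
      ultimately show ?thesis by (simp add: LIMSEQ_const_iff)
    qed
  qed
  have set0: "(\<integral>x. indicator A x * ?g x \<partial>lborel) = 0" if "A \<in> sets lborel" for A
  proof -
    have int: "integrable lborel (%x. indicator A x * ?g x)" if "A \<in> sets lborel" for A
      using integrable_mult_indicator[OF that gi] by simp
    have "A \<in> sigma_sets UNIV (range (%(a, b). box a b :: 'a set))"
      using that by (simp add: borel_eq_box)
    have "Int_stable (range (%(a, b). box a b :: 'a set))"
      by (auto simp: Int_stable_def box_Int_box)
    moreover have "range (%(a, b). box a b :: 'a set) \<subseteq> Pow UNIV" by simp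
    ultimately show ?thesis using \<open>A \<in> sigma_sets UNIV _\<close>
    proof (induction rule: sigma_sets_induct_disjoint)
      case (basic A)
      then show ?case using box0 by auto
    next
      case (compl A)
      then have A: "A \<in> sets lborel" by (simp add: borel_eq_box)
      have "indicator (box a b) x * ?g x = ?g x" for x by (simp split: split_indicator)
      then have "(\<integral>x. ?g x \<partial>lborel) = 0" using box0[of a b] by (simp only:)
      moreover have "(\<integral>x. indicator (UNIV - A) x * ?g x \<partial>lborel) = (\<integral>x. ?g x - indicator A x * ?g x \<partial>lborel)"
        by (auto intro!: B_integral_cong split: split_indicator)
      ultimately show ?case
        using compl B_integral_diff[OF gi int[OF A]] by simp
    next
      case (union F)
      then have F: "F i \<in> sets lborel" for i by (auto simp: borel_eq_box)
      have "set_lebesgue_integral lborel (\<Union>i. F i) ?g = (\<Sum>i. set_lebesgue_integral lborel (F i) ?g)"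
      proof (rule lebesgue_integral_countable_add[OF F])
        show "F i \<inter> F j = {}" if "i ~= j" for i j
          using union(1) that by (auto simp: disjoint_family_on_def)
        show "set_integrable lborel (\<Union>i. F i) ?g"
          unfolding set_integrable_def using F by (intro integrable_mult_indicator gi) auto
      qed
      then show ?case using union(3) by (simp add: set_lebesgue_integral_def)
    qed auto
  qed
  have "AE x in lborel. ?g x = 0"
    by (rule density_unique_real[OF gi, of "%_. 0"]) (use set0 in \<open>auto simp: set_lebesgue_integral_def\<close>)
  then show ?thesis by (rule eventually_mono) (auto split: split_indicator_asm)
qed

text \<open>An open set is a countable union of closed boxes, whose faces are null, so the statement
  for a single box suffices.\<close>

lemma AE_eq_0_if_orthogonal_test_functions:
  fixes g :: "'a::euclidean_space => real"
  assumes \<Omega>: "open \<Omega>"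
    and g: "!!a b. cbox a b \<subseteq> \<Omega> ==> integrable lborel (%x. indicator (cbox a b) x * g x)"
    and null: "!!\<phi>. \<phi> \<in> test_functions \<Omega> ==> (\<integral>x. g x * \<phi> x \<partial>lborel) = 0"
  shows "AE x in lborel. x \<in> \<Omega> --> g x = 0"
proof -
  obtain \<D> where \<D>: "countable \<D>" "\<D> \<subseteq> Pow \<Omega>" "!!X. X \<in> \<D> ==> \<exists>a b. X = cbox a b" "\<Union>\<D> = \<Omega>"
    using open_countable_Union_open_cbox[OF \<Omega>] by blast
  have "AE x in lborel. x \<in> X --> g x = 0" if XD: "X \<in> \<D>" for X
  proof -
    obtain a b where X: "X = cbox a b" using \<D>(3)[OF XD] by blast
    then have sub: "cbox a b \<subseteq> \<Omega>" using \<D>(2) XD by blast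
    have "AE x in lborel. x \<in> box a b --> g x = 0"
      by (rule AE_eq_0_on_box[OF g[OF sub]])
        (use sub in \<open>auto intro!: null test_functions_supportI[where K = "cbox a b"]\<close>)
    moreover have "AE x in lborel. x \<notin> cbox a b - box a b"
      using negligible_frontier_interval[of a b]
      by (intro AE_not_in) (simp add: negligible_iff_null_sets null_sets_completion_iff)
    ultimately show ?thesis unfolding X by eventually_elim auto
  qed
  then have "AE x in lborel. \<forall>X\<in>\<D>. x \<in> X --> g x = 0"
    unfolding AE_ball_countable[OF \<D>(1)] by blast
  then show ?thesis by (rule eventually_mono) (use \<D>(4) in blast)
qed

section \<open>Translations\<close>

lemma
  fixes f :: "'a::euclidean_space => 'b::{banach, second_countable_topology}"
  assumes f: "integrable lborel f"
  shows integrable_lborel_translation: "integrable lborel (%x. f (x + c))"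
    and integral_lborel_translation: "(\<integral>x. f (x + c) \<partial>lborel) = (\<integral>x. f x \<partial>lborel)"
proof -
  have "integrable (distr lborel borel ((+) c)) f" using f by (simp add: lborel_distr_plus)
  then show "integrable lborel (%x. f (x + c))"
    by (subst (asm) integrable_distr_eq) (use f in \<open>auto simp: add.commute\<close>)
  have "(\<integral>x. f x \<partial>distr lborel borel ((+) c)) = (\<integral>x. f (c + x) \<partial>lborel)"
    by (rule integral_distr) (use f in auto)
  then show "(\<integral>x. f (x + c) \<partial>lborel) = (\<integral>x. f x \<partial>lborel)"
    by (simp add: lborel_distr_plus add.commute)
qed

lemma integral_translation_diff_le:
  fixes f :: "'a::euclidean_space => 'b::{banach, second_countable_topology}"
  assumes f: "integrable lborel f"
  shows "(\<integral>x. norm (f (x + c) - f x) \<partial>lborel) <= 2 * (\<integral>x. norm (f x) \<partial>lborel)"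
proof -
  note n = integrable_norm[OF f] integrable_norm[OF integrable_lborel_translation[OF f, of c]]
  have "(\<integral>x. norm (f (x + c) - f x) \<partial>lborel) <= (\<integral>x. norm (f (x + c)) + norm (f x) \<partial>lborel)"
    by (intro integral_mono integrable_norm B_integrable_diff
        B_integrable_add integrable_lborel_translation f norm_triangle_ineq4)
  also have "\<dots> = 2 * (\<integral>x. norm (f x) \<partial>lborel)"
    using B_integral_add[OF n(2,1)] integral_lborel_translation[OF n(1), of c] by simp
  finally show ?thesis .
qed

text \<open>For open S every x in S keeps x + h n in S eventually, so dominated convergence applies
  directly. Only the points that leave S are measured; those that enter it are recovered later by
  the shift -h n.\<close>

lemma tendsto_translation_open:
  fixes S :: "'a::euclidean_space set"
  assumes S: "open S" "emeasure lborel S < \<infinity>" and h: "h \<longlonglongrightarrow> 0"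
  shows "(%n. \<integral>x. indicator S x * (1 - indicator S (x + h n)) \<partial>lborel) \<longlonglongrightarrow> (0::real)"
proof -
  have [measurable]: "S \<in> sets borel" using S(1) by simp
  have "(%n. \<integral>x. indicator S x * (1 - indicator S (x + h n)) \<partial>lborel) \<longlonglongrightarrow> (\<integral>x. (0::real) \<partial>(lborel :: 'a measure))"
  proof (rule integral_dominated_convergence[where w = "indicator S"])
    show "integrable lborel (indicator S :: 'a => real)"
      using S by (simp add: integrable_indicator_iff)
    show "AE x in lborel. (%n. indicator S x * (1 - indicator S (x + h n))) \<longlonglongrightarrow> (0::real)"
    proof (intro AE_I2)
      fix x
      show "(%n. indicator S x * (1 - indicator S (x + h n))) \<longlonglongrightarrow> (0::real)"
      proof (cases "x \<in> S")
        case True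
        have "(%n. x + h n) \<longlonglongrightarrow> x + 0" by (intro tendsto_intros h)
        then have "\<forall>\<^sub>F n in sequentially. x + h n \<in> S"
          using S(1) True by (intro topological_tendstoD) auto
        then show ?thesis
          by (intro tendsto_eventually) (erule eventually_mono, simp)
      qed simp
    qed
    show "AE x in lborel. norm (indicator S x * (1 - indicator S (x + h n)) :: real) <= indicator S x" for n
      by (intro AE_I2) (simp split: split_indicator)
  qed measurable
  then show ?thesis by simp
qed

text \<open>Outer regularity encloses A in an open S with small excess. The symmetric difference of
  A and its translate is bounded by the two one-sided differences of S plus twice the
  excess.\<close>

lemma tendsto_translation_indicator:
  fixes A :: "'a::euclidean_space set"
  assumes A: "A \<in> sets lborel" "emeasure lborel A < \<infinity>" and h: "h \<longlonglongrightarrow> 0"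
  shows "(%n. \<integral>x. \<bar>indicator A (x + h n) - indicator A x\<bar> \<partial>lborel) \<longlonglongrightarrow> (0::real)"
proof (rule tendstoI)
  fix e :: real assume e: "e > 0"
  obtain S where S: "open S" "A \<subseteq> S" "emeasure lborel (S - A) < ennreal (e / 4)"
    using outer_regular_lborel[of A "e/4"] A e by auto
  have [measurable]: "A \<in> sets borel" "S \<in> sets borel" using A S by auto
  have "emeasure lborel S <= emeasure lborel A + emeasure lborel (S - A)"
    using emeasure_subadditive[of A lborel "S - A"] S(2) by (simp add: Un_absorb1)
  also have "\<dots> < \<infinity>" using A(2) S(3) by (auto simp: ennreal_add_less_top intro: less_trans)
  finally have Sf: "emeasure lborel S < \<infinity>" .
  let ?i = "indicator :: 'a set => 'a => real"
  have iS: "integrable lborel (?i S)" and iSA: "integrable lborel (?i (S - A))" and iA: "integrable lborel (?i A)"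
    using Sf A(2) S(3) by (auto simp: integrable_indicator_iff intro: less_trans)
  have mSA: "(\<integral>x. ?i (S - A) x \<partial>lborel) <= e / 4"
  proof -
    have "enn2real (emeasure lborel (S - A)) <= enn2real (ennreal (e / 4))"
      using S(3) by (intro enn2real_mono) auto
    then show ?thesis using e by (simp add: measure_def)
  qed
  have i1: "integrable lborel (%x. ?i S x * (1 - ?i S (x + c)))" for c
    by (rule B_integrable_bound[OF iS]) (auto split: split_indicator)
  have i2: "integrable lborel (%x. ?i S (x + c) * (1 - ?i S x))" for c
    by (rule B_integrable_bound[OF integrable_lborel_translation[OF iS, of c]])
      (auto split: split_indicator)
  have e2: "(\<integral>x. ?i S (x + c) * (1 - ?i S x) \<partial>lborel) = (\<integral>x. ?i S x * (1 - ?i S (x + - c)) \<partial>lborel)" for c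
    using integral_lborel_translation[OF i1[of "- c"], of c] by simp
  have bd: "(\<integral>x. \<bar>?i A (x + c) - ?i A x\<bar> \<partial>lborel) \<le>
      (\<integral>x. ?i S x * (1 - ?i S (x + c)) \<partial>lborel) + (\<integral>x. ?i S x * (1 - ?i S (x + - c)) \<partial>lborel) + e / 2" for c
  proof -
    have "(\<integral>x. \<bar>?i A (x + c) - ?i A x\<bar> \<partial>lborel) \<le>
       (\<integral>x. (?i S x * (1 - ?i S (x + c)) + ?i S (x + c) * (1 - ?i S x)) + (?i (S - A) (x + c) + ?i (S - A) x) \<partial>lborel)"
    proof (rule integral_mono)
      show "integrable lborel (%x. \<bar>?i A (x + c) - ?i A x\<bar>)"
        by (intro integrable_abs B_integrable_diff integrable_lborel_translation iA)
      show "integrable lborel (%x. (?i S x * (1 - ?i S (x + c)) + ?i S (x + c) * (1 - ?i S x)) + (?i (S - A) (x + c) + ?i (S - A) x))"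
        by (intro B_integrable_add i1 i2 iSA integrable_lborel_translation)
      show "\<bar>?i A (x + c) - ?i A x\<bar> <= (?i S x * (1 - ?i S (x + c)) + ?i S (x + c) * (1 - ?i S x)) + (?i (S - A) (x + c) + ?i (S - A) x)" for x
        using S(2) by (auto simp: indicator_def)
    qed
    also have "\<dots> = ((\<integral>x. ?i S x * (1 - ?i S (x + c)) \<partial>lborel) + (\<integral>x. ?i S (x + c) * (1 - ?i S x) \<partial>lborel))
        + ((\<integral>x. ?i (S - A) (x + c) \<partial>lborel) + (\<integral>x. ?i (S - A) x \<partial>lborel))"
      by (simp add: i1 i2 iSA integrable_lborel_translation del: integral_indicator Bochner_Integration.integral_indicator)
    also have "\<dots> <= (\<integral>x. ?i S x * (1 - ?i S (x + c)) \<partial>lborel) + (\<integral>x. ?i S x * (1 - ?i S (x + - c)) \<partial>lborel) + e / 2"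
      using mSA integral_lborel_translation[OF iSA, of c] e2[of c] by linarith
    finally show ?thesis .
  qed
  have mh: "(%n. - h n) \<longlonglongrightarrow> 0" using tendsto_minus[OF h] by simp
  have "\<forall>\<^sub>F n in sequentially. (\<integral>x. ?i S x * (1 - ?i S (x + h n)) \<partial>lborel) < e / 4"
    using tendsto_translation_open[OF S(1) Sf h] e by (intro order_tendstoD) auto
  moreover have "\<forall>\<^sub>F n in sequentially. (\<integral>x. ?i S x * (1 - ?i S (x + - h n)) \<partial>lborel) < e / 4"
    using tendsto_translation_open[OF S(1) Sf mh] e by (intro order_tendstoD) auto
  ultimately show "\<forall>\<^sub>F n in sequentially. dist (\<integral>x. \<bar>?i A (x + h n) - ?i A x\<bar> \<partial>lborel) 0 < e"
  proof eventually_elim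
    case (elim n)
    have "0 <= (\<integral>x. \<bar>?i A (x + h n) - ?i A x\<bar> \<partial>lborel)" by simp
    then show ?case using bd[of "h n"] elim by simp
  qed
qed

text \<open>Continuity of translation in L1, carried from indicators through sums and dominated
  limits. In the limit step the approximation error enters twice, since the translated error has the
  same integral.\<close>

lemma tendsto_translation_L1:
  fixes g :: "'a::euclidean_space => 'b::{banach, second_countable_topology}"
  assumes g: "integrable lborel g" and h: "h \<longlonglongrightarrow> 0"
  shows "(%n. \<integral>x. norm (g (x + h n) - g x) \<partial>lborel) \<longlonglongrightarrow> 0"
  using g
proof (induction rule: integrable_induct)
  case (base A c)
  have "(\<integral>x. norm (indicator A (x + h n) *\<^sub>R c - indicator A x *\<^sub>R c) \<partial>lborel) =
      norm c * (\<integral>x. \<bar>indicator A (x + h n) - indicator A x\<bar> \<partial>lborel)" for n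
  proof -
    have eq: "norm (indicator A (x + h n) *\<^sub>R c - indicator A x *\<^sub>R c) =
        norm c * \<bar>indicator A (x + h n) - indicator A x\<bar>" for x
      unfolding scaleR_left_diff_distrib[symmetric] norm_scaleR by (rule mult.commute)
    show ?thesis unfolding eq by (rule Bochner_Integration.integral_mult_right_zero)
  qed
  then show ?case
    using tendsto_mult_right_zero[OF tendsto_translation_indicator[OF base h], of "norm c"] by simp
next
  case (add f g)
  note d = B_integrable_diff[OF integrable_lborel_translation[OF add.hyps(1)] add.hyps(1)]
    B_integrable_diff[OF integrable_lborel_translation[OF add.hyps(2)] add.hyps(2)]
  have "(\<integral>x. norm (f (x + h n) + g (x + h n) - (f x + g x)) \<partial>lborel) \<le>
      (\<integral>x. norm (f (x + h n) - f x) \<partial>lborel) + (\<integral>x. norm (g (x + h n) - g x) \<partial>lborel)" for n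
  proof -
    have "(\<integral>x. norm (f (x + h n) + g (x + h n) - (f x + g x)) \<partial>lborel) \<le>
      (\<integral>x. norm (f (x + h n) - f x) + norm (g (x + h n) - g x) \<partial>lborel)"
    proof (rule integral_mono)
      show "integrable lborel (%x. norm (f (x + h n) + g (x + h n) - (f x + g x)))"
        by (intro integrable_norm B_integrable_diff B_integrable_add
            integrable_lborel_translation add.hyps)
      show "norm (f (x + h n) + g (x + h n) - (f x + g x)) <= norm (f (x + h n) - f x) + norm (g (x + h n) - g x)" for x
        by (simp add: add_diff_add norm_triangle_ineq)
    qed (intro B_integrable_add integrable_norm d)
    then show ?thesis by (simp add: d)
  qed
  then have "\<forall>\<^sub>F n in sequentially. norm (\<integral>x. norm (f (x + h n) + g (x + h n) - (f x + g x)) \<partial>lborel) \<le>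
      (\<integral>x. norm (f (x + h n) - f x) \<partial>lborel) + (\<integral>x. norm (g (x + h n) - g x) \<partial>lborel)"
    by (intro always_eventually allI) (simp only: real_norm_def abs_of_nonneg[OF B_integral_nonneg] norm_ge_zero)
  then show ?case
    by (rule Lim_null_comparison[OF _ tendsto_add_zero[OF add.IH]])
next
  case (lim f s)
  show ?case
  proof (rule tendstoI)
    fix e :: real assume e: "e > 0"
    have "(%i. \<integral>x. norm (s i x - f x) \<partial>lborel) \<longlonglongrightarrow> (\<integral>x. norm (0::'b) \<partial>(lborel :: 'a measure))"
    proof (rule integral_dominated_convergence[where w = "%x. 3 * norm (f x)"])
      show "AE x in lborel. (%i. norm (s i x - f x)) \<longlonglongrightarrow> norm (0::'b)"
        using lim.hyps(2) by (intro AE_I2 tendsto_norm) (simp add: LIM_zero)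
      show "AE x in lborel. norm (norm (s i x - f x)) <= 3 * norm (f x)" for i
      proof (intro AE_I2)
        fix x
        show "norm (norm (s i x - f x)) <= 3 * norm (f x)"
          using norm_triangle_ineq4[of "s i x" "f x"] lim.hyps(3)[of x i] by simp
      qed
    qed (use lim.hyps in auto)
    then have "\<forall>\<^sub>F i in sequentially. (\<integral>x. norm (s i x - f x) \<partial>lborel) < e / 3"
      using e by (intro order_tendstoD) auto
    then obtain i where i: "(\<integral>x. norm (s i x - f x) \<partial>lborel) < e / 3"
      by (auto simp: eventually_sequentially)
    have d: "integrable lborel (%x. s i x - f x)" using lim.hyps by simp
    have ds: "integrable lborel (%x. s i (x + c) - s i x)" for c
      using lim.hyps by (intro B_integrable_diff integrable_lborel_translation)
    have "(\<integral>x. norm (f (x + h n) - f x) \<partial>lborel) <= (\<integral>x. norm (s i (x + h n) - s i x) \<partial>lborel) + 2 * (e / 3)" for n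
    proof -
      have "(\<integral>x. norm (f (x + h n) - f x) \<partial>lborel) \<le>
        (\<integral>x. norm (s i (x + h n) - s i x) + (norm (s i (x + h n) - f (x + h n)) + norm (s i x - f x)) \<partial>lborel)"
      proof (rule integral_mono)
        show "integrable lborel (%x. norm (f (x + h n) - f x))"
          using lim.hyps by (intro integrable_norm B_integrable_diff integrable_lborel_translation)
        show "integrable lborel (%x. norm (s i (x + h n) - s i x) + (norm (s i (x + h n) - f (x + h n)) + norm (s i x - f x)))"
          by (intro integrable_norm B_integrable_add d ds integrable_lborel_translation[OF d])
        fix x
        have eq: "f (x + h n) - f x = (s i (x + h n) - s i x) - (s i (x + h n) - f (x + h n)) + (s i x - f x)" by simp
        show "norm (f (x + h n) - f x) <= norm (s i (x + h n) - s i x) + (norm (s i (x + h n) - f (x + h n)) + norm (s i x - f x))"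
          unfolding eq using norm_triangle_ineq[of "(s i (x + h n) - s i x) - (s i (x + h n) - f (x + h n))" "s i x - f x"]
            norm_triangle_ineq4[of "s i (x + h n) - s i x" "s i (x + h n) - f (x + h n)"] by linarith
      qed
      also have "\<dots> = (\<integral>x. norm (s i (x + h n) - s i x) \<partial>lborel) +
          ((\<integral>x. norm (s i (x + h n) - f (x + h n)) \<partial>lborel) + (\<integral>x. norm (s i x - f x) \<partial>lborel))"
        using d ds integrable_lborel_translation[OF d, of "h n"] by simp
      also have "(\<integral>x. norm (s i (x + h n) - f (x + h n)) \<partial>lborel) = (\<integral>x. norm (s i x - f x) \<partial>lborel)"
        by (rule integral_lborel_translation[OF integrable_norm[OF d]])
      finally show ?thesis using i by linarith
    qed
    moreover have "\<forall>\<^sub>F n in sequentially. (\<integral>x. norm (s i (x + h n) - s i x) \<partial>lborel) < e / 3"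
      using lim.IH[of i] e by (intro order_tendstoD) auto
    ultimately show "\<forall>\<^sub>F n in sequentially. dist (\<integral>x. norm (f (x + h n) - f x) \<partial>lborel) 0 < e"
    proof (elim eventually_mono)
      fix n assume n: "(\<integral>x. norm (s i (x + h n) - s i x) \<partial>lborel) < e / 3"
        and "!!n. (\<integral>x. norm (f (x + h n) - f x) \<partial>lborel) <= (\<integral>x. norm (s i (x + h n) - s i x) \<partial>lborel) + 2 * (e / 3)"
      from this(2)[of n] n have "(\<integral>x. norm (f (x + h n) - f x) \<partial>lborel) < e" by linarith
      moreover have "0 <= (\<integral>x. norm (f (x + h n) - f x) \<partial>lborel)" by simp
      ultimately show "dist (\<integral>x. norm (f (x + h n) - f x) \<partial>lborel) 0 < e" by simp
    qed
  qed
qed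

section \<open>Weak directional derivatives\<close>

text \<open>A weak directional derivative for functions on the whole space with respect to
  \<open>lborel\<close>; only the test functions know \<Omega>. Representatives extended by 0 fit
  this form, and translations and Fubini's theorem apply to them without restricting the
  domain.\<close>

definition wderiv :: "'a::euclidean_space set => 'a => ('a => real) => ('a => real) => bool" where
  "wderiv \<Omega> e u g \<longleftrightarrow> integrable lborel u \<and> integrable lborel g \<and>
     (\<forall>\<phi>\<in>test_functions \<Omega>. (\<integral>x. u x * frechet_derivative \<phi> (at x) e \<partial>lborel) = - (\<integral>x. g x * \<phi> x \<partial>lborel))"

lemma integrable_mult_bounded:
  fixes f g :: "'a => real"
  assumes "integrable M f" "g \<in> borel_measurable M" "!!x. \<bar>g x\<bar> <= B"
  shows "integrable M (%x. f x * g x)"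
proof (rule B_integrable_bound[where f = "%x. B * f x"])
  show "AE x in M. norm (f x * g x) <= norm (B * f x)"
  proof (intro AE_I2)
    fix x
    have "\<bar>g x\<bar> <= \<bar>B\<bar>" using assms(3)[of x] by linarith
    then show "norm (f x * g x) <= norm (B * f x)"
      using mult_left_mono[of "\<bar>g x\<bar>" "\<bar>B\<bar>" "\<bar>f x\<bar>"] by (simp add: abs_mult mult.commute)
  qed
qed (use assms in \<open>auto intro: borel_measurable_times\<close>)

text \<open>Translation invariance makes the inner integral of the norm constant in t on [0,1]; this
  is the joint integrability behind the interchanges of integrals below.\<close>

lemma integrable_line_average:
  fixes g :: "'a::euclidean_space => 'b::{banach, second_countable_topology}"
  assumes g: "integrable lborel g"
  shows "integrable (lborel \<Otimes>\<^sub>M lborel) (%(t, x). indicator {0..1::real} t *\<^sub>R g (x + t *\<^sub>R e))"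
proof (rule lborel_pair.Fubini_integrable)
  have gm[measurable]: "g \<in> borel_measurable borel" using g by auto
  show "(%(t, x). indicator {0..1::real} t *\<^sub>R g (x + t *\<^sub>R e)) \<in> borel_measurable (lborel \<Otimes>\<^sub>M lborel)"
    by measurable
  note gt = integrable_lborel_translation[OF g]
  show "AE t in lborel. integrable lborel (%x. case (t, x) of (t, x) => indicator {0..1} t *\<^sub>R g (x + t *\<^sub>R e))"
    using gt by (intro AE_I2) simp
  have eq: "(\<integral>x. norm (case (t, x) of (t, x) => indicator {0..1} t *\<^sub>R g (x + t *\<^sub>R e)) \<partial>lborel) =
      indicator {0..1} t * (\<integral>x. norm (g x) \<partial>lborel)" for t :: real
    using integral_lborel_translation[OF integrable_norm[OF g], of "t *\<^sub>R e"] by simp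
  have "integrable lborel (%t::real. indicator {0..1} t * (\<integral>x. norm (g x) \<partial>lborel))"
    by (intro integrable_mult_left) simp
  then show "integrable lborel (%t. \<integral>x. norm (case (t, x) of (t, x) => indicator {0..1} t *\<^sub>R g (x + t *\<^sub>R e)) \<partial>lborel)"
    by (simp only: eq)
qed

lemma integrable_line_average':
  fixes g :: "'a::euclidean_space => 'b::{banach, second_countable_topology}"
  assumes g: "integrable lborel g"
  shows "integrable lborel (%x. \<integral>t. indicator {0..1::real} t *\<^sub>R g (x + t *\<^sub>R e) \<partial>lborel)"
  using lborel_pair.integrable_snd[OF integrable_line_average[OF g]] by simp

text \<open>Testing with \<open>\<phi>(\<cdot> - t e)\<close> and integrating over \<open>t\<close> turns the weak formulation into a fundamental
  theorem of calculus along almost every segment.\<close>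

lemma wderiv_increment:
  fixes \<Omega> Q :: "'a::euclidean_space set"
  assumes w: "wderiv \<Omega> e u g" and Q: "open Q"
    and sub: "!!x t. x \<in> Q ==> 0 <= t ==> t <= 1 ==> x + t *\<^sub>R e \<in> \<Omega>"
  shows "AE x in lborel. x \<in> Q --> u (x + e) - u x = (\<integral>t. indicator {0..1::real} t * g (x + t *\<^sub>R e) \<partial>lborel)"
proof -
  have u: "integrable lborel u" and g: "integrable lborel g"
    and weak: "!!\<phi>. \<phi> \<in> test_functions \<Omega> ==>
      (\<integral>x. u x * frechet_derivative \<phi> (at x) e \<partial>lborel) = - (\<integral>x. g x * \<phi> x \<partial>lborel)"
    using w by (auto simp: wderiv_def)
  let ?I = "%x. \<integral>t. indicator {0..1::real} t * g (x + t *\<^sub>R e) \<partial>lborel"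
  have I: "integrable lborel ?I" using integrable_line_average'[OF g, of e] by simp
  have d: "integrable lborel (%x. (u (x + e) - u x) - ?I x)"
    by (intro B_integrable_diff integrable_lborel_translation u I)
  have "AE x in lborel. x \<in> Q --> (u (x + e) - u x) - ?I x = 0"
  proof (rule AE_eq_0_if_orthogonal_test_functions[OF Q])
    show "integrable lborel (%x. indicator (cbox a b) x * ((u (x + e) - u x) - ?I x))" for a b
      using integrable_mult_indicator[OF _ d, of "cbox a b"] by simp
    fix \<phi> assume \<phi>: "\<phi> \<in> test_functions Q"
    note sm = test_functionsD(1)[OF \<phi>]
    note [measurable] = smooth_on_borel_measurable(1)[OF sm] smooth_on_borel_measurable(2)[OF sm, of e]
    obtain B where B: "!!x. \<bar>\<phi> x\<bar> <= B" by (rule test_functions_bounded[OF \<phi>]) auto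
    obtain B' where B': "!!x. \<bar>frechet_derivative \<phi> (at x) e\<bar> <= B'"
      by (rule test_functions_bounded_derivative[OF \<phi>]) auto
    let ?D = "%x. frechet_derivative \<phi> (at x) e"
    have ub: "integrable lborel (%x. u x * \<phi> (x - c))" for c
      by (rule integrable_mult_bounded[OF u _ B]) measurable
    have ui: "integrable lborel (%x. u (x + c) * \<phi> x)" for c
      by (rule integrable_mult_bounded[OF integrable_lborel_translation[OF u] _ B]) measurable
    have gi: "integrable lborel (%x. g (x + c) * \<phi> x)" for c
      by (rule integrable_mult_bounded[OF integrable_lborel_translation[OF g] _ B]) measurable
    have slice: "(\<integral>y. u y * ?D (y - t *\<^sub>R e) \<partial>lborel) = - (\<integral>x. g (x + t *\<^sub>R e) * \<phi> x \<partial>lborel)"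
      if "0 <= t" "t <= 1" for t
    proof -
      have "(%x. \<phi> (x - t *\<^sub>R e)) \<in> test_functions \<Omega>"
        by (rule test_functions_translation[OF \<phi>]) (use sub that in auto)
      from weak[OF this] have "(\<integral>y. u y * ?D (y - t *\<^sub>R e) \<partial>lborel) = - (\<integral>x. g x * \<phi> (x - t *\<^sub>R e) \<partial>lborel)"
        by (simp only: frechet_derivative_translation[OF sm])
      also have "(\<integral>x. g x * \<phi> (x - t *\<^sub>R e) \<partial>lborel) = (\<integral>x. g (x + t *\<^sub>R e) * \<phi> (x + t *\<^sub>R e - t *\<^sub>R e) \<partial>lborel)"
        by (rule integral_lborel_translation[symmetric])
          (rule integrable_mult_bounded[OF g _ B], measurable)
      finally show ?thesis by simp
    qed
    \<comment> \<open>The substitution t -> 1 - t runs the segment forwards from y - e to y, where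
      the fundamental theorem of calculus for \<phi> applies.\<close>
    have line: "(\<integral>t. indicator {0..1::real} t * ?D (y - t *\<^sub>R e) \<partial>lborel) = \<phi> y - \<phi> (y - e)" for y
    proof -
      have "(\<integral>t. indicator {0..1::real} t * ?D (y - t *\<^sub>R e) \<partial>lborel) =
          (\<integral>t. indicator {0..1} (1 - t) * ?D (y - (1 - t) *\<^sub>R e) \<partial>lborel)"
        using lborel_integral_real_affine[of "-1" "%t. indicator {0..1::real} t * ?D (y - t *\<^sub>R e)" 1]
        by simp
      also have "\<dots> = (\<integral>t. indicator {0..1} t * ?D ((y - e) + t *\<^sub>R e) \<partial>lborel)"
        by (rule B_integral_cong) (auto simp: indicator_def algebra_simps)
      also have "\<dots> = \<phi> ((y - e) + e) - \<phi> (y - e)" by (rule test_functions_line_integral[OF sm])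
      finally show ?thesis by simp
    qed
    have "(\<integral>x. (u (x + e) - u x) * \<phi> x \<partial>lborel) = (\<integral>x. u (x + e) * \<phi> x \<partial>lborel) - (\<integral>x. u x * \<phi> x \<partial>lborel)"
      using B_integral_diff[OF ui[of e] ui[of 0]] by (simp add: left_diff_distrib)
    also have "(\<integral>x. u (x + e) * \<phi> x \<partial>lborel) = (\<integral>y. u y * \<phi> (y - e) \<partial>lborel)"
      using integral_lborel_translation[OF ub[of e], of e] by simp
    also have "(\<integral>y. u y * \<phi> (y - e) \<partial>lborel) - (\<integral>x. u x * \<phi> x \<partial>lborel) =
        - (\<integral>y. u y * (\<phi> y - \<phi> (y - e)) \<partial>lborel)"
      using B_integral_diff[OF ub[of 0] ub[of e]] by (simp add: right_diff_distrib)
    also have "(\<integral>y. u y * (\<phi> y - \<phi> (y - e)) \<partial>lborel) =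
        (\<integral>y. \<integral>t. indicator {0..1::real} t * (u y * ?D (y - t *\<^sub>R e)) \<partial>lborel \<partial>lborel)"
      unfolding line[symmetric] Bochner_Integration.integral_mult_right_zero[symmetric]
      by (simp add: mult.left_commute)
    also have "\<dots> = (\<integral>t. \<integral>y. indicator {0..1::real} t * (u y * ?D (y - t *\<^sub>R e)) \<partial>lborel \<partial>lborel)"
    proof (rule lborel_pair.Fubini_integral)
      have ub': "integrable lborel (%y. u y * ?D (y - t *\<^sub>R e))" for t
        by (rule integrable_mult_bounded[OF u _ B']) measurable
      have [measurable]: "u \<in> borel_measurable borel" using u by auto
      have Bn: "B' >= 0" using B'[of 0] by linarith
      show "integrable (lborel \<Otimes>\<^sub>M lborel) (%(t, y). indicator {0..1::real} t * (u y * ?D (y - t *\<^sub>R e)))"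
      proof (rule B_integrable_bound)
        show "integrable (lborel \<Otimes>\<^sub>M lborel) (%(t, x). indicator {0..1::real} t *\<^sub>R (B' * u (x + t *\<^sub>R 0)))"
          by (rule integrable_line_average) (use u in simp)
        show "AE z in lborel \<Otimes>\<^sub>M lborel. norm (case z of (t, y) => indicator {0..1::real} t * (u y * ?D (y - t *\<^sub>R e)))
            <= norm (case z of (t, x) => indicator {0..1::real} t *\<^sub>R (B' * u (x + t *\<^sub>R 0)))"
          using B' Bn by (intro AE_I2) (auto simp: abs_mult mult.commute[of B'] intro!: mult_left_mono)
      qed measurable
    qed
    also have "\<dots> = (\<integral>t. \<integral>x. - (indicator {0..1::real} t * (g (x + t *\<^sub>R e) * \<phi> x)) \<partial>lborel \<partial>lborel)"
    proof (rule B_integral_cong[OF refl])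
      fix t :: real
      show "(\<integral>y. indicator {0..1} t * (u y * ?D (y - t *\<^sub>R e)) \<partial>lborel) =
          (\<integral>x. - (indicator {0..1} t * (g (x + t *\<^sub>R e) * \<phi> x)) \<partial>lborel)"
        using slice[of t] by (cases "t \<in> {0..1}") simp_all
    qed
    also have "\<dots> = - (\<integral>t. \<integral>x. indicator {0..1::real} t * (g (x + t *\<^sub>R e) * \<phi> x) \<partial>lborel \<partial>lborel)"
      by simp
    also have "(\<integral>t. \<integral>x. indicator {0..1::real} t * (g (x + t *\<^sub>R e) * \<phi> x) \<partial>lborel \<partial>lborel) =
        (\<integral>x. \<integral>t. indicator {0..1::real} t * (g (x + t *\<^sub>R e) * \<phi> x) \<partial>lborel \<partial>lborel)"
    proof (rule lborel_pair.Fubini_integral[symmetric])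
      have Bn: "B >= 0" using B[of 0] by linarith
      have [measurable]: "g \<in> borel_measurable borel" using g by auto
      show "integrable (lborel \<Otimes>\<^sub>M lborel) (%(t, x). indicator {0..1::real} t * (g (x + t *\<^sub>R e) * \<phi> x))"
      proof (rule B_integrable_bound)
        show "integrable (lborel \<Otimes>\<^sub>M lborel) (%(t, x). indicator {0..1::real} t *\<^sub>R (B * g (x + t *\<^sub>R e)))"
          by (rule integrable_line_average) (use g in simp)
        show "AE z in lborel \<Otimes>\<^sub>M lborel. norm (case z of (t, x) => indicator {0..1::real} t * (g (x + t *\<^sub>R e) * \<phi> x))
            <= norm (case z of (t, x) => indicator {0..1::real} t *\<^sub>R (B * g (x + t *\<^sub>R e)))"
          using B Bn by (intro AE_I2) (auto simp: abs_mult mult.commute[of B] intro!: mult_left_mono)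
      qed measurable
    qed
    also have "\<dots> = (\<integral>x. ?I x * \<phi> x \<partial>lborel)"
      by (simp add: mult.assoc[symmetric])
    finally have "(\<integral>x. (u (x + e) - u x) * \<phi> x \<partial>lborel) = (\<integral>x. ?I x * \<phi> x \<partial>lborel)"
      by simp
    moreover have "integrable lborel (%x. (u (x + e) - u x) * \<phi> x)" "integrable lborel (%x. ?I x * \<phi> x)"
      by (intro integrable_mult_bounded[OF _ _ B] B_integrable_diff integrable_lborel_translation u I;
          measurable)+
    ultimately show "(\<integral>x. ((u (x + e) - u x) - ?I x) * \<phi> x \<partial>lborel) = 0"
      by (simp add: left_diff_distrib)
  qed
  then show ?thesis by (rule eventually_mono) simp
qed

text \<open>Truncating \<open>s n\<close> to [-c, c] leaves a sequence with the fixed majorant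
  \<open>c\<close>, and the truncation error is at most |b n - c|. Moving majorants occur because
  difference quotients are dominated only by difference quotients.\<close>

lemma integral_dominated_convergence_L1:
  fixes f :: "'a => real"
  assumes lim: "AE x in M. (%n. s n x) \<longlonglongrightarrow> f x"
    and bound: "!!n. AE x in M. \<bar>s n x\<bar> <= b n x" "AE x in M. \<bar>f x\<bar> <= c x"
    and meas: "!!n. s n \<in> borel_measurable M" "f \<in> borel_measurable M"
    and int: "!!n. integrable M (b n)" "integrable M c"
    and conv: "(%n. \<integral>x. \<bar>b n x - c x\<bar> \<partial>M) \<longlonglongrightarrow> 0"
  shows "(%n. \<integral>x. s n x \<partial>M) \<longlonglongrightarrow> (\<integral>x. f x \<partial>M)"
proof -
  note [measurable] = meas borel_measurable_integrable[OF int(1)] borel_measurable_integrable[OF int(2)]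
  define g where "g n x = max (- c x) (min (c x) (s n x))" for n x
  have [measurable]: "g n \<in> borel_measurable M" for n unfolding g_def by measurable
  have gb: "AE x in M. \<bar>g n x\<bar> <= c x" for n
    using bound(2) by eventually_elim (auto simp: g_def)
  have sint: "integrable M (s n)" for n
    by (rule B_integrable_bound[OF int(1)[of n]]) (use bound(1)[of n] in auto)
  have gint: "integrable M (g n)" for n
    by (rule B_integrable_bound[OF int(2)]) (use gb[of n] in auto)
  have "(%n. \<integral>x. g n x \<partial>M) \<longlonglongrightarrow> (\<integral>x. f x \<partial>M)"
  proof (rule integral_dominated_convergence[where w = c])
    show "AE x in M. (%n. g n x) \<longlonglongrightarrow> f x"
      using lim bound(2)
    proof eventually_elim
      case (elim x)
      have "(%n. max (- c x) (min (c x) (s n x))) \<longlonglongrightarrow> max (- c x) (min (c x) (f x))"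
        by (intro tendsto_intros elim(1))
      moreover have "max (- c x) (min (c x) (f x)) = f x" using elim(2) by auto
      ultimately show ?case by (simp add: g_def)
    qed
  qed (use gb int in auto)
  moreover have "(%n. (\<integral>x. s n x \<partial>M) - (\<integral>x. g n x \<partial>M)) \<longlonglongrightarrow> 0"
  proof (rule Lim_null_comparison[OF always_eventually conv], rule allI)
    fix n
    have "norm ((\<integral>x. s n x \<partial>M) - (\<integral>x. g n x \<partial>M)) = norm (\<integral>x. s n x - g n x \<partial>M)"
      by (simp add: sint gint)
    also have "\<dots> <= (\<integral>x. norm (s n x - g n x) \<partial>M)" by (rule integral_norm_bound)
    also have "\<dots> <= (\<integral>x. \<bar>b n x - c x\<bar> \<partial>M)"
    proof (rule integral_mono_AE)
      show "AE x in M. norm (s n x - g n x) <= \<bar>b n x - c x\<bar>"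
        using bound(1)[of n] bound(2) by eventually_elim (auto simp: g_def)
    qed (auto intro!: integrable_abs B_integrable_diff sint gint int)
    finally show "norm ((\<integral>x. s n x \<partial>M) - (\<integral>x. g n x \<partial>M)) <= (\<integral>x. \<bar>b n x - c x\<bar> \<partial>M)" .
  qed
  ultimately have "(%n. (\<integral>x. g n x \<partial>M) + ((\<integral>x. s n x \<partial>M) - (\<integral>x. g n x \<partial>M))) \<longlonglongrightarrow> (\<integral>x. f x \<partial>M) + 0"
    by (rule tendsto_add)
  then show ?thesis by simp
qed

lemma AE_lborel_translation:
  fixes c :: "'a::euclidean_space"
  assumes "AE x in lborel. P x" shows "AE x in lborel. P (x + c)"
proof -
  obtain N where N: "N \<in> null_sets lborel" "{x. \<not> P x} \<subseteq> N"
    using assms by (auto simp: eventually_ae_filter)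
  have "emeasure (distr lborel borel ((+) c)) N = emeasure lborel ((+) c -` N)"
    using N(1) by (subst emeasure_distr) auto
  then have "emeasure lborel ((+) c -` N) = 0"
    using N(1) by (simp add: lborel_distr_plus null_sets_def)
  moreover have "(+) c -` N \<in> sets lborel"
    using measurable_sets[of "(+) c" borel borel N] null_setsD2[OF N(1)] by simp
  ultimately have "(+) c -` N \<in> null_sets lborel" by blast
  moreover have "{x. \<not> P (x + c)} \<subseteq> (+) c -` N" using N(2) by (auto simp: add.commute)
  ultimately show ?thesis by (auto simp: eventually_ae_filter)
qed

text \<open>The difference quotients of u and v supply directions \<open>d n\<close> that vary with
  n and merely converge, and the points reached lie in C but need not fill a neighbourhood; hence a
  sequential form of the derivative within C.\<close>

lemma has_derivative_along_sequence:
  fixes f :: "'c::real_normed_vector => 'd::real_normed_vector" and h :: "nat => real"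
  assumes f: "(f has_derivative f') (at z within C)"
    and d: "d \<longlonglongrightarrow> \<delta>" and h: "h \<longlonglongrightarrow> 0" and C: "\<forall>\<^sub>F n in sequentially. z + h n *\<^sub>R d n \<in> C"
    and h0: "!!n. h n ~= 0"
  shows "(%n. (f (z + h n *\<^sub>R d n) - f z) /\<^sub>R h n) \<longlonglongrightarrow> f' \<delta>"
proof -
  have bl: "bounded_linear f'" using f by (rule has_derivative_bounded_linear)
  have lin: "(%n. f' (d n)) \<longlonglongrightarrow> f' \<delta>" by (rule bounded_linear.tendsto[OF bl d])
  have "(%n. (f (z + h n *\<^sub>R d n) - f z) /\<^sub>R h n - f' (d n)) \<longlonglongrightarrow> 0"
  proof (rule tendstoI)
    fix e :: real assume e: "e > 0"
    obtain B where B: "B > 0" "!!n. norm (d n) <= B"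
      using convergent_imp_Bseq[of d] d by (auto simp: convergent_def Bseq_def)
    obtain \<delta>' where \<delta>': "\<delta>' > 0"
      "!!y. y \<in> C ==> norm (y - z) < \<delta>' ==> norm (f y - f z - f' (y - z)) <= e / (2 * B) * norm (y - z)"
    proof -
      have "e / (2 * B) > 0" using e B(1) by simp
      then show ?thesis using f that unfolding has_derivative_within_alt by blast
    qed
    have "(%n. h n *\<^sub>R d n) \<longlonglongrightarrow> 0 *\<^sub>R \<delta>" by (intro tendsto_intros h d)
    then have "\<forall>\<^sub>F n in sequentially. norm (h n *\<^sub>R d n) < \<delta>'"
      using \<delta>'(1) by (simp add: tendsto_iff dist_norm)
    with C show "\<forall>\<^sub>F n in sequentially. dist ((f (z + h n *\<^sub>R d n) - f z) /\<^sub>R h n - f' (d n)) 0 < e"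
    proof eventually_elim
      case (elim n)
      have f'h: "f' (h n *\<^sub>R d n) = h n *\<^sub>R f' (d n)"
        using bl by (simp add: linear_simps)
      have "norm (f (z + h n *\<^sub>R d n) - f z - f' (h n *\<^sub>R d n)) <= e / (2 * B) * (\<bar>h n\<bar> * norm (d n))"
        using \<delta>'(2)[OF elim(1)] elim(2) by simp
      also have "\<dots> <= e / (2 * B) * (\<bar>h n\<bar> * B)"
        using B e by (intro mult_left_mono) auto
      also have "\<dots> = \<bar>h n\<bar> * (e / 2)" using B(1) by simp
      finally have *: "norm (f (z + h n *\<^sub>R d n) - f z - h n *\<^sub>R f' (d n)) <= \<bar>h n\<bar> * (e / 2)" unfolding f'h .
      have "(f (z + h n *\<^sub>R d n) - f z) /\<^sub>R h n - f' (d n) = (f (z + h n *\<^sub>R d n) - f z - h n *\<^sub>R f' (d n)) /\<^sub>R h n"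
        using h0[of n] by (simp add: scaleR_right_diff_distrib)
      then have "norm ((f (z + h n *\<^sub>R d n) - f z) /\<^sub>R h n - f' (d n)) =
          norm (f (z + h n *\<^sub>R d n) - f z - h n *\<^sub>R f' (d n)) / \<bar>h n\<bar>"
        by (simp only: norm_scaleR abs_inverse divide_inverse mult.commute)
      also have "\<dots> <= e / 2" using * h0[of n] by (simp add: pos_divide_le_eq mult.commute)
      finally have "norm ((f (z + h n *\<^sub>R d n) - f z) /\<^sub>R h n - f' (d n)) <= e / 2" .
      then show ?case using e by simp
    qed
  qed
  from tendsto_add[OF this lin] show ?thesis by simp
qed

lemma test_functions_derivative_scale:
  assumes "smooth_on UNIV \<phi>"
  shows "frechet_derivative \<phi> (at x) (c *\<^sub>R e) = c * frechet_derivative \<phi> (at x) e"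
proof -
  have "linear (frechet_derivative \<phi> (at x))"
    using smooth_on_has_derivative[OF assms] has_derivative_bounded_linear bounded_linear.linear by blast
  then show ?thesis by (simp add: linear_scale)
qed

lemma wderiv_scale: "wderiv \<Omega> e u g ==> wderiv \<Omega> (c *\<^sub>R e) u (%x. c * g x)"
  unfolding wderiv_def
  by (simp add: test_functions_derivative_scale[OF test_functionsD(1)] mult.left_commute[of _ c] mult.assoc)

text \<open>By the increment formula the error is the average over t in [0,1] of g(x + t h e) -
  g(x). Its L1 norm is at most the average of the translation errors of g, which tend to 0 and are
  dominated by twice the norm of g.\<close>

lemma wderiv_difference_quotient:
  fixes \<Omega> Q :: "'a::euclidean_space set"
  assumes w: "wderiv \<Omega> e u g" and Q: "open Q"
    and sub: "!!x s. x \<in> Q ==> \<bar>s\<bar> <= \<delta> ==> x + s *\<^sub>R e \<in> \<Omega>"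
    and h: "h \<longlonglongrightarrow> 0" "!!n. h n ~= 0" "!!n. \<bar>h n\<bar> <= \<delta>"
  shows "(%n. \<integral>x. \<bar>indicator Q x * ((u (x + h n *\<^sub>R e) - u x) / h n - g x)\<bar> \<partial>lborel) \<longlonglongrightarrow> 0"
proof -
  have u: "integrable lborel u" and g: "integrable lborel g" using w by (auto simp: wderiv_def)
  have [measurable]: "u \<in> borel_measurable borel" "g \<in> borel_measurable borel" "Q \<in> sets borel"
    using u g Q by auto
  let ?I = "indicator {0..1} :: real => real"
  let ?F = "%n t x. ?I t * (g (x + t *\<^sub>R (h n *\<^sub>R e)) - g x)"
  have la: "integrable (lborel \<Otimes>\<^sub>M lborel) (%(t, x). ?I t * g (x + t *\<^sub>R c))" for c
    using integrable_line_average[OF g, of c] by simp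
  have F: "integrable (lborel \<Otimes>\<^sub>M lborel) (%(t, x). ?F n t x)" for n
    using B_integrable_diff[OF la[of "h n *\<^sub>R e"] la[of 0]]
    by (simp add: case_prod_unfold right_diff_distrib)
  have Fn: "integrable (lborel \<Otimes>\<^sub>M lborel) (%(t, x). \<bar>?F n t x\<bar>)" for n
    using integrable_abs[OF F[of n]] by (simp add: case_prod_unfold)
  let ?T = "%n t. ?I t * (\<integral>x. \<bar>g (x + t *\<^sub>R (h n *\<^sub>R e)) - g x\<bar> \<partial>lborel)"
  have bound: "(\<integral>x. \<bar>indicator Q x * ((u (x + h n *\<^sub>R e) - u x) / h n - g x)\<bar> \<partial>lborel) <= (\<integral>t. ?T n t \<partial>lborel)" for n
  proof -
    have inc: "AE x in lborel. x \<in> Q --> u (x + h n *\<^sub>R e) - u x = (\<integral>t. ?I t * (h n * g (x + t *\<^sub>R (h n *\<^sub>R e))) \<partial>lborel)"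
    proof (rule wderiv_increment[OF wderiv_scale[OF w] Q])
      fix x and t :: real assume "x \<in> Q" and t: "0 <= t" "t <= 1"
      have "\<bar>t * h n\<bar> <= 1 * \<bar>h n\<bar>" unfolding abs_mult using t by (intro mult_right_mono) auto
      then show "x + t *\<^sub>R (h n *\<^sub>R e) \<in> \<Omega>"
        using sub[OF \<open>x \<in> Q\<close>, of "t * h n"] h(3)[of n] by simp
    qed
    have int1: "AE x in lborel. integrable lborel (%t. ?I t * g (x + t *\<^sub>R (h n *\<^sub>R e)))"
      using lborel_pair.AE_integrable_snd[OF la[of "h n *\<^sub>R e"]] by simp
    have "(\<integral>x. \<bar>indicator Q x * ((u (x + h n *\<^sub>R e) - u x) / h n - g x)\<bar> \<partial>lborel) <= (\<integral>x. \<integral>t. \<bar>?F n t x\<bar> \<partial>lborel \<partial>lborel)"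
    proof (rule integral_mono_AE)
      show "integrable lborel (%x. \<integral>t. \<bar>?F n t x\<bar> \<partial>lborel)"
        using lborel_pair.integrable_snd[OF Fn[of n]] by simp
      have "integrable lborel (%x. (u (x + h n *\<^sub>R e) - u x) / h n - g x)"
        by (intro B_integrable_diff integrable_divide integrable_lborel_translation u g)
      from integrable_mult_indicator[OF _ this, of Q]
      show "integrable lborel (%x. \<bar>indicator Q x * ((u (x + h n *\<^sub>R e) - u x) / h n - g x)\<bar>)"
        by (intro integrable_abs) simp
      show "AE x in lborel. \<bar>indicator Q x * ((u (x + h n *\<^sub>R e) - u x) / h n - g x)\<bar> <= (\<integral>t. \<bar>?F n t x\<bar> \<partial>lborel)"
        using inc int1
      proof eventually_elim
        case (elim x)
        show ?case
        proof (cases "x \<in> Q")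
          case True
          have "(u (x + h n *\<^sub>R e) - u x) / h n = (\<integral>t. ?I t * g (x + t *\<^sub>R (h n *\<^sub>R e)) \<partial>lborel)"
            using elim(1) True h(2)[of n] by (simp add: mult.left_commute[of _ "h n"])
          moreover have "g x = (\<integral>t. ?I t * g x \<partial>lborel)" by simp
          ultimately have "(u (x + h n *\<^sub>R e) - u x) / h n - g x = (\<integral>t. ?F n t x \<partial>lborel)"
            using B_integral_diff[OF elim(2), of "%t. ?I t * g x"] by (simp add: right_diff_distrib)
          then show ?thesis using True integral_abs_bound[of lborel "%t. ?F n t x"] by simp
        qed simp
      qed
    qed
    also have "\<dots> = (\<integral>t. \<integral>x. \<bar>?F n t x\<bar> \<partial>lborel \<partial>lborel)"
      by (rule lborel_pair.Fubini_integral[OF Fn])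
    also have "\<dots> = (\<integral>t. ?T n t \<partial>lborel)" by (simp add: abs_mult)
    finally show ?thesis .
  qed
  have "(%n. \<integral>t. ?T n t \<partial>lborel) \<longlonglongrightarrow> (\<integral>t. 0 \<partial>(lborel :: real measure))"
  proof (rule integral_dominated_convergence[where w = "%t. ?I t * (2 * (\<integral>x. \<bar>g x\<bar> \<partial>lborel))"])
    show "?T n \<in> borel_measurable lborel" for n by measurable
    show "integrable lborel (%t. ?I t * (2 * (\<integral>x. \<bar>g x\<bar> \<partial>lborel)))"
      by (intro integrable_mult_left) simp
    show "AE t in lborel. (%n. ?T n t) \<longlonglongrightarrow> 0"
    proof (intro AE_I2 tendsto_mult_right_zero)
      fix t :: real
      have "(%n. t *\<^sub>R (h n *\<^sub>R e)) \<longlonglongrightarrow> t *\<^sub>R (0 *\<^sub>R e)" by (intro tendsto_intros h)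
      then show "(%n. \<integral>x. \<bar>g (x + t *\<^sub>R (h n *\<^sub>R e)) - g x\<bar> \<partial>lborel) \<longlonglongrightarrow> 0"
        using tendsto_translation_L1[OF g, of "%n. t *\<^sub>R (h n *\<^sub>R e)"] by simp
    qed
    show "AE t in lborel. norm (?T n t) <= ?I t * (2 * (\<integral>x. \<bar>g x\<bar> \<partial>lborel))" for n
    proof (intro AE_I2)
      fix t :: real
      show "norm (?T n t) <= ?I t * (2 * (\<integral>x. \<bar>g x\<bar> \<partial>lborel))"
        using integral_translation_diff_le[OF g, of "t *\<^sub>R (h n *\<^sub>R e)"]
        by (simp split: split_indicator)
    qed
  qed simp
  then have "(%n. \<integral>t. ?T n t \<partial>lborel) \<longlonglongrightarrow> 0" by simp
  then show ?thesis
    by (rule Lim_null_comparison[OF always_eventually, rotated]) (use bound in simp)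
qed

lemma smooth_on_directional_lipschitz:
  assumes \<phi>: "smooth_on UNIV \<phi>" and B: "!!x. \<bar>frechet_derivative \<phi> (at x) e\<bar> <= B"
  shows "\<bar>\<phi> (x + s *\<^sub>R e) - \<phi> x\<bar> <= B * \<bar>s\<bar>"
proof -
  have d: "((%t. \<phi> (x + t *\<^sub>R e)) has_field_derivative frechet_derivative \<phi> (at (x + t *\<^sub>R e)) e) (at t)" for t
  proof -
    have "((%t. \<phi> (x + t *\<^sub>R e)) has_derivative (%s. frechet_derivative \<phi> (at (x + t *\<^sub>R e)) (s *\<^sub>R e))) (at t)"
      by (rule has_derivative_compose[where f = "%t. x + t *\<^sub>R e", OF _ smooth_on_has_derivative[OF \<phi>]])
        (auto intro!: derivative_eq_intros)
    then show ?thesis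
      by (simp add: has_field_derivative_def test_functions_derivative_scale[OF \<phi>] mult_commute_abs)
  qed
  have "norm (\<phi> (x + s *\<^sub>R e) - \<phi> (x + 0 *\<^sub>R e)) <= B * norm (s - 0)"
    by (rule field_differentiable_bound[of UNIV "%t. \<phi> (x + t *\<^sub>R e)"]) (use d B in auto)
  then show ?thesis by simp
qed

text \<open>Chain rule by difference quotients. Along a subsequence the quotients of u and v
  converge almost everywhere, hence so do those of f(u, v); the Lipschitz constant L majorizes the
  latter by quotients that converge in L1. A translation then moves the quotient onto the test
  function. Values and derivatives of f enter only on the convex set C.\<close>

lemma wderiv_compose:
  fixes \<Omega> :: "'a::euclidean_space set" and f :: "real \<times> real => real"
  assumes \<Omega>: "open \<Omega>" "bounded \<Omega>"
    and wu: "wderiv \<Omega> e u gu" and wv: "wderiv \<Omega> e v gv"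
    and C: "convex C" "AE x in lborel. x \<in> \<Omega> --> (u x, v x) \<in> C"
    and f: "!!z. z \<in> C ==> (f has_derivative (%d. f' z \<bullet> d)) (at z within C)"
    and L: "!!z. z \<in> C ==> norm (f' z) <= L"
    and meas[measurable]: "f \<in> borel_measurable borel" "f' \<in> borel_measurable borel"
  shows "wderiv \<Omega> e (%x. indicator \<Omega> x * f (u x, v x)) (%x. indicator \<Omega> x * (f' (u x, v x) \<bullet> (gu x, gv x)))"
proof (cases "\<Omega> = {}")
  case True
  then show ?thesis by (auto simp: wderiv_def test_functions_def)
next
  case False
  have u: "integrable lborel u" and gu: "integrable lborel gu"
    and v: "integrable lborel v" and gv: "integrable lborel gv"
    using wu wv by (auto simp: wderiv_def)
  have [measurable]: "u \<in> borel_measurable borel" "gu \<in> borel_measurable borel"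
    "v \<in> borel_measurable borel" "gv \<in> borel_measurable borel" "\<Omega> \<in> sets borel"
    using u gu v gv \<Omega> by auto
  have \<Omega>fin: "emeasure lborel \<Omega> < \<infinity>" using \<Omega>(2) by (rule emeasure_bounded_finite)
  define W where "W x = indicator \<Omega> x * f (u x, v x)" for x
  define G where "G x = indicator \<Omega> x * (f' (u x, v x) \<bullet> (gu x, gv x))" for x
  have [measurable]: "W \<in> borel_measurable borel" "G \<in> borel_measurable borel"
    unfolding W_def G_def by measurable
  have lip: "\<bar>f z - f z'\<bar> <= L * norm (z - z')" if "z \<in> C" "z' \<in> C" for z z'
  proof -
    have "norm (f z - f z') <= L * norm (z - z')"
    proof (rule differentiable_bound[OF C(1) f])
      show "onorm (%d. f' x \<bullet> d) <= L" if "x \<in> C" for x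
      proof (rule onorm_le)
        fix d
        show "norm (f' x \<bullet> d) <= L * norm d"
          using Cauchy_Schwarz_ineq2[of "f' x" d] mult_right_mono[OF L[OF that], of "norm d"] by simp
      qed
    qed (use that in auto)
    then show ?thesis by simp
  qed
  \<comment> \<open>C cannot be empty: otherwise \<Omega> would be a null set, but it is open and
    nonempty.\<close>
  obtain z0 where z0: "z0 \<in> C"
  proof (cases "C = {}")
    case True
    then have "AE x in lborel. x \<notin> \<Omega>" using C(2) by simp
    then have "\<Omega> \<in> null_sets lborel" by (simp add: AE_iff_null_sets)
    then have "negligible \<Omega>" by (simp add: negligible_iff_null_sets null_sets_completionI)
    with open_not_negligible[OF \<Omega>(1)] False show ?thesis by simp
  qed auto
  have L0: "L >= 0" using L[OF z0] norm_ge_zero[of "f' z0"] by linarith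
  have np: "norm (a, b) <= \<bar>a\<bar> + \<bar>b\<bar>" for a b :: real using norm_Pair_le[of a b] by simp
  have W: "integrable lborel W"
  proof (rule B_integrable_bound)
    show "integrable lborel (%x. indicator \<Omega> x * (\<bar>f z0\<bar> + L * norm z0) + L * (\<bar>u x\<bar> + \<bar>v x\<bar>))"
      using u v \<Omega>fin by (auto intro!: integrable_mult_left integrable_mult_right integrable_real_indicator)
    show "AE x in lborel. norm (W x) <= norm (indicator \<Omega> x * (\<bar>f z0\<bar> + L * norm z0) + L * (\<bar>u x\<bar> + \<bar>v x\<bar>))"
      using C(2)
    proof eventually_elim
      case (elim x)
      show ?case
      proof (cases "x \<in> \<Omega>")
        case True
        have "\<bar>f (u x, v x)\<bar> <= \<bar>f z0\<bar> + L * norm ((u x, v x) - z0)"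
          using lip[of "(u x, v x)" z0] elim True z0 by auto
        moreover have "norm ((u x, v x) - z0) <= norm z0 + (\<bar>u x\<bar> + \<bar>v x\<bar>)"
          using norm_triangle_ineq4[of "(u x, v x)" z0] np[of "u x" "v x"] by linarith
        then have "L * norm ((u x, v x) - z0) <= L * (norm z0 + (\<bar>u x\<bar> + \<bar>v x\<bar>))"
          using L0 by (rule mult_left_mono)
        ultimately show ?thesis using True L0 by (simp add: W_def algebra_simps)
      qed (simp add: W_def)
    qed
  qed measurable
  have Gb: "AE x in lborel. \<bar>G x\<bar> <= L * (\<bar>gu x\<bar> + \<bar>gv x\<bar>)"
    using C(2)
  proof eventually_elim
    case (elim x)
    show ?case
    proof (cases "x \<in> \<Omega>")
      case True
      have "\<bar>f' (u x, v x) \<bullet> (gu x, gv x)\<bar> <= norm (f' (u x, v x)) * norm (gu x, gv x)"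
        by (rule Cauchy_Schwarz_ineq2)
      also have "\<dots> <= L * (\<bar>gu x\<bar> + \<bar>gv x\<bar>)"
        using L[of "(u x, v x)"] elim True np[of "gu x" "gv x"] L0 by (intro mult_mono) auto
      finally show ?thesis using True by (simp add: G_def)
    qed (simp add: G_def L0)
  qed
  have G: "integrable lborel G"
  proof (rule B_integrable_bound)
    show "integrable lborel (%x. L * (\<bar>gu x\<bar> + \<bar>gv x\<bar>))" using gu gv by auto
    show "AE x in lborel. norm (G x) <= norm (L * (\<bar>gu x\<bar> + \<bar>gv x\<bar>))"
      using Gb by eventually_elim auto
  qed measurable
  have "(\<integral>x. W x * frechet_derivative \<phi> (at x) e \<partial>lborel) = - (\<integral>x. G x * \<phi> x \<partial>lborel)"
    if \<phi>: "\<phi> \<in> test_functions \<Omega>" for \<phi>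
  proof -
    note sm = test_functionsD(1)[OF \<phi>]
    note [measurable] = smooth_on_borel_measurable(1)[OF sm] smooth_on_borel_measurable(2)[OF sm, of e]
    define K where "K = closure {x. \<phi> x ~= 0}"
    have K: "compact K" "K \<subseteq> \<Omega>" using test_functionsD[OF \<phi>] by (auto simp: K_def)
    have \<phi>0: "\<phi> x = 0" if "x \<notin> K" for x using that unfolding K_def by (rule test_functions_zero_outside(1)[OF \<phi>])
    obtain B where B: "B > 0" "!!x. \<bar>\<phi> x\<bar> <= B" by (rule test_functions_bounded[OF \<phi>]) auto
    obtain B' where B': "B' > 0" "!!x. \<bar>frechet_derivative \<phi> (at x) e\<bar> <= B'"
      by (rule test_functions_bounded_derivative[OF \<phi>]) auto
    have "closed (- \<Omega>)" "K \<inter> - \<Omega> = {}" using \<Omega>(1) K(2) by (auto simp: closed_Compl)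
    from separate_compact_closed[OF K(1) this] obtain d
      where d: "d > 0" "\<forall>x\<in>K. \<forall>y\<in>- \<Omega>. d <= dist x y" by (elim exE conjE)
    \<comment> \<open>Half of the distance from the support to the complement of \<Omega> is spent
      on the neighbourhood \<open>Q\<close> of the support, half on the shift;
      \<open>norm e + 1\<close> also covers e = 0.\<close>
    define \<delta> where "\<delta> = d / (2 * (norm e + 1))"
    have \<delta>: "\<delta> > 0" "\<delta> * norm e <= d / 2"
    proof -
      show "\<delta> > 0" using d(1) by (simp add: \<delta>_def add_nonneg_pos)
      have "\<delta> * norm e <= \<delta> * (norm e + 1)" using \<open>\<delta> > 0\<close> by simp
      also have "\<dots> = d / 2"
        using norm_ge_zero[of e] by (simp add: \<delta>_def field_simps add_nonneg_eq_0_iff)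
      finally show "\<delta> * norm e <= d / 2" .
    qed
    define Q where "Q = (\<Union>k\<in>K. ball k (d / 2))"
    have Qo: "open Q" and KQ: "K \<subseteq> Q" using d(1) by (auto simp: Q_def)
    have Qsub: "x + s *\<^sub>R e \<in> \<Omega>" if "x \<in> Q" "\<bar>s\<bar> <= \<delta>" for x s
    proof (rule ccontr)
      assume n: "x + s *\<^sub>R e \<notin> \<Omega>"
      obtain k where k: "k \<in> K" "dist k x < d / 2" using \<open>x \<in> Q\<close> by (auto simp: Q_def)
      have "dist k (x + s *\<^sub>R e) <= dist k x + dist x (x + s *\<^sub>R e)" by (rule dist_triangle)
      also have "dist x (x + s *\<^sub>R e) = \<bar>s\<bar> * norm e" by (simp add: dist_norm)
      also have "\<dots> <= \<delta> * norm e" using that(2) by (intro mult_right_mono) auto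
      finally have "dist k (x + s *\<^sub>R e) < d" using k(2) \<delta>(2) by linarith
      moreover have "d <= dist k (x + s *\<^sub>R e)" using d(2) k(1) n by simp
      ultimately show False by simp
    qed
    have [measurable]: "Q \<in> sets borel" using Qo by simp
    define h where "h n = \<delta> * inverse (real (Suc n))" for n
    have h: "h \<longlonglongrightarrow> 0" "!!n. h n ~= 0" "!!n. \<bar>h n\<bar> <= \<delta>"
    proof -
      show "h \<longlonglongrightarrow> 0" unfolding h_def by (intro tendsto_mult_right_zero LIMSEQ_inverse_real_of_nat)
      show "h n ~= 0" for n using \<delta>(1) by (simp add: h_def)
      have "inverse (real (Suc n)) <= 1" for n by (simp add: inverse_le_1_iff)
      then show "\<bar>h n\<bar> <= \<delta>" for n using \<delta>(1) by (simp add: h_def abs_mult mult_left_le)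
    qed
    let ?Eu = "%n x. indicator Q x * ((u (x + h n *\<^sub>R e) - u x) / h n - gu x)"
    let ?Ev = "%n x. indicator Q x * ((v (x + h n *\<^sub>R e) - v x) / h n - gv x)"
    define S where "S n x = \<bar>?Eu n x\<bar> + \<bar>?Ev n x\<bar>" for n x
    have iE: "integrable lborel (?Eu n)" "integrable lborel (?Ev n)" for n
    proof -
      have "integrable lborel (%x. (u (x + h n *\<^sub>R e) - u x) / h n - gu x)"
        "integrable lborel (%x. (v (x + h n *\<^sub>R e) - v x) / h n - gv x)"
        by (intro B_integrable_diff integrable_divide integrable_lborel_translation u v gu gv)+
      note i = this
      show "integrable lborel (?Eu n)" "integrable lborel (?Ev n)"
        using integrable_mult_indicator[OF _ i(1), of Q] integrable_mult_indicator[OF _ i(2), of Q] by simp_all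
    qed
    have iS: "integrable lborel (S n)" for n
      unfolding S_def by (intro B_integrable_add integrable_abs iE)
    have "(%n. (\<integral>x. \<bar>?Eu n x\<bar> \<partial>lborel) + (\<integral>x. \<bar>?Ev n x\<bar> \<partial>lborel)) \<longlonglongrightarrow> 0"
      by (intro tendsto_add_zero wderiv_difference_quotient[OF wu Qo Qsub h] wderiv_difference_quotient[OF wv Qo Qsub h])
    moreover have "(\<integral>x. \<bar>?Eu n x\<bar> \<partial>lborel) + (\<integral>x. \<bar>?Ev n x\<bar> \<partial>lborel) = (\<integral>x. S n x \<partial>lborel)" for n
      unfolding S_def by (intro B_integral_add[symmetric] integrable_abs iE)
    ultimately have S0: "(%n. \<integral>x. S n x \<partial>lborel) \<longlonglongrightarrow> 0" by simp
    moreover have "norm (S n x) = S n x" for n x by (simp add: S_def)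
    \<comment> \<open>\<open>S\<close> adds the errors of u and v, so one subsequence serves
      both.\<close>
    ultimately obtain r where r: "strict_mono r" "AE x in lborel. (%n. S (r n) x) \<longlonglongrightarrow> 0"
      using tendsto_L1_AE_subseq[of lborel S] iS by auto
    define k where "k n = h (r n)" for n
    have k: "k \<longlonglongrightarrow> 0" "!!n. k n ~= 0" "!!n. \<bar>k n\<bar> <= \<delta>"
      using h LIMSEQ_subseq_LIMSEQ[OF h(1) r(1)] by (auto simp: k_def[abs_def] o_def)
    let ?Du = "%n x. (u (x + k n *\<^sub>R e) - u x) / k n" and ?Dv = "%n x. (v (x + k n *\<^sub>R e) - v x) / k n"
    have Cn: "AE x in lborel. \<forall>n. x + k n *\<^sub>R e \<in> \<Omega> --> (u (x + k n *\<^sub>R e), v (x + k n *\<^sub>R e)) \<in> C"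
      unfolding AE_all_countable by (intro allI AE_lborel_translation C(2))
    define s where "s n x = \<phi> x * ((W (x + k n *\<^sub>R e) - W x) / k n)" for n x
    have smain: "AE x in lborel. (%n. s n x) \<longlonglongrightarrow> \<phi> x * G x \<and>
        (\<forall>n. \<bar>s n x\<bar> <= B * L * (indicator Q x * (\<bar>?Du n x\<bar> + \<bar>?Dv n x\<bar>)))"
      using C(2) Cn r(2)
    proof eventually_elim
      case (elim x)
      show ?case
      proof (cases "x \<in> K")
        case False
        then show ?thesis using \<phi>0[of x] B(1) L0 by (simp add: s_def)
      next
        case True
        then have xQ: "x \<in> Q" and x\<Omega>: "x \<in> \<Omega>" using KQ K(2) by auto
        have xk: "x + k n *\<^sub>R e \<in> \<Omega>" for n by (rule Qsub[OF xQ k(3)])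
        let ?z = "(u x, v x)" and ?d = "%n. (?Du n x, ?Dv n x)"
        have zC: "?z \<in> C" using elim(1) x\<Omega> by simp
        have zk: "?z + k n *\<^sub>R ?d n = (u (x + k n *\<^sub>R e), v (x + k n *\<^sub>R e))" for n
          using k(2)[of n] by simp
        have zkC: "?z + k n *\<^sub>R ?d n \<in> C" for n unfolding zk using elim(2) xk by simp
        have lim0: "(%n. \<bar>?Du n x - gu x\<bar>) \<longlonglongrightarrow> 0" "(%n. \<bar>?Dv n x - gv x\<bar>) \<longlonglongrightarrow> 0"
          by (rule Lim_null_comparison[OF always_eventually elim(3)], rule allI, use xQ in \<open>simp add: S_def k_def\<close>)+
        have "(%n. ?d n) \<longlonglongrightarrow> (gu x, gv x)"
          using lim0 by (intro tendsto_Pair) (simp_all add: tendsto_rabs_zero_iff LIM_zero_iff)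
        then have "(%n. (f (?z + k n *\<^sub>R ?d n) - f ?z) /\<^sub>R k n) \<longlonglongrightarrow> f' ?z \<bullet> (gu x, gv x)"
          by (intro has_derivative_along_sequence[OF f[OF zC]] k always_eventually allI zkC)
        moreover have Wd: "(W (x + k n *\<^sub>R e) - W x) / k n = (f (?z + k n *\<^sub>R ?d n) - f ?z) /\<^sub>R k n" for n
          unfolding zk using xk x\<Omega> by (simp add: W_def divide_inverse mult.commute)
        ultimately have "(%n. s n x) \<longlonglongrightarrow> \<phi> x * G x"
          unfolding s_def Wd using x\<Omega> by (intro tendsto_mult tendsto_const) (simp add: G_def)
        moreover have "\<bar>s n x\<bar> <= B * L * (indicator Q x * (\<bar>?Du n x\<bar> + \<bar>?Dv n x\<bar>))" for n
        proof -
          have "\<bar>f (?z + k n *\<^sub>R ?d n) - f ?z\<bar> <= L * norm (k n *\<^sub>R ?d n)"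
            using lip[OF zkC zC, of n] by (simp only: add_diff_cancel_left')
          then have "\<bar>(W (x + k n *\<^sub>R e) - W x) / k n\<bar> <= L * norm (?d n)"
            unfolding Wd using k(2)[of n] by (simp add: abs_mult field_simps del: norm_scaleR scaleR_Pair) (simp add: norm_scaleR del: scaleR_Pair)
          also have "\<dots> <= L * (\<bar>?Du n x\<bar> + \<bar>?Dv n x\<bar>)" by (intro mult_left_mono np L0)
          finally have "\<bar>s n x\<bar> <= B * (L * (\<bar>?Du n x\<bar> + \<bar>?Dv n x\<bar>))"
            unfolding s_def abs_mult using B by (intro mult_mono) auto
          then show ?thesis using xQ by simp
        qed
        ultimately show ?thesis by blast
      qed
    qed
    have lim1: "(%n. \<integral>x. s n x \<partial>lborel) \<longlonglongrightarrow> (\<integral>x. \<phi> x * G x \<partial>lborel)"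
    proof (rule integral_dominated_convergence_L1)
      let ?b = "%n x. B * L * (indicator Q x * (\<bar>?Du n x\<bar> + \<bar>?Dv n x\<bar>))"
      let ?c = "%x. B * L * (indicator Q x * (\<bar>gu x\<bar> + \<bar>gv x\<bar>))"
      show "AE x in lborel. (%n. s n x) \<longlonglongrightarrow> \<phi> x * G x" using smain by eventually_elim auto
      show "AE x in lborel. \<bar>s n x\<bar> <= ?b n x" for n using smain by eventually_elim auto
      show "AE x in lborel. \<bar>\<phi> x * G x\<bar> <= ?c x" using Gb
      proof eventually_elim
        case (elim x)
        show ?case
        proof (cases "x \<in> K")
          case True
          have "\<bar>\<phi> x * G x\<bar> <= B * (L * (\<bar>gu x\<bar> + \<bar>gv x\<bar>))"
            unfolding abs_mult using B elim by (intro mult_mono) auto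
          then show ?thesis using True KQ by (simp add: subsetD)
        next
          case False
          then show ?thesis using \<phi>0[of x] B(1) L0 by simp
        qed
      qed
      show "s n \<in> borel_measurable lborel" for n unfolding s_def by measurable
      show "(%x. \<phi> x * G x) \<in> borel_measurable lborel" by measurable
      have iD: "integrable lborel (%x. \<bar>?Du n x\<bar> + \<bar>?Dv n x\<bar>)" for n
        by (intro B_integrable_add integrable_abs B_integrable_diff
            integrable_divide integrable_lborel_translation u v)
      show ib: "integrable lborel (?b n)" for n
        using integrable_mult_indicator[OF _ iD[of n], of Q] by (intro integrable_mult_right) simp
      have "integrable lborel (%x. \<bar>gu x\<bar> + \<bar>gv x\<bar>)" using gu gv by auto
      from integrable_mult_indicator[OF _ this, of Q]
      show ic: "integrable lborel ?c" by (intro integrable_mult_right) simp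
      have "(%n. B * L * (\<integral>x. S (r n) x \<partial>lborel)) \<longlonglongrightarrow> 0"
        using LIMSEQ_subseq_LIMSEQ[OF S0 r(1)] by (intro tendsto_mult_right_zero) (simp add: o_def)
      then show "(%n. \<integral>x. \<bar>?b n x - ?c x\<bar> \<partial>lborel) \<longlonglongrightarrow> 0"
      proof (rule Lim_null_comparison[OF always_eventually, rotated], intro allI)
        fix n
        have "(\<integral>x. \<bar>?b n x - ?c x\<bar> \<partial>lborel) <= (\<integral>x. B * L * S (r n) x \<partial>lborel)"
        proof (rule integral_mono)
          show "integrable lborel (%x. \<bar>?b n x - ?c x\<bar>)"
            by (intro integrable_abs B_integrable_diff ib ic)
          show "integrable lborel (%x. B * L * S (r n) x)" by (intro integrable_mult_right iS)
          fix x
          have "\<bar>?b n x - ?c x\<bar> = B * L * \<bar>indicator Q x * (\<bar>?Du n x\<bar> + \<bar>?Dv n x\<bar>) - indicator Q x * (\<bar>gu x\<bar> + \<bar>gv x\<bar>)\<bar>"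
            using B(1) L0 by (simp only: right_diff_distrib[symmetric] abs_mult abs_of_nonneg abs_of_pos)
          also have "\<dots> <= B * L * S (r n) x"
          proof (rule mult_left_mono)
            show "\<bar>indicator Q x * (\<bar>?Du n x\<bar> + \<bar>?Dv n x\<bar>) - indicator Q x * (\<bar>gu x\<bar> + \<bar>gv x\<bar>)\<bar> <= S (r n) x"
            proof (cases "x \<in> Q")
              case True
              have "\<bar>\<bar>a\<bar> + \<bar>b\<bar> - (\<bar>c\<bar> + \<bar>d\<bar>)\<bar> <= \<bar>a - c\<bar> + \<bar>b - d\<bar>" for a b c d :: real by linarith
              then show ?thesis using True by (simp add: S_def k_def del: abs_divide)
            qed (simp add: S_def)
          qed (use B(1) L0 in simp)
          finally show "\<bar>?b n x - ?c x\<bar> <= B * L * S (r n) x" .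
        qed
        then show "norm (\<integral>x. \<bar>?b n x - ?c x\<bar> \<partial>lborel) <= B * L * (\<integral>x. S (r n) x \<partial>lborel)"
          by simp
      qed
    qed
    \<comment> \<open>Quotients of \<phi> with step -k n: after a translation by k n, the quotient
      of W integrated against \<phi> is minus the integral of W times these.\<close>
    let ?q = "%n x. (\<phi> (x + (- k n) *\<^sub>R e) - \<phi> x) / (- k n)"
    have lim2: "(%n. \<integral>x. W x * ?q n x \<partial>lborel) \<longlonglongrightarrow> (\<integral>x. W x * frechet_derivative \<phi> (at x) e \<partial>lborel)"
    proof (rule integral_dominated_convergence[where w = "%x. B' * \<bar>W x\<bar>"])
      show "integrable lborel (%x. B' * \<bar>W x\<bar>)" using W by auto
      show "AE x in lborel. (%n. W x * ?q n x) \<longlonglongrightarrow> W x * frechet_derivative \<phi> (at x) e"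
      proof (intro AE_I2 tendsto_mult tendsto_const)
        fix x
        have "(%n. (\<phi> (x + (- k n) *\<^sub>R e) - \<phi> x) /\<^sub>R (- k n)) \<longlonglongrightarrow> frechet_derivative \<phi> (at x) e"
          by (rule has_derivative_along_sequence[OF smooth_on_has_derivative[OF sm] tendsto_const])
            (use k tendsto_minus[OF k(1)] in auto)
        then show "(%n. ?q n x) \<longlonglongrightarrow> frechet_derivative \<phi> (at x) e"
          by (simp add: divide_inverse mult.commute)
      qed
      show "AE x in lborel. norm (W x * ?q n x) <= B' * \<bar>W x\<bar>" for n
      proof (intro AE_I2)
        fix x
        have "\<bar>?q n x\<bar> = \<bar>\<phi> (x + (- k n) *\<^sub>R e) - \<phi> x\<bar> / \<bar>- k n\<bar>" by (simp only: abs_divide)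
        also have "\<dots> <= B'"
          using smooth_on_directional_lipschitz[OF sm B'(2), of x "- k n"] k(2)[of n] by (simp add: pos_divide_le_eq)
        finally have "\<bar>W x\<bar> * \<bar>?q n x\<bar> <= \<bar>W x\<bar> * B'" by (rule mult_left_mono) simp
        then show "norm (W x * ?q n x) <= B' * \<bar>W x\<bar>" by (simp only: real_norm_def abs_mult mult.commute)
      qed
    qed measurable
    have "(\<integral>x. W x * ?q n x \<partial>lborel) = - (\<integral>x. s n x \<partial>lborel)" for n
    proof -
      have a: "integrable lborel (%x. W x * \<phi> (x + c))" for c
        by (rule integrable_mult_bounded[OF W _ B(2)]) measurable
      have b: "integrable lborel (%x. W (x + c) * \<phi> x)" for c
        by (rule integrable_mult_bounded[OF integrable_lborel_translation[OF W] _ B(2)]) measurable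
      have "(\<integral>x. W x * ?q n x \<partial>lborel) = (\<integral>x. (W x * \<phi> (x + (- k n) *\<^sub>R e) - W x * \<phi> (x + 0)) / (- k n) \<partial>lborel)"
        by (rule B_integral_cong) (simp_all add: right_diff_distrib)
      also have "\<dots> = ((\<integral>x. W x * \<phi> (x + (- k n) *\<^sub>R e) \<partial>lborel) - (\<integral>x. W x * \<phi> (x + 0) \<partial>lborel)) / (- k n)"
        by (simp only: integral_divide_zero B_integral_diff[OF a a])
      also have "(\<integral>x. W x * \<phi> (x + (- k n) *\<^sub>R e) \<partial>lborel) = (\<integral>x. W (x + k n *\<^sub>R e) * \<phi> x \<partial>lborel)"
        using integral_lborel_translation[OF a[of "(- k n) *\<^sub>R e"], of "k n *\<^sub>R e"] by simp
      also have "((\<integral>x. W (x + k n *\<^sub>R e) * \<phi> x \<partial>lborel) - (\<integral>x. W x * \<phi> (x + 0) \<partial>lborel)) / (- k n) =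
          - (\<integral>x. (W (x + k n *\<^sub>R e) * \<phi> x - W (x + 0) * \<phi> x) / k n \<partial>lborel)"
        by (simp only: integral_divide_zero B_integral_diff[OF b b]) simp
      also have "(\<integral>x. (W (x + k n *\<^sub>R e) * \<phi> x - W (x + 0) * \<phi> x) / k n \<partial>lborel) = (\<integral>x. s n x \<partial>lborel)"
        by (rule B_integral_cong) (simp_all add: s_def algebra_simps diff_divide_distrib)
      finally show ?thesis .
    qed
    then have "(%n. \<integral>x. W x * ?q n x \<partial>lborel) \<longlonglongrightarrow> - (\<integral>x. \<phi> x * G x \<partial>lborel)"
      using tendsto_minus[OF lim1] by simp
    from LIMSEQ_unique[OF lim2 this] show ?thesis by (simp add: mult.commute)
  qed
  then have "wderiv \<Omega> e W G" using W G by (simp add: wderiv_def)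
  then show ?thesis by (simp only: W_def[abs_def] G_def[abs_def])
qed

section \<open>Functions with integrable powers\<close>

definition in_Lp :: "'a measure => real => ('a => 'b::{real_normed_vector, second_countable_topology}) => bool" where
  "in_Lp M p f \<longleftrightarrow> f \<in> borel_measurable M \<and> integrable M (%x. norm (f x) powr p)"

text \<open>Convergence of p-th powers without taking roots: \<open>powr_norm_add_le\<close> with
  its constant 2^p stands in for Minkowski's inequality, and no quotient by null functions is
  formed.\<close>

definition Lp_lim :: "'a measure => real => (nat => 'a => 'b::real_normed_vector) => ('a => 'b) => bool" where
  "Lp_lim M p s f \<longleftrightarrow> (%n. \<integral>x. norm (s n x - f x) powr p \<partial>M) \<longlonglongrightarrow> 0"

lemma in_LpD:
  assumes "in_Lp M p f"
  shows in_Lp_measurable: "f \<in> borel_measurable M" and in_Lp_integrable: "integrable M (%x. norm (f x) powr p)"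
  using assms by (auto simp: in_Lp_def)

lemma powr_norm_add_le:
  fixes a b :: "'a::real_normed_vector"
  assumes "p >= 0"
  shows "norm (a + b) powr p <= 2 powr p * (norm a powr p + norm b powr p)"
proof -
  have "norm (a + b) powr p <= (2 * max (norm a) (norm b)) powr p"
    using norm_triangle_ineq[of a b] assms by (intro powr_mono2) auto
  also have "\<dots> = 2 powr p * max (norm a) (norm b) powr p" by (rule powr_mult)
  also have "\<dots> <= 2 powr p * (norm a powr p + norm b powr p)"
    by (intro mult_left_mono) (auto simp: max_def)
  finally show ?thesis .
qed

text \<open>Both factors are bounded by powers of max(1, x, y). On a finite measure space this gives
  integrability of mixed products with s + t <= p, in the place of Hoelder's inequality.\<close>

lemma powr_mult_powr_le:
  fixes x y :: real
  assumes "x >= 0" "y >= 0" "s >= 0" "t >= 0" "s + t <= p"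
  shows "x powr s * y powr t <= 1 + x powr p + y powr p"
proof -
  let ?m = "max 1 (max x y)"
  have "x powr s * y powr t <= ?m powr s * ?m powr t"
    using assms by (intro mult_mono powr_mono2) auto
  also have "\<dots> = ?m powr (s + t)" by (simp add: powr_add)
  also have "\<dots> <= ?m powr p" using assms by (intro powr_mono) auto
  also have "\<dots> <= 1 + x powr p + y powr p" by (auto simp: max_def)
  finally show ?thesis .
qed

lemma in_Lp_bounded_by:
  assumes "f \<in> borel_measurable M" "integrable M g" "AE x in M. norm (f x) powr p <= g x"
  shows "in_Lp M p f"
proof -
  have "integrable M (%x. norm (f x) powr p)"
    by (rule B_integrable_bound[OF assms(2)])
      (use assms in \<open>auto elim: eventually_mono\<close>)
  then show ?thesis using assms(1) by (simp add: in_Lp_def)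
qed

lemma in_Lp_cong_AE:
  assumes "in_Lp M p f" "g \<in> borel_measurable M" "AE x in M. f x = g x"
  shows "in_Lp M p g"
  by (rule in_Lp_bounded_by[OF assms(2) in_Lp_integrable[OF assms(1)]])
    (use assms(3) in \<open>auto elim: eventually_mono\<close>)

lemma in_Lp_zero: "in_Lp M p (%x. 0)"
  by (simp add: in_Lp_def)

lemma in_Lp_add:
  assumes "in_Lp M p f" "in_Lp M p g" "p >= 0" shows "in_Lp M p (%x. f x + g x)"
  by (rule in_Lp_bounded_by[where g = "%x. 2 powr p * (norm (f x) powr p + norm (g x) powr p)"])
    (use assms powr_norm_add_le[OF assms(3)] in \<open>auto simp: in_Lp_def\<close>)

lemma in_Lp_mult_bounded:
  fixes f :: "'a => 'b::{real_normed_vector, second_countable_topology}"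
  assumes f: "in_Lp M p f" and b: "b \<in> borel_measurable M" "AE x in M. \<bar>b x\<bar> <= B" and p: "p >= 0"
  shows "in_Lp M p (%x. b x *\<^sub>R f x)"
proof (rule in_Lp_bounded_by)
  show "(%x. b x *\<^sub>R f x) \<in> borel_measurable M"
    by (intro borel_measurable_scaleR b(1) in_Lp_measurable[OF f])
  show "integrable M (%x. \<bar>B\<bar> powr p * norm (f x) powr p)" using f by (simp add: in_Lp_def)
  show "AE x in M. norm (b x *\<^sub>R f x) powr p <= \<bar>B\<bar> powr p * norm (f x) powr p"
    using b(2)
  proof eventually_elim
    case (elim x)
    have "norm (b x *\<^sub>R f x) powr p = \<bar>b x\<bar> powr p * norm (f x) powr p" by (simp add: powr_mult)
    also have "\<dots> <= \<bar>B\<bar> powr p * norm (f x) powr p"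
      using elim p by (intro mult_right_mono powr_mono2) auto
    finally show ?case .
  qed
qed

lemma in_Lp_scale:
  assumes "in_Lp M p f" "p >= 0" shows "in_Lp M p (%x. c *\<^sub>R f x)"
  by (rule in_Lp_mult_bounded[where B = "\<bar>c\<bar>"]) (use assms in auto)

lemma in_Lp_diff:
  assumes "in_Lp M p f" "in_Lp M p g" "p >= 0" shows "in_Lp M p (%x. f x - g x)"
  using in_Lp_add[OF assms(1) in_Lp_scale[OF assms(2,3), of "-1"] assms(3)] by simp

lemma in_Lp_const:
  assumes "finite_measure M" shows "in_Lp M p (%x. c)"
  using finite_measure.integrable_const[OF assms] by (simp add: in_Lp_def)

lemma in_Lp_norm: "in_Lp M p f ==> in_Lp M p (%x. norm (f x))"
  by (auto simp: in_Lp_def)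

lemma integrable_powr_mult_powr:
  assumes "finite_measure M" "in_Lp M p f" "in_Lp M p g" "s >= 0" "t >= 0" "s + t <= p"
  shows "integrable M (%x. norm (f x) powr s * norm (g x) powr t)"
proof (rule B_integrable_bound)
  note [measurable] = in_Lp_measurable[OF assms(2)] in_Lp_measurable[OF assms(3)]
  show "integrable M (%x. 1 + norm (f x) powr p + norm (g x) powr p)"
    using in_Lp_integrable[OF assms(2)] in_Lp_integrable[OF assms(3)] finite_measure.integrable_const[OF assms(1)]
    by (intro B_integrable_add) auto
  show "(%x. norm (f x) powr s * norm (g x) powr t) \<in> borel_measurable M" by measurable
  show "AE x in M. norm (norm (f x) powr s * norm (g x) powr t) <= norm (1 + norm (f x) powr p + norm (g x) powr p)"
    using powr_mult_powr_le[OF norm_ge_zero norm_ge_zero assms(4-6)]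
    by (intro AE_I2) (simp add: abs_of_nonneg)
qed

lemma integrable_powr_smaller:
  assumes "finite_measure M" "in_Lp M p f" "0 <= s" "s <= p"
  shows "integrable M (%x. norm (f x) powr s)"
proof -
  interpret finite_measure M by fact
  have "integrable M (%x. norm (f x) powr s * norm (1::real) powr 0)"
    by (rule integrable_powr_mult_powr[OF assms(1,2) in_Lp_const[OF assms(1)]]) (use assms in auto)
  then show ?thesis by simp
qed

lemma in_Lp_imp_integrable:
  fixes f :: "'a => 'b::{banach, second_countable_topology}"
  assumes "finite_measure M" "in_Lp M p f" "1 <= p"
  shows "integrable M f"
  using integrable_powr_smaller[OF assms(1,2), of 1] assms in_Lp_measurable[OF assms(2)]
  by (intro integrable_norm_cancel[of M f]) auto

lemma Lp_lim_AE_subseq: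
  fixes f :: "'a => 'b::{banach, second_countable_topology}"
  assumes s: "!!n. in_Lp M p (s n)" and f: "in_Lp M p f" and p: "p > 0" and lim: "Lp_lim M p s f"
  obtains r where "strict_mono r" "AE x in M. (%n. s (r n) x) \<longlonglongrightarrow> f x"
proof -
  have d: "in_Lp M p (%x. s n x - f x)" for n using in_Lp_diff[OF s f] p by simp
  have "\<exists>r. strict_mono r \<and> (AE x in M. (%n. norm (s (r n) x - f x) powr p) \<longlonglongrightarrow> 0)"
    by (rule tendsto_L1_AE_subseq) (use d lim in \<open>auto simp: in_Lp_def Lp_lim_def\<close>)
  then obtain r where r: "strict_mono r" "AE x in M. (%n. norm (s (r n) x - f x) powr p) \<longlonglongrightarrow> 0" by blast
  from r(2) have "AE x in M. (%n. s (r n) x) \<longlonglongrightarrow> f x"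
  proof eventually_elim
    case (elim x)
    have "(%n. (norm (s (r n) x - f x) powr p) powr (1 / p)) \<longlonglongrightarrow> 0"
      by (rule tendsto_zero_powrI[OF elim tendsto_const]) (use p in auto)
    then have "(%n. norm (s (r n) x - f x)) \<longlonglongrightarrow> 0" using p by (simp add: powr_powr)
    then show ?case by (simp add: tendsto_norm_zero_iff LIM_zero_iff)
  qed
  with r(1) that show ?thesis by blast
qed

lemma Lp_lim_subseq: "Lp_lim M p s f ==> strict_mono r ==> Lp_lim M p (%n. s (r n)) f"
  using LIMSEQ_subseq_LIMSEQ[of "%n. \<integral>x. norm (s n x - f x) powr p \<partial>M" 0 r]
  by (simp add: Lp_lim_def o_def)

lemma Lp_lim_dominated:
  fixes f :: "'a => 'b::{banach, second_countable_topology}"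
  assumes "!!n. s n \<in> borel_measurable M" "f \<in> borel_measurable M" and w: "integrable M w"
    and lim: "AE x in M. (%n. s n x) \<longlonglongrightarrow> f x"
    and bd: "!!n. AE x in M. norm (s n x - f x) powr p <= w x" and p: "p > 0"
  shows "Lp_lim M p s f"
proof -
  have "(%n. \<integral>x. norm (s n x - f x) powr p \<partial>M) \<longlonglongrightarrow> (\<integral>x. 0 \<partial>M)"
  proof (rule integral_dominated_convergence[OF _ _ w])
    show "AE x in M. (%n. norm (s n x - f x) powr p) \<longlonglongrightarrow> 0"
      using lim
    proof eventually_elim
      case (elim x)
      then have "(%n. norm (s n x - f x)) \<longlonglongrightarrow> 0"
        by (simp add: tendsto_norm_zero_iff LIM_zero_iff)
      then show ?case by (rule tendsto_zero_powrI[OF _ tendsto_const]) (use p in auto)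
    qed
  qed (use assms(1,2) bd in auto)
  then show ?thesis by (simp add: Lp_lim_def)
qed

lemma Lp_lim_add:
  assumes "!!n. in_Lp M p (s n)" "in_Lp M p f" "!!n. in_Lp M p (t n)" "in_Lp M p g" "p >= 0"
    and "Lp_lim M p s f" "Lp_lim M p t g"
  shows "Lp_lim M p (%n x. s n x + t n x) (%x. f x + g x)"
  unfolding Lp_lim_def
proof (rule Lim_null_comparison[OF always_eventually])
  let ?S = "%n. \<integral>x. norm (s n x - f x) powr p \<partial>M" and ?T = "%n. \<integral>x. norm (t n x - g x) powr p \<partial>M"
  have d: "integrable M (%x. norm (s n x - f x) powr p)" "integrable M (%x. norm (t n x - g x) powr p)" for n
    by (intro in_Lp_integrable in_Lp_diff assms)+
  show "(%n. 2 powr p * (?S n + ?T n)) \<longlonglongrightarrow> 0"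
    using assms(6,7) by (intro tendsto_mult_right_zero tendsto_add_zero) (auto simp: Lp_lim_def)
  show "\<forall>n. norm (\<integral>x. norm (s n x + t n x - (f x + g x)) powr p \<partial>M) <= 2 powr p * (?S n + ?T n)"
  proof
    fix n
    have "(\<integral>x. norm (s n x + t n x - (f x + g x)) powr p \<partial>M) \<le>
        (\<integral>x. 2 powr p * (norm (s n x - f x) powr p + norm (t n x - g x) powr p) \<partial>M)"
    proof (rule integral_mono)
      show "integrable M (%x. norm (s n x + t n x - (f x + g x)) powr p)"
        by (intro in_Lp_integrable in_Lp_diff in_Lp_add assms)
      show "norm (s n x + t n x - (f x + g x)) powr p <= 2 powr p * (norm (s n x - f x) powr p + norm (t n x - g x) powr p)" for x
        using powr_norm_add_le[OF assms(5), of "s n x - f x" "t n x - g x"] by (simp add: algebra_simps)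
    qed (use d in auto)
    also have "\<dots> = 2 powr p * (?S n + ?T n)" using d by simp
    finally show "norm (\<integral>x. norm (s n x + t n x - (f x + g x)) powr p \<partial>M) <= 2 powr p * (?S n + ?T n)" by simp
  qed
qed

lemma Lp_lim_mult_bounded:
  assumes "!!n. in_Lp M p (s n)" "in_Lp M p f" "p >= 0" and lim: "Lp_lim M p s f"
    and b: "!!n. b n \<in> borel_measurable M" "!!n. AE x in M. \<bar>b n x\<bar> <= B"
  shows "Lp_lim M p (%n x. b n x *\<^sub>R (s n x - f x)) (%x. 0)"
  unfolding Lp_lim_def
proof (rule Lim_null_comparison[OF always_eventually])
  show "(%n. \<bar>B\<bar> powr p * (\<integral>x. norm (s n x - f x) powr p \<partial>M)) \<longlonglongrightarrow> 0"
    using lim by (intro tendsto_mult_right_zero) (simp add: Lp_lim_def)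
  show "\<forall>n. norm (\<integral>x. norm (b n x *\<^sub>R (s n x - f x) - 0) powr p \<partial>M) <= \<bar>B\<bar> powr p * (\<integral>x. norm (s n x - f x) powr p \<partial>M)"
  proof
    fix n
    have d: "in_Lp M p (%x. s n x - f x)" using assms by (intro in_Lp_diff)
    have "(\<integral>x. norm (b n x *\<^sub>R (s n x - f x)) powr p \<partial>M) <= (\<integral>x. \<bar>B\<bar> powr p * norm (s n x - f x) powr p \<partial>M)"
    proof (rule integral_mono_AE)
      show "integrable M (%x. norm (b n x *\<^sub>R (s n x - f x)) powr p)"
        by (rule in_Lp_integrable[OF in_Lp_mult_bounded[OF d b assms(3)]])
      show "integrable M (%x. \<bar>B\<bar> powr p * norm (s n x - f x) powr p)"
        using in_Lp_integrable[OF d] by simp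
      show "AE x in M. norm (b n x *\<^sub>R (s n x - f x)) powr p <= \<bar>B\<bar> powr p * norm (s n x - f x) powr p"
        using b(2)[of n]
      proof eventually_elim
        case (elim x)
        have "norm (b n x *\<^sub>R (s n x - f x)) powr p = \<bar>b n x\<bar> powr p * norm (s n x - f x) powr p" by (simp add: powr_mult)
        also have "\<dots> <= \<bar>B\<bar> powr p * norm (s n x - f x) powr p"
          using elim assms(3) by (intro mult_right_mono powr_mono2) auto
        finally show ?case .
      qed
    qed
    then show "norm (\<integral>x. norm (b n x *\<^sub>R (s n x - f x) - 0) powr p \<partial>M) <= \<bar>B\<bar> powr p * (\<integral>x. norm (s n x - f x) powr p \<partial>M)"
      by simp
  qed
qed

text \<open>Riesz-Fischer: a fast subsequence converges almost everywhere by a geometric bound on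
  its increments, and Fatou's lemma turns the Cauchy bound into a bound against the limit.\<close>

lemma Lp_complete:
  fixes s :: "nat => 'a => 'b::{banach, second_countable_topology}"
  assumes s: "!!n. in_Lp M p (s n)" and p: "p > 0"
    and Cauchy: "!!e. e > 0 ==> \<exists>N. \<forall>m\<ge>N. \<forall>n\<ge>N. (\<integral>x. norm (s m x - s n x) powr p \<partial>M) <= e"
  obtains f where "in_Lp M p f" "Lp_lim M p s f"
proof -
  note sm[measurable] = in_Lp_measurable[OF s]
  have d: "integrable M (%x. norm (s m x - s n x) powr p)" for m n
    using in_Lp_integrable[OF in_Lp_diff[OF s s]] p by simp
  have "\<exists>N. \<forall>k. \<forall>m\<ge>N k. \<forall>n\<ge>N k. (\<integral>x. norm (s m x - s n x) powr p \<partial>M) <= (1/4) ^ k"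
    by (intro choice allI Cauchy) simp
  then obtain N where N: "!!k m n. m >= N k ==> n >= N k ==> (\<integral>x. norm (s m x - s n x) powr p \<partial>M) <= (1/4) ^ k"
    by blast
  \<comment> \<open>At least k and at least N k, and the same holds at Suc k for the bound N k;
    adding up the N j replaces a recursive choice.\<close>
  define r where "r k = k + (\<Sum>j\<le>k. N j)" for k
  have rN: "r k >= N k" "r k >= k" "r (Suc k) >= N k" for k
  proof -
    have "N k <= (\<Sum>j\<le>k. N j)" by (rule member_le_sum) auto
    then show "r k >= N k" "r k >= k" "r (Suc k) >= N k" by (auto simp: r_def)
  qed
  let ?d = "%k x. norm (s (r (Suc k)) x - s (r k) x) powr p"
  \<comment> \<open>The bound 4^(-k) leaves room for the weight 2^k: the weighted sum is integrable,
    so almost everywhere the increments decay like 2^(-k/p).\<close>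
  have dk: "(\<integral>x. ?d k x \<partial>M) <= (1/4) ^ k" for k by (rule N[OF rN(3,1)])
  have "(\<integral>\<^sup>+ x. (\<Sum>k. ennreal (2 ^ k * ?d k x)) \<partial>M) = (\<Sum>k. \<integral>\<^sup>+ x. ennreal (2 ^ k * ?d k x) \<partial>M)"
    by (rule nn_integral_suminf) measurable
  also have "\<dots> <= (\<Sum>k. ennreal ((1/2) ^ k))"
  proof (intro suminf_le allI)
    fix k
    have "(\<integral>\<^sup>+ x. ennreal (2 ^ k * ?d k x) \<partial>M) = ennreal (\<integral>x. 2 ^ k * ?d k x \<partial>M)"
      by (rule nn_integral_eq_integral) (use d in auto)
    also have "(\<integral>x. 2 ^ k * ?d k x \<partial>M) <= 2 ^ k * (1/4) ^ k" using dk[of k] by simp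
    also have "(2::real) ^ k * (1/4) ^ k = (1/2) ^ k" by (simp add: power_mult_distrib[symmetric])
    finally show "(\<integral>\<^sup>+ x. ennreal (2 ^ k * ?d k x) \<partial>M) <= ennreal ((1/2) ^ k)"
      by (simp add: ennreal_leI)
  qed auto
  also have "\<dots> = ennreal (\<Sum>k. (1/2) ^ k)"
    by (intro suminf_ennreal_eq summable_sums summable_geometric) auto
  finally have "(\<integral>\<^sup>+ x. (\<Sum>k. ennreal (2 ^ k * ?d k x)) \<partial>M) ~= \<infinity>"
    by (metis ennreal_neq_top infinity_ennreal_def top_unique)
  then have "AE x in M. (\<Sum>k. ennreal (2 ^ k * ?d k x)) ~= \<infinity>"
    by (intro nn_integral_PInf_AE) measurable
  then have conv: "AE x in M. convergent (%k. s (r k) x)"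
  proof eventually_elim
    case (elim x)
    have sm2: "summable (%k. 2 ^ k * ?d k x)"
      by (rule summable_suminf_not_top) (use elim in auto)
    then obtain B where B: "B > 0" "!!k. norm (2 ^ k * ?d k x) <= B"
      using convergent_imp_Bseq[OF convergentI[OF summable_LIMSEQ_zero[OF sm2]]] by (auto simp: Bseq_def)
    have "norm (s (r (Suc k)) x - s (r k) x) <= B powr (1/p) * ((1/2) powr (1/p)) ^ k" for k
    proof -
      have "?d k x <= B * (1/2) ^ k" using B(2)[of k] by (simp add: power_one_over field_simps)
      then have "(?d k x) powr (1/p) <= (B * (1/2) ^ k) powr (1/p)" using p by (intro powr_mono2) auto
      also have "\<dots> = B powr (1/p) * ((1/2) ^ k) powr (1/p)" by (simp add: powr_mult)
      also have "((1/2::real) ^ k) powr (1/p) = ((1/2) powr (1/p)) ^ k"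
        by (simp add: powr_realpow[symmetric] powr_powr mult.commute)
      finally show ?thesis using p by (simp add: powr_powr)
    qed
    moreover have "(1/2::real) powr (1/p) < 1"
    proof -
      have "(1/2::real) powr (1/p) < 1 powr (1/p)" using p by (intro powr_less_mono2) auto
      then show ?thesis by simp
    qed
    ultimately have "summable (%k. s (r (Suc k)) x - s (r k) x)"
      by (intro summable_comparison_test[OF _ summable_mult[OF summable_geometric]]) auto
    then have "convergent (%n. \<Sum>k<n. s (r (Suc k)) x - s (r k) x)" by (simp add: summable_iff_convergent)
    then have "convergent (%n. (s (r n) x - s (r 0) x) + s (r 0) x)"
      by (intro convergent_add convergent_const) (simp add: sum_lessThan_telescope[of "%n. s (r n) x"])
    then show ?case by simp
  qed
  define f where "f x = lim (%k. s (r k) x)" for x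
  have fm[measurable]: "f \<in> borel_measurable M" unfolding f_def by measurable
  have flim: "AE x in M. (%k. s (r k) x) \<longlonglongrightarrow> f x"
    using conv by eventually_elim (simp add: f_def convergent_LIMSEQ_iff)
  have fatou: "integrable M (%x. norm (s n x - f x) powr p) \<and> (\<integral>x. norm (s n x - f x) powr p \<partial>M) <= (1/4) ^ k"
    if n: "n >= N k" for n k
  proof -
    have "(\<integral>\<^sup>+ x. ennreal (norm (s n x - f x) powr p) \<partial>M) = (\<integral>\<^sup>+ x. liminf (%j. ennreal (norm (s n x - s (r j) x) powr p)) \<partial>M)"
    proof (rule nn_integral_cong_AE)
      show "AE x in M. ennreal (norm (s n x - f x) powr p) = liminf (%j. ennreal (norm (s n x - s (r j) x) powr p))"
        using flim
      proof eventually_elim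
        case (elim x)
        have "(%j. ennreal (norm (s n x - s (r j) x) powr p)) \<longlonglongrightarrow> ennreal (norm (s n x - f x) powr p)"
          using p by (intro tendsto_ennrealI tendsto_powr' tendsto_norm tendsto_diff tendsto_const elim) auto
        then show ?case by (rule lim_imp_Liminf[OF trivial_limit_sequentially, symmetric])
      qed
    qed
    also have "\<dots> <= liminf (%j. \<integral>\<^sup>+ x. ennreal (norm (s n x - s (r j) x) powr p) \<partial>M)"
      by (rule nn_integral_liminf) measurable
    also have "\<dots> <= limsup (%j. \<integral>\<^sup>+ x. ennreal (norm (s n x - s (r j) x) powr p) \<partial>M)"
      by (rule Liminf_le_Limsup) simp
    also have "\<dots> <= ennreal ((1/4) ^ k)"
    proof (rule Limsup_bounded)
      show "\<forall>\<^sub>F j in sequentially. (\<integral>\<^sup>+ x. ennreal (norm (s n x - s (r j) x) powr p) \<partial>M) <= ennreal ((1/4) ^ k)"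
        using eventually_ge_at_top[of "N k"]
      proof eventually_elim
        case (elim j)
        have "(\<integral>\<^sup>+ x. ennreal (norm (s n x - s (r j) x) powr p) \<partial>M) = ennreal (\<integral>x. norm (s n x - s (r j) x) powr p \<partial>M)"
          by (rule nn_integral_eq_integral[OF d]) auto
        also have "\<dots> <= ennreal ((1/4) ^ k)"
          by (intro ennreal_leI N n) (use elim rN(2)[of j] in linarith)
        finally show ?case .
      qed
    qed
    finally have le: "(\<integral>\<^sup>+ x. ennreal (norm (s n x - f x) powr p) \<partial>M) <= ennreal ((1/4) ^ k)" .
    have int: "integrable M (%x. norm (s n x - f x) powr p)"
      by (rule integrableI_bounded) (use le in \<open>auto intro: le_less_trans\<close>)
    moreover have "ennreal (\<integral>x. norm (s n x - f x) powr p \<partial>M) <= ennreal ((1/4) ^ k)"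
      using le nn_integral_eq_integral[OF int] by simp
    ultimately show ?thesis by (simp add: ennreal_le_iff)
  qed
  have "in_Lp M p (%x. s (N 0) x - f x)" using fatou[of 0 "N 0"] by (simp add: in_Lp_def)
  from in_Lp_diff[OF s[of "N 0"] this] p have "in_Lp M p f" by simp
  moreover have "Lp_lim M p s f"
    unfolding Lp_lim_def
  proof (rule LIMSEQ_I)
    fix e :: real assume e: "e > 0"
    have "(%k. (1/4::real) ^ k) \<longlonglongrightarrow> 0" by (rule LIMSEQ_realpow_zero) auto
    then obtain k where k: "(1/4::real) ^ k < e"
      using e by (metis (no_types, lifting) order_tendstoD(2) eventually_sequentially order_refl)
    show "\<exists>no. \<forall>n\<ge>no. norm ((\<integral>x. norm (s n x - f x) powr p \<partial>M) - 0) < e"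
      using fatou[of k] k by (intro exI[of _ "N k"]) (auto intro: le_less_trans)
  qed
  ultimately show ?thesis using that by blast
qed

text \<open>The growth bound splits, by \<open>powr_norm_add_le\<close>, into a fixed integrable
  part and a multiple of |s n - f|^p, whose integral tends to 0; so the majorants converge in
  L1.\<close>

lemma integral_tendsto_Lp_growth:
  fixes f :: "'a => 'b::{banach, second_countable_topology}"
  assumes M: "finite_measure M" and s: "!!n. in_Lp M p (s n)" and f: "in_Lp M p f" and p: "p > 0" and lim: "Lp_lim M p s f"
    and F: "!!n. F n \<in> borel_measurable M" "F0 \<in> borel_measurable M" "AE x in M. (%n. F n x) \<longlonglongrightarrow> F0 x"
    and growth: "!!n. AE x in M. \<bar>F n x\<bar> <= C * (1 + norm (s n x) powr p)" "AE x in M. \<bar>F0 x\<bar> <= C * (1 + norm (f x) powr p)"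
    and C: "C >= 0"
  shows "(%n. \<integral>x. F n x \<partial>M) \<longlonglongrightarrow> (\<integral>x. (F0 x :: real) \<partial>M)"
proof (rule integral_dominated_convergence_L1[OF F(3) _ _ F(1,2)])
  interpret finite_measure M by fact
  have d: "integrable M (%x. norm (s n x - f x) powr p)" for n
    using in_Lp_integrable[OF in_Lp_diff[OF s f]] p by simp
  let ?c = "%x. C * (1 + 2 powr p * norm (f x) powr p)"
  let ?b = "%n x. ?c x + C * (2 powr p * norm (s n x - f x) powr p)"
  show "AE x in M. \<bar>F n x\<bar> <= ?b n x" for n
    using growth(1)[of n]
  proof eventually_elim
    case (elim x)
    have "norm (s n x) powr p <= 2 powr p * (norm (s n x - f x) powr p + norm (f x) powr p)"
      using powr_norm_add_le[of p "s n x - f x" "f x"] p by simp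
    then have "C * (1 + norm (s n x) powr p) <= C * (1 + 2 powr p * (norm (s n x - f x) powr p + norm (f x) powr p))"
      using C by (intro mult_left_mono) auto
    also have "\<dots> = ?b n x" by (simp add: algebra_simps)
    finally show ?case using elim by linarith
  qed
  show "AE x in M. \<bar>F0 x\<bar> <= ?c x"
    using growth(2)
  proof eventually_elim
    case (elim x)
    have "1 * norm (f x) powr p <= 2 powr p * norm (f x) powr p"
      using p by (intro mult_right_mono ge_one_powr_ge_zero) auto
    then have "C * (1 + norm (f x) powr p) <= ?c x" using C by (intro mult_left_mono) auto
    with elim show ?case by linarith
  qed
  show ic: "integrable M ?c" using in_Lp_integrable[OF f] by auto
  show "integrable M (?b n)" for n
    by (intro B_integrable_add ic integrable_mult_right d)
  have "(\<integral>x. \<bar>?b n x - ?c x\<bar> \<partial>M) = C * 2 powr p * (\<integral>x. norm (s n x - f x) powr p \<partial>M)" for n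
    using C by (simp add: abs_mult mult.assoc)
  then show "(%n. \<integral>x. \<bar>?b n x - ?c x\<bar> \<partial>M) \<longlonglongrightarrow> 0"
    using lim by (simp add: Lp_lim_def tendsto_mult_right_zero)
qed

section \<open>Weak gradients\<close>

definition gradient :: "('a::euclidean_space => real) => 'a => 'a" where
  "gradient \<phi> x = (\<Sum>i\<in>Basis. frechet_derivative \<phi> (at x) i *\<^sub>R i)"

lemma gradient_inner:
  assumes "smooth_on UNIV \<phi>" shows "gradient \<phi> x \<bullet> e = frechet_derivative \<phi> (at x) e"
proof -
  have "linear (frechet_derivative \<phi> (at x))"
    using smooth_on_has_derivative[OF assms] has_derivative_bounded_linear bounded_linear.linear by blast
  then have "frechet_derivative \<phi> (at x) (\<Sum>i\<in>Basis. (e \<bullet> i) *\<^sub>R i) = (\<Sum>i\<in>Basis. (e \<bullet> i) * frechet_derivative \<phi> (at x) i)"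
    by (simp add: linear_sum linear_scale)
  then have "frechet_derivative \<phi> (at x) e = (\<Sum>i\<in>Basis. (e \<bullet> i) * frechet_derivative \<phi> (at x) i)"
    by (simp only: euclidean_representation)
  then show ?thesis
    unfolding gradient_def inner_sum_left by (simp add: inner_commute mult.commute)
qed

text \<open>The weak formulation lives on \<open>lebesgue_on\<close>, whereas translations and
  product measures are used with \<open>lborel\<close>. A Lebesgue measurable function on S is
  therefore exchanged for a Borel function that vanishes off S.\<close>

lemma borel_representative:
  fixes f :: "'a::euclidean_space => 'b::euclidean_space"
  assumes S: "S \<in> sets borel" and f: "f \<in> borel_measurable (lebesgue_on S)"
  obtains g where "g \<in> borel_measurable borel" "!!x. x \<notin> S ==> g x = 0" "AE x in lborel. x \<in> S --> g x = f x"
proof -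
  have Sl: "S \<inter> space lebesgue \<in> sets lebesgue" using S by simp
  have fi: "(%x. indicator S x *\<^sub>R f x) \<in> borel_measurable lebesgue"
    using f borel_measurable_restrict_space_iff[OF Sl, of f] by simp
  have "\<forall>i\<in>Basis. \<exists>g. g \<in> borel_measurable lborel \<and> (AE x in lborel. (indicator S x *\<^sub>R f x) \<bullet> i = g x)"
  proof
    fix i :: 'b assume "i \<in> Basis"
    have "(%x. (indicator S x *\<^sub>R f x) \<bullet> i) \<in> borel_measurable lebesgue" using fi by measurable
    from completion_ex_borel_measurable_real[OF this]
    show "\<exists>g. g \<in> borel_measurable lborel \<and> (AE x in lborel. (indicator S x *\<^sub>R f x) \<bullet> i = g x)" by blast
  qed
  then obtain g where g: "!!i. i \<in> Basis ==> g i \<in> borel_measurable lborel"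
      "!!i. i \<in> Basis ==> AE x in lborel. (indicator S x *\<^sub>R f x) \<bullet> i = g i x"
    by metis
  define h where "h x = indicator S x *\<^sub>R (\<Sum>i\<in>Basis. g i x *\<^sub>R i)" for x
  have "h \<in> borel_measurable borel"
    unfolding h_def using g(1) S by (intro borel_measurable_scaleR borel_measurable_sum) auto
  moreover have "AE x in lborel. \<forall>i\<in>Basis. (indicator S x *\<^sub>R f x) \<bullet> i = g i x"
    using g(2) by (intro AE_finite_allI) auto
  then have "AE x in lborel. x \<in> S --> h x = f x"
  proof eventually_elim
    case (elim x)
    show ?case
    proof
      assume "x \<in> S"
      then have "h x = (\<Sum>i\<in>Basis. (f x \<bullet> i) *\<^sub>R i)" using elim by (simp add: h_def)
      then show "h x = f x" by (simp add: euclidean_representation)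
    qed
  qed
  ultimately show ?thesis using that[of h] by (simp add: h_def)
qed

lemma AE_lebesgue_on_iff:
  assumes "S \<in> sets borel"
  shows "(AE x in lebesgue_on S. P x) \<longleftrightarrow> (AE x in lborel. x \<in> S --> P x)"
  using assms by (simp add: AE_restrict_space_iff AE_completion_iff)

lemma
  fixes f :: "'a::euclidean_space => 'b::{banach, second_countable_topology}"
  assumes S: "S \<in> sets borel" and g: "g \<in> borel_measurable borel" "!!x. x \<notin> S ==> g x = 0"
    and eq: "AE x in lborel. x \<in> S --> g x = f x" and f: "f \<in> borel_measurable (lebesgue_on S)"
  shows integral_borel_representative: "(\<integral>x. f x \<partial>lebesgue_on S) = (\<integral>x. g x \<partial>lborel)"
    and integrable_borel_representative: "integrable (lebesgue_on S) f \<longleftrightarrow> integrable lborel g"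
proof -
  have Sl: "S \<inter> space lebesgue \<in> sets lebesgue" using S by simp
  have gl: "g \<in> borel_measurable lebesgue" using g(1) by (simp add: measurable_completion)
  have fi: "(%x. indicator S x *\<^sub>R f x) \<in> borel_measurable lebesgue"
    using f borel_measurable_restrict_space_iff[OF Sl, of f] by simp
  have "AE x in lebesgue. x \<in> S --> g x = f x" using eq by (rule AE_completion)
  then have ae: "AE x in lebesgue. indicator S x *\<^sub>R f x = g x"
    by eventually_elim (use g(2) in \<open>auto split: split_indicator\<close>)
  show "(\<integral>x. f x \<partial>lebesgue_on S) = (\<integral>x. g x \<partial>lborel)"
    using integral_restrict_space[OF Sl, of f] integral_cong_AE[OF fi gl ae] integral_completion[of g lborel] g(1)
    by simp
  show "integrable (lebesgue_on S) f \<longleftrightarrow> integrable lborel g"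
    using integrable_restrict_space[OF Sl, of f] integrable_cong_AE[OF fi gl ae] integrable_completion[of g lborel] g(1)
    by simp
qed

lemma borel_measurable_lebesgue_onI: "f \<in> borel_measurable borel ==> f \<in> borel_measurable (lebesgue_on S)"
  by (intro measurable_restrict_space1 measurable_completion) simp

lemma integrable_mult_test_function:
  fixes g :: "'a::euclidean_space => real"
  assumes \<Omega>: "open \<Omega>" and g: "locally_integrable \<Omega> g" and K: "compact K" "K \<subseteq> \<Omega>"
    and \<phi>: "\<phi> \<in> borel_measurable borel" "!!x. \<bar>\<phi> x\<bar> <= B" "!!x. x \<notin> K ==> \<phi> x = 0"
  shows "integrable (lebesgue_on \<Omega>) (%x. g x * \<phi> x)"
    and "(\<integral>x. g x * \<phi> x \<partial>lebesgue_on \<Omega>) = (\<integral>x. g x * \<phi> x \<partial>lebesgue_on K)"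
proof -
  have Kb: "K \<in> sets borel" using K(1) by (simp add: borel_compact)
  have Kl: "K \<inter> space lebesgue \<in> sets lebesgue" and \<Omega>l: "\<Omega> \<inter> space lebesgue \<in> sets lebesgue"
    using Kb \<Omega> by auto
  have gK: "integrable (lebesgue_on K) g" using g K by (simp add: locally_integrable_def)
  have i: "integrable (lebesgue_on K) (%x. g x * \<phi> x)"
    by (rule integrable_mult_bounded[OF gK borel_measurable_lebesgue_onI[OF \<phi>(1)] \<phi>(2)])
  have eq: "indicator K x *\<^sub>R (g x * \<phi> x) = indicator \<Omega> x *\<^sub>R (g x * \<phi> x)" for x
    using \<phi>(3)[of x] K(2) by (cases "x \<in> K") auto
  show "integrable (lebesgue_on \<Omega>) (%x. g x * \<phi> x)"
    using i unfolding integrable_restrict_space[OF Kl] integrable_restrict_space[OF \<Omega>l] eq .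
  show "(\<integral>x. g x * \<phi> x \<partial>lebesgue_on \<Omega>) = (\<integral>x. g x * \<phi> x \<partial>lebesgue_on K)"
    unfolding integral_restrict_space[OF Kl] integral_restrict_space[OF \<Omega>l] eq ..
qed

lemma locally_integrable_diff:
  "locally_integrable \<Omega> f ==> locally_integrable \<Omega> g ==> locally_integrable \<Omega> (%x. f x - g x)"
  by (auto simp: locally_integrable_def)

lemma locally_integrable_inner: "locally_integrable \<Omega> f ==> locally_integrable \<Omega> (%x. f x \<bullet> i)"
  by (auto simp: locally_integrable_def)

text \<open>On each closed box of a countable covering g is integrable and has a Borel
  representative, to which the fundamental lemma on boxes applies.\<close>

lemma locally_integrable_AE_zero:
  fixes g :: "'a::euclidean_space => real"
  assumes \<Omega>: "open \<Omega>" and g: "locally_integrable \<Omega> g"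
    and null: "!!\<phi>. \<phi> \<in> test_functions \<Omega> ==> (\<integral>x. g x * \<phi> x \<partial>lebesgue_on \<Omega>) = 0"
  shows "AE x in lebesgue_on \<Omega>. g x = 0"
proof -
  obtain \<D> where \<D>: "countable \<D>" "\<D> \<subseteq> Pow \<Omega>" "!!X. X \<in> \<D> ==> \<exists>a b. X = cbox a b" "\<Union>\<D> = \<Omega>"
    using open_countable_Union_open_cbox[OF \<Omega>] by blast
  have "AE x in lborel. x \<in> X --> g x = 0" if XD: "X \<in> \<D>" for X
  proof -
    obtain a b where X: "X = cbox a b" using \<D>(3)[OF XD] by blast
    then have sub: "cbox a b \<subseteq> \<Omega>" using \<D>(2) XD by blast
    have gi: "integrable (lebesgue_on (cbox a b)) g" using g sub by (simp add: locally_integrable_def)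
    obtain h where h: "h \<in> borel_measurable borel" "!!x. x \<notin> cbox a b ==> h x = 0"
        "AE x in lborel. x \<in> cbox a b --> h x = g x"
      by (rule borel_representative[of "cbox a b" g]) (use gi in auto)
    have hi: "integrable lborel h"
      using integrable_borel_representative[OF _ h borel_measurable_integrable[OF gi]] gi by simp
    have "AE x in lborel. x \<in> box a b --> h x = 0"
    proof (rule AE_eq_0_on_box)
      show "integrable lborel (%x. indicator (cbox a b) x * h x)"
        using integrable_mult_indicator[OF _ hi, of "cbox a b"] by simp
      fix \<phi> :: "'a => real" assume \<phi>: "smooth_on UNIV \<phi>" "{x. \<phi> x ~= 0} \<subseteq> cbox a b"
      have \<phi>t: "\<phi> \<in> test_functions \<Omega>"
        by (rule test_functions_supportI[OF \<phi>]) (use sub in auto)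
      obtain B where B: "!!x. \<bar>\<phi> x\<bar> <= B" by (rule test_functions_bounded[OF \<phi>t]) auto
      have \<phi>0: "x \<notin> cbox a b ==> \<phi> x = 0" for x using \<phi>(2) by blast
      note [measurable] = smooth_on_borel_measurable(1)[OF \<phi>(1)] h(1)
      have "(\<integral>x. h x * \<phi> x \<partial>lborel) = (\<integral>x. g x * \<phi> x \<partial>lebesgue_on (cbox a b))"
      proof (rule integral_borel_representative[symmetric])
        show "(%x. h x * \<phi> x) \<in> borel_measurable borel" by measurable
        show "(%x. g x * \<phi> x) \<in> borel_measurable (lebesgue_on (cbox a b))"
          using borel_measurable_integrable[OF gi] borel_measurable_lebesgue_onI[OF smooth_on_borel_measurable(1)[OF \<phi>(1)]]
          by (rule borel_measurable_times)
        show "AE x in lborel. x \<in> cbox a b --> h x * \<phi> x = g x * \<phi> x" using h(3) by eventually_elim auto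
      qed (use h(2) in auto)
      also have "\<dots> = 0"
        using null[OF \<phi>t] integrable_mult_test_function(2)[OF \<Omega> g _ sub smooth_on_borel_measurable(1)[OF \<phi>(1)] B \<phi>0]
        by simp
      finally show "(\<integral>x. h x * \<phi> x \<partial>lborel) = 0" .
    qed
    moreover have "AE x in lborel. x \<notin> cbox a b - box a b"
      using negligible_frontier_interval[of a b]
      by (intro AE_not_in) (simp add: negligible_iff_null_sets null_sets_completion_iff)
    ultimately show ?thesis unfolding X using h(3) by eventually_elim auto
  qed
  then have "AE x in lborel. \<forall>X\<in>\<D>. x \<in> X --> g x = 0"
    unfolding AE_ball_countable[OF \<D>(1)] by blast
  then have "AE x in lborel. x \<in> \<Omega> --> g x = 0" by (rule eventually_mono) (use \<D>(4) in blast)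
  then show ?thesis using \<Omega> by (simp add: AE_lebesgue_on_iff)
qed

lemma has_weak_gradient_unique:
  fixes \<Omega> :: "'a::euclidean_space set"
  assumes \<Omega>: "open \<Omega>" and G: "has_weak_gradient \<Omega> u G" and H: "has_weak_gradient \<Omega> u H"
  shows "AE x in lebesgue_on \<Omega>. G x = H x"
proof -
  have "AE x in lebesgue_on \<Omega>. G x \<bullet> i - H x \<bullet> i = 0" if i: "i \<in> Basis" for i
  proof (rule locally_integrable_AE_zero[OF \<Omega>])
    have l: "locally_integrable \<Omega> (%x. G x \<bullet> i)" "locally_integrable \<Omega> (%x. H x \<bullet> i)"
      using G H by (auto simp: has_weak_gradient_def intro: locally_integrable_inner)
    then show "locally_integrable \<Omega> (%x. G x \<bullet> i - H x \<bullet> i)" by (rule locally_integrable_diff)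
    fix \<phi> assume \<phi>: "\<phi> \<in> test_functions \<Omega>"
    obtain B where B: "!!x. \<bar>\<phi> x\<bar> <= B" by (rule test_functions_bounded[OF \<phi>]) auto
    note t = integrable_mult_test_function(1)[OF \<Omega> _ test_functionsD(2,3)[OF \<phi>]
        smooth_on_borel_measurable(1)[OF test_functionsD(1)[OF \<phi>]] B test_functions_zero_outside(1)[OF \<phi>]]
    have "(\<integral>x. (G x \<bullet> i) * \<phi> x \<partial>lebesgue_on \<Omega>) = (\<integral>x. (H x \<bullet> i) * \<phi> x \<partial>lebesgue_on \<Omega>)"
      using G H \<phi> i by (simp add: has_weak_gradient_def)
    then show "(\<integral>x. (G x \<bullet> i - H x \<bullet> i) * \<phi> x \<partial>lebesgue_on \<Omega>) = 0"
      using B_integral_diff[OF t[OF l(1)] t[OF l(2)]] by (simp add: left_diff_distrib)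
  qed
  then have "AE x in lebesgue_on \<Omega>. \<forall>i\<in>Basis. G x \<bullet> i - H x \<bullet> i = 0"
    by (intro AE_finite_allI) auto
  then show ?thesis
    by eventually_elim (simp add: euclidean_eq_iff[where 'a='a])
qed

section \<open>Sobolev functions with their gradients\<close>

lemma le_one_plus_powr:
  fixes x :: real
  assumes "x >= 0" "1 <= p" shows "x <= 1 + x powr p"
proof (cases "x <= 1")
  case False
  then have "x powr 1 <= x powr p" using assms by (intro powr_mono) auto
  then show ?thesis using False by simp
next
  case True
  then show ?thesis using powr_ge_zero[of x p] by linarith
qed

locale bounded_open_set =
  fixes \<Omega> :: "'a::euclidean_space set" and p :: real
  assumes open_\<Omega>: "open \<Omega>" and bounded_\<Omega>: "bounded \<Omega>" and p_gt_1: "1 < p"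
begin

abbreviation "M \<equiv> lebesgue_on \<Omega>"

lemma \<Omega>_borel: "\<Omega> \<in> sets borel" using open_\<Omega> by simp

lemma finite_M: "finite_measure M"
  by (intro finite_measure_lebesgue_on lmeasurable_open bounded_\<Omega> open_\<Omega>)

lemma p_pos: "p > 0" "p >= 0" using p_gt_1 by auto

text \<open>The gradient is carried as a second argument, so that explicit formulas can be stated
  for it; \<open>weak_gradient\<close> agrees with it only almost everywhere.\<close>

definition sob :: "('a => real) => ('a => 'a) => bool" where
  "sob u G \<longleftrightarrow> in_Lp M p u \<and> in_Lp M p G \<and> has_weak_gradient \<Omega> u G"

lemma sobD: assumes "sob u G" shows "in_Lp M p u" "in_Lp M p G" "has_weak_gradient \<Omega> u G"
  using assms by (auto simp: sob_def)

lemma in_Lp_integrable_M: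
  fixes f :: "'a => 'b::{banach, second_countable_topology}"
  shows "in_Lp M p f ==> integrable M f"
  by (rule in_Lp_imp_integrable[OF finite_M]) (use p_gt_1 in auto)

lemma locally_integrable_if_integrable:
  fixes f :: "'a => 'b::{banach, second_countable_topology}"
  assumes f: "integrable M f" shows "locally_integrable \<Omega> f"
  unfolding locally_integrable_def
proof (intro allI impI)
  fix K assume K: "compact K \<and> K \<subseteq> \<Omega>"
  then have "K \<in> sets borel" by (simp add: borel_compact)
  then have Kl: "K \<inter> space lebesgue \<in> sets lebesgue" and \<Omega>l: "\<Omega> \<inter> space lebesgue \<in> sets lebesgue" and K2: "K \<in> sets lebesgue"
    using \<Omega>_borel by auto
  have "integrable lebesgue (%x. indicator \<Omega> x *\<^sub>R f x)" using f integrable_restrict_space[OF \<Omega>l, of f] by simp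
  note i = integrable_mult_indicator[OF K2 this]
  have eq: "indicator K x *\<^sub>R (indicator \<Omega> x *\<^sub>R f x) = indicator K x *\<^sub>R f x" for x
    using K by (auto split: split_indicator)
  show "integrable (lebesgue_on K) f" using i unfolding integrable_restrict_space[OF Kl] eq .
qed

lemma integral_representative_mult:
  fixes f :: "'a => real"
  assumes f: "f \<in> borel_measurable M" and g: "g \<in> borel_measurable borel" "!!x. x \<notin> \<Omega> ==> g x = 0"
    and eq: "AE x in lborel. x \<in> \<Omega> --> g x = f x" and b: "b \<in> borel_measurable borel"
  shows "(\<integral>x. f x * b x \<partial>M) = (\<integral>x. g x * b x \<partial>lborel)"
proof (rule integral_borel_representative[OF \<Omega>_borel])
  show "(%x. f x * b x) \<in> borel_measurable M"
    by (intro borel_measurable_times f borel_measurable_lebesgue_onI b)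
  show "AE x in lborel. x \<in> \<Omega> --> g x * b x = f x * b x" using eq by eventually_elim auto
qed (use g b in auto)

text \<open>The bridge between the two formulations. A weak gradient is tested in basis directions
  only; linearity of the derivative of \<phi> in its direction extends this to every e.\<close>

lemma has_weak_gradient_iff_wderiv:
  assumes u: "integrable M u" and G: "integrable M G"
    and u0: "u0 \<in> borel_measurable borel" "!!x. x \<notin> \<Omega> ==> u0 x = 0" "AE x in lborel. x \<in> \<Omega> --> u0 x = u x"
    and G0: "G0 \<in> borel_measurable borel" "!!x. x \<notin> \<Omega> ==> G0 x = 0" "AE x in lborel. x \<in> \<Omega> --> G0 x = G x"
  shows "has_weak_gradient \<Omega> u G \<longleftrightarrow> (\<forall>e. wderiv \<Omega> e u0 (%x. G0 x \<bullet> e))"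
proof -
  have u0i: "integrable lborel u0" and G0i: "integrable lborel G0"
    using integrable_borel_representative[OF \<Omega>_borel u0 borel_measurable_integrable[OF u]] u
      integrable_borel_representative[OF \<Omega>_borel G0 borel_measurable_integrable[OF G]] G by auto
  have l: "(\<integral>x. u x * frechet_derivative \<phi> (at x) e \<partial>M) = (\<integral>x. u0 x * frechet_derivative \<phi> (at x) e \<partial>lborel)"
    "(\<integral>x. (G x \<bullet> e) * \<phi> x \<partial>M) = (\<integral>x. (G0 x \<bullet> e) * \<phi> x \<partial>lborel)"
    if "\<phi> \<in> test_functions \<Omega>" for \<phi> e
  proof -
    note m = smooth_on_borel_measurable[OF test_functionsD(1)[OF that]]
    show "(\<integral>x. u x * frechet_derivative \<phi> (at x) e \<partial>M) = (\<integral>x. u0 x * frechet_derivative \<phi> (at x) e \<partial>lborel)"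
      by (rule integral_representative_mult[OF borel_measurable_integrable[OF u] u0 m(2)])
    show "(\<integral>x. (G x \<bullet> e) * \<phi> x \<partial>M) = (\<integral>x. (G0 x \<bullet> e) * \<phi> x \<partial>lborel)"
    proof (rule integral_representative_mult[OF _ _ _ _ m(1)])
      show "AE x in lborel. x \<in> \<Omega> --> G0 x \<bullet> e = G x \<bullet> e" using G0(3) by eventually_elim auto
    qed (use G0 borel_measurable_integrable[OF G] in auto)
  qed
  show ?thesis
  proof
    assume w: "has_weak_gradient \<Omega> u G"
    show "\<forall>e. wderiv \<Omega> e u0 (%x. G0 x \<bullet> e)"
      unfolding wderiv_def
    proof (intro allI conjI ballI)
      fix e \<phi> assume \<phi>: "\<phi> \<in> test_functions \<Omega>"
      note sm = test_functionsD(1)[OF \<phi>]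
      obtain B where B: "!!x. \<bar>\<phi> x\<bar> <= B" by (rule test_functions_bounded[OF \<phi>]) auto
      have i1: "integrable lborel (%x. u0 x * frechet_derivative \<phi> (at x) i)" for i
      proof -
        obtain B' where "!!x. \<bar>frechet_derivative \<phi> (at x) i\<bar> <= B'"
          by (rule test_functions_bounded_derivative[OF \<phi>]) auto
        with u0i show ?thesis
          by (intro integrable_mult_bounded) (use smooth_on_borel_measurable(2)[OF sm] in auto)
      qed
      have i2: "integrable lborel (%x. (G0 x \<bullet> i) * \<phi> x)" for i
        using G0i by (intro integrable_mult_bounded[OF _ _ B]) (use smooth_on_borel_measurable(1)[OF sm] in auto)
      have "(\<integral>x. u0 x * frechet_derivative \<phi> (at x) e \<partial>lborel) =
          (\<integral>x. (\<Sum>i\<in>Basis. (e \<bullet> i) * (u0 x * frechet_derivative \<phi> (at x) i)) \<partial>lborel)"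
      proof (rule B_integral_cong[OF refl])
        fix x
        have "frechet_derivative \<phi> (at x) e = (\<Sum>i\<in>Basis. (e \<bullet> i) * frechet_derivative \<phi> (at x) i)"
          using euclidean_inner[of "gradient \<phi> x" e] by (simp only: gradient_inner[OF sm] mult.commute)
        then show "u0 x * frechet_derivative \<phi> (at x) e = (\<Sum>i\<in>Basis. (e \<bullet> i) * (u0 x * frechet_derivative \<phi> (at x) i))"
          by (simp add: sum_distrib_left mult.left_commute)
      qed
      also have "\<dots> = (\<Sum>i\<in>Basis. (e \<bullet> i) * (\<integral>x. u0 x * frechet_derivative \<phi> (at x) i \<partial>lborel))"
        using i1 by simp
      also have "\<dots> = (\<Sum>i\<in>Basis. (e \<bullet> i) * - (\<integral>x. (G0 x \<bullet> i) * \<phi> x \<partial>lborel))"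
        using w \<phi> by (intro sum.cong) (simp_all add: has_weak_gradient_def l[OF \<phi>, symmetric])
      also have "\<dots> = - (\<integral>x. (\<Sum>i\<in>Basis. (e \<bullet> i) * ((G0 x \<bullet> i) * \<phi> x)) \<partial>lborel)"
        using i2 by (simp add: sum_negf)
      also have "(\<integral>x. (\<Sum>i\<in>Basis. (e \<bullet> i) * ((G0 x \<bullet> i) * \<phi> x)) \<partial>lborel) = (\<integral>x. (G0 x \<bullet> e) * \<phi> x \<partial>lborel)"
      proof (rule B_integral_cong[OF refl])
        fix x
        have "(\<Sum>i\<in>Basis. (e \<bullet> i) * ((G0 x \<bullet> i) * \<phi> x)) = (\<Sum>i\<in>Basis. (G0 x \<bullet> i) * (e \<bullet> i)) * \<phi> x"
          unfolding sum_distrib_right by (intro sum.cong) auto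
        then show "(\<Sum>i\<in>Basis. (e \<bullet> i) * ((G0 x \<bullet> i) * \<phi> x)) = (G0 x \<bullet> e) * \<phi> x"
          by (simp only: euclidean_inner[of "G0 x" e])
      qed
      finally show "(\<integral>x. u0 x * frechet_derivative \<phi> (at x) e \<partial>lborel) = - (\<integral>x. (G0 x \<bullet> e) * \<phi> x \<partial>lborel)" .
    qed (use u0i G0i in auto)
  next
    assume "\<forall>e. wderiv \<Omega> e u0 (%x. G0 x \<bullet> e)"
    then show "has_weak_gradient \<Omega> u G"
      using locally_integrable_if_integrable[OF u] locally_integrable_if_integrable[OF G]
      by (simp add: has_weak_gradient_def wderiv_def l)
  qed
qed

text \<open>The chain rule for \<open>wderiv\<close> in every direction e, reassembled to a vector:
  pairing f' with \<open>(G \<bullet> e, H \<bullet> e)\<close> gives the e-component of the stated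
  combination. The Lipschitz bound puts the composition into Lp.\<close>

lemma sob_chain:
  fixes f :: "real \<times> real => real"
  assumes u: "sob u G" and v: "sob v H"
    and C: "convex C" "AE x in M. (u x, v x) \<in> C"
    and f: "!!z. z \<in> C ==> (f has_derivative (%d. f' z \<bullet> d)) (at z within C)"
    and L: "!!z. z \<in> C ==> norm (f' z) <= L"
    and meas: "f \<in> borel_measurable borel" "f' \<in> borel_measurable borel"
  shows "sob (%x. f (u x, v x)) (%x. fst (f' (u x, v x)) *\<^sub>R G x + snd (f' (u x, v x)) *\<^sub>R H x)"
  (is "sob ?w ?W")
proof -
  note lu = sobD(1)[OF u] and lG = sobD(2)[OF u] and lv = sobD(1)[OF v] and lH = sobD(2)[OF v]
  have um: "u \<in> borel_measurable M" and vm: "v \<in> borel_measurable M" and Gm: "G \<in> borel_measurable M" and Hm: "H \<in> borel_measurable M"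
    using lu lv lG lH by (auto intro: in_Lp_measurable)
  have zm: "(%x. (u x, v x)) \<in> M \<rightarrow>\<^sub>M borel" using um vm by (rule borel_measurable_Pair)
  have f'm: "(%x. f' (u x, v x)) \<in> M \<rightarrow>\<^sub>M borel" by (rule measurable_compose[OF zm meas(2)])
  have m1: "(%x. fst (f' (u x, v x))) \<in> borel_measurable M" and m2: "(%x. snd (f' (u x, v x))) \<in> borel_measurable M"
    using f'm by (auto simp: borel_prod[symmetric] intro: measurable_fst'' measurable_snd'')
  have b1: "AE x in M. \<bar>fst (f' (u x, v x))\<bar> <= L" and b2: "AE x in M. \<bar>snd (f' (u x, v x))\<bar> <= L"
  proof -
    have "\<bar>fst (f' z)\<bar> <= L" "\<bar>snd (f' z)\<bar> <= L" if "z \<in> C" for z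
      using L[OF that] norm_fst_le[of "fst (f' z)" "snd (f' z)"] norm_snd_le[of "snd (f' z)" "fst (f' z)"] by simp_all
    then show "AE x in M. \<bar>fst (f' (u x, v x))\<bar> <= L" "AE x in M. \<bar>snd (f' (u x, v x))\<bar> <= L"
      using C(2) by (auto elim: eventually_mono)
  qed
  have W: "in_Lp M p ?W"
    by (intro in_Lp_add in_Lp_mult_bounded[OF lG m1 b1] in_Lp_mult_bounded[OF lH m2 b2] p_pos)
  have wm: "?w \<in> borel_measurable M" by (rule measurable_compose[OF zm meas(1)])
  obtain u0 where u0: "u0 \<in> borel_measurable borel" "!!x. x \<notin> \<Omega> ==> u0 x = 0" "AE x in lborel. x \<in> \<Omega> --> u0 x = u x"
    by (rule borel_representative[OF \<Omega>_borel um]) auto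
  obtain v0 where v0: "v0 \<in> borel_measurable borel" "!!x. x \<notin> \<Omega> ==> v0 x = 0" "AE x in lborel. x \<in> \<Omega> --> v0 x = v x"
    by (rule borel_representative[OF \<Omega>_borel vm]) auto
  obtain G0 where G0: "G0 \<in> borel_measurable borel" "!!x. x \<notin> \<Omega> ==> G0 x = 0" "AE x in lborel. x \<in> \<Omega> --> G0 x = G x"
    by (rule borel_representative[OF \<Omega>_borel Gm]) auto
  obtain H0 where H0: "H0 \<in> borel_measurable borel" "!!x. x \<notin> \<Omega> ==> H0 x = 0" "AE x in lborel. x \<in> \<Omega> --> H0 x = H x"
    by (rule borel_representative[OF \<Omega>_borel Hm]) auto
  note [measurable] = u0(1) v0(1) G0(1) H0(1) meas \<Omega>_borel
  have wu: "wderiv \<Omega> e u0 (%x. G0 x \<bullet> e)" and wv: "wderiv \<Omega> e v0 (%x. H0 x \<bullet> e)" for e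
    using sobD(3)[OF u] has_weak_gradient_iff_wderiv[OF in_Lp_integrable_M[OF lu] in_Lp_integrable_M[OF lG] u0 G0]
      sobD(3)[OF v] has_weak_gradient_iff_wderiv[OF in_Lp_integrable_M[OF lv] in_Lp_integrable_M[OF lH] v0 H0]
    by auto
  have C0: "AE x in lborel. x \<in> \<Omega> --> (u0 x, v0 x) \<in> C"
    using C(2)[unfolded AE_lebesgue_on_iff[OF \<Omega>_borel]] u0(3) v0(3) by eventually_elim auto
  define w0 where "w0 x = indicator \<Omega> x * f (u0 x, v0 x)" for x
  define W0 where "W0 x = indicator \<Omega> x *\<^sub>R (fst (f' (u0 x, v0 x)) *\<^sub>R G0 x + snd (f' (u0 x, v0 x)) *\<^sub>R H0 x)" for x
  have w0: "w0 \<in> borel_measurable borel" "!!x. x \<notin> \<Omega> ==> w0 x = 0" "AE x in lborel. x \<in> \<Omega> --> w0 x = ?w x"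
  proof -
    show "w0 \<in> borel_measurable borel" unfolding w0_def by measurable
    show "AE x in lborel. x \<in> \<Omega> --> w0 x = ?w x" using u0(3) v0(3) by eventually_elim (auto simp: w0_def)
  qed (simp add: w0_def)
  have W0: "W0 \<in> borel_measurable borel" "!!x. x \<notin> \<Omega> ==> W0 x = 0" "AE x in lborel. x \<in> \<Omega> --> W0 x = ?W x"
  proof -
    have "(%x. f' (u0 x, v0 x)) \<in> borel \<rightarrow>\<^sub>M borel"
      by (rule measurable_compose[OF borel_measurable_Pair[OF u0(1) v0(1)] meas(2)])
    then have [measurable]: "(%x. fst (f' (u0 x, v0 x))) \<in> borel_measurable borel" "(%x. snd (f' (u0 x, v0 x))) \<in> borel_measurable borel"
      by (auto simp: borel_prod[symmetric] intro: measurable_fst'' measurable_snd'')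
    show "W0 \<in> borel_measurable borel" unfolding W0_def
      by (intro borel_measurable_scaleR borel_measurable_add borel_measurable_indicator) measurable
    show "AE x in lborel. x \<in> \<Omega> --> W0 x = ?W x" using u0(3) v0(3) G0(3) H0(3) by eventually_elim (auto simp: W0_def)
  qed (simp add: W0_def)
  have wd: "wderiv \<Omega> e w0 (%x. W0 x \<bullet> e)" for e
  proof -
    have eq: "W0 x \<bullet> e = indicator \<Omega> x * (f' (u0 x, v0 x) \<bullet> (G0 x \<bullet> e, H0 x \<bullet> e))" for x
      by (cases "f' (u0 x, v0 x)") (simp add: W0_def inner_add_left)
    show ?thesis
      unfolding w0_def[abs_def] eq
      by (rule wderiv_compose[OF open_\<Omega> bounded_\<Omega> wu wv C(1) C0 f L meas])
  qed
  have wi: "integrable M ?w"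
    using integrable_borel_representative[OF \<Omega>_borel w0 wm] wd by (simp add: wderiv_def)
  have "has_weak_gradient \<Omega> ?w ?W"
    using has_weak_gradient_iff_wderiv[OF wi in_Lp_integrable_M[OF W] w0 W0] wd by blast
  moreover have "in_Lp M p ?w"
  proof (cases "C = {}")
    case True
    then have "AE x in M. False" using C(2) by simp
    then have "AE x in M. ?w x = 0" by (rule eventually_mono) simp
    then show ?thesis
      by (intro in_Lp_cong_AE[OF in_Lp_zero wm]) (auto elim: eventually_mono)
  next
    case False
    then obtain z0 where z0: "z0 \<in> C" by blast
    have lip: "\<bar>f z - f z0\<bar> <= L * norm (z - z0)" if "z \<in> C" for z
    proof -
      have "norm (f z - f z0) <= L * norm (z - z0)"
      proof (rule differentiable_bound[OF C(1) f])
        show "onorm (%d. f' x \<bullet> d) <= L" if "x \<in> C" for x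
        proof (rule onorm_le)
          fix d
          show "norm (f' x \<bullet> d) <= L * norm d"
            using Cauchy_Schwarz_ineq2[of "f' x" d] mult_right_mono[OF L[OF that], of "norm d"] by simp
        qed
      qed (use that z0 in auto)
      then show ?thesis by simp
    qed
    have L0: "L >= 0" using L[OF z0] norm_ge_zero[of "f' z0"] by linarith
    have g: "in_Lp M p (%x. (\<bar>f z0\<bar> + L * norm z0) + (L *\<^sub>R norm (u x) + L *\<^sub>R norm (v x)))"
      by (intro in_Lp_add in_Lp_scale in_Lp_const in_Lp_norm finite_M lu lv p_pos)
    show ?thesis
    proof (rule in_Lp_bounded_by[OF wm in_Lp_integrable[OF g]])
      show "AE x in M. norm (?w x) powr p <= norm ((\<bar>f z0\<bar> + L * norm z0) + (L *\<^sub>R norm (u x) + L *\<^sub>R norm (v x))) powr p"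
        using C(2)
      proof eventually_elim
        case (elim x)
        have "norm ((u x, v x) - z0) <= norm z0 + (\<bar>u x\<bar> + \<bar>v x\<bar>)"
          using norm_triangle_ineq4[of "(u x, v x)" z0] norm_Pair_le[of "u x" "v x"] by simp
        then have "L * norm ((u x, v x) - z0) <= L * (norm z0 + (\<bar>u x\<bar> + \<bar>v x\<bar>))" using L0 by (rule mult_left_mono)
        then have "\<bar>f (u x, v x)\<bar> <= (\<bar>f z0\<bar> + L * norm z0) + (L * \<bar>u x\<bar> + L * \<bar>v x\<bar>)"
          using lip[OF elim] by (simp add: algebra_simps)
        then show ?case using p_pos by (intro powr_mono2) auto
      qed
    qed
  qed
  ultimately show ?thesis using W by (simp add: sob_def)
qed

text \<open>Both sides of the weak identity pass to the limit, since \<phi> and its derivatives are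
  bounded; a common subsequence supplies the convergence almost everywhere.\<close>

lemma sob_limit:
  assumes s: "!!n. sob (s n) (S n)" and u: "in_Lp M p u" and G: "in_Lp M p G"
    and lim: "Lp_lim M p s u" "Lp_lim M p S G"
  shows "sob u G"
proof -
  have "(\<integral>x. u x * frechet_derivative \<phi> (at x) i \<partial>M) = - (\<integral>x. (G x \<bullet> i) * \<phi> x \<partial>M)"
    if \<phi>: "\<phi> \<in> test_functions \<Omega>" and i: "i \<in> Basis" for \<phi> i
  proof -
    note sm = test_functionsD(1)[OF \<phi>]
    note m = smooth_on_borel_measurable(1)[OF sm, THEN borel_measurable_lebesgue_onI[of _ \<Omega>]]
      smooth_on_borel_measurable(2)[OF sm, of i, THEN borel_measurable_lebesgue_onI[of _ \<Omega>]]
    obtain B where B: "B > 0" "!!x. \<bar>\<phi> x\<bar> <= B" by (rule test_functions_bounded[OF \<phi>]) auto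
    obtain B' where B': "B' > 0" "!!x. \<bar>frechet_derivative \<phi> (at x) i\<bar> <= B'"
      by (rule test_functions_bounded_derivative[OF \<phi>]) auto
    obtain r where r: "strict_mono r" "AE x in M. (%n. s (r n) x) \<longlonglongrightarrow> u x"
      by (rule Lp_lim_AE_subseq[OF sobD(1)[OF s] u _ lim(1)]) (use p_pos in auto)
    obtain r' where r': "strict_mono r'" "AE x in M. (%n. S (r (r' n)) x) \<longlonglongrightarrow> G x"
      by (rule Lp_lim_AE_subseq[OF sobD(2)[OF s] G _ Lp_lim_subseq[OF lim(2) r(1)]]) (use p_pos in auto)
    have growth: "\<bar>b * y\<bar> <= K * (1 + c powr p)" if "\<bar>y\<bar> <= K" "\<bar>b\<bar> <= c" for b y K c :: real
    proof -
      have "c <= 1 + c powr p" using p_gt_1 that by (intro le_one_plus_powr) auto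
      then have "\<bar>b\<bar> * \<bar>y\<bar> <= (1 + c powr p) * K" using that by (intro mult_mono) auto
      then show ?thesis by (simp add: abs_mult mult.commute)
    qed
    have "(%n. \<integral>x. s (r n) x * frechet_derivative \<phi> (at x) i \<partial>M) \<longlonglongrightarrow> (\<integral>x. u x * frechet_derivative \<phi> (at x) i \<partial>M)"
    proof (rule integral_tendsto_Lp_growth[OF finite_M sobD(1)[OF s] u _ Lp_lim_subseq[OF lim(1) r(1)], where C = B'])
      show "AE x in M. (%n. s (r n) x * frechet_derivative \<phi> (at x) i) \<longlonglongrightarrow> u x * frechet_derivative \<phi> (at x) i"
        using r(2) by eventually_elim (intro tendsto_intros)
    qed (use p_pos B' in \<open>auto intro!: growth borel_measurable_times m in_Lp_measurable[OF sobD(1)[OF s]] in_Lp_measurable[OF u]\<close>)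
    from LIMSEQ_subseq_LIMSEQ[OF this r'(1)]
    have l1: "(%n. \<integral>x. s (r (r' n)) x * frechet_derivative \<phi> (at x) i \<partial>M) \<longlonglongrightarrow> (\<integral>x. u x * frechet_derivative \<phi> (at x) i \<partial>M)"
      by (simp add: o_def)
    have l2: "(%n. \<integral>x. (S (r (r' n)) x \<bullet> i) * \<phi> x \<partial>M) \<longlonglongrightarrow> (\<integral>x. (G x \<bullet> i) * \<phi> x \<partial>M)"
    proof (rule integral_tendsto_Lp_growth[OF finite_M sobD(2)[OF s] G _ Lp_lim_subseq[OF Lp_lim_subseq[OF lim(2) r(1)] r'(1)], where C = B])
      show "AE x in M. (%n. (S (r (r' n)) x \<bullet> i) * \<phi> x) \<longlonglongrightarrow> (G x \<bullet> i) * \<phi> x"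
        using r'(2) by eventually_elim (intro tendsto_intros)
    qed (use p_pos B i in \<open>auto intro!: growth borel_measurable_times borel_measurable_inner m
          in_Lp_measurable[OF sobD(2)[OF s]] in_Lp_measurable[OF G] Basis_le_norm\<close>)
    have "(\<integral>x. s (r (r' n)) x * frechet_derivative \<phi> (at x) i \<partial>M) = - (\<integral>x. (S (r (r' n)) x \<bullet> i) * \<phi> x \<partial>M)" for n
      using sobD(3)[OF s] \<phi> i by (simp add: has_weak_gradient_def)
    with l1 have "(%n. - (\<integral>x. (S (r (r' n)) x \<bullet> i) * \<phi> x \<partial>M)) \<longlonglongrightarrow> (\<integral>x. u x * frechet_derivative \<phi> (at x) i \<partial>M)" by simp
    from LIMSEQ_unique[OF this tendsto_minus[OF l2]] show ?thesis .
  qed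
  then show ?thesis
    using u G locally_integrable_if_integrable[OF in_Lp_integrable_M[OF u]]
      locally_integrable_if_integrable[OF in_Lp_integrable_M[OF G]]
    by (simp add: sob_def has_weak_gradient_def)
qed

end

section \<open>Classical gradients of test functions as weak gradients\<close>

lemma gradient_has_derivative:
  assumes "(\<phi> has_derivative (%v. g \<bullet> v)) (at x)" shows "gradient \<phi> x = g"
proof -
  have "frechet_derivative \<phi> (at x) i = g \<bullet> i" for i using assms by (rule frechet_derivative_eqI)
  then show ?thesis by (simp add: gradient_def euclidean_representation)
qed

lemma smooth_on_gradient: "smooth_on UNIV \<phi> ==> (\<phi> has_derivative (%v. gradient \<phi> x \<bullet> v)) (at x)"
  using smooth_on_has_derivative[of \<phi> x] by (simp only: gradient_inner)

lemma continuous_on_gradient: "smooth_on UNIV \<phi> ==> continuous_on UNIV (gradient \<phi>)"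
  unfolding gradient_def[abs_def]
  by (intro continuous_on_sum continuous_on_scaleR continuous_on_const smooth_on_continuous_derivative)

lemma gradient_zero_outside:
  assumes "\<phi> \<in> test_functions \<Omega>" "x \<notin> closure {x. \<phi> x ~= 0}" shows "gradient \<phi> x = 0"
  unfolding gradient_def test_functions_zero_outside(2)[OF assms] by simp

lemma integrable_if_zero_outside_compact:
  fixes f :: "'a::euclidean_space => 'b::euclidean_space"
  assumes "continuous_on UNIV f" "compact K" "!!x. x \<notin> K ==> f x = 0"
  shows "integrable lborel f"
proof -
  have "integrable lborel (%x. indicator K x *\<^sub>R f x)"
    by (rule borel_integrable_compact[OF assms(2) continuous_on_subset[OF assms(1)]]) simp
  moreover have "indicator K x *\<^sub>R f x = f x" for x using assms(3) by (cases "x \<in> K") auto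
  ultimately show ?thesis by simp
qed

text \<open>Averaging over translates in direction e and exchanging the integrals turns the
  derivative into \<phi>(x + e) - \<phi>(x), whose integral is 0.\<close>

lemma integral_derivative_test_function:
  assumes \<phi>: "\<phi> \<in> test_functions \<Omega>"
  shows "(\<integral>x. frechet_derivative \<phi> (at x) e \<partial>lborel) = 0"
proof -
  note sm = test_functionsD(1)[OF \<phi>]
  have \<phi>i: "integrable lborel \<phi>"
    by (rule integrable_if_zero_outside_compact[OF smooth_on_continuous[OF sm] test_functionsD(2)[OF \<phi>]
          test_functions_zero_outside(1)[OF \<phi>]])
  have Di: "integrable lborel (%x. frechet_derivative \<phi> (at x) e)"
    by (rule integrable_if_zero_outside_compact[OF smooth_on_continuous_derivative[OF sm] test_functionsD(2)[OF \<phi>]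
          test_functions_zero_outside(2)[OF \<phi>]])
  have F: "integrable (lborel \<Otimes>\<^sub>M lborel) (%(t, x). indicator {0..1::real} t * frechet_derivative \<phi> (at (x + t *\<^sub>R e)) e)"
    using integrable_line_average[OF Di, of e] by simp
  have "(\<integral>x. frechet_derivative \<phi> (at x) e \<partial>lborel) =
      (\<integral>t. indicator {0..1::real} t * (\<integral>x. frechet_derivative \<phi> (at x) e \<partial>lborel) \<partial>lborel)" by simp
  also have "\<dots> = (\<integral>t. \<integral>x. indicator {0..1::real} t * frechet_derivative \<phi> (at (x + t *\<^sub>R e)) e \<partial>lborel \<partial>lborel)"
    using integral_lborel_translation[OF Di] by simp
  also have "\<dots> = (\<integral>x. \<integral>t. indicator {0..1::real} t * frechet_derivative \<phi> (at (x + t *\<^sub>R e)) e \<partial>lborel \<partial>lborel)"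
    by (rule lborel_pair.Fubini_integral[OF F, symmetric])
  also have "\<dots> = (\<integral>x. \<phi> (x + e) - \<phi> x \<partial>lborel)" by (simp only: test_functions_line_integral[OF sm])
  also have "\<dots> = 0"
    using B_integral_diff[OF integrable_lborel_translation[OF \<phi>i, of e] \<phi>i]
      integral_lborel_translation[OF \<phi>i, of e] by simp
  finally show ?thesis .
qed

context bounded_open_set
begin

lemma borel_bounded_in_Lp:
  fixes f :: "'a => 'b::euclidean_space"
  assumes "f \<in> borel_measurable borel" "!!x. norm (f x) <= B" shows "in_Lp M p f"
proof (rule in_Lp_bounded_by[OF borel_measurable_lebesgue_onI[OF assms(1)]])
  show "integrable M (%x. B powr p)" by (rule finite_measure.integrable_const[OF finite_M])
  show "AE x in M. norm (f x) powr p <= B powr p"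
    using assms(2) p_pos by (intro AE_I2 powr_mono2) auto
qed

lemma test_function_in_Lp:
  assumes \<phi>: "\<phi> \<in> test_functions \<Omega>"
  shows "in_Lp M p \<phi>" "in_Lp M p (gradient \<phi>)"
proof -
  note sm = test_functionsD(1)[OF \<phi>]
  obtain B where B: "!!x. \<bar>\<phi> x\<bar> <= B" by (rule test_functions_bounded[OF \<phi>]) auto
  show "in_Lp M p \<phi>"
    by (rule borel_bounded_in_Lp[OF smooth_on_borel_measurable(1)[OF sm]]) (use B in auto)
  have "bounded (gradient \<phi> ` closure {x. \<phi> x ~= 0})"
    by (intro compact_imp_bounded compact_continuous_image continuous_on_subset[OF continuous_on_gradient[OF sm]]
        test_functionsD(2)[OF \<phi>]) auto
  then obtain B' where B': "B' > 0" "!!x. x \<in> closure {x. \<phi> x ~= 0} ==> norm (gradient \<phi> x) <= B'"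
    unfolding bounded_pos by blast
  have "norm (gradient \<phi> x) <= B'" for x
  proof (cases "x \<in> closure {x. \<phi> x ~= 0}")
    case True
    then show ?thesis by (rule B'(2))
  next
    case False
    from gradient_zero_outside[OF \<phi> this] B'(1) show ?thesis by simp
  qed
  then show "in_Lp M p (gradient \<phi>)"
    by (rule borel_bounded_in_Lp[OF borel_measurable_continuous_onI[OF continuous_on_gradient[OF sm]]])
qed

text \<open>The product \<phi> \<psi> is again a test function, so its derivative has integral 0; by
  the product rule this is integration by parts.\<close>

lemma sob_test_function:
  assumes \<phi>: "\<phi> \<in> test_functions \<Omega>" shows "sob \<phi> (gradient \<phi>)"
proof -
  note sm = test_functionsD(1)[OF \<phi>] and lp = test_function_in_Lp[OF \<phi>]
  have ind: "(\<integral>x. f x \<partial>M) = (\<integral>x. f x \<partial>lborel)" if "f \<in> borel_measurable borel" "!!x. x \<notin> \<Omega> ==> f x = 0" for f :: "'a => real"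
    by (rule integral_borel_representative[OF \<Omega>_borel that]) (use that borel_measurable_lebesgue_onI in auto)
  have "(\<integral>x. \<phi> x * frechet_derivative \<psi> (at x) i \<partial>M) = - (\<integral>x. (gradient \<phi> x \<bullet> i) * \<psi> x \<partial>M)"
    if \<psi>: "\<psi> \<in> test_functions \<Omega>" for \<psi> i
  proof -
    note sm' = test_functionsD(1)[OF \<psi>]
    let ?K = "closure {x. \<psi> x ~= 0}"
    note K = test_functionsD(2,3)[OF \<psi>] and z = test_functions_zero_outside[OF \<psi>]
    have c: "continuous_on UNIV (%x. \<phi> x * frechet_derivative \<psi> (at x) i)"
        "continuous_on UNIV (%x. frechet_derivative \<phi> (at x) i * \<psi> x)"
      by (intro continuous_on_mult smooth_on_continuous smooth_on_continuous_derivative sm sm')+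
    have i: "integrable lborel (%x. \<phi> x * frechet_derivative \<psi> (at x) i)"
        "integrable lborel (%x. frechet_derivative \<phi> (at x) i * \<psi> x)"
      by (rule integrable_if_zero_outside_compact[OF c(1) K(1)], subst z(2), assumption, simp)
        (rule integrable_if_zero_outside_compact[OF c(2) K(1)], subst z(1), assumption, simp)
    have "frechet_derivative (%x. \<phi> x * \<psi> x) (at x) i =
        \<phi> x * frechet_derivative \<psi> (at x) i + frechet_derivative \<phi> (at x) i * \<psi> x" for x
      by (rule frechet_derivative_eqI)
        (rule has_derivative_mult[OF smooth_on_has_derivative[OF sm] smooth_on_has_derivative[OF sm']])
    then have "(\<integral>x. \<phi> x * frechet_derivative \<psi> (at x) i + frechet_derivative \<phi> (at x) i * \<psi> x \<partial>lborel) = 0"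
      using integral_derivative_test_function[OF test_functions_mult[OF sm \<psi>], of i] by simp
    then have eq: "(\<integral>x. \<phi> x * frechet_derivative \<psi> (at x) i \<partial>lborel) = - (\<integral>x. frechet_derivative \<phi> (at x) i * \<psi> x \<partial>lborel)"
      using B_integral_add[OF i] by simp
    have "(\<integral>x. \<phi> x * frechet_derivative \<psi> (at x) i \<partial>M) = (\<integral>x. \<phi> x * frechet_derivative \<psi> (at x) i \<partial>lborel)"
    proof (rule ind[OF borel_measurable_continuous_onI[OF c(1)]])
      show "\<phi> x * frechet_derivative \<psi> (at x) i = 0" if "x \<notin> \<Omega>" for x
        using z(2)[of x i] K(2) that by auto
    qed
    moreover have "(\<integral>x. frechet_derivative \<phi> (at x) i * \<psi> x \<partial>M) = (\<integral>x. frechet_derivative \<phi> (at x) i * \<psi> x \<partial>lborel)"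
    proof (rule ind[OF borel_measurable_continuous_onI[OF c(2)]])
      show "frechet_derivative \<phi> (at x) i * \<psi> x = 0" if "x \<notin> \<Omega>" for x
        using z(1)[of x] K(2) that by auto
    qed
    ultimately show ?thesis using eq by (simp add: gradient_inner[OF sm])
  qed
  then show ?thesis
    using lp locally_integrable_if_integrable[OF in_Lp_integrable_M[OF lp(1)]]
      locally_integrable_if_integrable[OF in_Lp_integrable_M[OF lp(2)]]
    by (simp add: sob_def has_weak_gradient_def)
qed

section \<open>Modification on null sets\<close>

lemma sob_unique: "sob u G ==> sob u H ==> AE x in M. G x = H x"
  using has_weak_gradient_unique[OF open_\<Omega>] by (auto simp: sob_def)

lemma lebesgue_on_measurable_AE:
  fixes f g :: "'a => 'b::euclidean_space"
  assumes f: "f \<in> borel_measurable M" and eq: "AE x in M. f x = g x"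
  shows "g \<in> borel_measurable M"
proof -
  have \<Omega>l: "\<Omega> \<inter> space lebesgue \<in> sets lebesgue" using \<Omega>_borel by simp
  have "AE x in lebesgue. indicator \<Omega> x *\<^sub>R f x = indicator \<Omega> x *\<^sub>R g x"
    using eq unfolding AE_restrict_space_iff[OF \<Omega>l] by (rule eventually_mono) (auto split: split_indicator)
  then show ?thesis
    using f borel_measurable_AE[of "%x. indicator \<Omega> x *\<^sub>R f x" "%x. indicator \<Omega> x *\<^sub>R g x"]
    unfolding borel_measurable_restrict_space_iff[OF \<Omega>l] by blast
qed

lemma in_Lp_AE:
  fixes f g :: "'a => 'b::euclidean_space"
  assumes "in_Lp M p f" "AE x in M. f x = g x" shows "in_Lp M p g"
  using in_Lp_cong_AE[OF assms(1) lebesgue_on_measurable_AE[OF in_Lp_measurable[OF assms(1)] assms(2)] assms(2)] .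

lemma Lp_lim_const: "Lp_lim M p (%n. f) f"
  using p_pos by (simp add: Lp_lim_def)

text \<open>Lebesgue measure is complete, so two functions equal almost everywhere are both
  measurable or both not; in the second case both integrals are 0 by convention.\<close>

lemma integral_cong_AE_M:
  fixes f g :: "'a => 'b::euclidean_space"
  assumes eq: "AE x in M. f x = g x" shows "(\<integral>x. f x \<partial>M) = (\<integral>x. g x \<partial>M)"
proof (cases "f \<in> borel_measurable M")
  case True
  show ?thesis by (rule integral_cong_AE[OF True lebesgue_on_measurable_AE[OF True eq] eq])
next
  case False
  moreover have "g \<notin> borel_measurable M"
  proof -
    have "AE x in M. g x = f x" using eq by (rule eventually_mono) simp
    then show ?thesis using False lebesgue_on_measurable_AE[of g f] by blast
  qed
  ultimately show ?thesis
    using borel_measurable_integrable[of M f] borel_measurable_integrable[of M g]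
    by (metis not_integrable_integral_eq)
qed

lemma Lp_lim_cong_AE:
  assumes "!!n. AE x in M. norm (s n x - f x) = norm (t n x - g x)" and "Lp_lim M p s f"
  shows "Lp_lim M p t g"
proof -
  have "(\<integral>x. norm (s n x - f x) powr p \<partial>M) = (\<integral>x. norm (t n x - g x) powr p \<partial>M)" for n
    by (rule integral_cong_AE_M) (use assms(1)[of n] in \<open>auto elim!: eventually_mono\<close>)
  then show ?thesis using assms(2) by (simp add: Lp_lim_def)
qed

lemma sob_AE:
  assumes "sob u G" "AE x in M. u x = v x" "AE x in M. G x = H x" shows "sob v H"
proof (rule sob_limit)
  show "in_Lp M p v" "in_Lp M p H"
    using assms by (auto intro: in_Lp_AE sobD)
  show "sob u G" for n :: nat by (rule assms(1))
  show "Lp_lim M p (%n. u) v"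
    by (rule Lp_lim_cong_AE[OF _ Lp_lim_const[of u]]) (use assms(2) in \<open>auto elim: eventually_mono\<close>)
  show "Lp_lim M p (%n. G) H"
    by (rule Lp_lim_cong_AE[OF _ Lp_lim_const[of G]]) (use assms(3) in \<open>auto elim: eventually_mono\<close>)
qed

lemma sob_linear:
  assumes u: "sob u G" and v: "sob v H"
  shows "sob (%x. a * u x + b * v x) (%x. a *\<^sub>R G x + b *\<^sub>R H x)"
proof -
  have "sob (%x. (%z. a * fst z + b * snd z) (u x, v x))
      (%x. fst ((%z. (a, b)) (u x, v x)) *\<^sub>R G x + snd ((%z. (a, b)) (u x, v x)) *\<^sub>R H x)"
    by (rule sob_chain[OF u v convex_UNIV, where L = "norm (a, b)"])
      (auto intro!: derivative_eq_intros simp: inner_prod_def borel_prod[symmetric])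
  then show ?thesis by simp
qed

lemma sob_weak_gradient:
  assumes "u \<in> W1p \<Omega> p" shows "sob u (weak_gradient \<Omega> u)"
proof -
  obtain G where G: "G \<in> Lp_space \<Omega> p" "has_weak_gradient \<Omega> u G" and u: "u \<in> Lp_space \<Omega> p"
    using assms by (auto simp: W1p_def)
  have uG: "sob u G" using u G by (auto simp: sob_def in_Lp_def Lp_space_def)
  have "has_weak_gradient \<Omega> u (weak_gradient \<Omega> u)"
    unfolding weak_gradient_def by (rule someI[of "has_weak_gradient \<Omega> u"]) (rule G)
  from has_weak_gradient_unique[OF open_\<Omega> G(2) this] show ?thesis
    by (intro sob_AE[OF uG]) auto
qed

lemma sob_imp_W1p:
  assumes "sob u G" shows "u \<in> W1p \<Omega> p" "AE x in M. weak_gradient \<Omega> u x = G x"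
proof -
  show u: "u \<in> W1p \<Omega> p" using assms by (auto simp: W1p_def sob_def in_Lp_def Lp_space_def)
  show "AE x in M. weak_gradient \<Omega> u x = G x" by (rule sob_unique[OF sob_weak_gradient[OF u] assms])
qed

section \<open>Approximation by test functions\<close>

text \<open>The approximating class T is a parameter because nonnegative approximants are required
  later, for compositions that make sense on nonnegative arguments only.\<close>

definition approximable :: "('a => real) set => ('a => real) => ('a => 'a) => bool" where
  "approximable T u G \<longleftrightarrow> (\<exists>\<phi>. (\<forall>n. \<phi> n \<in> T) \<and> Lp_lim M p \<phi> u \<and> Lp_lim M p (%n. gradient (\<phi> n)) G)"

definition sob_dist :: "('a => real) => ('a => 'a) => ('a => real) => ('a => 'a) => real" where
  "sob_dist u G v H = (\<integral>x. norm (u x - v x) powr p \<partial>M) + (\<integral>x. norm (G x - H x) powr p \<partial>M)"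

lemma sob_dist_nonneg: "sob_dist u G v H >= 0"
  by (simp add: sob_dist_def)

lemma Lp_lim_iff_sob_dist:
  "Lp_lim M p s u \<and> Lp_lim M p S G \<longleftrightarrow> (%n. sob_dist (s n) (S n) u G) \<longlonglongrightarrow> 0"
proof
  assume "Lp_lim M p s u \<and> Lp_lim M p S G"
  then show "(%n. sob_dist (s n) (S n) u G) \<longlonglongrightarrow> 0"
    unfolding Lp_lim_def sob_dist_def by (intro tendsto_add_zero) auto
next
  assume d: "(%n. sob_dist (s n) (S n) u G) \<longlonglongrightarrow> 0"
  show "Lp_lim M p s u \<and> Lp_lim M p S G"
    unfolding Lp_lim_def
    by (intro conjI; rule Lim_null_comparison[OF always_eventually d]) (auto simp: sob_dist_def)
qed

lemma sob_dist_triangle: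
  assumes "in_Lp M p u" "in_Lp M p G" "in_Lp M p v" "in_Lp M p H" "in_Lp M p w" "in_Lp M p K"
  shows "sob_dist u G w K <= 2 powr p * (sob_dist u G v H + sob_dist v H w K)"
proof -
  have *: "(\<integral>x. norm (a x - c x) powr p \<partial>M) <= 2 powr p * ((\<integral>x. norm (a x - b x) powr p \<partial>M) + (\<integral>x. norm (b x - c x) powr p \<partial>M))"
    if "in_Lp M p a" "in_Lp M p b" "in_Lp M p c" for a b c :: "'a => 'b::euclidean_space"
  proof -
    note i = in_Lp_integrable[OF in_Lp_diff[OF that(1,3) p_pos(2)]] in_Lp_integrable[OF in_Lp_diff[OF that(1,2) p_pos(2)]]
      in_Lp_integrable[OF in_Lp_diff[OF that(2,3) p_pos(2)]]
    have "(\<integral>x. norm (a x - c x) powr p \<partial>M) <= (\<integral>x. 2 powr p * (norm (a x - b x) powr p + norm (b x - c x) powr p) \<partial>M)"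
    proof (rule integral_mono[OF i(1)])
      show "integrable M (%x. 2 powr p * (norm (a x - b x) powr p + norm (b x - c x) powr p))" using i by auto
      show "norm (a x - c x) powr p <= 2 powr p * (norm (a x - b x) powr p + norm (b x - c x) powr p)" for x
        using powr_norm_add_le[OF p_pos(2), of "a x - b x" "b x - c x"] by simp
    qed
    then show ?thesis using i by simp
  qed
  show ?thesis
    using *[OF assms(1,3,5)] *[OF assms(2,4,6)] by (simp add: sob_dist_def algebra_simps)
qed

lemma approximable_iff:
  "approximable T u G \<longleftrightarrow> (\<forall>\<epsilon>>0. \<exists>\<phi>\<in>T. sob_dist \<phi> (gradient \<phi>) u G < \<epsilon>)"
proof
  assume "approximable T u G"
  then obtain \<phi> where \<phi>: "!!n. \<phi> n \<in> T" "(%n. sob_dist (\<phi> n) (gradient (\<phi> n)) u G) \<longlonglongrightarrow> 0"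
    unfolding approximable_def Lp_lim_iff_sob_dist by blast
  show "\<forall>\<epsilon>>0. \<exists>\<phi>\<in>T. sob_dist \<phi> (gradient \<phi>) u G < \<epsilon>"
  proof (intro allI impI)
    fix \<epsilon> :: real assume "\<epsilon> > 0"
    then have "\<forall>\<^sub>F n in sequentially. sob_dist (\<phi> n) (gradient (\<phi> n)) u G < \<epsilon>"
      using order_tendstoD(2)[OF \<phi>(2)] by blast
    then obtain n where "sob_dist (\<phi> n) (gradient (\<phi> n)) u G < \<epsilon>" by (auto simp: eventually_sequentially)
    then show "\<exists>\<phi>\<in>T. sob_dist \<phi> (gradient \<phi>) u G < \<epsilon>" using \<phi>(1) by blast
  qed
next
  assume *: "\<forall>\<epsilon>>0. \<exists>\<phi>\<in>T. sob_dist \<phi> (gradient \<phi>) u G < \<epsilon>"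
  have "\<exists>\<phi>. \<forall>n. \<phi> n \<in> T \<and> sob_dist (\<phi> n) (gradient (\<phi> n)) u G < inverse (real (Suc n))"
    by (intro choice allI) (use * in \<open>auto simp: Bex_def\<close>)
  then obtain \<phi> where \<phi>: "!!n. \<phi> n \<in> T" "!!n. sob_dist (\<phi> n) (gradient (\<phi> n)) u G < inverse (real (Suc n))" by blast
  have "(%n. sob_dist (\<phi> n) (gradient (\<phi> n)) u G) \<longlonglongrightarrow> 0"
    by (rule Lim_null_comparison[OF always_eventually LIMSEQ_inverse_real_of_nat])
      (use \<phi>(2) sob_dist_nonneg in \<open>auto simp: abs_of_nonneg less_imp_le simp del: of_nat_Suc\<close>)
  then show "approximable T u G"
    using \<phi>(1) Lp_lim_iff_sob_dist[of \<phi> u "%n. gradient (\<phi> n)" G] unfolding approximable_def by blast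
qed

lemma approximable_limit:
  assumes T: "T \<subseteq> test_functions \<Omega>"
    and s: "!!n. approximable T (s n) (S n)" "!!n. in_Lp M p (s n)" "!!n. in_Lp M p (S n)"
    and u: "in_Lp M p u" "in_Lp M p G" and lim: "Lp_lim M p s u" "Lp_lim M p S G"
  shows "approximable T u G"
  unfolding approximable_iff
proof (intro allI impI)
  fix \<epsilon> :: real assume e: "\<epsilon> > 0"
  define e' where "e' = \<epsilon> / (2 powr p * 2)"
  have e': "e' > 0" using e by (simp add: e'_def)
  have "(%n. sob_dist (s n) (S n) u G) \<longlonglongrightarrow> 0" using lim Lp_lim_iff_sob_dist[of s u S G] by blast
  then have "\<forall>\<^sub>F n in sequentially. sob_dist (s n) (S n) u G < e'" using order_tendstoD(2) e' by blast
  then obtain n where n: "sob_dist (s n) (S n) u G < e'" by (auto simp: eventually_sequentially)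
  obtain \<phi> where \<phi>: "\<phi> \<in> T" "sob_dist \<phi> (gradient \<phi>) (s n) (S n) < e'"
    using s(1)[of n] e' unfolding approximable_iff by blast
  have "sob_dist \<phi> (gradient \<phi>) u G <= 2 powr p * (sob_dist \<phi> (gradient \<phi>) (s n) (S n) + sob_dist (s n) (S n) u G)"
    by (rule sob_dist_triangle) (use test_function_in_Lp T \<phi>(1) s u in auto)
  also have "\<dots> < 2 powr p * (e' + e')"
    using n \<phi>(2) by (intro mult_strict_left_mono add_strict_mono) auto
  also have "\<dots> = \<epsilon>" by (simp add: e'_def)
  finally show "\<exists>\<phi>\<in>T. sob_dist \<phi> (gradient \<phi>) u G < \<epsilon>" using \<phi>(1) by blast
qed

lemma gradient_compose:
  assumes "smooth_on UNIV \<phi>" "smooth_on UNIV \<psi>" "!!x. (\<phi> x, \<psi> x) \<in> C"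
    and f: "!!z. z \<in> C ==> (f has_derivative (%d. f' z \<bullet> d)) (at z within C)"
  shows "gradient (%x. f (\<phi> x, \<psi> x)) x = fst (f' (\<phi> x, \<psi> x)) *\<^sub>R gradient \<phi> x + snd (f' (\<phi> x, \<psi> x)) *\<^sub>R gradient \<psi> x"
proof (rule gradient_has_derivative)
  have "((%x. (\<phi> x, \<psi> x)) has_derivative (%v. (gradient \<phi> x \<bullet> v, gradient \<psi> x \<bullet> v))) (at x)"
    by (intro has_derivative_Pair smooth_on_gradient assms)
  moreover have "(f has_derivative (%d. f' (\<phi> x, \<psi> x) \<bullet> d)) (at (\<phi> x, \<psi> x) within range (%x. (\<phi> x, \<psi> x)))"
    by (rule has_derivative_subset[OF f]) (use assms(3) in auto)
  ultimately have "((%x. f (\<phi> x, \<psi> x)) has_derivative (%v. f' (\<phi> x, \<psi> x) \<bullet> (gradient \<phi> x \<bullet> v, gradient \<psi> x \<bullet> v))) (at x)"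
    by (rule has_derivative_in_compose)
  moreover have "f' (\<phi> x, \<psi> x) \<bullet> (gradient \<phi> x \<bullet> v, gradient \<psi> x \<bullet> v) =
      (fst (f' (\<phi> x, \<psi> x)) *\<^sub>R gradient \<phi> x + snd (f' (\<phi> x, \<psi> x)) *\<^sub>R gradient \<psi> x) \<bullet> v" for v
    by (cases "f' (\<phi> x, \<psi> x)") (simp add: inner_add_left)
  ultimately show "((%x. f (\<phi> x, \<psi> x)) has_derivative (%v. (fst (f' (\<phi> x, \<psi> x)) *\<^sub>R gradient \<phi> x + snd (f' (\<phi> x, \<psi> x)) *\<^sub>R gradient \<psi> x) \<bullet> v)) (at x)"
    by simp
qed

text \<open>The gradient error splits into f' at the approximants times the gradient errors, small
  because f' is bounded, and the error of f' times the fixed gradients, small by dominated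
  convergence along a subsequence because f' is continuous. The hypotheses on T and T' keep the
  arguments in C and the compositions in the target class.\<close>

lemma approximable_chain:
  fixes f :: "real \<times> real => real"
  assumes u: "in_Lp M p u" "in_Lp M p G" and v: "in_Lp M p v" "in_Lp M p H"
    and T: "T \<subseteq> test_functions \<Omega>" and ap: "approximable T u G" "approximable T v H"
    and C: "convex C" "AE x in M. (u x, v x) \<in> C"
    and f: "!!z. z \<in> C ==> (f has_derivative (%d. f' z \<bullet> d)) (at z within C)"
    and L: "!!z. z \<in> C ==> norm (f' z) <= L" and f'c: "continuous_on C f'"
    and meas: "f \<in> borel_measurable borel" "f' \<in> borel_measurable borel"
    and TC: "!!\<phi> \<psi> x. \<phi> \<in> T ==> \<psi> \<in> T ==> (\<phi> x, \<psi> x) \<in> C"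
    and T': "!!\<phi> \<psi>. \<phi> \<in> T ==> \<psi> \<in> T ==> (%x. f (\<phi> x, \<psi> x)) \<in> T'"
  shows "approximable T' (%x. f (u x, v x)) (%x. fst (f' (u x, v x)) *\<^sub>R G x + snd (f' (u x, v x)) *\<^sub>R H x)"
proof -
  obtain \<phi>0 where \<phi>0: "!!n. \<phi>0 n \<in> T" "Lp_lim M p \<phi>0 u" "Lp_lim M p (%n. gradient (\<phi>0 n)) G"
    using ap(1) by (auto simp: approximable_def)
  obtain \<psi>0 where \<psi>0: "!!n. \<psi>0 n \<in> T" "Lp_lim M p \<psi>0 v" "Lp_lim M p (%n. gradient (\<psi>0 n)) H"
    using ap(2) by (auto simp: approximable_def)
  have lT: "in_Lp M p \<phi>" "in_Lp M p (gradient \<phi>)" "smooth_on UNIV \<phi>" if "\<phi> \<in> T" for \<phi>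
    using that T test_function_in_Lp[of \<phi>] test_functionsD(1)[of \<phi> \<Omega>] by auto
  obtain r where r: "strict_mono r" "AE x in M. (%n. \<phi>0 (r n) x) \<longlonglongrightarrow> u x"
    by (rule Lp_lim_AE_subseq[OF lT(1)[OF \<phi>0(1)] u(1) p_pos(1) \<phi>0(2)])
  obtain r' where r': "strict_mono r'" "AE x in M. (%n. \<psi>0 (r (r' n)) x) \<longlonglongrightarrow> v x"
    by (rule Lp_lim_AE_subseq[OF lT(1)[OF \<psi>0(1)] v(1) p_pos(1) Lp_lim_subseq[OF \<psi>0(2) r(1)]])
  define \<phi> where "\<phi> n = \<phi>0 (r (r' n))" for n
  define \<psi> where "\<psi> n = \<psi>0 (r (r' n))" for n
  have \<phi>: "\<phi> n \<in> T" and \<psi>: "\<psi> n \<in> T" for n using \<phi>0(1) \<psi>0(1) by (auto simp: \<phi>_def \<psi>_def)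
  have lim: "Lp_lim M p \<phi> u" "Lp_lim M p (%n. gradient (\<phi> n)) G" "Lp_lim M p \<psi> v" "Lp_lim M p (%n. gradient (\<psi> n)) H"
    using Lp_lim_subseq[OF Lp_lim_subseq[OF \<phi>0(2) r(1)] r'(1)] Lp_lim_subseq[OF Lp_lim_subseq[OF \<phi>0(3) r(1)] r'(1)]
      Lp_lim_subseq[OF Lp_lim_subseq[OF \<psi>0(2) r(1)] r'(1)] Lp_lim_subseq[OF Lp_lim_subseq[OF \<psi>0(3) r(1)] r'(1)]
    by (simp_all add: \<phi>_def[abs_def] \<psi>_def[abs_def])
  have ae: "AE x in M. (%n. (\<phi> n x, \<psi> n x)) \<longlonglongrightarrow> (u x, v x)"
    using r(2) r'(2)
  proof eventually_elim
    case (elim x)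
    show ?case
      using LIMSEQ_subseq_LIMSEQ[OF elim(1) r'(1)] elim(2) by (intro tendsto_Pair) (simp_all add: \<phi>_def \<psi>_def o_def)
  qed
  have um: "u \<in> borel_measurable M" and vm: "v \<in> borel_measurable M"
    and \<phi>m: "!!n. \<phi> n \<in> borel_measurable M" and \<psi>m: "!!n. \<psi> n \<in> borel_measurable M"
    using u v lT(1)[OF \<phi>] lT(1)[OF \<psi>] by (auto intro: in_Lp_measurable)
  have comp: "(%x. fst (f' (a x, b x))) \<in> borel_measurable M" "(%x. snd (f' (a x, b x))) \<in> borel_measurable M"
      "(%x. f (a x, b x)) \<in> borel_measurable M"
    if "a \<in> borel_measurable M" "b \<in> borel_measurable M" for a b
  proof -
    have zm: "(%x. (a x, b x)) \<in> M \<rightarrow>\<^sub>M borel" using that by (rule borel_measurable_Pair)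
    have "(%x. f' (a x, b x)) \<in> M \<rightarrow>\<^sub>M borel" by (rule measurable_compose[OF zm meas(2)])
    then show "(%x. fst (f' (a x, b x))) \<in> borel_measurable M" "(%x. snd (f' (a x, b x))) \<in> borel_measurable M"
      by (auto simp: borel_prod[symmetric] intro: measurable_fst'' measurable_snd'')
    show "(%x. f (a x, b x)) \<in> borel_measurable M" by (rule measurable_compose[OF zm meas(1)])
  qed
  have bC: "\<bar>fst (f' z)\<bar> <= L" "\<bar>snd (f' z)\<bar> <= L" if "z \<in> C" for z
    using L[OF that] norm_fst_le[of "fst (f' z)" "snd (f' z)"] norm_snd_le[of "snd (f' z)" "fst (f' z)"] by simp_all
  have bn: "\<bar>fst (f' (\<phi> n x, \<psi> n x))\<bar> <= L" "\<bar>snd (f' (\<phi> n x, \<psi> n x))\<bar> <= L" for n x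
    using bC[OF TC[OF \<phi> \<psi>]] by auto
  have bu: "AE x in M. \<bar>fst (f' (u x, v x))\<bar> <= L" "AE x in M. \<bar>snd (f' (u x, v x))\<bar> <= L"
    using C(2) bC by (auto elim: eventually_mono)
  have L0: "L >= 0" using bn(1)[of 0 undefined] by linarith
  have lip: "\<bar>f z - f z'\<bar> <= L * norm (z - z')" if "z \<in> C" "z' \<in> C" for z z'
  proof -
    have "norm (f z - f z') <= L * norm (z - z')"
    proof (rule differentiable_bound[OF C(1) f])
      show "onorm (%d. f' x \<bullet> d) <= L" if "x \<in> C" for x
      proof (rule onorm_le)
        fix d
        show "norm (f' x \<bullet> d) <= L * norm d"
          using Cauchy_Schwarz_ineq2[of "f' x" d] mult_right_mono[OF L[OF that], of "norm d"] by simp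
      qed
    qed (use that in auto)
    then show ?thesis by simp
  qed
  let ?w = "%n x. f (\<phi> n x, \<psi> n x)"
  have wlim: "Lp_lim M p ?w (%x. f (u x, v x))"
    unfolding Lp_lim_def
  proof (rule Lim_null_comparison[OF always_eventually])
    let ?S = "%n. \<integral>x. norm (\<phi> n x - u x) powr p \<partial>M" and ?T = "%n. \<integral>x. norm (\<psi> n x - v x) powr p \<partial>M"
    show "(%n. L powr p * 2 powr p * (?S n + ?T n)) \<longlonglongrightarrow> 0"
      using lim(1,3) by (intro tendsto_mult_right_zero tendsto_add_zero) (auto simp: Lp_lim_def)
    show "\<forall>n. norm (\<integral>x. norm (?w n x - f (u x, v x)) powr p \<partial>M) <= L powr p * 2 powr p * (?S n + ?T n)"
    proof
      fix n
      have i: "integrable M (%x. norm (\<phi> n x - u x) powr p)" "integrable M (%x. norm (\<psi> n x - v x) powr p)"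
        by (intro in_Lp_integrable in_Lp_diff lT \<phi> \<psi> u v p_pos)+
      have i2: "integrable M (%x. L powr p * 2 powr p * (norm (\<phi> n x - u x) powr p + norm (\<psi> n x - v x) powr p))"
        using i by auto
      have pw: "AE x in M. norm (?w n x - f (u x, v x)) powr p <= L powr p * 2 powr p * (norm (\<phi> n x - u x) powr p + norm (\<psi> n x - v x) powr p)"
        using C(2)
      proof eventually_elim
        case (elim x)
        have "norm (?w n x - f (u x, v x)) <= L * norm (\<bar>\<phi> n x - u x\<bar> + \<bar>\<psi> n x - v x\<bar>)"
        proof -
          have "norm ((\<phi> n x, \<psi> n x) - (u x, v x)) <= \<bar>\<phi> n x - u x\<bar> + \<bar>\<psi> n x - v x\<bar>"
            using norm_Pair_le[of "\<phi> n x - u x" "\<psi> n x - v x"] by simp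
          then have "L * norm ((\<phi> n x, \<psi> n x) - (u x, v x)) <= L * (\<bar>\<phi> n x - u x\<bar> + \<bar>\<psi> n x - v x\<bar>)"
            using L0 by (rule mult_left_mono)
          then show ?thesis using lip[OF TC[OF \<phi> \<psi>] elim, of n x n] by simp
        qed
        then have "norm (?w n x - f (u x, v x)) powr p <= (L * norm (\<bar>\<phi> n x - u x\<bar> + \<bar>\<psi> n x - v x\<bar>)) powr p"
          using p_pos by (intro powr_mono2) auto
        also have "\<dots> = L powr p * norm (\<bar>\<phi> n x - u x\<bar> + \<bar>\<psi> n x - v x\<bar>) powr p" by (rule powr_mult)
        also have "\<dots> <= L powr p * (2 powr p * (norm \<bar>\<phi> n x - u x\<bar> powr p + norm \<bar>\<psi> n x - v x\<bar> powr p))"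
          by (intro mult_left_mono powr_norm_add_le p_pos) simp
        finally show ?case by (simp add: mult.assoc)
      qed
      have "(\<integral>x. norm (?w n x - f (u x, v x)) powr p \<partial>M) \<le>
          (\<integral>x. L powr p * 2 powr p * (norm (\<phi> n x - u x) powr p + norm (\<psi> n x - v x) powr p) \<partial>M)"
      proof (rule integral_mono_AE[OF _ i2 pw])
        have "in_Lp M p (%x. ?w n x - f (u x, v x))"
          by (rule in_Lp_bounded_by[OF borel_measurable_diff[OF comp(3)[OF \<phi>m \<psi>m] comp(3)[OF um vm]] i2 pw])
        then show "integrable M (%x. norm (?w n x - f (u x, v x)) powr p)" by (rule in_Lp_integrable)
      qed
      then show "norm (\<integral>x. norm (?w n x - f (u x, v x)) powr p \<partial>M) <= L powr p * 2 powr p * (?S n + ?T n)"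
        using i by simp
    qed
  qed
  let ?a = "%n x. fst (f' (\<phi> n x, \<psi> n x))" and ?b = "%n x. snd (f' (\<phi> n x, \<psi> n x))"
  let ?ca = "%x. fst (f' (u x, v x))" and ?cb = "%x. snd (f' (u x, v x))"
  have am: "?a n \<in> borel_measurable M" "?b n \<in> borel_measurable M" for n using comp[OF \<phi>m \<psi>m] by auto
  have a0m: "?ca \<in> borel_measurable M" "?cb \<in> borel_measurable M" using comp[OF um vm] by auto
  have abl: "AE x in M. (%n. ?a n x) \<longlonglongrightarrow> ?ca x \<and> (%n. ?b n x) \<longlonglongrightarrow> ?cb x"
    using ae C(2)
  proof eventually_elim
    case (elim x)
    have "(%n. f' (\<phi> n x, \<psi> n x)) \<longlonglongrightarrow> f' (u x, v x)"
      by (rule continuous_on_tendsto_compose[OF f'c elim]) (simp add: TC[OF \<phi> \<psi>])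
    then show ?case by (auto intro: tendsto_fst tendsto_snd)
  qed
  have c1: "Lp_lim M p (%n x. ?a n x *\<^sub>R (gradient (\<phi> n) x - G x)) (%x. 0)"
    by (rule Lp_lim_mult_bounded[OF lT(2)[OF \<phi>] u(2) p_pos(2) lim(2) am(1), where B = L]) (intro AE_I2 bn)
  have c2: "Lp_lim M p (%n x. ?b n x *\<^sub>R (gradient (\<psi> n) x - H x)) (%x. 0)"
    by (rule Lp_lim_mult_bounded[OF lT(2)[OF \<psi>] v(2) p_pos(2) lim(4) am(2), where B = L]) (intro AE_I2 bn)
  have dom: "Lp_lim M p (%n x. (c n x - c0 x) *\<^sub>R F x) (%x. 0)"
    if F: "in_Lp M p F" and c: "!!n. c n \<in> borel_measurable M" "c0 \<in> borel_measurable M"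
      and l: "AE x in M. (%n. c n x) \<longlonglongrightarrow> c0 x" and b: "!!n x. \<bar>c n x\<bar> <= L" "AE x in M. \<bar>c0 x\<bar> <= L"
    for F :: "'a => 'a" and c and c0 :: "'a => real"
  proof (rule Lp_lim_dominated[where w = "%x. (2 * L) powr p * norm (F x) powr p"])
    show "(%x. (c n x - c0 x) *\<^sub>R F x) \<in> borel_measurable M" for n
      by (intro borel_measurable_scaleR borel_measurable_diff c in_Lp_measurable[OF F])
    show "integrable M (%x. (2 * L) powr p * norm (F x) powr p)" using in_Lp_integrable[OF F] by simp
    show "AE x in M. (%n. (c n x - c0 x) *\<^sub>R F x) \<longlonglongrightarrow> 0"
      using l
    proof eventually_elim
      case (elim x)
      have "(%n. (c n x - c0 x) *\<^sub>R F x) \<longlonglongrightarrow> (c0 x - c0 x) *\<^sub>R F x" by (intro tendsto_intros elim)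
      then show ?case by simp
    qed
    show "AE x in M. norm ((c n x - c0 x) *\<^sub>R F x - 0) powr p <= (2 * L) powr p * norm (F x) powr p" for n
      using b(2)
    proof eventually_elim
      case (elim x)
      have "norm ((c n x - c0 x) *\<^sub>R F x - 0) powr p = \<bar>c n x - c0 x\<bar> powr p * norm (F x) powr p" by (simp add: powr_mult)
      also have "\<dots> <= (2 * L) powr p * norm (F x) powr p"
        using elim b(1)[of n x] p_pos by (intro mult_right_mono powr_mono2) auto
      finally show ?case .
    qed
  qed (use p_pos in auto)
  have c3: "Lp_lim M p (%n x. (?a n x - ?ca x) *\<^sub>R G x) (%x. 0)"
    by (rule dom[OF u(2) am(1) a0m(1) _ bn(1) bu(1)]) (use abl in \<open>auto elim: eventually_mono\<close>)
  have c4: "Lp_lim M p (%n x. (?b n x - ?cb x) *\<^sub>R H x) (%x. 0)"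
    by (rule dom[OF v(2) am(2) a0m(2) _ bn(2) bu(2)]) (use abl in \<open>auto elim: eventually_mono\<close>)
  have i1: "in_Lp M p (%x. ?a n x *\<^sub>R (gradient (\<phi> n) x - G x))" "in_Lp M p (%x. ?b n x *\<^sub>R (gradient (\<psi> n) x - H x))" for n
    by (intro in_Lp_mult_bounded[where B = L] in_Lp_diff lT(2) \<phi> \<psi> u v am p_pos AE_I2 bn)+
  have i2: "in_Lp M p (%x. (?a n x - ?ca x) *\<^sub>R G x)" "in_Lp M p (%x. (?b n x - ?cb x) *\<^sub>R H x)" for n
  proof -
    have "AE x in M. \<bar>?a n x - ?ca x\<bar> <= 2 * L" "AE x in M. \<bar>?b n x - ?cb x\<bar> <= 2 * L"
    proof -
      show "AE x in M. \<bar>?a n x - ?ca x\<bar> <= 2 * L" using bu(1) by (rule eventually_mono) (use bn(1)[of n] in \<open>smt (verit)\<close>)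
      show "AE x in M. \<bar>?b n x - ?cb x\<bar> <= 2 * L" using bu(2) by (rule eventually_mono) (use bn(2)[of n] in \<open>smt (verit)\<close>)
    qed
    then show "in_Lp M p (%x. (?a n x - ?ca x) *\<^sub>R G x)" "in_Lp M p (%x. (?b n x - ?cb x) *\<^sub>R H x)"
      using u(2) v(2) am a0m p_pos by (auto intro!: in_Lp_mult_bounded)
  qed
  note z = in_Lp_zero[of M p, where ?'b = 'a]
  have "Lp_lim M p (%n x. (?a n x *\<^sub>R (gradient (\<phi> n) x - G x) + (?a n x - ?ca x) *\<^sub>R G x) +
       (?b n x *\<^sub>R (gradient (\<psi> n) x - H x) + (?b n x - ?cb x) *\<^sub>R H x)) (%x. (0 + 0) + (0 + 0))"
    by (intro Lp_lim_add in_Lp_add z i1 i2 c1 c2 c3 c4 p_pos)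
  then have "Lp_lim M p (%n. gradient (?w n)) (%x. ?ca x *\<^sub>R G x + ?cb x *\<^sub>R H x)"
  proof (rule Lp_lim_cong_AE[rotated], intro AE_I2 arg_cong[where f = norm])
    fix n x
    have gc: "gradient (?w n) x = ?a n x *\<^sub>R gradient (\<phi> n) x + ?b n x *\<^sub>R gradient (\<psi> n) x"
      by (rule gradient_compose[OF lT(3)[OF \<phi>] lT(3)[OF \<psi>] TC[OF \<phi> \<psi>] f])
    show "(?a n x *\<^sub>R (gradient (\<phi> n) x - G x) + (?a n x - ?ca x) *\<^sub>R G x) +
       (?b n x *\<^sub>R (gradient (\<psi> n) x - H x) + (?b n x - ?cb x) *\<^sub>R H x) - ((0 + 0) + (0 + 0)) =
       gradient (?w n) x - (?ca x *\<^sub>R G x + ?cb x *\<^sub>R H x)"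
      unfolding gc by (simp add: algebra_simps)
  qed
  then show ?thesis
    unfolding approximable_def using T'[OF \<phi> \<psi>] wlim by (intro exI[of _ ?w]) simp
qed

end

lemma test_functions_compose:
  assumes "\<phi> \<in> test_functions \<Omega>" "\<psi> \<in> test_functions \<Omega>" "smooth_on UNIV (%x. f (\<phi> x) (\<psi> x))" "f 0 0 = 0"
  shows "(%x. f (\<phi> x) (\<psi> x)) \<in> test_functions \<Omega>"
proof (rule test_functions_supportI[OF assms(3)])
  show "{x. f (\<phi> x) (\<psi> x) ~= 0} \<subseteq> closure {x. \<phi> x ~= 0} \<union> closure {x. \<psi> x ~= 0}"
  proof
    fix x assume x: "x \<in> {x. f (\<phi> x) (\<psi> x) ~= 0}"
    have "\<phi> x ~= 0 \<or> \<psi> x ~= 0" using x assms(4) by auto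
    then show "x \<in> closure {x. \<phi> x ~= 0} \<union> closure {x. \<psi> x ~= 0}"
      using closure_subset[of "{x. \<phi> x ~= 0}"] closure_subset[of "{x. \<psi> x ~= 0}"] by blast
  qed
qed (use test_functionsD[OF assms(1)] test_functionsD[OF assms(2)] in auto)

lemma test_functions_linear:
  assumes "\<phi> \<in> test_functions \<Omega>" "\<psi> \<in> test_functions \<Omega>"
  shows "(%x. a * \<phi> x + b * \<psi> x) \<in> test_functions \<Omega>"
  by (rule test_functions_compose[OF assms, where f = "%s t. a * s + b * t"])
    (intro smooth_on_add smooth_on_mult smooth_on_const test_functionsD(1)[OF assms(1)] test_functionsD(1)[OF assms(2)], simp)

context bounded_open_set
begin

section \<open>The energy space for either boundary condition\<close>

text \<open>One predicate serves both boundary conditions, and only the Dirichlet case adds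
  approximability; the arguments about solutions can then treat the two together.\<close>

definition sobX :: "boundary_condition => ('a => real) => ('a => 'a) => bool" where
  "sobX bc u G \<longleftrightarrow> sob u G \<and> (bc = Dirichlet --> approximable (test_functions \<Omega>) u G)"

lemma sobX_sob: "sobX bc u G ==> sob u G" by (simp add: sobX_def)

lemma sobXD: assumes "sobX bc u G" shows "in_Lp M p u" "in_Lp M p G"
  using assms by (auto simp: sobX_def sob_def)

lemma sob_dist_eq_W1p_norm:
  assumes u: "sob u G" and \<phi>: "\<phi> \<in> test_functions \<Omega>"
  shows "W1p_norm \<Omega> p (%x. u x - \<phi> x) = sob_dist \<phi> (gradient \<phi>) u G powr (1 / p)"
proof -
  have "sob (%x. u x - \<phi> x) (%x. G x - gradient \<phi> x)"
    using sob_linear[OF u sob_test_function[OF \<phi>], of 1 "-1"] by simp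
  then have "AE x in M. weak_gradient \<Omega> (%x. u x - \<phi> x) x = G x - gradient \<phi> x" by (rule sob_imp_W1p)
  then have "(\<integral>x. norm (weak_gradient \<Omega> (%x. u x - \<phi> x) x) powr p \<partial>M) = (\<integral>x. norm (gradient \<phi> x - G x) powr p \<partial>M)"
    by (intro integral_cong_AE_M) (auto elim!: eventually_mono simp: norm_minus_commute)
  then show ?thesis
    by (simp add: W1p_norm_def sob_dist_def abs_minus_commute)
qed

lemma powr_inverse_less_iff: "x >= 0 ==> y >= 0 ==> x powr (1 / p) < y powr (1 / p) \<longleftrightarrow> x < y"
  using p_pos powr_less_mono2[of "1/p" x y] powr_mono2[of "1/p" y x] by (auto simp: not_less[symmetric] simp del: not_less)

lemma energy_space_imp_sobX:
  assumes "u \<in> energy_space bc \<Omega> p" shows "sobX bc u (weak_gradient \<Omega> u)"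
proof (cases bc)
  case Neumann
  then show ?thesis using assms sob_weak_gradient by (simp add: sobX_def)
next
  case Dirichlet
  then have u: "u \<in> W1p \<Omega> p" and a: "!!\<epsilon>. \<epsilon> > 0 ==> \<exists>\<phi>\<in>test_functions \<Omega>. W1p_norm \<Omega> p (%x. u x - \<phi> x) < \<epsilon>"
    using assms by (auto simp: W1p_0_def)
  note s = sob_weak_gradient[OF u]
  have "approximable (test_functions \<Omega>) u (weak_gradient \<Omega> u)"
    unfolding approximable_iff
  proof (intro allI impI)
    fix \<epsilon> :: real assume e: "\<epsilon> > 0"
    then obtain \<phi> where \<phi>: "\<phi> \<in> test_functions \<Omega>" "W1p_norm \<Omega> p (%x. u x - \<phi> x) < \<epsilon> powr (1 / p)"
      using a[of "\<epsilon> powr (1 / p)"] by auto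
    then have "sob_dist \<phi> (gradient \<phi>) u (weak_gradient \<Omega> u) < \<epsilon>"
      unfolding sob_dist_eq_W1p_norm[OF s \<phi>(1)] using powr_inverse_less_iff[OF sob_dist_nonneg less_imp_le[OF e]] by blast
    with \<phi>(1) show "\<exists>\<phi>\<in>test_functions \<Omega>. sob_dist \<phi> (gradient \<phi>) u (weak_gradient \<Omega> u) < \<epsilon>" by blast
  qed
  with s show ?thesis by (simp add: sobX_def)
qed

lemma sobX_imp_energy_space:
  assumes "sobX bc u G" shows "u \<in> energy_space bc \<Omega> p" "AE x in M. weak_gradient \<Omega> u x = G x"
proof -
  have s: "sob u G" using assms by (simp add: sobX_def)
  show "AE x in M. weak_gradient \<Omega> u x = G x" by (rule sob_imp_W1p(2)[OF s])
  show "u \<in> energy_space bc \<Omega> p"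
  proof (cases bc)
    case Neumann
    then show ?thesis using sob_imp_W1p(1)[OF s] by simp
  next
    case Dirichlet
    have "\<exists>\<phi>\<in>test_functions \<Omega>. W1p_norm \<Omega> p (%x. u x - \<phi> x) < \<epsilon>" if e: "\<epsilon> > 0" for \<epsilon>
    proof -
      have "approximable (test_functions \<Omega>) u G" using assms Dirichlet by (simp add: sobX_def)
      then obtain \<phi> where \<phi>: "\<phi> \<in> test_functions \<Omega>" "sob_dist \<phi> (gradient \<phi>) u G < \<epsilon> powr p"
      proof -
        have "\<epsilon> powr p > 0" using e by simp
        then show ?thesis
          using that \<open>approximable (test_functions \<Omega>) u G\<close> unfolding approximable_iff by blast
      qed
      then have "sob_dist \<phi> (gradient \<phi>) u G powr (1 / p) < (\<epsilon> powr p) powr (1 / p)"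
        using powr_inverse_less_iff[OF sob_dist_nonneg, of "\<epsilon> powr p"] by simp
      then have "W1p_norm \<Omega> p (%x. u x - \<phi> x) < \<epsilon>"
        unfolding sob_dist_eq_W1p_norm[OF s \<phi>(1)] using e p_pos by (simp add: powr_powr)
      with \<phi>(1) show ?thesis by blast
    qed
    then show ?thesis using sob_imp_W1p(1)[OF s] Dirichlet by (simp add: W1p_0_def)
  qed
qed

lemma sobX_test_function:
  assumes "\<phi> \<in> test_functions \<Omega>" shows "sobX bc \<phi> (gradient \<phi>)"
  unfolding sobX_def approximable_def using sob_test_function[OF assms] assms
  by (auto intro!: exI[of _ "%n. \<phi>"] Lp_lim_const)

lemma approximable_AE:
  assumes "approximable T u G" "AE x in M. u x = v x" "AE x in M. G x = H x" shows "approximable T v H"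
proof -
  obtain \<phi> where \<phi>: "!!n. \<phi> n \<in> T" "Lp_lim M p \<phi> u" "Lp_lim M p (%n. gradient (\<phi> n)) G"
    using assms(1) by (auto simp: approximable_def)
  have "Lp_lim M p \<phi> v"
    by (rule Lp_lim_cong_AE[OF _ \<phi>(2)]) (use assms(2) in \<open>auto elim: eventually_mono\<close>)
  moreover have "Lp_lim M p (%n. gradient (\<phi> n)) H"
    by (rule Lp_lim_cong_AE[OF _ \<phi>(3)]) (use assms(3) in \<open>auto elim: eventually_mono\<close>)
  ultimately show ?thesis using \<phi>(1) unfolding approximable_def by blast
qed

lemma sobX_linear:
  assumes u: "sobX bc u G" and v: "sobX bc v H"
  shows "sobX bc (%x. a * u x + b * v x) (%x. a *\<^sub>R G x + b *\<^sub>R H x)"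
proof -
  have "approximable (test_functions \<Omega>) (%x. (%z. a * fst z + b * snd z) (u x, v x))
      (%x. fst ((%z. (a, b)) (u x, v x)) *\<^sub>R G x + snd ((%z. (a, b)) (u x, v x)) *\<^sub>R H x)" if "bc = Dirichlet"
    by (rule approximable_chain[OF sobXD[OF u] sobXD[OF v] subset_refl _ _ convex_UNIV, where L = "norm (a, b)"])
      (use u v that in \<open>auto intro!: derivative_eq_intros test_functions_linear simp: sobX_def inner_prod_def borel_prod[symmetric]\<close>)
  then show ?thesis
    using sob_linear[OF sobX_sob[OF u] sobX_sob[OF v], of a b] by (simp add: sobX_def)
qed

lemma sobX_limit:
  assumes s: "!!n. sobX bc (s n) (S n)" and u: "in_Lp M p u" "in_Lp M p G"
    and lim: "Lp_lim M p s u" "Lp_lim M p S G"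
  shows "sobX bc u G"
  unfolding sobX_def
proof (intro conjI impI)
  show "sob u G" by (rule sob_limit[OF sobX_sob[OF s] u lim])
  show "approximable (test_functions \<Omega>) u G" if "bc = Dirichlet"
    by (rule approximable_limit[OF subset_refl _ sobXD(1)[OF s] sobXD(2)[OF s] u lim])
      (use s that in \<open>auto simp: sobX_def\<close>)
qed

section \<open>Smooth approximation of the absolute value\<close>

text \<open>The function sqrt(s^2 + \<epsilon>^2) - \<epsilon> is smooth, 1-Lipschitz and vanishes
  at 0, so it maps test functions to nonnegative test functions. It is written on pairs, ignoring
  the second entry, to fit the chain rule in two variables.\<close>

lemma smooth_abs_derivative:
  assumes "\<epsilon> > 0"
  shows "((%z. sqrt ((fst z)\<^sup>2 + \<epsilon>\<^sup>2) - \<epsilon>) has_derivative (%d. (fst z / sqrt ((fst z)\<^sup>2 + \<epsilon>\<^sup>2), 0) \<bullet> d)) (at (z :: real \<times> real) within UNIV)"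
proof -
  have "(fst z)\<^sup>2 + \<epsilon>\<^sup>2 > 0" using assms by (simp add: add_nonneg_pos)
  then show ?thesis
    by (auto intro!: derivative_eq_intros simp: inner_prod_def fun_eq_iff divide_simps; use assms in simp)
qed

lemma smooth_abs_bounds:
  fixes s :: real
  assumes "\<epsilon> > 0"
  shows "sqrt (s\<^sup>2 + \<epsilon>\<^sup>2) > 0" "\<bar>s\<bar> <= sqrt (s\<^sup>2 + \<epsilon>\<^sup>2)" "sqrt (s\<^sup>2 + \<epsilon>\<^sup>2) <= \<bar>s\<bar> + \<epsilon>" "\<epsilon> <= sqrt (s\<^sup>2 + \<epsilon>\<^sup>2)"
    "\<bar>s / sqrt (s\<^sup>2 + \<epsilon>\<^sup>2)\<bar> <= 1"
proof -
  have pos: "s\<^sup>2 + \<epsilon>\<^sup>2 > 0" using assms by (simp add: add_nonneg_pos)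
  then show 1: "sqrt (s\<^sup>2 + \<epsilon>\<^sup>2) > 0" by simp
  show 2: "\<bar>s\<bar> <= sqrt (s\<^sup>2 + \<epsilon>\<^sup>2)" by (rule real_le_rsqrt) simp
  show "sqrt (s\<^sup>2 + \<epsilon>\<^sup>2) <= \<bar>s\<bar> + \<epsilon>"
    using assms by (intro real_le_lsqrt) (auto simp: power2_sum)
  show "\<epsilon> <= sqrt (s\<^sup>2 + \<epsilon>\<^sup>2)" by (rule real_le_rsqrt) simp
  show "\<bar>s / sqrt (s\<^sup>2 + \<epsilon>\<^sup>2)\<bar> <= 1" using 1 2 by simp
qed

lemma smooth_abs_conditions:
  fixes \<epsilon> :: real
  assumes "\<epsilon> > 0"
  defines "f \<equiv> %z :: real \<times> real. sqrt ((fst z)\<^sup>2 + \<epsilon>\<^sup>2) - \<epsilon>" and "f' \<equiv> %z :: real \<times> real. (fst z / sqrt ((fst z)\<^sup>2 + \<epsilon>\<^sup>2), 0 :: real)"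
  shows "norm (f' z) <= 1" "continuous_on UNIV f'" "f \<in> borel_measurable borel" "f' \<in> borel_measurable borel"
proof -
  show "norm (f' z) <= 1" using smooth_abs_bounds(5)[OF assms(1), of "fst z"] by (simp add: f'_def norm_Pair)
  have nz: "sqrt ((fst z)\<^sup>2 + \<epsilon>\<^sup>2) ~= 0" for z :: "real \<times> real"
    using smooth_abs_bounds(1)[OF assms(1), of "fst z"] by (metis less_irrefl)
  show c: "continuous_on UNIV f'" unfolding f'_def by (intro continuous_intros nz ballI)
  then show "f' \<in> borel_measurable borel" by (rule borel_measurable_continuous_onI)
  have "continuous_on UNIV f" unfolding f_def by (intro continuous_intros)
  then show "f \<in> borel_measurable borel" by (rule borel_measurable_continuous_onI)
qed

lemma smooth_abs_smooth:
  assumes "\<epsilon> > 0" "smooth_on UNIV \<phi>" shows "smooth_on UNIV (%x. sqrt ((\<phi> x)\<^sup>2 + \<epsilon>\<^sup>2) - \<epsilon>)"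
proof -
  have "smooth_on UNIV (%x. ((\<phi> x)\<^sup>2 + \<epsilon>\<^sup>2) powr (1/2) - \<epsilon>)"
    using assms(1) by (intro smooth_on_diff smooth_on_powr smooth_on_add smooth_on_power smooth_on_const assms(2)) (simp add: add_nonneg_pos)
  then show ?thesis by (simp add: powr_half_sqrt)
qed

definition nonneg_tests :: "('a => real) set" where
  "nonneg_tests = {\<phi> \<in> test_functions \<Omega>. \<forall>x. \<phi> x >= 0}"

lemma sob_smooth_abs:
  assumes "sob u G" "\<epsilon> > 0"
  shows "sob (%x. sqrt ((u x)\<^sup>2 + \<epsilon>\<^sup>2) - \<epsilon>) (%x. (u x / sqrt ((u x)\<^sup>2 + \<epsilon>\<^sup>2)) *\<^sub>R G x)"
proof -
  note c = smooth_abs_conditions[OF assms(2)]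
  have "AE x in M. (u x, u x) \<in> UNIV" by simp
  from sob_chain[where f = "%z. sqrt ((fst z)\<^sup>2 + \<epsilon>\<^sup>2) - \<epsilon>" and f' = "%z. (fst z / sqrt ((fst z)\<^sup>2 + \<epsilon>\<^sup>2), 0)" and C = UNIV and L = 1, OF assms(1,1) convex_UNIV this smooth_abs_derivative[OF assms(2)] c(1,3,4)]
  show ?thesis by simp
qed

lemma approximable_smooth_abs:
  assumes "sob u G" "approximable (test_functions \<Omega>) u G" "\<epsilon> > 0"
  shows "approximable nonneg_tests (%x. sqrt ((u x)\<^sup>2 + \<epsilon>\<^sup>2) - \<epsilon>) (%x. (u x / sqrt ((u x)\<^sup>2 + \<epsilon>\<^sup>2)) *\<^sub>R G x)"
proof -
  note c = smooth_abs_conditions[OF assms(3)]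
  have ae: "AE x in M. (u x, u x) \<in> UNIV" by simp
  have nn: "(%x. sqrt ((fst (\<phi> x, \<psi> x))\<^sup>2 + \<epsilon>\<^sup>2) - \<epsilon>) \<in> nonneg_tests"
    if \<phi>: "\<phi> \<in> test_functions \<Omega>" "\<psi> \<in> test_functions \<Omega>" for \<phi> \<psi>
  proof -
    have "(%x. (%s t. sqrt (s\<^sup>2 + \<epsilon>\<^sup>2) - \<epsilon>) (\<phi> x) (\<psi> x)) \<in> test_functions \<Omega>"
      by (rule test_functions_compose[OF \<phi>]) (use smooth_abs_smooth[OF assms(3)] test_functionsD(1)[OF \<phi>(1)] assms(3) in auto)
    then show ?thesis
      using smooth_abs_bounds(4)[OF assms(3)] by (simp add: nonneg_tests_def)
  qed
  have "approximable nonneg_tests (%x. f (u x, u x)) (%x. fst (f' (u x, u x)) *\<^sub>R G x + snd (f' (u x, u x)) *\<^sub>R G x)"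
    if "f = (%z. sqrt ((fst z)\<^sup>2 + \<epsilon>\<^sup>2) - \<epsilon>)" "f' = (%z. (fst z / sqrt ((fst z)\<^sup>2 + \<epsilon>\<^sup>2), 0))"
    for f :: "real \<times> real => real" and f' :: "real \<times> real => real \<times> real"
  proof (rule approximable_chain[where T = "test_functions \<Omega>" and C = UNIV and L = 1])
    show "(f has_derivative (%d. f' z \<bullet> d)) (at z within UNIV)" for z
      unfolding that by (rule smooth_abs_derivative[OF assms(3)])
    show "(%x. f (\<phi> x, \<psi> x)) \<in> nonneg_tests" if "\<phi> \<in> test_functions \<Omega>" "\<psi> \<in> test_functions \<Omega>" for \<phi> \<psi>
      using nn[OF that] by (simp only: \<open>f = _\<close>)
    show "norm (f' z) <= 1" for z unfolding that by (rule c)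
    show "continuous_on UNIV f'" "f \<in> borel_measurable borel" "f' \<in> borel_measurable borel"
      unfolding that by (rule c)+
  qed (use assms(2) sobD(1,2)[OF assms(1)] ae in auto)
  from this[OF refl refl] show ?thesis by simp
qed

text \<open>The factor u / sqrt(u^2 + \<epsilon>^2) tends to 1 where u > 0 and stays 0 where u = 0,
  so the gradients converge to G cut off to {u ~= 0}.\<close>

lemma smooth_abs_tendsto:
  assumes u: "in_Lp M p u" "in_Lp M p (G :: 'a => 'a)" and nn: "AE x in M. u x >= 0"
  defines "e \<equiv> %n. inverse (real (Suc n))"
  shows "Lp_lim M p (%n x. sqrt ((u x)\<^sup>2 + (e n)\<^sup>2) - e n) u"
    "Lp_lim M p (%n x. (u x / sqrt ((u x)\<^sup>2 + (e n)\<^sup>2)) *\<^sub>R G x) (%x. (if u x = 0 then 0 else 1) *\<^sub>R G x)"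
    "in_Lp M p (%x. (if u x = 0 then 0 else 1) *\<^sub>R G x)"
proof -
  have e: "e n > 0" "e n <= 1" for n by (simp_all add: e_def inverse_le_1_iff del: of_nat_Suc)
  have e0: "e \<longlonglongrightarrow> 0" unfolding e_def by (rule LIMSEQ_inverse_real_of_nat)
  have [measurable]: "u \<in> borel_measurable M" "G \<in> borel_measurable M" using u by (auto intro: in_Lp_measurable)
  have lim: "(%n. sqrt (s\<^sup>2 + (e n)\<^sup>2)) \<longlonglongrightarrow> \<bar>s\<bar>" for s :: real
  proof -
    have "(%n. sqrt (s\<^sup>2 + (e n)\<^sup>2)) \<longlonglongrightarrow> sqrt (s\<^sup>2 + 0\<^sup>2)" by (intro tendsto_intros e0)
    then show ?thesis by simp
  qed
  show "Lp_lim M p (%n x. sqrt ((u x)\<^sup>2 + (e n)\<^sup>2) - e n) u"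
  proof (rule Lp_lim_dominated[where w = "%x. 1"])
    show "integrable M (%x. 1)" by (rule finite_measure.integrable_const[OF finite_M])
    show "AE x in M. (%n. sqrt ((u x)\<^sup>2 + (e n)\<^sup>2) - e n) \<longlonglongrightarrow> u x"
      using nn
    proof eventually_elim
      case (elim x)
      have "(%n. sqrt ((u x)\<^sup>2 + (e n)\<^sup>2) - e n) \<longlonglongrightarrow> \<bar>u x\<bar> - 0" by (intro tendsto_diff lim e0)
      then show ?case using elim by simp
    qed
    show "AE x in M. norm (sqrt ((u x)\<^sup>2 + (e n)\<^sup>2) - e n - u x) powr p <= 1" for n
      using nn
    proof eventually_elim
      case (elim x)
      have "norm (sqrt ((u x)\<^sup>2 + (e n)\<^sup>2) - e n - u x) <= 1"
        using smooth_abs_bounds(2,3)[OF e(1)[of n], of "u x"] elim e[of n] unfolding real_norm_def by linarith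
      then have "norm (sqrt ((u x)\<^sup>2 + (e n)\<^sup>2) - e n - u x) powr p <= 1 powr p"
        using p_pos by (intro powr_mono2) auto
      then show ?case by simp
    qed
  qed (use p_pos in measurable)
  show "Lp_lim M p (%n x. (u x / sqrt ((u x)\<^sup>2 + (e n)\<^sup>2)) *\<^sub>R G x) (%x. (if u x = 0 then 0 else 1) *\<^sub>R G x)"
  proof (rule Lp_lim_dominated[where w = "%x. 2 powr p * norm (G x) powr p"])
    show "integrable M (%x. 2 powr p * norm (G x) powr p)" using in_Lp_integrable[OF u(2)] by simp
    show "AE x in M. (%n. (u x / sqrt ((u x)\<^sup>2 + (e n)\<^sup>2)) *\<^sub>R G x) \<longlonglongrightarrow> (if u x = 0 then 0 else 1) *\<^sub>R G x"
      using nn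
    proof eventually_elim
      case (elim x)
      show ?case
      proof (cases "u x = 0")
        case False
        then have "(%n. (u x / sqrt ((u x)\<^sup>2 + (e n)\<^sup>2)) *\<^sub>R G x) \<longlonglongrightarrow> (u x / \<bar>u x\<bar>) *\<^sub>R G x"
          by (intro tendsto_scaleR tendsto_divide tendsto_const lim) auto
        then show ?thesis using False elim by simp
      qed simp
    qed
    show "AE x in M. norm ((u x / sqrt ((u x)\<^sup>2 + (e n)\<^sup>2)) *\<^sub>R G x - (if u x = 0 then 0 else 1) *\<^sub>R G x) powr p <= 2 powr p * norm (G x) powr p" for n
    proof (intro AE_I2)
      fix x
      have "\<bar>u x / sqrt ((u x)\<^sup>2 + (e n)\<^sup>2) - (if u x = 0 then 0 else 1)\<bar> <= 2"
        using smooth_abs_bounds(5)[OF e(1)[of n], of "u x"] by (auto simp del: abs_divide)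
      then have "norm ((u x / sqrt ((u x)\<^sup>2 + (e n)\<^sup>2) - (if u x = 0 then 0 else 1)) *\<^sub>R G x) powr p <= (2 * norm (G x)) powr p"
        using p_pos unfolding norm_scaleR by (intro powr_mono2 mult_right_mono) auto
      then show "norm ((u x / sqrt ((u x)\<^sup>2 + (e n)\<^sup>2)) *\<^sub>R G x - (if u x = 0 then 0 else 1) *\<^sub>R G x) powr p <= 2 powr p * norm (G x) powr p"
        by (simp only: scaleR_left_diff_distrib powr_mult)
    qed
  qed (use p_pos in measurable)
  show "in_Lp M p (%x. (if u x = 0 then 0 else 1) *\<^sub>R G x)"
    by (rule in_Lp_mult_bounded[OF u(2), where B = 1]) (use p_pos in \<open>auto simp: measurable_If\<close>)
qed

text \<open>The smoothed absolute values converge to u itself while their gradients converge to G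
  cut off to {u ~= 0}; uniqueness of the weak gradient does the rest.\<close>

lemma gradient_zero_on_zero_set:
  assumes u: "sob u G" and nn: "AE x in M. u x >= 0"
  shows "AE x in M. u x = 0 --> G x = 0"
proof -
  note t = smooth_abs_tendsto[OF sobD(1,2)[OF u] nn]
  have "sob u (%x. (if u x = 0 then 0 else 1) *\<^sub>R G x)"
    by (rule sob_limit[OF sob_smooth_abs[OF u] sobD(1)[OF u] t(3,1,2)]) (simp del: of_nat_Suc)
  from sob_unique[OF u this] show ?thesis by eventually_elim auto
qed

text \<open>Smoothing the absolute value makes the approximants nonnegative; the limit carries the
  cut-off gradient, which is G because G vanishes on the zero set.\<close>

lemma approximable_nonneg:
  assumes u: "sob u G" and a: "approximable (test_functions \<Omega>) u G" and nn: "AE x in M. u x >= 0"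
  shows "approximable nonneg_tests u G"
proof -
  note t = smooth_abs_tendsto[OF sobD(1,2)[OF u] nn]
  have e: "inverse (real (Suc n)) > 0" for n by (simp del: of_nat_Suc)
  have "approximable nonneg_tests u (%x. (if u x = 0 then 0 else 1) *\<^sub>R G x)"
    by (rule approximable_limit[OF _ approximable_smooth_abs[OF u a e] sobD(1)[OF sob_smooth_abs[OF u e]]
          sobD(2)[OF sob_smooth_abs[OF u e]] sobD(1)[OF u] t(3,1,2)]) (auto simp: nonneg_tests_def)
  then show ?thesis
    by (rule approximable_AE) (use gradient_zero_on_zero_set[OF u nn] in \<open>auto elim: eventually_mono\<close>)
qed

lemma sobX_smooth_abs:
  assumes "sobX bc u G" "\<epsilon> > 0"
  shows "sobX bc (%x. sqrt ((u x)\<^sup>2 + \<epsilon>\<^sup>2) - \<epsilon>) (%x. (u x / sqrt ((u x)\<^sup>2 + \<epsilon>\<^sup>2)) *\<^sub>R G x)"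
  unfolding sobX_def
proof (intro conjI impI)
  show "sob (%x. sqrt ((u x)\<^sup>2 + \<epsilon>\<^sup>2) - \<epsilon>) (%x. (u x / sqrt ((u x)\<^sup>2 + \<epsilon>\<^sup>2)) *\<^sub>R G x)"
    by (rule sob_smooth_abs[OF sobX_sob[OF assms(1)] assms(2)])
  assume "bc = Dirichlet"
  then have "approximable nonneg_tests (%x. sqrt ((u x)\<^sup>2 + \<epsilon>\<^sup>2) - \<epsilon>) (%x. (u x / sqrt ((u x)\<^sup>2 + \<epsilon>\<^sup>2)) *\<^sub>R G x)"
    using assms by (intro approximable_smooth_abs) (auto simp: sobX_def)
  then show "approximable (test_functions \<Omega>) (%x. sqrt ((u x)\<^sup>2 + \<epsilon>\<^sup>2) - \<epsilon>) (%x. (u x / sqrt ((u x)\<^sup>2 + \<epsilon>\<^sup>2)) *\<^sub>R G x)"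
    unfolding approximable_def nonneg_tests_def by blast
qed

text \<open>Nonnegative approximants keep the arguments in the quadrant C, and f(0, 0) = 0 keeps the
  supports compact. The assumption \<open>sm\<close> allows f to be smooth on nonnegative arguments
  only, as real powers are after a positive shift.\<close>

lemma sobX_chain_nonneg:
  fixes f :: "real \<times> real => real"
  defines "C \<equiv> {z. fst z >= 0 \<and> snd z >= 0}"
  assumes u: "sobX bc u G" and v: "sobX bc v H" and nn: "AE x in M. u x >= 0" "AE x in M. v x >= 0"
    and f: "!!z. z \<in> C ==> (f has_derivative (%d. f' z \<bullet> d)) (at z within C)"
    and L: "!!z. z \<in> C ==> norm (f' z) <= L" and f'c: "continuous_on C f'"
    and meas: "f \<in> borel_measurable borel" "f' \<in> borel_measurable borel"
    and sm: "!!\<phi> \<psi>. smooth_on UNIV \<phi> ==> smooth_on UNIV \<psi> ==> (!!x. \<phi> x >= 0) ==> (!!x. \<psi> x >= 0) ==>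
      smooth_on UNIV (%x::'a. f (\<phi> x, \<psi> x))"
    and f0: "f (0, 0) = 0"
  shows "sobX bc (%x. f (u x, v x)) (%x. fst (f' (u x, v x)) *\<^sub>R G x + snd (f' (u x, v x)) *\<^sub>R H x)"
proof -
  have C: "convex C" unfolding C_def by (intro convexI) auto
  have ae: "AE x in M. (u x, v x) \<in> C" using nn by eventually_elim (simp add: C_def)
  have "approximable (test_functions \<Omega>) (%x. f (u x, v x)) (%x. fst (f' (u x, v x)) *\<^sub>R G x + snd (f' (u x, v x)) *\<^sub>R H x)"
    if bc: "bc = Dirichlet"
  proof (rule approximable_chain[OF sobXD[OF u] sobXD[OF v] _ _ _ C ae f L f'c meas])
    show "nonneg_tests \<subseteq> test_functions \<Omega>" by (auto simp: nonneg_tests_def)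
    show "approximable nonneg_tests u G" "approximable nonneg_tests v H"
      using u v nn bc by (auto simp: sobX_def intro: approximable_nonneg)
    fix \<phi> \<psi> assume *: "\<phi> \<in> nonneg_tests" "\<psi> \<in> nonneg_tests"
    then show "(\<phi> x, \<psi> x) \<in> C" for x by (auto simp: nonneg_tests_def C_def)
    have t: "\<phi> \<in> test_functions \<Omega>" "\<psi> \<in> test_functions \<Omega>" using * by (auto simp: nonneg_tests_def)
    show "(%x. f (\<phi> x, \<psi> x)) \<in> test_functions \<Omega>"
    proof (rule test_functions_compose[OF t, where f = "%s t. f (s, t)"])
      show "smooth_on UNIV (%x. f (\<phi> x, \<psi> x))"
        by (rule sm[OF test_functionsD(1)[OF t(1)] test_functionsD(1)[OF t(2)]])
          (use * in \<open>auto simp: nonneg_tests_def\<close>)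
    qed (rule f0)
  qed
  then show ?thesis
    unfolding sobX_def using sob_chain[OF sobX_sob[OF u] sobX_sob[OF v] C ae f L meas] by blast
qed

end

section \<open>Young's and Picone's inequalities\<close>

text \<open>Concavity of ln: with w the weighted mean, the bounds ln t <= t - 1 at t = a/w and t =
  b/w add up to 0. Equality forces equality in both, hence a = w = b.\<close>

lemma weighted_am_gm:
  fixes a b \<theta> :: real
  assumes "0 < \<theta>" "\<theta> < 1" "a >= 0" "b >= 0"
  shows "a powr (1 - \<theta>) * b powr \<theta> <= (1 - \<theta>) * a + \<theta> * b"
    and "a powr (1 - \<theta>) * b powr \<theta> = (1 - \<theta>) * a + \<theta> * b ==> a = b"
proof -
  have "a powr (1 - \<theta>) * b powr \<theta> <= (1 - \<theta>) * a + \<theta> * b \<and>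
      (a powr (1 - \<theta>) * b powr \<theta> = (1 - \<theta>) * a + \<theta> * b --> a = b)"
  proof (cases "a = 0 \<or> b = 0")
    case True
    then show ?thesis using assms by auto
  next
    case False
    then have ab: "a > 0" "b > 0" using assms by auto
    define w where "w = (1 - \<theta>) * a + \<theta> * b"
    have w: "w > 0" using ab assms by (simp add: w_def add_pos_pos)
    have e: "(1 - \<theta>) * (a / w - 1) + \<theta> * (b / w - 1) = 0"
    proof -
      have "(1 - \<theta>) * (a / w - 1) + \<theta> * (b / w - 1) = ((1 - \<theta>) * a + \<theta> * b) / w - 1"
        by (simp add: algebra_simps add_divide_distrib diff_divide_distrib)
      then show ?thesis using w by (simp add: w_def[symmetric])
    qed
    have l: "ln (a powr (1 - \<theta>) * b powr \<theta>) - ln w = (1 - \<theta>) * ln (a / w) + \<theta> * ln (b / w)"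
      using ab w by (simp add: ln_mult ln_powr ln_div algebra_simps)
    have la: "ln (a / w) <= a / w - 1" and lb: "ln (b / w) <= b / w - 1"
      using ab w by (simp_all add: ln_le_minus_one)
    have t: "(1 - \<theta>) * ln (a / w) <= (1 - \<theta>) * (a / w - 1)" "\<theta> * ln (b / w) <= \<theta> * (b / w - 1)"
      using la lb assms by (auto intro: mult_left_mono)
    have pos: "a powr (1 - \<theta>) * b powr \<theta> > 0" using ab by simp
    have "ln (a powr (1 - \<theta>) * b powr \<theta>) <= ln w" using l t e by linarith
    then have le: "a powr (1 - \<theta>) * b powr \<theta> <= w" using pos w by simp
    have "a = b" if eq: "a powr (1 - \<theta>) * b powr \<theta> = w"
    proof -
      have "(1 - \<theta>) * ln (a / w) = (1 - \<theta>) * (a / w - 1)" "\<theta> * ln (b / w) = \<theta> * (b / w - 1)"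
        using l t e unfolding eq by linarith+
      then have "ln (a / w) = a / w - 1" "ln (b / w) = b / w - 1" using assms by auto
      then have "a / w = 1" "b / w = 1"
        using ln_eq_minus_one[OF divide_pos_pos[OF ab(1) w]] ln_eq_minus_one[OF divide_pos_pos[OF ab(2) w]] by blast+
      then show ?thesis using w by simp
    qed
    then show ?thesis using le by (simp add: w_def)
  qed
  then show "a powr (1 - \<theta>) * b powr \<theta> <= (1 - \<theta>) * a + \<theta> * b"
    "a powr (1 - \<theta>) * b powr \<theta> = (1 - \<theta>) * a + \<theta> * b ==> a = b" by auto
qed

text \<open>The weighted mean of x^p and y^p with \<theta> = s/p. Its equality case is what later
  identifies two solutions.\<close>

lemma young_powr:
  fixes x y p s :: real
  assumes "0 < s" "s < p" "x >= 0" "y >= 0"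
  shows "x powr (p - s) * y powr s <= (p - s) / p * x powr p + s / p * y powr p"
    and "x powr (p - s) * y powr s = (p - s) / p * x powr p + s / p * y powr p ==> x = y"
proof -
  have \<theta>: "0 < s / p" "s / p < 1" using assms by auto
  have p: "p > 0" using assms by simp
  have e: "(x powr p) powr (1 - s / p) = x powr (p - s)" "(y powr p) powr (s / p) = y powr s" "1 - s / p = (p - s) / p"
    using p by (simp_all add: powr_powr right_diff_distrib diff_divide_distrib)
  note w = weighted_am_gm[OF \<theta> powr_ge_zero[of x p] powr_ge_zero[of y p], unfolded e(1,2), unfolded e(3)]
  show "x powr (p - s) * y powr s <= (p - s) / p * x powr p + s / p * y powr p" by (rule w(1))
  assume "x powr (p - s) * y powr s = (p - s) / p * x powr p + s / p * y powr p"
  then have "x powr p = y powr p" by (rule w(2))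
  then have "(x powr p) powr (1 / p) = (y powr p) powr (1 / p)" by simp
  then show "x = y" using p assms by (simp add: powr_powr)
qed

lemma norm_powr_inner_self: "norm (g :: 'a::real_inner) powr (p - 2) * (g \<bullet> g) = norm g powr p"
proof (cases "g = 0")
  case False
  then show ?thesis using powr_add[of "norm g" "p - 2" 2] by (simp add: power2_norm_eq_inner)
qed simp

lemma norm_powr_inner_le:
  "\<bar>norm (g :: 'a::real_inner) powr (p - 2) * (g \<bullet> k)\<bar> <= norm g powr (p - 1) * norm k"
proof (cases "g = 0")
  case False
  have "\<bar>norm g powr (p - 2) * (g \<bullet> k)\<bar> <= norm g powr (p - 2) * (norm g * norm k)"
    unfolding abs_mult using Cauchy_Schwarz_ineq2[of g k] by (intro mult_mono) auto
  also have "norm g powr (p - 2) * norm g = norm g powr (p - 1)"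
    using False powr_add[of "norm g" "p - 2" 1] by simp
  then have "norm g powr (p - 2) * (norm g * norm k) = norm g powr (p - 1) * norm k"
    by (simp only: mult.assoc[symmetric])
  finally show ?thesis .
qed simp

text \<open>Here g and k stand for the gradients of u and v, and r for v/u: the left side is
  |\<nabla>u|^(p-2) \<nabla>u paired with the gradient of v^q / u^(q-1). After Cauchy-Schwarz it is
  Young's inequality with exponent q for r |g| and |k|.\<close>

lemma picone_pointwise:
  fixes g k :: "'a::real_inner"
  assumes q: "1 < q" and r: "r >= 0"
  shows "norm g powr (p - 2) * (g \<bullet> ((q * r powr (q - 1)) *\<^sub>R k - ((q - 1) * r powr q) *\<^sub>R g))
    <= norm g powr (p - q) * norm k powr q"
proof (cases "g = 0")
  case False
  then have g: "norm g > 0" by simp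
  let ?x = "r * norm g"
  have y: "q * (?x powr (q - 1) * norm k) <= (q - 1) * ?x powr q + norm k powr q"
  proof -
    have "?x powr (q - 1) * norm k powr 1 <= (q - 1) / q * ?x powr q + 1 / q * norm k powr q"
      using young_powr(1)[of 1 q ?x "norm k"] q r by simp
    then have "q * (?x powr (q - 1) * norm k powr 1) <= q * ((q - 1) / q * ?x powr q + 1 / q * norm k powr q)"
      using q by (intro mult_left_mono) auto
    also have "\<dots> = (q - 1) * ?x powr q + norm k powr q" using q by (simp add: field_simps)
    finally show ?thesis by simp
  qed
  have e1: "norm g powr (p - q) * ?x powr (q - 1) = r powr (q - 1) * norm g powr (p - 1)"
    using g r by (simp add: powr_mult powr_add[symmetric] mult.left_commute)
  have e2: "norm g powr (p - q) * ?x powr q = r powr q * norm g powr p"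
    using g r by (simp add: powr_mult powr_add[symmetric] mult.left_commute)
  have "norm g powr (p - 2) * (g \<bullet> ((q * r powr (q - 1)) *\<^sub>R k - ((q - 1) * r powr q) *\<^sub>R g)) =
      q * r powr (q - 1) * (norm g powr (p - 2) * (g \<bullet> k)) - (q - 1) * r powr q * (norm g powr (p - 2) * (g \<bullet> g))"
    by (simp add: inner_diff_right algebra_simps)
  also have "\<dots> <= q * r powr (q - 1) * (norm g powr (p - 1) * norm k) - (q - 1) * r powr q * norm g powr p"
    unfolding norm_powr_inner_self using norm_powr_inner_le[of g p k] q
    by (intro diff_right_mono mult_left_mono) auto
  also have "\<dots> = norm g powr (p - q) * (q * (?x powr (q - 1) * norm k) - (q - 1) * ?x powr q)"
  proof -
    have "norm g powr (p - q) * (q * (?x powr (q - 1) * norm k) - (q - 1) * ?x powr q) =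
        q * norm k * (norm g powr (p - q) * ?x powr (q - 1)) - (q - 1) * (norm g powr (p - q) * ?x powr q)"
      by (simp add: algebra_simps)
    then show ?thesis unfolding e1 e2 by (simp add: algebra_simps)
  qed
  also have "\<dots> <= norm g powr (p - q) * norm k powr q"
    using y by (intro mult_left_mono) auto
  finally show ?thesis .
qed simp

context bounded_open_set
begin

text \<open>One construction for two test functions: \<beta> = q - 1 with a truncated q-th power of
  v for Picone's inequality, and \<beta> = p - 1 with a cutoff for the logarithmic estimate. The
  shift \<epsilon> and the bound B keep the derivative bounded; g 0 = 0 preserves the Dirichlet
  condition.\<close>

lemma sobX_quotient:
  fixes g g' :: "real => real"
  assumes u: "sobX bc u G" and v: "sobX bc v H" and nn: "AE x in M. u x >= 0" "AE x in M. v x >= 0"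
    and \<epsilon>: "\<epsilon> > 0" and \<beta>: "\<beta> > 0"
    and g: "!!t. t >= 0 ==> (g has_real_derivative g' t) (at t)" "g 0 = 0"
    and B: "!!t. t >= 0 ==> \<bar>g t\<bar> <= B" "!!t. t >= 0 ==> \<bar>g' t\<bar> <= B"
    and g'c: "continuous_on {0..} g'" and meas[measurable]: "g \<in> borel_measurable borel" "g' \<in> borel_measurable borel"
    and sm: "!!\<psi>. smooth_on UNIV \<psi> ==> (!!x. \<psi> x >= 0) ==> smooth_on UNIV (%x::'a. g (\<psi> x))"
  shows "sobX bc (%x. g (v x) * (u x + \<epsilon>) powr (- \<beta>))
    (%x. (- \<beta> * g (v x) * (u x + \<epsilon>) powr (- \<beta> - 1)) *\<^sub>R G x + (g' (v x) * (u x + \<epsilon>) powr (- \<beta>)) *\<^sub>R H x)"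
proof -
  let ?C = "{z :: real \<times> real. fst z >= 0 \<and> snd z >= 0}"
  define f where "f z = g (snd z) * (fst z + \<epsilon>) powr (- \<beta>)" for z :: "real \<times> real"
  define f' where "f' z = (- \<beta> * g (snd z) * (fst z + \<epsilon>) powr (- \<beta> - 1), g' (snd z) * (fst z + \<epsilon>) powr (- \<beta>))" for z :: "real \<times> real"
  have "sobX bc (%x. f (u x, v x)) (%x. fst (f' (u x, v x)) *\<^sub>R G x + snd (f' (u x, v x)) *\<^sub>R H x)"
  proof (rule sobX_chain_nonneg[OF u v nn])
    fix z :: "real \<times> real" assume z: "z \<in> ?C"
    have zp: "fst z + \<epsilon> > 0" using z \<epsilon> by auto
    have d1: "((%z. g (snd z)) has_derivative (%d. g' (snd z) * snd d)) (at z within ?C)"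
    proof -
      have "(g has_derivative (*) (g' (snd z))) (at (snd z))" using g(1)[of "snd z"] z by (simp add: has_field_derivative_def)
      from has_derivative_compose[OF has_derivative_snd[OF has_derivative_ident] this] show ?thesis by simp
    qed
    have d2: "((%z. (fst z + \<epsilon>) powr (- \<beta>)) has_derivative (%d. - \<beta> * (fst z + \<epsilon>) powr (- \<beta> - 1) * fst d)) (at z within ?C)"
    proof -
      have "((%s. s powr (- \<beta>)) has_real_derivative - \<beta> * (fst z + \<epsilon>) powr (- \<beta> - 1)) (at (fst z + \<epsilon>))"
        using zp by (auto intro!: derivative_eq_intros)
      then have "((%s. s powr (- \<beta>)) has_derivative (*) (- \<beta> * (fst z + \<epsilon>) powr (- \<beta> - 1))) (at (fst z + \<epsilon>))"
        by (simp add: has_field_derivative_def)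
      from has_derivative_compose[OF has_derivative_add_const[OF has_derivative_fst[OF has_derivative_ident]] this]
      show ?thesis by simp
    qed
    have "(f has_derivative (%d. g (snd z) * (- \<beta> * (fst z + \<epsilon>) powr (- \<beta> - 1) * fst d) + g' (snd z) * snd d * (fst z + \<epsilon>) powr (- \<beta>))) (at z within ?C)"
      unfolding f_def[abs_def] by (rule has_derivative_mult[OF d1 d2])
    then show "(f has_derivative (%d. f' z \<bullet> d)) (at z within ?C)"
      by (simp add: f'_def inner_prod_def algebra_simps)
    have e1: "(fst z + \<epsilon>) powr (- \<beta> - 1) <= \<epsilon> powr (- \<beta> - 1)" "(fst z + \<epsilon>) powr (- \<beta>) <= \<epsilon> powr (- \<beta>)"
      using z \<epsilon> \<beta> by (auto intro!: powr_mono2')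
    have z2: "snd z >= 0" using z by simp
    have B0: "B >= 0" using B(1)[OF z2] by linarith
    have "norm (f' z) <= \<bar>fst (f' z)\<bar> + \<bar>snd (f' z)\<bar>"
      using norm_Pair_le[of "fst (f' z)" "snd (f' z)"] by simp
    also have "\<bar>fst (f' z)\<bar> <= \<beta> * (B * \<epsilon> powr (- \<beta> - 1))"
      using B(1)[OF z2] e1(1) \<beta> B0 by (simp add: f'_def abs_mult mult.assoc) (intro mult_mono, auto)
    also have "\<bar>snd (f' z)\<bar> <= B * \<epsilon> powr (- \<beta>)"
      using B(2)[OF z2] e1(2) B0 by (simp add: f'_def abs_mult) (intro mult_mono, auto)
    finally show "norm (f' z) <= \<beta> * (B * \<epsilon> powr (- \<beta> - 1)) + B * \<epsilon> powr (- \<beta>)" by simp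
  next
    have nz: "fst z + \<epsilon> ~= 0" if "z \<in> ?C" for z :: "real \<times> real" using that \<epsilon> by auto
    have gc: "continuous_on {0..} g"
      using g(1) by (meson DERIV_isCont atLeast_iff continuous_at_imp_continuous_on)
    have c: "continuous_on ?C (%z. g (snd z))" "continuous_on ?C (%z. g' (snd z))"
      by (auto intro!: continuous_on_compose2[OF gc] continuous_on_compose2[OF g'c] continuous_on_snd continuous_on_id)
    show "continuous_on ?C f'"
      unfolding f'_def[abs_def]
      by (intro continuous_on_Pair continuous_on_mult continuous_on_const c continuous_on_powr continuous_on_add
          continuous_on_fst continuous_on_id nz ballI)
    show "f \<in> borel_measurable borel" "f' \<in> borel_measurable borel"
      unfolding f_def[abs_def] f'_def[abs_def] borel_prod[symmetric] by measurable
    show "f (0, 0) = 0" using g(2) by (simp add: f_def)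
    fix \<phi> \<psi> :: "'a => real" assume s: "smooth_on UNIV \<phi>" "smooth_on UNIV \<psi>" "!!x. \<phi> x >= 0" "!!x. \<psi> x >= 0"
    have "\<phi> x + \<epsilon> > 0" for x using s(3)[of x] \<epsilon> by linarith
    then have "smooth_on UNIV (%x. g (\<psi> x) * (\<phi> x + \<epsilon>) powr (- \<beta>))"
      by (intro smooth_on_mult sm smooth_on_powr smooth_on_add smooth_on_const s)
    then show "smooth_on UNIV (%x. f (\<phi> x, \<psi> x))" by (simp add: f_def)
  qed
  then show ?thesis by (simp add: f_def f'_def)
qed

end

section \<open>Comparison of solutions\<close>

locale elliptic_problem = bounded_open_set \<Omega> p for \<Omega> :: "'a::euclidean_space set" and p :: real +
  fixes q l :: real and a :: "'a => real" and bc :: boundary_condition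
  assumes q_gt_1: "1 < q" and q_less_p: "q < p" and l_neg: "l < 0"
    and a_cont: "continuous_on (closure \<Omega>) a"
begin

definition solution :: "('a => real) => ('a => 'a) => bool" where
  "solution u G \<longleftrightarrow> sobX bc u G \<and> (AE x in M. u x >= 0) \<and>
     (\<forall>\<phi> \<Phi>. sobX bc \<phi> \<Phi> --> (\<integral>x. norm (G x) powr (p - 2) * (G x \<bullet> \<Phi> x) \<partial>M) =
        (\<integral>x. (l * u x powr (p - 1) + a x * u x powr (q - 1)) * \<phi> x \<partial>M))"

definition hh :: "('a => real) => ('a => 'a) => real" where
  "hh u G = (\<integral>x. norm (G x) powr p - l * \<bar>u x\<bar> powr p \<partial>M)"

definition aa :: "('a => real) => real" where
  "aa u = (\<integral>x. a x * \<bar>u x\<bar> powr q \<partial>M)"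

lemma a_bounded: obtains A where "A > 0" "AE x in M. \<bar>a x\<bar> <= A"
proof -
  have "compact (closure \<Omega>)" using bounded_\<Omega> by (simp add: compact_closure)
  then have "bounded (a ` closure \<Omega>)" using a_cont by (intro compact_imp_bounded compact_continuous_image)
  then obtain A where A: "A > 0" "!!x. x \<in> closure \<Omega> ==> \<bar>a x\<bar> <= A" by (auto simp: bounded_pos)
  have "AE x in M. \<bar>a x\<bar> <= A"
    using A(2) closure_subset by (intro AE_I2) (auto simp: subset_iff)
  with A(1) that show ?thesis by blast
qed

lemma a_measurable: "a \<in> borel_measurable M"
proof -
  have "continuous_on \<Omega> a" using a_cont closure_subset continuous_on_subset by blast
  then have "a \<in> borel_measurable (restrict_space borel \<Omega>)" by (rule borel_measurable_continuous_on_restrict)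
  then have "(%x. indicator \<Omega> x *\<^sub>R a x) \<in> borel_measurable borel"
    using borel_measurable_restrict_space_iff[of \<Omega> borel a] \<Omega>_borel by simp
  then have "(%x. indicator \<Omega> x *\<^sub>R a x) \<in> borel_measurable M" by (rule borel_measurable_lebesgue_onI)
  then show ?thesis by (rule lebesgue_on_measurable_AE) (auto intro: AE_I2)
qed

lemma integrable_a_mult:
  assumes "integrable M f" shows "integrable M (%x. a x * f x)"
proof -
  obtain A where A: "A > 0" "AE x in M. \<bar>a x\<bar> <= A" by (rule a_bounded)
  show ?thesis
  proof (rule B_integrable_bound)
    show "integrable M (%x. A * f x)" using assms by simp
    show "(%x. a x * f x) \<in> borel_measurable M"
      using a_measurable borel_measurable_integrable[OF assms] by (rule borel_measurable_times)
    show "AE x in M. norm (a x * f x) <= norm (A * f x)"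
      using A(2) by eventually_elim (use A(1) in \<open>simp add: abs_mult mult_right_mono\<close>)
  qed
qed

lemma exponents: "1 < p" "0 < q" "0 < p" "0 < p - q" "0 < q - 1" "p >= 0" "q >= 0" "q <= p"
  using q_gt_1 q_less_p by auto

lemma integrable_hh: assumes "in_Lp M p u" "in_Lp M p G" shows "integrable M (%x. norm (G x) powr p - l * \<bar>u x\<bar> powr p)"
  using in_Lp_integrable[OF assms(1)] in_Lp_integrable[OF assms(2)] by auto

lemma integrable_aa: "in_Lp M p u ==> integrable M (%x. a x * \<bar>u x\<bar> powr q)"
  using integrable_powr_smaller[OF finite_M, of p u q] exponents by (intro integrable_a_mult) simp

lemma hh_nonneg: "hh u G >= 0"
  unfolding hh_def
proof (rule B_integral_nonneg)
  fix x
  have "l * \<bar>u x\<bar> powr p <= 0" using l_neg by (simp add: mult_nonpos_nonneg)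
  then show "0 <= norm (G x) powr p - l * \<bar>u x\<bar> powr p" using powr_ge_zero[of "norm (G x)" p] by linarith
qed

lemma hh_eq_0:
  assumes "in_Lp M p u" "in_Lp M p G" "hh u G <= 0" shows "AE x in M. u x = 0"
proof -
  have nn: "0 <= norm (G x) powr p - l * \<bar>u x\<bar> powr p" for x
  proof -
    have "l * \<bar>u x\<bar> powr p <= 0" using l_neg by (simp add: mult_nonpos_nonneg)
    then show ?thesis using powr_ge_zero[of "norm (G x)" p] by linarith
  qed
  have "(\<integral>x. norm (G x) powr p - l * \<bar>u x\<bar> powr p \<partial>M) = 0"
    using assms(3) hh_nonneg[of u G] unfolding hh_def by linarith
  then have "AE x in M. norm (G x) powr p - l * \<bar>u x\<bar> powr p = 0"
    using integral_nonneg_eq_0_iff_AE[OF integrable_hh[OF assms(1,2)] AE_I2[OF nn]] by blast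
  then show ?thesis
  proof eventually_elim
    case (elim x)
    have "l * \<bar>u x\<bar> powr p <= 0" using l_neg by (simp add: mult_nonpos_nonneg)
    then have "l * \<bar>u x\<bar> powr p = 0" using elim powr_ge_zero[of "norm (G x)" p] by linarith
    then show ?case using l_neg by simp
  qed
qed

lemma solution_hh_eq_aa:
  assumes "solution u G" shows "hh u G = aa u"
proof -
  have X: "sobX bc u G" and nn: "AE x in M. u x >= 0"
    and e: "(\<integral>x. norm (G x) powr (p - 2) * (G x \<bullet> G x) \<partial>M) = (\<integral>x. (l * u x powr (p - 1) + a x * u x powr (q - 1)) * u x \<partial>M)"
    using assms by (auto simp: solution_def)
  note lu = sobXD[OF X]
  have "(\<integral>x. (l * u x powr (p - 1) + a x * u x powr (q - 1)) * u x \<partial>M) = (\<integral>x. l * \<bar>u x\<bar> powr p + a x * \<bar>u x\<bar> powr q \<partial>M)"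
  proof (rule integral_cong_AE_M)
    show "AE x in M. (l * u x powr (p - 1) + a x * u x powr (q - 1)) * u x = l * \<bar>u x\<bar> powr p + a x * \<bar>u x\<bar> powr q"
      using nn
    proof eventually_elim
      case (elim x)
      have "u x powr (s - 1) * u x = \<bar>u x\<bar> powr s" for s
        using elim powr_add[of "u x" "s - 1" 1] by simp
      then show ?case by (simp add: distrib_right mult.assoc)
    qed
  qed
  also have "\<dots> = (\<integral>x. l * \<bar>u x\<bar> powr p \<partial>M) + aa u"
    unfolding aa_def using in_Lp_integrable[OF lu(1)] integrable_aa[OF lu(1)] by (intro B_integral_add) auto
  finally have "(\<integral>x. norm (G x) powr p \<partial>M) = (\<integral>x. l * \<bar>u x\<bar> powr p \<partial>M) + aa u"
    using e by (simp add: norm_powr_inner_self)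
  then show ?thesis
    unfolding hh_def using in_Lp_integrable[OF lu(1)] in_Lp_integrable[OF lu(2)] by simp
qed

text \<open>Picone's inequality after regularization. V truncates v at height 1/e; its shift e^2
  keeps the base of the power positive, hence the power smooth, and subtracting (e^2)^q restores the
  value 0 at v = 0. The subtraction costs (e^2)^q (u + e)^(-q) <= e^q, which tends to 0 because e^2
  is of smaller order than e.\<close>

lemma picone_test_bound:
  fixes G K :: 'a and u v e :: real
  assumes u: "u >= 0" and v: "v >= 0" and e: "e > 0"
  defines "V \<equiv> v / (1 + e * v) + e\<^sup>2"
  shows "norm G powr (p - 2) * (G \<bullet> ((- (q - 1) * (V powr q - (e\<^sup>2) powr q) * (u + e) powr (- (q - 1) - 1)) *\<^sub>R G
      + (q * V powr (q - 1) / (1 + e * v)\<^sup>2 * (u + e) powr (- (q - 1))) *\<^sub>R K))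
    <= norm G powr (p - q) * norm K powr q + (q - 1) * e powr q * norm G powr p"
proof -
  have V: "V >= 0" using v e by (simp add: V_def)
  have W: "u + e > 0" using u e by simp
  define r where "r = V / (u + e)"
  \<comment> \<open>The gradient of V when K is that of v: the derivative 1/(1 + e v)^2 is at most
    1, so the truncation does not enlarge the right-hand side.\<close>
  define k where "k = (1 / (1 + e * v)\<^sup>2) *\<^sub>R K"
  have r: "r >= 0" using V W by (simp add: r_def)
  have r1: "r powr (q - 1) = V powr (q - 1) * (u + e) powr (- (q - 1))" and r2: "r powr q = V powr q * (u + e) powr (- q)"
    unfolding r_def powr_divide by (simp_all only: powr_minus_divide) (simp_all add: divide_inverse)
  have q1: "- (q - 1) - 1 = - q" by simp
  have "norm G powr (p - 2) * (G \<bullet> ((- (q - 1) * (V powr q - (e\<^sup>2) powr q) * (u + e) powr (- (q - 1) - 1)) *\<^sub>R G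
      + (q * V powr (q - 1) / (1 + e * v)\<^sup>2 * (u + e) powr (- (q - 1))) *\<^sub>R K)) =
    norm G powr (p - 2) * (G \<bullet> ((q * r powr (q - 1)) *\<^sub>R k - ((q - 1) * r powr q) *\<^sub>R G))
      + (q - 1) * ((e\<^sup>2) powr q * (u + e) powr (- q)) * (norm G powr (p - 2) * (G \<bullet> G))"
    unfolding r1 r2 q1 k_def by (simp add: inner_add_right inner_diff_right algebra_simps divide_inverse)
  also have "norm G powr (p - 2) * (G \<bullet> ((q * r powr (q - 1)) *\<^sub>R k - ((q - 1) * r powr q) *\<^sub>R G)) <= norm G powr (p - q) * norm k powr q"
    by (rule picone_pointwise[OF q_gt_1 r])
  also have "norm G powr (p - q) * norm k powr q <= norm G powr (p - q) * norm K powr q"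
  proof -
    have "1 <= (1 + e * v)\<^sup>2" using e v by (intro one_le_power) simp
    then have "1 / (1 + e * v)\<^sup>2 <= 1" by (simp add: divide_simps)
    then have "norm k <= norm K" unfolding k_def norm_scaleR by (intro mult_left_le_one_le) auto
    then show ?thesis using exponents by (intro mult_left_mono powr_mono2) auto
  qed
  also have "(q - 1) * ((e\<^sup>2) powr q * (u + e) powr (- q)) * (norm G powr (p - 2) * (G \<bullet> G)) <= (q - 1) * e powr q * norm G powr p"
  proof -
    have "(u + e) powr (- q) <= e powr (- q)" using u e exponents by (intro powr_mono2') auto
    then have "(e\<^sup>2) powr q * (u + e) powr (- q) <= (e\<^sup>2) powr q * e powr (- q)" by (intro mult_left_mono) auto
    also have "\<dots> = e powr q" using e by (simp add: power2_eq_square powr_mult powr_minus)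
    finally show ?thesis
      unfolding norm_powr_inner_self using exponents by (intro mult_right_mono mult_left_mono) auto
  qed
  finally show ?thesis by simp
qed

lemma picone_test_function:
  assumes u: "sobX bc u G" and v: "sobX bc v K" and nn: "AE x in M. u x >= 0" "AE x in M. v x >= 0" and e: "e > 0"
  shows "sobX bc (%x. ((v x / (1 + e * v x) + e\<^sup>2) powr q - (e\<^sup>2) powr q) * (u x + e) powr (- (q - 1)))
    (%x. (- (q - 1) * ((v x / (1 + e * v x) + e\<^sup>2) powr q - (e\<^sup>2) powr q) * (u x + e) powr (- (q - 1) - 1)) *\<^sub>R G x
      + (q * (v x / (1 + e * v x) + e\<^sup>2) powr (q - 1) / (1 + e * v x)\<^sup>2 * (u x + e) powr (- (q - 1))) *\<^sub>R K x)"
proof -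
  \<comment> \<open>The sum of a bound for the truncated power and one for its derivative, since a
    single B serves both.\<close>
  let ?B = "(1 / e + e\<^sup>2) powr q + q * (1 / e + e\<^sup>2) powr (q - 1)"
  have qn: "q >= 0" "q - 1 >= 0" using q_gt_1 by auto
  have T: "t / (1 + e * t) + e\<^sup>2 > 0" "t / (1 + e * t) + e\<^sup>2 <= 1 / e + e\<^sup>2" "1 + e * t > 0" "1 <= (1 + e * t)\<^sup>2" if "t >= 0" for t
  proof -
    show "1 + e * t > 0" using e that by (simp add: add_pos_nonneg)
    then show "t / (1 + e * t) + e\<^sup>2 > 0" using e that by (simp add: add_nonneg_pos)
    show "t / (1 + e * t) + e\<^sup>2 <= 1 / e + e\<^sup>2" using \<open>1 + e * t > 0\<close> e by (simp add: field_simps)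
    show "1 <= (1 + e * t)\<^sup>2" using e that by (intro one_le_power) simp
  qed
  show ?thesis
  proof (rule sobX_quotient[OF u v nn e, where B = ?B])
    show "q - 1 > 0" using q_gt_1 by simp
    fix t :: real assume t: "t >= 0"
    show "((%t. (t / (1 + e * t) + e\<^sup>2) powr q - (e\<^sup>2) powr q) has_real_derivative
        q * (t / (1 + e * t) + e\<^sup>2) powr (q - 1) / (1 + e * t)\<^sup>2) (at t)"
      using T[OF t] by (auto intro!: derivative_eq_intros simp: power2_eq_square field_simps)
    have m: "(t / (1 + e * t) + e\<^sup>2) powr q <= (1 / e + e\<^sup>2) powr q"
      "(t / (1 + e * t) + e\<^sup>2) powr (q - 1) <= (1 / e + e\<^sup>2) powr (q - 1)"
      using T[OF t] qn by (auto intro!: powr_mono2)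
    have n: "(e\<^sup>2) powr q <= (t / (1 + e * t) + e\<^sup>2) powr q"
      using t T(3)[OF t] qn by (intro powr_mono2) auto
    show "\<bar>(t / (1 + e * t) + e\<^sup>2) powr q - (e\<^sup>2) powr q\<bar> <= ?B"
      using m(1) n qn powr_ge_zero[of "e\<^sup>2" q] mult_nonneg_nonneg[OF qn(1) powr_ge_zero[of "1 / e + e\<^sup>2" "q - 1"]] by linarith
    have "\<bar>q * (t / (1 + e * t) + e\<^sup>2) powr (q - 1) / (1 + e * t)\<^sup>2\<bar> = q * (t / (1 + e * t) + e\<^sup>2) powr (q - 1) / (1 + e * t)\<^sup>2"
      using qn by simp
    also have "\<dots> <= q * (t / (1 + e * t) + e\<^sup>2) powr (q - 1) / 1"
      using T(4)[OF t] qn by (intro divide_left_mono) auto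
    also have "\<dots> <= ?B" using mult_left_mono[OF m(2) qn(1)] powr_ge_zero[of "1 / e + e\<^sup>2" q] by linarith
    finally show "\<bar>q * (t / (1 + e * t) + e\<^sup>2) powr (q - 1) / (1 + e * t)\<^sup>2\<bar> <= ?B" .
  next
    show "continuous_on {0..} (%t. q * (t / (1 + e * t) + e\<^sup>2) powr (q - 1) / (1 + e * t)\<^sup>2)"
    proof -
      have nz: "1 + e * t ~= 0" "t / (1 + e * t) + e\<^sup>2 ~= 0" "(1 + e * t)\<^sup>2 ~= 0" if "t \<in> {0..}" for t
      proof -
        have t: "t >= 0" using that by simp
        show "1 + e * t ~= 0" using T(3)[OF t] by linarith
        then show "(1 + e * t)\<^sup>2 ~= 0" by simp
        show "t / (1 + e * t) + e\<^sup>2 ~= 0" using T(1)[OF t] by linarith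
      qed
      show ?thesis
        by (intro continuous_on_divide continuous_on_mult continuous_on_powr continuous_on_add continuous_on_power
            continuous_on_const continuous_on_id ballI nz)
    qed
    fix \<psi> :: "'a => real" assume s: "smooth_on UNIV \<psi>" "!!x. \<psi> x >= 0"
    have eq: "\<psi> x / (1 + e * \<psi> x) = \<psi> x * (1 + e * \<psi> x) powr (- 1)" for x
      using T(3)[OF s(2)[of x]] by (simp add: powr_minus divide_inverse)
    have p1: "1 + e * \<psi> x > 0" and p2: "\<psi> x * (1 + e * \<psi> x) powr (- 1) + e\<^sup>2 > 0" for x
    proof -
      show "1 + e * \<psi> x > 0" by (rule T(3)[OF s(2)])
      show "\<psi> x * (1 + e * \<psi> x) powr (- 1) + e\<^sup>2 > 0" using T(1)[OF s(2)[of x]] by (simp only: eq)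
    qed
    show "smooth_on UNIV (%x. (\<psi> x / (1 + e * \<psi> x) + e\<^sup>2) powr q - (e\<^sup>2) powr q)"
      by (simp only: eq) (intro smooth_on_diff smooth_on_powr p1 p2 smooth_on_add smooth_on_mult smooth_on_const s)
  qed auto
qed

lemma powr_shift_le:
  fixes u e s t :: real
  assumes "u >= 0" "e > 0" "t >= 0"
  shows "u powr s * (u + e) powr (- t) <= u powr (s - t)"
proof (cases "u = 0")
  case False
  then have "(u + e) powr (- t) <= u powr (- t)" using assms by (intro powr_mono2') auto
  then have "u powr s * (u + e) powr (- t) <= u powr s * u powr (- t)" by (intro mult_left_mono) auto
  also have "\<dots> = u powr (s - t)" by (simp add: powr_add[symmetric])
  finally show ?thesis .
qed simp

lemma integrable_energy_pairing:
  assumes G: "in_Lp M p (G :: 'a => 'a)" and H: "in_Lp M p H"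
  shows "integrable M (%x. norm (G x) powr (p - 2) * (G x \<bullet> H x))"
proof (rule B_integrable_bound)
  note [measurable] = in_Lp_measurable[OF G] in_Lp_measurable[OF H]
  have "integrable M (%x. norm (G x) powr (p - 1) * norm (H x) powr 1)"
    by (rule integrable_powr_mult_powr[OF finite_M G H]) (use exponents in auto)
  then show "integrable M (%x. norm (G x) powr (p - 1) * norm (H x))" by simp
  show "(%x. norm (G x) powr (p - 2) * (G x \<bullet> H x)) \<in> borel_measurable M" by measurable
  show "AE x in M. norm (norm (G x) powr (p - 2) * (G x \<bullet> H x)) <= norm (norm (G x) powr (p - 1) * norm (H x))"
    using norm_powr_inner_le by (intro AE_I2) (simp add: abs_of_nonneg)
qed

text \<open>All error terms are kept: the Young defects of the gradients and of the functions are
  nonnegative, and equality of H makes the second one vanish almost everywhere. This alone gives u =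
  v, without any information on the gradients.\<close>

lemma comparison:
  assumes u: "solution u G" and v: "solution v K" and z: "AE x in M. u x = 0 --> a x <= 0"
  shows "hh v K <= hh u G" and "hh v K = hh u G ==> AE x in M. u x = v x"
proof -
  have Xu: "sobX bc u G" and Xv: "sobX bc v K" and nu: "AE x in M. u x >= 0" and nv: "AE x in M. v x >= 0"
    using u v by (auto simp: solution_def)
  note lu = sobXD[OF Xu] and lv = sobXD[OF Xv]
  note [measurable] = in_Lp_measurable[OF lu(1)] in_Lp_measurable[OF lu(2)] in_Lp_measurable[OF lv(1)] in_Lp_measurable[OF lv(2)] a_measurable
  define e where "e n = inverse (real (Suc n))" for n
  have e: "e n > 0" "e n <= 1" for n by (simp_all add: e_def inverse_le_1_iff del: of_nat_Suc)
  have e0: "e \<longlonglongrightarrow> 0" unfolding e_def by (rule LIMSEQ_inverse_real_of_nat)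
  define \<phi> where "\<phi> n x = ((v x / (1 + e n * v x) + (e n)\<^sup>2) powr q - ((e n)\<^sup>2) powr q) * (u x + e n) powr (- (q - 1))" for n x
  define F where "F n x = (l * u x powr (p - 1) + a x * u x powr (q - 1)) * \<phi> n x" for n x
  \<comment> \<open>The pointwise limit of \<open>F\<close>. Where u = 0 every \<open>F n\<close> is
    already 0, because \<open>0 powr s\<close> is 0.\<close>
  define F0 where "F0 x = (if u x = 0 then 0 else l * (u x powr (p - q) * v x powr q) + a x * v x powr q)" for x
  define R where "R = (\<integral>x. norm (G x) powr (p - q) * norm (K x) powr q \<partial>M)"
  define P where "P = (\<integral>x. norm (G x) powr p \<partial>M)"
  have iR: "integrable M (%x. norm (G x) powr (p - q) * norm (K x) powr q)"
    by (rule integrable_powr_mult_powr[OF finite_M lu(2) lv(2)]) (use exponents in auto)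
  have ineq: "(\<integral>x. F n x \<partial>M) <= R + (q - 1) * e n powr q * P" for n
  proof -
    note T = picone_test_function[OF Xu Xv nu nv e(1)[of n]]
    let ?\<Phi> = "%x. (- (q - 1) * ((v x / (1 + e n * v x) + (e n)\<^sup>2) powr q - ((e n)\<^sup>2) powr q) * (u x + e n) powr (- (q - 1) - 1)) *\<^sub>R G x
      + (q * (v x / (1 + e n * v x) + (e n)\<^sup>2) powr (q - 1) / (1 + e n * v x)\<^sup>2 * (u x + e n) powr (- (q - 1))) *\<^sub>R K x"
    have l\<Phi>: "in_Lp M p ?\<Phi>" by (rule sobXD(2)[OF T])
    have "(\<integral>x. F n x \<partial>M) = (\<integral>x. norm (G x) powr (p - 2) * (G x \<bullet> ?\<Phi> x) \<partial>M)"
      using u T unfolding solution_def F_def \<phi>_def by simp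
    also have "\<dots> <= (\<integral>x. norm (G x) powr (p - q) * norm (K x) powr q + (q - 1) * e n powr q * norm (G x) powr p \<partial>M)"
    proof (rule integral_mono_AE)
      show "AE x in M. norm (G x) powr (p - 2) * (G x \<bullet> ?\<Phi> x) <= norm (G x) powr (p - q) * norm (K x) powr q + (q - 1) * e n powr q * norm (G x) powr p"
        using nu nv by eventually_elim (rule picone_test_bound[OF _ _ e(1)])
      show "integrable M (%x. norm (G x) powr (p - 2) * (G x \<bullet> ?\<Phi> x))"
        by (rule integrable_energy_pairing[OF lu(2) l\<Phi>])
    qed (use iR in_Lp_integrable[OF lu(2)] in auto)
    also have "\<dots> = R + (q - 1) * e n powr q * P"
      unfolding R_def P_def using iR in_Lp_integrable[OF lu(2)] by simp
    finally show ?thesis .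
  qed
  have Flim: "(%n. \<integral>x. F n x \<partial>M) \<longlonglongrightarrow> (\<integral>x. F0 x \<partial>M)"
  proof (rule integral_dominated_convergence)
    have l1: "in_Lp M p (%x. v x + 1)" by (intro in_Lp_add in_Lp_const finite_M lv p_pos)
    have i1: "integrable M (%x. norm (u x) powr (p - q) * norm (v x + 1) powr q)"
      by (rule integrable_powr_mult_powr[OF finite_M lu(1) l1]) (use exponents in auto)
    have i2: "integrable M (%x. a x * norm (v x + 1) powr q)"
      using integrable_powr_smaller[OF finite_M l1, of q] exponents by (intro integrable_a_mult) auto
    show "integrable M (%x. \<bar>l\<bar> * (norm (u x) powr (p - q) * norm (v x + 1) powr q) + \<bar>a x * norm (v x + 1) powr q\<bar>)"
      by (intro B_integrable_add integrable_mult_right i1 integrable_abs i2)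
    show "F0 \<in> borel_measurable M" unfolding F0_def by measurable
    show "F n \<in> borel_measurable M" for n unfolding F_def \<phi>_def by measurable
    show "AE x in M. norm (F n x) <= \<bar>l\<bar> * (norm (u x) powr (p - q) * norm (v x + 1) powr q) + \<bar>a x * norm (v x + 1) powr q\<bar>" for n
      using nu nv
    proof eventually_elim
      case (elim x)
      let ?V = "v x / (1 + e n * v x) + (e n)\<^sup>2"
      have en: "1 <= 1 + e n * v x" using elim e(1)[of n] by simp
      have V: "0 <= v x / (1 + e n * v x)" "v x / (1 + e n * v x) <= v x"
        using en elim by (auto intro!: divide_left_mono[of 1 _ "v x", simplified])
      have "(e n)\<^sup>2 <= 1" using e[of n] by (simp add: power_le_one)
      then have "?V powr q <= (v x + 1) powr q" using V exponents by (intro powr_mono2) auto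
      moreover have "((e n)\<^sup>2) powr q <= ?V powr q" using V exponents by (intro powr_mono2) auto
      ultimately have D: "0 <= ?V powr q - ((e n)\<^sup>2) powr q" "?V powr q - ((e n)\<^sup>2) powr q <= (v x + 1) powr q"
        using powr_ge_zero[of "(e n)\<^sup>2" q] by linarith+
      let ?D = "?V powr q - ((e n)\<^sup>2) powr q" and ?W = "(u x + e n) powr (- (q - 1))"
      have w1: "u x powr (p - 1) * ?W <= u x powr (p - q)" "u x powr (q - 1) * ?W <= 1"
        using powr_shift_le[OF elim(1) e(1)[of n], of "q - 1" "p - 1"] powr_shift_le[OF elim(1) e(1)[of n], of "q - 1" "q - 1"]
          exponents by (auto intro: order_trans)
      have "norm (F n x) = \<bar>l * (u x powr (p - 1) * ?W * ?D) + a x * (u x powr (q - 1) * ?W * ?D)\<bar>"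
        unfolding F_def \<phi>_def by (simp add: algebra_simps)
      also have "\<dots> <= \<bar>l\<bar> * (u x powr (p - 1) * ?W * ?D) + \<bar>a x\<bar> * (u x powr (q - 1) * ?W * ?D)"
        using D(1) by (intro order_trans[OF abs_triangle_ineq]) (simp add: abs_mult)
      also have "\<dots> <= \<bar>l\<bar> * (u x powr (p - q) * (v x + 1) powr q) + \<bar>a x\<bar> * (1 * (v x + 1) powr q)"
        using D w1 by (intro add_mono mult_left_mono mult_mono) auto
      finally show ?case using elim by (simp add: abs_mult)
    qed
    show "AE x in M. (%n. F n x) \<longlonglongrightarrow> F0 x"
      using nu nv
    proof eventually_elim
      case (elim x)
      show ?case
      proof (cases "u x = 0")
        case True
        then show ?thesis by (simp add: F_def F0_def)
      next
        case False
        then have up: "u x > 0" using elim by simp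
        have V: "(%n. v x / (1 + e n * v x) + (e n)\<^sup>2) \<longlonglongrightarrow> v x / (1 + 0 * v x) + 0\<^sup>2"
          by (intro tendsto_intros e0) simp
        have "(%n. (v x / (1 + e n * v x) + (e n)\<^sup>2) powr q) \<longlonglongrightarrow> v x powr q"
        proof (rule tendsto_powr'[OF _ tendsto_const])
          show "(%n. v x / (1 + e n * v x) + (e n)\<^sup>2) \<longlonglongrightarrow> v x" using V by simp
          have "0 <= v x / (1 + e n * v x) + (e n)\<^sup>2" for n using elim e(1)[of n] by simp
          then show "v x ~= 0 \<or> 0 < q \<and> (\<forall>\<^sub>F n in sequentially. 0 <= v x / (1 + e n * v x) + (e n)\<^sup>2)"
            using exponents by (auto intro: always_eventually)
        qed
        moreover have "(%n. ((e n)\<^sup>2) powr q) \<longlonglongrightarrow> 0"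
          by (rule tendsto_zero_powrI[OF _ tendsto_const]) (use tendsto_power[OF e0, of 2] exponents in auto)
        moreover have "(%n. (u x + e n) powr (- (q - 1))) \<longlonglongrightarrow> (u x + 0) powr (- (q - 1))"
          by (intro tendsto_powr tendsto_add tendsto_const e0) (use up in simp)
        ultimately have "(%n. F n x) \<longlonglongrightarrow> (l * u x powr (p - 1) + a x * u x powr (q - 1)) * ((v x powr q - 0) * (u x + 0) powr (- (q - 1)))"
          unfolding F_def \<phi>_def by (intro tendsto_mult tendsto_diff tendsto_const)
        also have "(l * u x powr (p - 1) + a x * u x powr (q - 1)) * ((v x powr q - 0) * (u x + 0) powr (- (q - 1))) =
            l * ((u x powr (p - 1) * u x powr (- (q - 1))) * v x powr q) + a x * ((u x powr (q - 1) * u x powr (- (q - 1))) * v x powr q)"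
          by (simp add: algebra_simps)
        also have "\<dots> = F0 x"
          using False up by (simp add: F0_def powr_add[symmetric])
        finally show ?thesis .
      qed
    qed
  qed
  have "(%n. e n powr q) \<longlonglongrightarrow> 0"
    by (rule tendsto_zero_powrI[OF e0 tendsto_const])
      (use e(1) exponents in \<open>auto intro!: always_eventually less_imp_le\<close>)
  then have "(%n. R + (q - 1) * e n powr q * P) \<longlonglongrightarrow> R + (q - 1) * 0 * P"
    by (intro tendsto_intros)
  then have F0R: "(\<integral>x. F0 x \<partial>M) <= R"
    using LIMSEQ_le[OF Flim] ineq by simp
  let ?Q = "%x. norm (u x) powr (p - q) * norm (v x) powr q"
  have iQ: "integrable M ?Q"
    by (rule integrable_powr_mult_powr[OF finite_M lu(1) lv(1)]) (use exponents in auto)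
  have iF0: "integrable M F0"
  proof (rule B_integrable_bound)
    show "integrable M (%x. \<bar>l\<bar> * ?Q x + \<bar>a x * \<bar>v x\<bar> powr q\<bar>)"
      using iQ integrable_aa[OF lv(1)] by (intro B_integrable_add integrable_mult_right integrable_abs)
    show "F0 \<in> borel_measurable M" unfolding F0_def by measurable
    show "AE x in M. norm (F0 x) <= norm (\<bar>l\<bar> * ?Q x + \<bar>a x * \<bar>v x\<bar> powr q\<bar>)"
      using nu nv by eventually_elim
        (auto simp: F0_def abs_mult intro!: order_trans[OF abs_triangle_ineq])
  qed
  \<comment> \<open>The defects in Young's inequality with weights (p-q)/p and q/p, for the
    gradients and for the functions.\<close>
  define E1 where "E1 x = (p - q) / p * norm (G x) powr p + q / p * norm (K x) powr p - norm (G x) powr (p - q) * norm (K x) powr q" for x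
  define E2 where "E2 x = (p - q) / p * norm (u x) powr p + q / p * norm (v x) powr p - ?Q x" for x
  have E1: "E1 x >= 0" and E2: "E2 x >= 0" for x
    using young_powr(1)[of q p "norm (G x)" "norm (K x)"] young_powr(1)[of q p "norm (u x)" "norm (v x)"] exponents q_less_p
    unfolding E1_def E2_def by auto
  have iE: "integrable M (%x. E1 x - l * E2 x)"
    unfolding E1_def E2_def using iR iQ in_Lp_integrable[OF lu(1)] in_Lp_integrable[OF lu(2)] in_Lp_integrable[OF lv(1)] in_Lp_integrable[OF lv(2)]
    by auto
  have Enn: "E1 x - l * E2 x >= 0" for x
    using E1[of x] mult_nonpos_nonneg[OF less_imp_le[OF l_neg] E2[of x]] by linarith
  \<comment> \<open>Where u > 0 the integrands agree; where u = 0 the right one is 0 and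
    \<open>z\<close> makes the left one nonpositive. This is where the hypothesis on the zero set
    enters.\<close>
  have "aa v <= (\<integral>x. F0 x - l * ?Q x \<partial>M)"
    unfolding aa_def
  proof (rule integral_mono_AE[OF integrable_aa[OF lv(1)]])
    show "integrable M (%x. F0 x - l * ?Q x)" using iF0 iQ by auto
    show "AE x in M. a x * \<bar>v x\<bar> powr q <= F0 x - l * ?Q x"
      using nu nv z by eventually_elim (auto simp: F0_def mult_nonpos_nonneg)
  qed
  also have "\<dots> = (\<integral>x. F0 x \<partial>M) - (\<integral>x. l * ?Q x \<partial>M)" using iF0 iQ by simp
  also have "\<dots> <= R - (\<integral>x. l * ?Q x \<partial>M)" using F0R by simp
  also have "\<dots> = (\<integral>x. norm (G x) powr (p - q) * norm (K x) powr q - l * ?Q x \<partial>M)"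
    unfolding R_def using iR iQ by simp
  also have "\<dots> = (\<integral>x. ((p - q) / p * (norm (G x) powr p - l * \<bar>u x\<bar> powr p) + q / p * (norm (K x) powr p - l * \<bar>v x\<bar> powr p)) - (E1 x - l * E2 x) \<partial>M)"
    by (rule B_integral_cong) (simp_all add: E1_def E2_def algebra_simps)
  also have "\<dots> = (p - q) / p * hh u G + q / p * hh v K - (\<integral>x. E1 x - l * E2 x \<partial>M)"
    unfolding hh_def using integrable_hh[OF lu] integrable_hh[OF lv] iE by simp
  finally have main: "hh v K <= (p - q) / p * hh u G + q / p * hh v K - (\<integral>x. E1 x - l * E2 x \<partial>M)"
    using solution_hh_eq_aa[OF v] by simp
  have Ei: "(\<integral>x. E1 x - l * E2 x \<partial>M) >= 0" using Enn by (rule B_integral_nonneg)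
  \<comment> \<open>Moving q/p H(v) to the left leaves the factor (p-q)/p in front of both H(v) and
    H(u).\<close>
  define \<theta> where "\<theta> = (p - q) / p"
  have \<theta>: "\<theta> > 0" "q / p = 1 - \<theta>" using exponents by (simp_all add: \<theta>_def diff_divide_distrib)
  have main': "\<theta> * hh v K <= \<theta> * hh u G - (\<integral>x. E1 x - l * E2 x \<partial>M)"
    using main unfolding \<theta>(2) \<theta>_def[symmetric] by (simp add: left_diff_distrib)
  then have "\<theta> * hh v K <= \<theta> * hh u G" using Ei by linarith
  then show "hh v K <= hh u G" using \<theta>(1) by simp
  assume "hh v K = hh u G"
  then have "(\<integral>x. E1 x - l * E2 x \<partial>M) = 0" using main' Ei by simp
  then have "AE x in M. E1 x - l * E2 x = 0"
    using integral_nonneg_eq_0_iff_AE[OF iE AE_I2[OF Enn]] by blast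
  then show "AE x in M. u x = v x"
    using nu nv
  proof eventually_elim
    case (elim x)
    have "l * E2 x <= 0" by (rule mult_nonpos_nonneg[OF less_imp_le[OF l_neg] E2])
    then have "l * E2 x = 0" using elim(1) E1[of x] by linarith
    then have "E2 x = 0" using l_neg by simp
    then have "norm (u x) = norm (v x)"
      using young_powr(2)[of q p "norm (u x)" "norm (v x)"] exponents q_less_p by (simp add: E2_def)
    then show ?case using elim(2,3) by simp
  qed
qed

end

section \<open>The strong maximum principle\<close>

text \<open>Convexity keeps the segment from x to x + h in B whenever its ends are there, so the
  increment formula applies. The nonnegative integral avoids integrability questions on the
  left.\<close>

lemma wderiv_translation_bound:
  fixes \<Omega> B :: "'a::euclidean_space set"
  assumes w: "!!e. wderiv \<Omega> e u (%x. G x \<bullet> e)" and G: "integrable lborel G"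
    and B: "open B" "convex B" "B \<subseteq> \<Omega>"
  shows "(\<integral>\<^sup>+ x. indicator B x * (indicator B (x + h) * ennreal \<bar>u (x + h) - u x\<bar>) \<partial>lborel)
    <= ennreal (norm h * (\<integral>x. indicator B x * norm (G x) \<partial>lborel))"
proof -
  let ?g = "%x. indicator B x * norm (G x)"
  have [measurable]: "G \<in> borel_measurable borel" "B \<in> sets borel" using G B by auto
  have gi: "integrable lborel ?g" using integrable_mult_indicator[OF _ integrable_norm[OF G], of B] by simp
  define Q where "Q = B \<inter> (%x. x + h) -` B"
  have "open ((%x. x + h) -` B)" using B(1) by (intro open_vimage continuous_intros)
  then have Q: "open Q" using B(1) by (simp add: Q_def open_Int)
  have line: "x + t *\<^sub>R h \<in> B" if "x \<in> Q" "0 <= t" "t <= 1" for x t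
  proof -
    have "(1 - t) *\<^sub>R x + t *\<^sub>R (x + h) \<in> B" using that B(2) by (intro convexD) (auto simp: Q_def)
    then show ?thesis by (simp add: algebra_simps)
  qed
  let ?I = "indicator {0..1} :: real => real"
  have la: "integrable (lborel \<Otimes>\<^sub>M lborel) (%(t, x). ?I t * (norm h * ?g (x + t *\<^sub>R h)))"
    using integrable_line_average[OF integrable_mult_right[OF gi, of "norm h"], of h] by simp
  have ae: "AE x in lborel. indicator B x * (indicator B (x + h) * ennreal \<bar>u (x + h) - u x\<bar>) \<le>
      ennreal (\<integral>t. ?I t * (norm h * ?g (x + t *\<^sub>R h)) \<partial>lborel)"
  proof -
    have "AE x in lborel. x \<in> Q --> u (x + h) - u x = (\<integral>t. ?I t * (G (x + t *\<^sub>R h) \<bullet> h) \<partial>lborel)"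
      by (rule wderiv_increment[OF w Q]) (use line B(3) in blast)
    moreover have "AE x in lborel. integrable lborel (%t. ?I t * (norm h * ?g (x + t *\<^sub>R h)))"
      using lborel_pair.AE_integrable_snd[OF la] by simp
    ultimately show ?thesis
    proof eventually_elim
      case (elim x)
      show ?case
      proof (cases "x \<in> Q")
        case True
        have "\<bar>u (x + h) - u x\<bar> <= (\<integral>t. \<bar>?I t * (G (x + t *\<^sub>R h) \<bullet> h)\<bar> \<partial>lborel)"
          using elim(1) True integral_abs_bound[of lborel "%t. ?I t * (G (x + t *\<^sub>R h) \<bullet> h)"] by simp
        also have "\<dots> <= (\<integral>t. ?I t * (norm h * ?g (x + t *\<^sub>R h)) \<partial>lborel)"
        proof (rule Bochner_Integration.integral_mono'[OF elim(2)])
          fix t :: real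
          show "\<bar>?I t * (G (x + t *\<^sub>R h) \<bullet> h)\<bar> <= ?I t * (norm h * ?g (x + t *\<^sub>R h))"
            using line[OF True, of t] Cauchy_Schwarz_ineq2[of "G (x + t *\<^sub>R h)" h]
            by (cases "t \<in> {0..1}") (simp_all add: mult.commute)
        qed simp
        finally show ?thesis using True by (simp add: Q_def ennreal_leI)
      next
        case False
        then show ?thesis by (auto simp: Q_def indicator_def)
      qed
    qed
  qed
  have "(\<integral>\<^sup>+ x. indicator B x * (indicator B (x + h) * ennreal \<bar>u (x + h) - u x\<bar>) \<partial>lborel) \<le>
      (\<integral>\<^sup>+ x. ennreal (\<integral>t. ?I t * (norm h * ?g (x + t *\<^sub>R h)) \<partial>lborel) \<partial>lborel)"
    by (rule nn_integral_mono_AE[OF ae])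
  also have "\<dots> = ennreal (\<integral>x. \<integral>t. ?I t * (norm h * ?g (x + t *\<^sub>R h)) \<partial>lborel \<partial>lborel)"
  proof (rule nn_integral_eq_integral)
    show "integrable lborel (%x. \<integral>t. ?I t * (norm h * ?g (x + t *\<^sub>R h)) \<partial>lborel)"
      using lborel_pair.integrable_snd[OF la] by simp
  qed (intro AE_I2 B_integral_nonneg mult_nonneg_nonneg indicator_pos_le norm_ge_zero)
  also have "(\<integral>x. \<integral>t. ?I t * (norm h * ?g (x + t *\<^sub>R h)) \<partial>lborel \<partial>lborel) =
      (\<integral>t. \<integral>x. ?I t * (norm h * ?g (x + t *\<^sub>R h)) \<partial>lborel \<partial>lborel)"
    by (rule lborel_pair.Fubini_integral[OF la])
  also have "\<dots> = norm h * (\<integral>x. ?g x \<partial>lborel)"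
    using integral_lborel_translation[OF gi] by simp
  finally show ?thesis .
qed

text \<open>At a zero x of u, |u(y)| is the increment |u(x + h) - u(x)| with h = y - x. Integrating
  over x in Z and over y, exchanging the integrals and applying the translation bound for each h of
  norm below 2 r gives a Poincare inequality in product form, whose left side measures the size of
  Z.\<close>

lemma poincare_zero_set:
  fixes \<Omega> B Z :: "'a::euclidean_space set"
  assumes w: "!!e. wderiv \<Omega> e u (%x. G x \<bullet> e)" and G: "integrable lborel G"
    and B: "B = ball c r" "B \<subseteq> \<Omega>" "r > 0"
    and Z: "Z \<in> sets borel" "Z \<subseteq> B" "!!x. x \<in> Z ==> u x = 0"
  shows "emeasure lborel Z * (\<integral>\<^sup>+ x. indicator B x * ennreal \<bar>u x\<bar> \<partial>lborel) \<le>
    ennreal (2 * r * (\<integral>x. indicator B x * norm (G x) \<partial>lborel) * measure lborel (ball (0::'a) (2 * r)))"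
proof -
  have [measurable]: "u \<in> borel_measurable borel" using w[of 0] by (auto simp: wderiv_def)
  have [measurable]: "B \<in> sets borel" using B by simp
  note [measurable] = Z(1)
  let ?I = "\<integral>x. indicator B x * norm (G x) \<partial>lborel"
  have I: "?I >= 0" by (intro B_integral_nonneg mult_nonneg_nonneg indicator_pos_le norm_ge_zero)
  let ?f = "%x h. indicator B x * (indicator B (x + h) * ennreal \<bar>u (x + h) - u x\<bar>)"
  have "emeasure lborel Z * (\<integral>\<^sup>+ y. indicator B y * ennreal \<bar>u y\<bar> \<partial>lborel) =
      (\<integral>\<^sup>+ x. indicator Z x * (\<integral>\<^sup>+ y. indicator B y * ennreal \<bar>u y\<bar> \<partial>lborel) \<partial>lborel)"
    by (subst nn_integral_multc) auto
  also have "\<dots> <= (\<integral>\<^sup>+ x. (\<integral>\<^sup>+ h. ?f x h \<partial>lborel) \<partial>lborel)"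
  proof (rule nn_integral_mono)
    fix x :: 'a
    show "indicator Z x * (\<integral>\<^sup>+ y. indicator B y * ennreal \<bar>u y\<bar> \<partial>lborel) <= (\<integral>\<^sup>+ h. ?f x h \<partial>lborel)"
    proof (cases "x \<in> Z")
      case True
      have "(\<integral>\<^sup>+ y. indicator B y * ennreal \<bar>u y\<bar> \<partial>lborel) = (\<integral>\<^sup>+ y. indicator B y * ennreal \<bar>u y\<bar> \<partial>distr lborel borel ((+) x))"
        by (simp add: lborel_distr_plus)
      also have "\<dots> = (\<integral>\<^sup>+ h. indicator B (x + h) * ennreal \<bar>u (x + h)\<bar> \<partial>lborel)"
        by (rule nn_integral_distr) measurable
      finally show ?thesis using True Z(2,3) by (simp add: subsetD)
    qed simp
  qed
  also have "\<dots> = (\<integral>\<^sup>+ h. (\<integral>\<^sup>+ x. ?f x h \<partial>lborel) \<partial>lborel)"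
    by (rule lborel_pair.Fubini'[symmetric]) measurable
  also have "\<dots> <= (\<integral>\<^sup>+ h. ennreal (2 * r * ?I) * indicator (ball (0::'a) (2 * r)) h \<partial>lborel)"
  proof (rule nn_integral_mono)
    fix h :: 'a
    show "(\<integral>\<^sup>+ x. ?f x h \<partial>lborel) <= ennreal (2 * r * ?I) * indicator (ball (0::'a) (2 * r)) h"
    proof (cases "norm h < 2 * r")
      case True
      have "(\<integral>\<^sup>+ x. ?f x h \<partial>lborel) <= ennreal (norm h * ?I)"
        by (rule wderiv_translation_bound[OF w G _ _ B(2)]) (simp_all add: B(1))
      also have "\<dots> <= ennreal (2 * r * ?I)" using True I by (intro ennreal_leI mult_right_mono) auto
      finally show ?thesis using True by simp
    next
      case False
      have z: "?f x h = 0" for x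
      proof -
        have "norm h <= dist c (x + h) + dist c x"
          using norm_triangle_ineq4[of "c - x" "c - (x + h)"] by (simp add: dist_norm)
        then have "\<not> (x \<in> B \<and> x + h \<in> B)" using False by (auto simp: B(1))
        then show ?thesis by (auto simp: indicator_def)
      qed
      show ?thesis unfolding z by simp
    qed
  qed
  also have "\<dots> = ennreal (2 * r * ?I) * emeasure lborel (ball (0::'a) (2 * r))"
    by (rule nn_integral_cmult_indicator) simp
  also have "\<dots> = ennreal (2 * r * ?I * measure lborel (ball (0::'a) (2 * r)))"
  proof -
    have "emeasure lborel (ball (0::'a) (2 * r)) = ennreal (measure lborel (ball (0::'a) (2 * r)))"
      by (rule emeasure_eq_ennreal_measure) (use emeasure_bounded_finite[of "ball (0::'a) (2*r)"] in auto)
    then show ?thesis using I B(3) by (simp add: ennreal_mult)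
  qed
  finally show ?thesis .
qed

text \<open>A power \<phi> = \<eta>^m of a bump with m >= p: its gradient is of order \<eta>^(m-1),
  and (m-1)/m >= (p-1)/p, so it is controlled by the power (p-1)/p of \<phi>. Young's inequality in
  the logarithmic estimate calls for exactly this, with the weight \<phi>/(1 + \<phi>).\<close>

lemma exists_cutoff:
  fixes P :: "'a::euclidean_space set"
  assumes P: "open P" "x \<in> P" and p: "1 < p"
  obtains \<phi> r \<kappa> K where "\<phi> \<in> test_functions P" "!!y. 0 <= \<phi> y" "r > 0" "\<kappa> > 0" "cball x r \<subseteq> P"
    "!!y. y \<in> ball x r ==> \<kappa> <= \<phi> y / (1 + \<phi> y)"
    "!!y. norm (gradient \<phi> y) <= K * (\<phi> y / (1 + \<phi> y)) powr ((p - 1) / p)" "K >= 0"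
proof -
  obtain a b where ab: "x \<in> box a b" "cbox a b \<subseteq> P"
    using open_contains_cbox[of P x] P by (metis box_subset_cbox subset_trans open_contains_cbox)
  obtain \<eta>0 :: "'a => real" where \<eta>0: "smooth_on UNIV \<eta>0" "!!x. \<eta>0 x >= 0" "!!x. \<eta>0 x > 0 \<longleftrightarrow> x \<in> box a b"
    by (rule exists_bump_box[of a b]) auto
  have \<eta>0z: "\<eta>0 y = 0" if "y \<notin> box a b" for y using \<eta>0(2)[of y] \<eta>0(3)[of y] that by simp
  have t0: "\<eta>0 \<in> test_functions P"
    by (rule test_functions_supportI[OF \<eta>0(1), of "cbox a b"]) (use \<eta>0z box_subset_cbox ab(2) in \<open>auto simp: subset_iff\<close>)
  obtain B where B: "B > 0" "!!x. \<bar>\<eta>0 x\<bar> <= B" by (rule test_functions_bounded[OF t0]) auto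
  define \<eta> where "\<eta> y = (1 / B) * \<eta>0 y" for y
  have \<eta>: "smooth_on UNIV \<eta>" "!!y. 0 <= \<eta> y" "!!y. \<eta> y <= 1"
  proof -
    show "smooth_on UNIV \<eta>" unfolding \<eta>_def by (intro smooth_on_mult smooth_on_const \<eta>0(1))
    show "0 <= \<eta> y" for y using \<eta>0(2)[of y] B(1) by (simp add: \<eta>_def)
    show "\<eta> y <= 1" for y using B(1) B(2)[of y] by (simp add: \<eta>_def)
  qed
  have t: "\<eta> \<in> test_functions P" unfolding \<eta>_def by (rule test_functions_mult[OF smooth_on_const t0])
  have "bounded (gradient \<eta> ` closure {x. \<eta> x ~= 0})"
    by (intro compact_imp_bounded compact_continuous_image continuous_on_subset[OF continuous_on_gradient[OF \<eta>(1)]]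
        test_functionsD(2)[OF t]) auto
  then obtain B' where B': "B' > 0" "!!x. x \<in> closure {x. \<eta> x ~= 0} ==> norm (gradient \<eta> x) <= B'"
    unfolding bounded_pos by blast
  have gb: "norm (gradient \<eta> y) <= B'" for y
  proof (cases "y \<in> closure {x. \<eta> x ~= 0}")
    case False
    from gradient_zero_outside[OF t this] B'(1) show ?thesis by simp
  qed (rule B'(2))
  obtain m :: nat where m: "real m >= p" using real_arch_simple by blast
  have m1: "m >= 1" using m p by linarith
  define \<phi> where "\<phi> y = \<eta> y ^ m" for y
  have \<phi>: "0 <= \<phi> y" "\<phi> y <= 1" for y using \<eta>(2,3)[of y] by (auto simp: \<phi>_def power_le_one)
  have "\<phi> = (%y. \<eta> y ^ (m - 1) * \<eta> y)" using m1 by (auto simp: \<phi>_def power_eq_if mult.commute)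
  then have \<phi>t: "\<phi> \<in> test_functions P" using test_functions_mult[OF smooth_on_power[OF \<eta>(1)] t, of "m - 1"] by simp
  have grad: "gradient \<phi> y = (real m * \<eta> y ^ (m - 1)) *\<^sub>R gradient \<eta> y" for y
  proof (rule gradient_has_derivative)
    have "((%y. \<eta> y ^ m) has_derivative (%v. real m * (gradient \<eta> y \<bullet> v) * \<eta> y ^ (m - 1))) (at y)"
      by (rule derivative_eq_intros smooth_on_gradient[OF \<eta>(1)] refl)+
    then show "(\<phi> has_derivative (%v. (real m * \<eta> y ^ (m - 1)) *\<^sub>R gradient \<eta> y \<bullet> v)) (at y)"
      by (simp add: \<phi>_def[abs_def] mult_ac)
  qed
  have gK: "norm (gradient \<phi> y) <= (real m * 2 * B') * (\<phi> y / (1 + \<phi> y)) powr ((p - 1) / p)" for y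
  proof (cases "\<eta> y = 0")
    case True
    have "m - 1 ~= 0" using m p by linarith
    then have "gradient \<phi> y = 0" using True by (simp add: grad)
    then show ?thesis using B'(1) by simp
  next
    case False
    then have c: "0 < \<eta> y" "\<eta> y <= 1" using \<eta>(2,3)[of y] by auto
    have ex: "real m * ((p - 1) / p) <= real (m - 1)"
    proof -
      have "real m * ((p - 1) / p) = real m - real m / p" using p by (simp add: field_simps)
      moreover have "1 <= real m / p" using m p by simp
      ultimately show ?thesis using m1 by (simp add: of_nat_diff)
    qed
    have "\<eta> y ^ (m - 1) = \<eta> y powr real (m - 1)" using c by (simp add: powr_realpow)
    also have "\<dots> <= \<eta> y powr (real m * ((p - 1) / p))" using c ex by (intro powr_mono') auto
    also have "\<dots> = \<phi> y powr ((p - 1) / p)" using c by (simp add: \<phi>_def powr_realpow[symmetric] powr_powr)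
    \<comment> \<open>Since \<phi> <= 1, passing from \<phi> to \<phi>/(1 + \<phi>) costs at most a
      factor 2.\<close>
    also have "\<dots> <= (2 * (\<phi> y / (1 + \<phi> y))) powr ((p - 1) / p)"
    proof (rule powr_mono2)
      have "\<phi> y * (1 + \<phi> y) <= \<phi> y * 2" using \<phi>[of y] by (intro mult_left_mono) auto
      then show "\<phi> y <= 2 * (\<phi> y / (1 + \<phi> y))" using \<phi>[of y] by (simp add: pos_le_divide_eq mult.commute)
    qed (use p \<phi> in auto)
    also have "\<dots> = 2 powr ((p - 1) / p) * (\<phi> y / (1 + \<phi> y)) powr ((p - 1) / p)" by (rule powr_mult)
    also have "\<dots> <= 2 * (\<phi> y / (1 + \<phi> y)) powr ((p - 1) / p)"
    proof (rule mult_right_mono)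
      have "(2::real) powr ((p - 1) / p) <= 2 powr 1" using p by (intro powr_mono) auto
      then show "(2::real) powr ((p - 1) / p) <= 2" by simp
    qed simp
    finally have k: "\<eta> y ^ (m - 1) <= 2 * (\<phi> y / (1 + \<phi> y)) powr ((p - 1) / p)" .
    have "norm (gradient \<phi> y) = real m * \<eta> y ^ (m - 1) * norm (gradient \<eta> y)" using c by (simp add: grad abs_mult)
    also have "\<dots> <= real m * (2 * (\<phi> y / (1 + \<phi> y)) powr ((p - 1) / p)) * B'"
      using k gb[of y] c by (intro mult_mono) auto
    finally show ?thesis by (simp add: mult_ac)
  qed
  obtain r where r: "r > 0" "cball x r \<subseteq> box a b" using open_contains_cball open_box ab(1) by blast
  have cont: "continuous_on (cball x r) \<phi>" using smooth_on_continuous[OF test_functionsD(1)[OF \<phi>t]] continuous_on_subset by blast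
  obtain y0 where y0: "y0 \<in> cball x r" "!!y. y \<in> cball x r ==> \<phi> y0 <= \<phi> y"
    using continuous_attains_inf[OF compact_cball _ cont] r(1) by force
  have "\<eta>0 y0 > 0" using \<eta>0(3) r(2) y0(1) by blast
  then have y0p: "\<phi> y0 > 0" using B(1) by (simp add: \<phi>_def \<eta>_def)
  show ?thesis
  proof (rule that[OF \<phi>t \<phi>(1) r(1) _ _ _ gK])
    show "\<phi> y0 / 2 > 0" using y0p by simp
    show "cball x r \<subseteq> P" using r(2) ab(2) box_subset_cbox by blast
    show "\<phi> y0 / 2 <= \<phi> y / (1 + \<phi> y)" if "y \<in> ball x r" for y
    proof -
      have "\<phi> y0 <= \<phi> y" using y0(2)[of y] that by auto
      then show ?thesis using \<phi>[of y] y0p by (intro frac_le) auto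
    qed
    show "real m * 2 * B' >= 0" using B'(1) by simp
  qed
qed

section \<open>Solutions on the set where a is positive\<close>

context elliptic_problem
begin

lemma integrable_powr_mult:
  assumes u: "in_Lp M p u" and \<phi>: "in_Lp M p \<phi>" and nn: "AE x in M. u x >= 0" and s: "0 <= s" "s + 1 <= p"
  shows "integrable M (%x. u x powr s * (\<phi> x :: real))"
proof (rule B_integrable_bound)
  note [measurable] = in_Lp_measurable[OF u] in_Lp_measurable[OF \<phi>]
  show "integrable M (%x. norm (u x) powr s * norm (\<phi> x) powr 1)"
    by (rule integrable_powr_mult_powr[OF finite_M u \<phi>]) (use s in auto)
  show "(%x. u x powr s * \<phi> x) \<in> borel_measurable M" by measurable
  show "AE x in M. norm (u x powr s * \<phi> x) <= norm (norm (u x) powr s * norm (\<phi> x) powr 1)"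
    using nn by eventually_elim (simp add: abs_mult)
qed

lemma integrable_rhs:
  assumes u: "in_Lp M p u" and \<phi>: "in_Lp M p \<phi>" and nn: "AE x in M. u x >= 0"
  shows "integrable M (%x. (l * u x powr (p - 1) + a x * u x powr (q - 1)) * \<phi> x)"
proof -
  have "integrable M (%x. l * (u x powr (p - 1) * \<phi> x) + a x * (u x powr (q - 1) * \<phi> x))"
    using exponents by (intro B_integrable_add integrable_mult_right integrable_a_mult integrable_powr_mult[OF u \<phi> nn]) auto
  then show ?thesis by (simp add: distrib_right mult.assoc)
qed

definition P :: "'a set" where "P = {x \<in> \<Omega>. a x > 0}"

lemma P_open: "open P"
proof -
  have "continuous_on \<Omega> a" using a_cont closure_subset continuous_on_subset by blast
  from this[unfolded continuous_on_open_vimage[OF open_\<Omega>], rule_format, OF open_greaterThan[of 0]]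
  have "open (a -` {0<..} \<inter> \<Omega>)" .
  moreover have "a -` {0<..} \<inter> \<Omega> = P" by (auto simp: P_def)
  ultimately show ?thesis by simp
qed

lemma P_subset: "P \<subseteq> \<Omega>" by (auto simp: P_def)

text \<open>Testing with \<open>\<phi>/(1+\<phi>) (u+\<epsilon>)\<^sup>1\<^sup>-\<^sup>p\<close>: the good term controls \<open>|\<nabla> ln (u+\<epsilon>)|\<^sup>p\<close> uniformly in \<open>\<epsilon>\<close>.\<close>

lemma log_gradient_bound:
  assumes u: "solution u G" and x0: "x0 \<in> P"
  obtains r C where "r > 0" "cball x0 r \<subseteq> P"
    "!!\<epsilon>. \<epsilon> > 0 ==> (\<integral>x. indicator (ball x0 r) x * norm (inverse (u x + \<epsilon>) *\<^sub>R G x) \<partial>M) <= C"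
proof -
  have Xu: "sobX bc u G" and nu: "AE x in M. u x >= 0" using u by (auto simp: solution_def)
  note lu = sobXD[OF Xu]
  have weak: "(\<integral>x. norm (G x) powr (p - 2) * (G x \<bullet> \<Phi> x) \<partial>M) = (\<integral>x. (l * u x powr (p - 1) + a x * u x powr (q - 1)) * \<phi> x \<partial>M)"
    if "sobX bc \<phi> \<Phi>" for \<phi> \<Phi> using u that unfolding solution_def by blast
  obtain \<phi> r \<kappa> K where \<phi>: "\<phi> \<in> test_functions P" "!!y. 0 <= \<phi> y" and r: "r > 0" "cball x0 r \<subseteq> P" and \<kappa>: "\<kappa> > 0"
      "!!y. y \<in> ball x0 r ==> \<kappa> <= \<phi> y / (1 + \<phi> y)"
    and K: "!!y. norm (gradient \<phi> y) <= K * (\<phi> y / (1 + \<phi> y)) powr ((p - 1) / p)" "K >= 0"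
    by (rule exists_cutoff[OF P_open x0 p_gt_1]) blast
  have X\<phi>: "sobX bc \<phi> (gradient \<phi>)" by (rule sobX_test_function[OF test_functions_mono[OF \<phi>(1) P_subset]])
  have \<phi>P: "a x >= 0" if "\<phi> x ~= 0" for x
  proof -
    have "x \<in> closure {x. \<phi> x ~= 0}" using that closure_subset[of "{x. \<phi> x ~= 0}"] by blast
    then show ?thesis using test_functionsD(3)[OF \<phi>(1)] by (auto simp: P_def)
  qed
  \<comment> \<open>The weight is \<phi>/(1 + \<phi>) instead of \<phi> because
    \<open>sobX_quotient\<close> asks for a function of \<phi> that is bounded on the whole
    half-line.\<close>
  define g where "g x = \<phi> x / (1 + \<phi> x)" for x
  have g: "0 <= g x" "g x <= 1" for x using \<phi>(2)[of x] by (auto simp: g_def divide_simps)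
  define m where "m = measure M (space M)"
  \<comment> \<open>What is left of the good term: p - 1 minus the share (p-1)/p lost to Young's
    inequality.\<close>
  define c where "c = (p - 1) * ((p - 1) / p)"
  have c: "c > 0" using p_gt_1 by (simp add: c_def)
  define C where "C = m + (1 / \<kappa>) * ((K powr p / p * m - l * m) / c)"
  have const: "(\<integral>x. k \<partial>M) = k * m" for k :: real by (simp add: m_def)
  have ic: "integrable M (%x. k)" for k :: real by (rule finite_measure.integrable_const[OF finite_M])
  have "(\<integral>x. indicator (ball x0 r) x * norm (inverse (u x + \<epsilon>) *\<^sub>R G x) \<partial>M) <= C" if \<epsilon>: "\<epsilon> > 0" for \<epsilon>
  proof -
    define X where "X x = norm (inverse (u x + \<epsilon>) *\<^sub>R G x)" for x
    let ?w = "%x. \<phi> x / (1 + \<phi> x) * (u x + \<epsilon>) powr (- (p - 1))"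
    let ?W = "%x. (- (p - 1) * (\<phi> x / (1 + \<phi> x)) * (u x + \<epsilon>) powr (- (p - 1) - 1)) *\<^sub>R G x +
        (1 / (1 + \<phi> x)\<^sup>2 * (u x + \<epsilon>) powr (- (p - 1))) *\<^sub>R gradient \<phi> x"
    have XW: "sobX bc ?w ?W"
    proof (rule sobX_quotient[OF Xu X\<phi> nu _ \<epsilon>, where B = 1])
      show "p - 1 > 0" using p_gt_1 by simp
      show "AE x in M. \<phi> x >= 0" using \<phi>(2) by simp
      fix t :: real assume t: "t >= 0"
      show "((%t. t / (1 + t)) has_real_derivative 1 / (1 + t)\<^sup>2) (at t)"
        using t by (auto intro!: derivative_eq_intros simp: power2_eq_square)
      show "\<bar>t / (1 + t)\<bar> <= 1" using t by simp
      have "1 <= (1 + t)\<^sup>2" using t by (intro one_le_power) simp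
      then show "\<bar>1 / (1 + t)\<^sup>2\<bar> <= 1" using frac_le[of 1 1 1 "(1 + t)\<^sup>2"] by simp
    next
      have nz: "(1 + t)\<^sup>2 ~= 0" if "t \<in> {0..}" for t :: real using that by auto
      show "continuous_on {0..} (%t::real. 1 / (1 + t)\<^sup>2)"
        by (intro continuous_on_divide continuous_on_power continuous_on_add continuous_on_const continuous_on_id ballI nz)
      fix \<psi> :: "'a => real" assume s: "smooth_on UNIV \<psi>" "!!x. \<psi> x >= 0"
      have p1: "1 + \<psi> x > 0" for x using s(2)[of x] by linarith
      have eq: "\<psi> x / (1 + \<psi> x) = \<psi> x * (1 + \<psi> x) powr (- 1)" for x
        using p1[of x] by (simp add: powr_minus divide_inverse)
      show "smooth_on UNIV (%x. \<psi> x / (1 + \<psi> x))"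
        by (simp only: eq) (intro smooth_on_powr p1 smooth_on_add smooth_on_mult smooth_on_const s)
    qed auto
    note lw = sobXD[OF XW]
    have gX: "integrable M (%x. g x * X x powr p)"
    proof (rule B_integrable_bound)
      note [measurable] = in_Lp_measurable[OF lu(1)] in_Lp_measurable[OF lu(2)] in_Lp_measurable[OF sobXD(1)[OF X\<phi>]]
      show "integrable M (%x. inverse \<epsilon> powr p * norm (G x) powr p)" using in_Lp_integrable[OF lu(2)] by simp
      show "(%x. g x * X x powr p) \<in> borel_measurable M" unfolding g_def X_def by measurable
      show "AE x in M. norm (g x * X x powr p) <= norm (inverse \<epsilon> powr p * norm (G x) powr p)"
        using nu
      proof eventually_elim
        case (elim x)
        have "inverse (u x + \<epsilon>) <= inverse \<epsilon>" using elim \<epsilon> by (intro le_imp_inverse_le) auto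
        then have "X x <= inverse \<epsilon> * norm (G x)" unfolding X_def using elim \<epsilon> by (simp add: mult_right_mono)
        then have "X x powr p <= inverse \<epsilon> powr p * norm (G x) powr p"
          unfolding powr_mult[symmetric] using p_pos by (intro powr_mono2) (auto simp: X_def)
        then have "g x * X x powr p <= 1 * (inverse \<epsilon> powr p * norm (G x) powr p)" using g[of x] by (intro mult_mono) auto
        then show ?case using g[of x] by simp
      qed
    qed
    have pw: "AE x in M. norm (G x) powr (p - 2) * (G x \<bullet> ?W x) <= K powr p / p - c * (g x * X x powr p)"
      using nu
    proof eventually_elim
      case (elim x)
      have W: "u x + \<epsilon> > 0" using elim \<epsilon> by simp
      have X0: "X x >= 0" by (simp add: X_def)
      have Xe: "X x powr s = (u x + \<epsilon>) powr (- s) * norm (G x) powr s" for s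
        using W by (simp add: X_def powr_mult inverse_powr powr_minus)
      have "norm (G x) powr (p - 2) * (G x \<bullet> ?W x) =
          - (p - 1) * g x * ((u x + \<epsilon>) powr (- p) * (norm (G x) powr (p - 2) * (G x \<bullet> G x)))
          + 1 / (1 + \<phi> x)\<^sup>2 * ((u x + \<epsilon>) powr (- (p - 1)) * (norm (G x) powr (p - 2) * (G x \<bullet> gradient \<phi> x)))"
        by (simp add: inner_add_right g_def algebra_simps)
      also have "\<dots> = - (p - 1) * g x * X x powr p
          + 1 / (1 + \<phi> x)\<^sup>2 * ((u x + \<epsilon>) powr (- (p - 1)) * (norm (G x) powr (p - 2) * (G x \<bullet> gradient \<phi> x)))"
        unfolding norm_powr_inner_self Xe ..
      also have "1 / (1 + \<phi> x)\<^sup>2 * ((u x + \<epsilon>) powr (- (p - 1)) * (norm (G x) powr (p - 2) * (G x \<bullet> gradient \<phi> x))) \<le>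
          1 * ((u x + \<epsilon>) powr (- (p - 1)) * (norm (G x) powr (p - 1) * norm (gradient \<phi> x)))"
      proof -
        have "1 <= (1 + \<phi> x)\<^sup>2" using \<phi>(2)[of x] by (intro one_le_power) simp
        then have d: "0 <= 1 / (1 + \<phi> x)\<^sup>2" "1 / (1 + \<phi> x)\<^sup>2 <= 1" using frac_le[of 1 1 1 "(1 + \<phi> x)\<^sup>2"] by auto
        have "norm (G x) powr (p - 2) * (G x \<bullet> gradient \<phi> x) <= norm (G x) powr (p - 1) * norm (gradient \<phi> x)"
          using norm_powr_inner_le[of "G x" p "gradient \<phi> x"] by linarith
        then have "1 / (1 + \<phi> x)\<^sup>2 * ((u x + \<epsilon>) powr (- (p - 1)) * (norm (G x) powr (p - 2) * (G x \<bullet> gradient \<phi> x))) \<le>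
          1 / (1 + \<phi> x)\<^sup>2 * ((u x + \<epsilon>) powr (- (p - 1)) * (norm (G x) powr (p - 1) * norm (gradient \<phi> x)))"
          using d(1) by (intro mult_left_mono) auto
        also have "\<dots> <= 1 * ((u x + \<epsilon>) powr (- (p - 1)) * (norm (G x) powr (p - 1) * norm (gradient \<phi> x)))"
          using d(2) by (intro mult_right_mono) auto
        finally show ?thesis .
      qed
      also have "1 * ((u x + \<epsilon>) powr (- (p - 1)) * (norm (G x) powr (p - 1) * norm (gradient \<phi> x))) = X x powr (p - 1) * norm (gradient \<phi> x)"
        unfolding Xe by simp
      also have "X x powr (p - 1) * norm (gradient \<phi> x) <= X x powr (p - 1) * (K * g x powr ((p - 1) / p))"
        using K(1)[of x] by (intro mult_left_mono) (auto simp: g_def)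
      \<comment> \<open>The exponent (p-1)/p in the cutoff bound lets g enter as g^(1/p) X, whose
        p-th power is again the good term g X^p.\<close>
      also have "X x powr (p - 1) * (K * g x powr ((p - 1) / p)) = (g x powr (1 / p) * X x) powr (p - 1) * K powr 1"
        using K(2) by (simp add: powr_mult powr_powr mult_ac)
      also have "\<dots> <= (p - 1) / p * (g x powr (1 / p) * X x) powr p + 1 / p * K powr p"
        using young_powr(1)[of 1 p "g x powr (1 / p) * X x" K] p_gt_1 K(2) X0 by simp
      also have "(g x powr (1 / p) * X x) powr p = g x * X x powr p"
        using g[of x] p_pos by (simp add: powr_mult powr_powr)
      finally have "norm (G x) powr (p - 2) * (G x \<bullet> ?W x) \<le>
          - (p - 1) * g x * X x powr p + ((p - 1) / p * (g x * X x powr p) + 1 / p * K powr p)" by simp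
      also have "\<dots> = K powr p / p - c * (g x * X x powr p)"
        using p_pos unfolding c_def by (simp add: field_simps)
      finally show ?case .
    qed
    have "l * m <= (\<integral>x. (l * u x powr (p - 1) + a x * u x powr (q - 1)) * ?w x \<partial>M)"
      unfolding const[symmetric]
    proof (rule integral_mono_AE[OF ic integrable_rhs[OF lu(1) lw(1) nu]])
      show "AE x in M. l <= (l * u x powr (p - 1) + a x * u x powr (q - 1)) * ?w x"
        using nu
      proof eventually_elim
        case (elim x)
        have wn: "?w x >= 0" using \<phi>(2)[of x] by simp
        have "u x powr (p - 1) * ?w x = g x * (u x powr (p - 1) * (u x + \<epsilon>) powr (- (p - 1)))" by (simp add: g_def)
        also have "\<dots> <= 1 * 1"
        proof (rule mult_mono)
          have "u x powr (p - 1) * (u x + \<epsilon>) powr (- (p - 1)) <= u x powr ((p - 1) - (p - 1))"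
            using elim \<epsilon> p_gt_1 by (intro powr_shift_le) auto
          also have "\<dots> <= 1" by simp
          finally show "u x powr (p - 1) * (u x + \<epsilon>) powr (- (p - 1)) <= 1" .
        qed (use g in auto)
        finally have "l * 1 <= l * (u x powr (p - 1) * ?w x)" using l_neg by (intro mult_left_mono_neg) auto
        moreover have "0 <= a x * (u x powr (q - 1) * ?w x)"
        proof (cases "\<phi> x = 0")
          case False
          show ?thesis by (rule mult_nonneg_nonneg[OF \<phi>P[OF False] mult_nonneg_nonneg[OF powr_ge_zero wn]])
        qed simp
        ultimately show ?case unfolding distrib_right mult.assoc by linarith
      qed
    qed
    also have "\<dots> = (\<integral>x. norm (G x) powr (p - 2) * (G x \<bullet> ?W x) \<partial>M)"
      by (rule weak[OF XW, symmetric])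
    also have "\<dots> <= (\<integral>x. K powr p / p - c * (g x * X x powr p) \<partial>M)"
      by (rule integral_mono_AE[OF integrable_energy_pairing[OF lu(2) lw(2)] _ pw]) (use gX ic in auto)
    also have "\<dots> = K powr p / p * m - c * (\<integral>x. g x * X x powr p \<partial>M)"
      by (simp only: B_integral_diff[OF ic integrable_mult_right[OF gX]] const integral_mult_right_zero)
    finally have b: "(\<integral>x. g x * X x powr p \<partial>M) <= (K powr p / p * m - l * m) / c"
      using c by (simp add: pos_le_divide_eq mult.commute)
    have "(\<integral>x. indicator (ball x0 r) x * X x \<partial>M) <= (\<integral>x. 1 + (1 / \<kappa>) * (g x * X x powr p) \<partial>M)"
    proof (rule Bochner_Integration.integral_mono')
      show "integrable M (%x. 1 + (1 / \<kappa>) * (g x * X x powr p))" by (intro B_integrable_add ic integrable_mult_right gX)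
      fix x
      have rhs: "0 <= 1 + (1 / \<kappa>) * (g x * X x powr p)" using g[of x] \<kappa>(1) by simp
      then show "0 <= 1 + (1 / \<kappa>) * (g x * X x powr p)" .
      show "indicator (ball x0 r) x * X x <= 1 + (1 / \<kappa>) * (g x * X x powr p)"
      proof (cases "x \<in> ball x0 r")
        case True
        have "X x <= 1 + X x powr p" using p_gt_1 by (intro le_one_plus_powr) (auto simp: X_def)
        moreover have "\<kappa> * X x powr p <= g x * X x powr p" using \<kappa>(2)[OF True] by (intro mult_right_mono) (auto simp: g_def)
        then have "X x powr p <= (1 / \<kappa>) * (g x * X x powr p)" using \<kappa>(1) by (simp add: pos_le_divide_eq mult.commute)
        ultimately show ?thesis using True by simp
      qed (use rhs in simp)
    qed
    also have "\<dots> = m + (1 / \<kappa>) * (\<integral>x. g x * X x powr p \<partial>M)" using gX ic const[of 1] by simp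
    also have "\<dots> <= C" unfolding C_def using b \<kappa>(1) by (intro add_left_mono mult_left_mono) auto
    finally show ?thesis by (simp add: X_def)
  qed
  with r that show ?thesis by blast
qed

text \<open>By the logarithmic bound and the Poincare inequality, \<open>|{u = 0}| |{u \<ge> \<delta>}| n\<close> stays bounded as
  \<open>\<epsilon> = \<delta> exp (-n)\<close> tends to \<open>0\<close>.\<close>

lemma local_strong_maximum_principle:
  assumes u: "solution u G" and x0: "x0 \<in> P"
  obtains r where "r > 0" "ball x0 r \<subseteq> P"
    "(AE y in M. y \<in> ball x0 r --> u y = 0) \<or> (AE y in M. y \<in> ball x0 r --> u y ~= 0)"
proof -
  have Xu: "sobX bc u G" and nu: "AE x in M. u x >= 0" using u by (auto simp: solution_def)
  note lu = sobXD[OF Xu]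
  obtain r C where r: "r > 0" "cball x0 r \<subseteq> P"
    and C: "!!\<epsilon>. \<epsilon> > 0 ==> (\<integral>x. indicator (ball x0 r) x * norm (inverse (u x + \<epsilon>) *\<^sub>R G x) \<partial>M) <= C"
    by (rule log_gradient_bound[OF u x0]) blast
  define B where "B = ball x0 r"
  have BP: "B \<subseteq> P" using r(2) ball_subset_cball unfolding B_def by blast
  then have B\<Omega>: "B \<subseteq> \<Omega>" using P_subset by blast
  have Bm[measurable]: "B \<in> sets borel" by (simp add: B_def)
  obtain u0 where u0: "u0 \<in> borel_measurable borel" "!!x. x \<notin> \<Omega> ==> u0 x = 0" "AE x in lborel. x \<in> \<Omega> --> u0 x = u x"
    by (rule borel_representative[OF \<Omega>_borel in_Lp_measurable[OF lu(1)]]) blast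
  obtain G0 where G0: "G0 \<in> borel_measurable borel" "!!x. x \<notin> \<Omega> ==> G0 x = 0" "AE x in lborel. x \<in> \<Omega> --> G0 x = G x"
    by (rule borel_representative[OF \<Omega>_borel in_Lp_measurable[OF lu(2)]]) blast
  \<comment> \<open>A nonnegative Borel representative, so that the logarithm and the level sets
    belong to one function defined everywhere.\<close>
  define u1 where "u1 x = max 0 (u0 x)" for x
  note [measurable] = u0(1) G0(1)
  have u1m[measurable]: "u1 \<in> borel_measurable borel" unfolding u1_def by measurable
  have u1e: "AE x in lborel. x \<in> \<Omega> --> u1 x = u x"
    using u0(3) nu unfolding AE_lebesgue_on_iff[OF \<Omega>_borel] by eventually_elim (auto simp: u1_def)
  have u1n: "u1 x >= 0" for x by (simp add: u1_def)
  define Z where "Z = {y \<in> B. u1 y = 0}"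
  have Zm: "Z \<in> sets borel" unfolding Z_def by measurable
  have fin: "emeasure lborel A < \<infinity>" if "A \<subseteq> B" for A
  proof -
    have "bounded A" using that unfolding B_def by (meson bounded_ball bounded_subset)
    then show ?thesis by (rule emeasure_bounded_finite)
  qed
  have aeB: "(AE y in M. y \<in> ball x0 r --> Q (u y)) \<longleftrightarrow> (AE y in lborel. y \<in> B --> Q (u1 y))" for Q
    unfolding AE_lebesgue_on_iff[OF \<Omega>_borel]
  proof
    assume "AE y in lborel. y \<in> \<Omega> --> y \<in> ball x0 r --> Q (u y)"
    then show "AE y in lborel. y \<in> B --> Q (u1 y)" using u1e by eventually_elim (use B\<Omega> in \<open>auto simp: B_def\<close>)
  next
    assume "AE y in lborel. y \<in> B --> Q (u1 y)"
    then show "AE y in lborel. y \<in> \<Omega> --> y \<in> ball x0 r --> Q (u y)" using u1e by eventually_elim (auto simp: B_def)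
  qed
  have "(AE y in M. y \<in> ball x0 r --> u y = 0) \<or> (AE y in M. y \<in> ball x0 r --> u y ~= 0)"
  proof (cases "emeasure lborel Z = 0")
    case True
    then have "AE y in lborel. y \<notin> Z" using Zm by (intro AE_not_in) (simp add: null_sets_def)
    then have "AE y in lborel. y \<in> B --> u1 y ~= 0" by eventually_elim (auto simp: Z_def)
    then show ?thesis using aeB[of "%t. t ~= 0"] by blast
  next
    case False
    define K where "K = 2 * r * C * measure lborel (ball (0::'a) (2 * r))"
    have aeD: "AE y in lborel. y \<notin> {y \<in> B. u1 y >= 1 / real (Suc k)}" for k
    proof -
      define \<delta> where "\<delta> = 1 / real (Suc k)"
      have \<delta>: "\<delta> > 0" by (simp add: \<delta>_def)
      define D where "D = {y \<in> B. u1 y >= \<delta>}"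
      have Dm: "D \<in> sets borel" unfolding D_def by measurable
      have ineq: "measure lborel Z * measure lborel D * real n <= K" for n
      proof -
        define \<epsilon> where "\<epsilon> = \<delta> * exp (- real n)"
        have \<epsilon>: "\<epsilon> > 0" using \<delta> by (simp add: \<epsilon>_def)
        \<comment> \<open>For u >= 0, ln(1 + u/\<epsilon>) vanishes exactly where u does, so the
          Poincare inequality applies with the zero set of u; its gradient is the one bounded by
          \<open>C\<close> uniformly in \<epsilon>.\<close>
        let ?f = "%z::real \<times> real. ln (1 + fst z / \<epsilon>)" and ?f' = "%z::real \<times> real. (inverse (fst z + \<epsilon>), 0::real)"
        have "sob (%x. ?f (u x, u x)) (%x. fst (?f' (u x, u x)) *\<^sub>R G x + snd (?f' (u x, u x)) *\<^sub>R G x)"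
        proof (rule sob_chain[OF sobX_sob[OF Xu] sobX_sob[OF Xu], where C = "{z. fst z >= 0}" and L = "inverse \<epsilon>"])
          show "convex {z::real \<times> real. fst z >= 0}" by (rule convexI) auto
          show "AE x in M. (u x, u x) \<in> {z. fst z >= 0}" using nu by simp
          fix z :: "real \<times> real" assume z: "z \<in> {z. fst z >= 0}"
          have pos: "1 + fst z / \<epsilon> > 0" using z \<epsilon> by (simp add: add_pos_nonneg)
          have eq: "inverse (1 + fst z / \<epsilon>) * (t / \<epsilon>) = inverse (fst z + \<epsilon>) * t" for t
            using \<epsilon> z by (simp add: field_simps)
          have "(?f has_derivative (%d. inverse (1 + fst z / \<epsilon>) * (fst d / \<epsilon>))) (at z within {z. fst z >= 0})"
            using pos \<epsilon> by (auto intro!: derivative_eq_intros simp: fun_eq_iff field_simps)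
          then show "(?f has_derivative (%d. ?f' z \<bullet> d)) (at z within {z. fst z >= 0})"
            unfolding eq by (simp add: inner_prod_def)
          show "norm (?f' z) <= inverse \<epsilon>" using z \<epsilon> by (auto simp: norm_prod_def intro!: le_imp_inverse_le)
        next
          show "?f \<in> borel_measurable borel" unfolding borel_prod[symmetric] by measurable
          have "(%z::real \<times> real. inverse (fst z + \<epsilon>)) \<in> borel_measurable borel" unfolding borel_prod[symmetric] by measurable
          then show "?f' \<in> borel_measurable borel" by (intro borel_measurable_Pair borel_measurable_const)
        qed
        then have S: "sob (%x. ln (1 + u x / \<epsilon>)) (%x. inverse (u x + \<epsilon>) *\<^sub>R G x)" by simp
        define w where "w x = indicator \<Omega> x * ln (1 + u1 x / \<epsilon>)" for x
        define W where "W x = inverse (u1 x + \<epsilon>) *\<^sub>R G0 x" for x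
        have [measurable]: "\<Omega> \<in> sets borel" by (rule \<Omega>_borel)
        have wm[measurable]: "w \<in> borel_measurable borel" unfolding w_def by measurable
        have Wm[measurable]: "W \<in> borel_measurable borel" unfolding W_def by measurable
        have we: "AE x in lborel. x \<in> \<Omega> --> w x = ln (1 + u x / \<epsilon>)" using u1e by eventually_elim (auto simp: w_def)
        have We: "AE x in lborel. x \<in> \<Omega> --> W x = inverse (u x + \<epsilon>) *\<^sub>R G x"
          using u1e G0(3) by eventually_elim (auto simp: W_def)
        have w0: "w x = 0" "W x = 0" if "x \<notin> \<Omega>" for x using that G0(2) by (auto simp: w_def W_def)
        note S_int = in_Lp_integrable_M[OF sobD(1)[OF S]] in_Lp_integrable_M[OF sobD(2)[OF S]]
        have wd: "wderiv \<Omega> e w (%x. W x \<bullet> e)" for e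
          using has_weak_gradient_iff_wderiv[OF S_int wm w0(1) we Wm w0(2) We] sobD(3)[OF S] by blast
        have Wi: "integrable lborel W"
          using integrable_borel_representative[OF \<Omega>_borel Wm w0(2) We borel_measurable_integrable[OF S_int(2)]] S_int(2) by blast
        have "emeasure lborel Z * (\<integral>\<^sup>+ x. indicator B x * ennreal \<bar>w x\<bar> \<partial>lborel) \<le>
            ennreal (2 * r * (\<integral>x. indicator B x * norm (W x) \<partial>lborel) * measure lborel (ball (0::'a) (2 * r)))"
          by (rule poincare_zero_set[OF wd Wi B_def B\<Omega> r(1) Zm]) (auto simp: Z_def w_def)
        also have "\<dots> <= ennreal K"
        proof -
          have gm: "(%x. indicator B x * norm (inverse (u x + \<epsilon>) *\<^sub>R G x)) \<in> borel_measurable M"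
            by (rule borel_measurable_times[OF borel_measurable_lebesgue_onI[OF borel_measurable_indicator[OF Bm]]
                borel_measurable_integrable[OF integrable_norm[OF S_int(2)]]])
          have "(\<integral>x. indicator B x * norm (inverse (u x + \<epsilon>) *\<^sub>R G x) \<partial>M) = (\<integral>x. indicator B x * norm (W x) \<partial>lborel)"
            by (rule integral_borel_representative[OF \<Omega>_borel _ _ _ gm]) (use We w0 in \<open>auto elim: eventually_mono\<close>)
          then have "(\<integral>x. indicator B x * norm (W x) \<partial>lborel) <= C" using C[OF \<epsilon>] by (simp add: B_def)
          then show ?thesis unfolding K_def using r(1) by (intro ennreal_leI mult_right_mono mult_left_mono) auto
        qed
        finally have up: "emeasure lborel Z * (\<integral>\<^sup>+ x. indicator B x * ennreal \<bar>w x\<bar> \<partial>lborel) <= ennreal K" .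
        have "(\<integral>\<^sup>+ x. ennreal (real n) * indicator D x \<partial>lborel) <= (\<integral>\<^sup>+ x. indicator B x * ennreal \<bar>w x\<bar> \<partial>lborel)"
        proof (rule nn_integral_mono)
          fix x
          show "ennreal (real n) * indicator D x <= indicator B x * ennreal \<bar>w x\<bar>"
          proof (cases "x \<in> D")
            case True
            then have x: "x \<in> B" "u1 x >= \<delta>" by (auto simp: D_def)
            have "exp (real n) = \<delta> / \<epsilon>" using \<delta> by (simp add: \<epsilon>_def exp_minus field_simps)
            also have "\<dots> <= u1 x / \<epsilon>" using x(2) \<epsilon> by (intro divide_right_mono) auto
            also have "\<dots> <= 1 + u1 x / \<epsilon>" by simp
            finally have "real n <= ln (1 + u1 x / \<epsilon>)"
              by (subst ln_ge_iff) (use u1n[of x] \<epsilon> in \<open>auto intro: add_pos_nonneg\<close>)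
            also have "\<dots> = w x" using x(1) B\<Omega> by (auto simp: w_def)
            finally have "real n <= \<bar>w x\<bar>" by linarith
            then show ?thesis using True x(1) by (simp add: ennreal_leI)
          qed simp
        qed
        then have "ennreal (real n) * emeasure lborel D <= (\<integral>\<^sup>+ x. indicator B x * ennreal \<bar>w x\<bar> \<partial>lborel)"
          using Dm by (simp add: nn_integral_cmult_indicator)
        then have "emeasure lborel Z * (ennreal (real n) * emeasure lborel D) <= ennreal K"
          by (intro order_trans[OF mult_left_mono up] zero_le)
        moreover have "emeasure lborel Z = ennreal (measure lborel Z)" "emeasure lborel D = ennreal (measure lborel D)"
          using fin[of Z] fin[of D] by (auto simp: emeasure_eq_ennreal_measure Z_def D_def less_top)
        ultimately have "ennreal (measure lborel Z * (real n * measure lborel D)) <= ennreal K"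
          by (simp add: ennreal_mult)
        moreover have "K >= 0"
        proof -
          have "0 <= (\<integral>x. indicator (ball x0 r) x * norm (inverse (u x + 1) *\<^sub>R G x) \<partial>M)"
            by (intro B_integral_nonneg) auto
          then have "C >= 0" using C[of 1] by linarith
          then show ?thesis using r(1) by (simp add: K_def)
        qed
        ultimately show ?thesis by (simp add: mult_ac)
      qed
      \<comment> \<open>\<open>K\<close> does not depend on n, so the bound for all n leaves no
        positive value for the product.\<close>
      have "measure lborel Z * measure lborel D <= 0"
      proof (rule ccontr)
        assume "\<not> measure lborel Z * measure lborel D <= 0"
        then obtain n where "K < real n * (measure lborel Z * measure lborel D)"
          using reals_Archimedean3[of "measure lborel Z * measure lborel D"] by auto
        with ineq[of n] show False by (simp add: mult.commute)
      qed
      moreover have "measure lborel Z > 0"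
      proof -
        have "emeasure lborel Z = ennreal (measure lborel Z)"
          using fin[of Z] by (auto simp: emeasure_eq_ennreal_measure Z_def less_top)
        with False have "measure lborel Z ~= 0" by auto
        then show ?thesis by (simp add: zero_less_measure_iff)
      qed
      ultimately have "\<not> measure lborel D > 0" using mult_pos_pos[of "measure lborel Z" "measure lborel D"] by linarith
      then have "measure lborel D = 0" using measure_nonneg[of lborel D] by linarith
      moreover have "emeasure lborel D = ennreal (measure lborel D)"
        using fin[of D] by (auto simp: emeasure_eq_ennreal_measure D_def less_top)
      ultimately have "emeasure lborel D = 0" by simp
      then have "AE y in lborel. y \<notin> D" using Dm by (intro AE_not_in) (simp add: null_sets_def)
      then show ?thesis by (simp add: D_def \<delta>_def)
    qed
    have "AE y in lborel. \<forall>k. y \<notin> {y \<in> B. u1 y >= 1 / real (Suc k)}" unfolding AE_all_countable using aeD by blast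
    then have "AE y in lborel. y \<in> B --> u1 y = 0"
    proof eventually_elim
      case (elim y)
      show ?case
      proof (rule impI, rule ccontr)
        assume y: "y \<in> B" "u1 y ~= 0"
        then have "u1 y > 0" using u1n[of y] by simp
        then obtain k where "inverse (real (Suc k)) < u1 y" using reals_Archimedean by blast
        then show False using elim y(1) by (auto simp: inverse_eq_divide dest!: spec[of _ k])
      qed
    qed
    then show ?thesis using aeB[of "%t. t = 0"] by blast
  qed
  moreover have "ball x0 r \<subseteq> P" using BP by (simp add: B_def)
  ultimately show ?thesis using that r(1) by blast
qed

section \<open>From local to global positivity\<close>

text \<open>By the Lindelof property countably many members cover the union, so only countably many
  exceptional null sets occur.\<close>

lemma AE_Union_open:
  assumes "!!S. S \<in> \<F> ==> open S" "!!S. S \<in> \<F> ==> AE x in M. x \<in> S --> Q x"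
  shows "AE x in M. x \<in> \<Union>\<F> --> Q x"
proof -
  obtain \<G> where \<G>: "\<G> \<subseteq> \<F>" "countable \<G>" "\<Union>\<G> = \<Union>\<F>" using Lindelof[OF assms(1)] by metis
  have "AE x in M. \<forall>S\<in>\<G>. x \<in> S --> Q x" using \<G> assms(2) by (subst AE_ball_countable) auto
  then show ?thesis by eventually_elim (use \<G>(3) in blast)
qed

text \<open>The balls on which u vanishes and those on which it is nonzero almost everywhere cover P
  by two open sets; their overlap is open and null, hence empty, and connectedness leaves only one
  of them. If u vanished on P, then H(u), the integral of a u^q, would be nonpositive and u
  trivial.\<close>

lemma connected_imp_positive:
  assumes u: "solution u G" and nz: "\<not> (AE x in M. u x = 0)" and con: "connected P"
  shows "AE x in M. u x = 0 --> a x <= 0"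
proof -
  define F1 where "F1 = {ball x r |x r. r > 0 \<and> ball x r \<subseteq> P \<and> (AE y in M. y \<in> ball x r --> u y = 0)}"
  define F2 where "F2 = {ball x r |x r. r > 0 \<and> ball x r \<subseteq> P \<and> (AE y in M. y \<in> ball x r --> u y ~= 0)}"
  have ae1: "AE x in M. x \<in> \<Union>F1 --> u x = 0" by (rule AE_Union_open) (auto simp: F1_def)
  have ae2: "AE x in M. x \<in> \<Union>F2 --> u x ~= 0" by (rule AE_Union_open) (auto simp: F2_def)
  have op: "open (\<Union>F1)" "open (\<Union>F2)" by (auto simp: F1_def F2_def)
  have cover: "P \<subseteq> \<Union>F1 \<union> \<Union>F2"
  proof
    fix x assume "x \<in> P"
    then obtain r where "r > 0" "ball x r \<subseteq> P"
      "(AE y in M. y \<in> ball x r --> u y = 0) \<or> (AE y in M. y \<in> ball x r --> u y ~= 0)"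
      by (rule local_strong_maximum_principle[OF u])
    then have "ball x r \<in> F1 \<or> ball x r \<in> F2" "x \<in> ball x r" by (auto simp: F1_def F2_def)
    then show "x \<in> \<Union>F1 \<union> \<Union>F2" by blast
  qed
  have sub: "\<Union>F1 \<subseteq> P" "\<Union>F2 \<subseteq> P" by (auto simp: F1_def F2_def)
  have disj: "\<Union>F1 \<inter> \<Union>F2 = {}"
  proof (rule ccontr)
    assume ne: "\<Union>F1 \<inter> \<Union>F2 ~= {}"
    have "AE x in M. x \<notin> \<Union>F1 \<inter> \<Union>F2" using ae1 ae2 by eventually_elim blast
    then have "AE x in lborel. x \<notin> \<Union>F1 \<inter> \<Union>F2"
      unfolding AE_lebesgue_on_iff[OF \<Omega>_borel] by (rule eventually_mono) (use sub P_subset in blast)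
    then have "\<Union>F1 \<inter> \<Union>F2 \<in> null_sets lborel"
      by (subst AE_iff_null_sets) (use open_Int[OF op] in auto)
    then have "negligible (\<Union>F1 \<inter> \<Union>F2)" by (simp add: negligible_iff_null_sets null_sets_completionI)
    then show False using open_not_negligible[OF open_Int[OF op] ne] by blast
  qed
  have "\<Union>F1 \<inter> P = {} \<or> \<Union>F2 \<inter> P = {}"
    using connectedD[OF con op] disj cover by blast
  then show ?thesis
  proof
    assume "\<Union>F1 \<inter> P = {}"
    then have "P \<subseteq> \<Union>F2" using cover by blast
    have "AE x in M. x \<in> \<Omega>" by (rule AE_I2) simp
    with ae2 show ?thesis
    proof eventually_elim
      case (elim x)
      show ?case
      proof (rule impI, rule ccontr)
        assume x: "u x = 0" "\<not> a x <= 0"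
        then have "x \<in> P" using elim by (simp add: P_def)
        then show False using elim x(1) \<open>P \<subseteq> \<Union>F2\<close> by blast
      qed
    qed
  next
    assume "\<Union>F2 \<inter> P = {}"
    then have P1: "P \<subseteq> \<Union>F1" using cover by blast
    have Xu: "sobX bc u G" using u by (simp add: solution_def)
    note lu = sobXD[OF Xu]
    have "AE x in M. x \<in> \<Omega>" by (rule AE_I2) simp
    with ae1 have "AE x in M. a x * \<bar>u x\<bar> powr q <= 0"
    proof eventually_elim
      case (elim x)
      show ?case
      proof (cases "a x > 0")
        case True
        then have "x \<in> P" using elim by (simp add: P_def)
        then have "u x = 0" using elim P1 by blast
        then show ?thesis by simp
      next
        case False then show ?thesis by (intro mult_nonpos_nonneg) auto
      qed
    qed
    then have "(\<integral>x. a x * \<bar>u x\<bar> powr q \<partial>M) <= (\<integral>x. 0 \<partial>M)" by (intro integral_mono_AE integrable_aa lu) auto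
    then have "hh u G <= 0" using solution_hh_eq_aa[OF u] by (simp add: aa_def)
    then show ?thesis using hh_eq_0[OF lu] nz by blast
  qed
qed

end

section \<open>Convexity defects\<close>

text \<open>Young's inequality with exponent r between the midpoint c and each of x, y is the
  tangent inequality at c. Adding the two gives the claim, and equality in the sum forces c =
  x.\<close>

lemma power_mean:
  fixes x y r :: real
  assumes "r > 1" "x >= 0" "y >= 0"
  shows "((x + y) / 2) powr r <= (x powr r + y powr r) / 2"
    and "((x + y) / 2) powr r = (x powr r + y powr r) / 2 ==> x = y"
proof -
  define c where "c = (x + y) / 2"
  have c: "c >= 0" using assms by (simp add: c_def)
  have r: "r > 0" using assms by simp
  have yx: "c powr (r - 1) * x <= (r - 1) / r * c powr r + 1 / r * x powr r"
    using young_powr(1)[of 1 r c x] assms c by simp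
  have yy: "c powr (r - 1) * y <= (r - 1) / r * c powr r + 1 / r * y powr r"
    using young_powr(1)[of 1 r c y] assms c by simp
  have "c powr (r - 1) * c = c powr r" using c powr_mult_base[of c "r - 1"] by (cases "c = 0") (auto simp: mult.commute)
  then have s: "c powr (r - 1) * x + c powr (r - 1) * y = 2 * c powr r" by (simp add: c_def algebra_simps)
  have e: "(r - 1) / r * c powr r = c powr r - c powr r / r" using r by (simp add: field_simps)
  have "2 * c powr r / r <= (x powr r + y powr r) / r"
    using yx yy s unfolding e by (simp add: add_divide_distrib)
  then have "2 * c powr r <= x powr r + y powr r" using r by (simp add: divide_le_cancel)
  then show "((x + y) / 2) powr r <= (x powr r + y powr r) / 2" by (simp add: c_def)
  assume "((x + y) / 2) powr r = (x powr r + y powr r) / 2"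
  then have "x powr r + y powr r = 2 * c powr r" by (simp add: c_def)
  then have "1 / r * x powr r + 1 / r * y powr r = 2 * (c powr r / r)"
    by (simp add: add_divide_distrib[symmetric])
  then have "c powr (r - 1) * x = (r - 1) / r * c powr r + 1 / r * x powr r"
    using yx yy s unfolding e by linarith
  then have "c = x" using young_powr(2)[of 1 r c x] assms c by simp
  then show "x = y" by (simp add: c_def field_simps)
qed

lemma powr_eq_imp_eq:
  fixes x y r :: real
  assumes "r > 0" "x >= 0" "y >= 0" "x powr r = y powr r" shows "x = y"
  using powr_less_mono2[of r x y] powr_less_mono2[of r y x] assms by (cases x y rule: linorder_cases) auto

text \<open>In the equality case the power mean gives |a| = |b|, then |a + b| = 2 |a|, and the
  parallelogram law yields a = b.\<close>

lemma midpoint_norm_powr: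
  fixes a b :: "'a::real_inner"
  assumes "p > 1"
  shows "norm ((1 / 2) *\<^sub>R (a + b)) powr p <= (norm a powr p + norm b powr p) / 2"
    and "norm ((1 / 2) *\<^sub>R (a + b)) powr p = (norm a powr p + norm b powr p) / 2 ==> a = b"
proof -
  have n: "norm ((1 / 2) *\<^sub>R (a + b)) <= (norm a + norm b) / 2" using norm_triangle_ineq[of a b] by simp
  have 1: "norm ((1 / 2) *\<^sub>R (a + b)) powr p <= ((norm a + norm b) / 2) powr p"
    using n assms by (intro powr_mono2) auto
  have 2: "((norm a + norm b) / 2) powr p <= (norm a powr p + norm b powr p) / 2"
    by (rule power_mean(1)) (use assms in auto)
  from 1 2 show "norm ((1 / 2) *\<^sub>R (a + b)) powr p <= (norm a powr p + norm b powr p) / 2" by (rule order_trans)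
  assume eq: "norm ((1 / 2) *\<^sub>R (a + b)) powr p = (norm a powr p + norm b powr p) / 2"
  have "((norm a + norm b) / 2) powr p = (norm a powr p + norm b powr p) / 2" using 1 2 eq by linarith
  then have ab: "norm a = norm b" by (rule power_mean(2)[rotated -1]) (use assms in auto)
  have "norm ((1 / 2) *\<^sub>R (a + b)) powr p = norm a powr p" using eq ab by simp
  then have "norm ((1 / 2) *\<^sub>R (a + b)) = norm a" by (rule powr_eq_imp_eq[of p, rotated -1]) (use assms in auto)
  then have "norm (a + b) = 2 * norm a" by simp
  then have "(norm (a + b))\<^sup>2 = 4 * (norm a)\<^sup>2" by (simp add: power_mult_distrib)
  moreover have "(norm (a + b))\<^sup>2 + (norm (a - b))\<^sup>2 = 2 * (norm a)\<^sup>2 + 2 * (norm b)\<^sup>2"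
    by (simp add: power2_norm_eq_inner inner_add inner_diff inner_commute)
  ultimately have "(norm (a - b))\<^sup>2 = 0" using ab by simp
  then show "a = b" by simp
qed

text \<open>Compactness of the unit sphere turns strictness of a homogeneous defect \<open>D\<close> into a quantitative bound.\<close>

lemma homogeneous_domination:
  fixes K D :: "'b::euclidean_space => real"
  assumes cont: "continuous_on UNIV K" "continuous_on UNIV D" and p: "p > 0"
    and hom: "!!t z. t >= 0 ==> K (t *\<^sub>R z) = t powr p * K z" "!!t z. t >= 0 ==> D (t *\<^sub>R z) = t powr p * D z"
    and D: "!!z. D z >= 0" "!!z. D z = 0 ==> K z = 0" and \<eta>: "\<eta> > 0"
  obtains C where "C >= 0" "!!z. K z <= \<eta> * norm z powr p + C * D z"
proof -
  let ?S = "sphere (0::'b) 1"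
  have "\<exists>C\<ge>0. \<forall>z\<in>?S. K z <= \<eta> + C * D z"
  proof (cases "?S \<inter> K -` {\<eta>..} = {}")
    case True
    have "K z <= \<eta> + 0 * D z" if "z \<in> ?S" for z using True that by (auto simp: disjoint_iff not_le less_imp_le)
    then show ?thesis by blast
  next
    case False
    have cS: "compact ?S" by (rule compact_sphere)
    have contS: "continuous_on ?S K" using cont(1) continuous_on_subset by blast
    have "closed (K -` {\<eta>..})" using continuous_closed_vimage[of "{\<eta>..}" K] cont(1) by (auto simp: continuous_on_eq_continuous_at)
    then have c1: "compact (?S \<inter> K -` {\<eta>..})" by (rule compact_Int_closed[OF cS])
    have contD: "continuous_on (?S \<inter> K -` {\<eta>..}) D" using cont(2) continuous_on_subset by blast
    \<comment> \<open>The part of the sphere with K >= \<eta> is compact and contains no zero of D,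
      so D has a positive minimum there; the maximum of K divided by it is the constant.\<close>
    obtain z0 where z0: "z0 \<in> ?S" "K z0 >= \<eta>" "!!z. z \<in> ?S ==> K z >= \<eta> ==> D z0 <= D z"
      using continuous_attains_inf[OF c1 False contD] by auto
    have d0: "D z0 > 0" using D[of z0] z0(2) \<eta> by force
    obtain z1 where z1: "z1 \<in> ?S" "!!z. z \<in> ?S ==> K z <= K z1"
      using continuous_attains_sup[OF cS _ contS] False by (metis Int_empty_left)
    have k1: "K z1 >= 0" using z1(2)[OF z0(1)] z0(2) \<eta> by linarith
    have "K z <= \<eta> + K z1 / D z0 * D z" if z: "z \<in> ?S" for z
    proof (cases "K z >= \<eta>")
      case True
      have "K z1 / D z0 * D z0 <= K z1 / D z0 * D z" using z0(3)[OF z True] k1 d0 by (intro mult_left_mono) auto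
      then show ?thesis using z1(2)[OF z] d0 \<eta> by simp
    next
      case False
      have "0 <= K z1 / D z0 * D z" using k1 d0 D(1)[of z] by simp
      then show ?thesis using False by linarith
    qed
    then show ?thesis using k1 d0 by (intro exI[of _ "K z1 / D z0"]) simp
  qed
  then obtain C where C: "C >= 0" "!!z. z \<in> ?S ==> K z <= \<eta> + C * D z" by blast
  have "K z <= \<eta> * norm z powr p + C * D z" for z
  proof (cases "z = 0")
    case True
    then show ?thesis using hom(1)[of 0 0] D(1)[of 0] C(1) by simp
  next
    case False
    define w where "w = (1 / norm z) *\<^sub>R z"
    have w: "w \<in> ?S" "z = norm z *\<^sub>R w" using False by (auto simp: w_def)
    have "K z = norm z powr p * K w" "D z = norm z powr p * D w" using hom[of "norm z" w] w(2) by auto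
    moreover have "norm z powr p * K w <= norm z powr p * (\<eta> + C * D w)" using C(2)[OF w(1)] by (intro mult_left_mono) auto
    ultimately show ?thesis by (simp add: algebra_simps)
  qed
  with C(1) that show ?thesis by blast
qed

definition norm_defect :: "real => 'a::real_inner => 'a => real" where
  "norm_defect p a b = (norm a powr p + norm b powr p) / 2 - norm ((1 / 2) *\<^sub>R (a + b)) powr p"

text \<open>The Jensen gap of t^(p/q) at |s|^q and |t|^q: what the p-th power loses when s and t are
  replaced by their q-mean ((s^q + t^q)/2)^(1/q). Absolute values make it continuous and homogeneous
  on the whole plane.\<close>

definition mean_defect :: "real => real => real => real => real" where
  "mean_defect p q s t = (\<bar>s\<bar> powr p + \<bar>t\<bar> powr p) / 2 - ((\<bar>s\<bar> powr q + \<bar>t\<bar> powr q) / 2) powr (p / q)"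

lemma norm_Pair_powr_le:
  assumes "p >= 0"
  shows "norm (a, b) powr p <= 2 powr p * (norm a powr p + norm b powr p)"
  using powr_norm_add_le[OF assms, of "(a, 0)" "(0, b)"] by simp

text \<open>Quantitative uniform convexity: a small midpoint gap makes a and b close, up to an
  arbitrarily small multiple of their size.\<close>

lemma norm_defect_dominates:
  assumes p: "p > 1" and \<eta>: "\<eta> > 0"
  obtains C where "C >= 0"
    "!!a b :: 'a::euclidean_space. norm (a - b) powr p <= \<eta> * (norm a powr p + norm b powr p) + C * norm_defect p a b"
proof -
  let ?D = "%z::'a \<times> 'a. norm_defect p (fst z) (snd z)" and ?K = "%z::'a \<times> 'a. norm (fst z - snd z) powr p"
  have p0: "0 < \<eta> / 2 powr p" "p > 0" using \<eta> p by auto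
  \<comment> \<open>The division of \<eta> by 2^p pays for estimating the norm of the pair by the
    norms of its entries.\<close>
  obtain C where C: "C >= 0" "!!z. ?K z <= \<eta> / 2 powr p * norm z powr p + C * ?D z"
  proof (rule homogeneous_domination[where K = ?K and D = ?D and p = p and \<eta> = "\<eta> / 2 powr p"])
    show "continuous_on UNIV ?K" by (intro continuous_on_powr' continuous_intros) (use p in auto)
    show "continuous_on UNIV ?D" unfolding norm_defect_def by (intro continuous_on_powr' continuous_intros) (use p in auto)
    fix t :: real and z :: "'a \<times> 'a" assume t: "t >= 0"
    have "norm (fst (t *\<^sub>R z) - snd (t *\<^sub>R z)) = t * norm (fst z - snd z)"
      using t by (simp add: scaleR_diff_right[symmetric] del: scaleR_diff_right)
    then show "?K (t *\<^sub>R z) = t powr p * ?K z" using t by (simp add: powr_mult)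
    have "norm ((1 / 2) *\<^sub>R (fst (t *\<^sub>R z) + snd (t *\<^sub>R z))) = t * norm ((1 / 2) *\<^sub>R (fst z + snd z))"
      using t by (simp add: scaleR_add_right[symmetric] del: scaleR_add_right)
    then have "norm ((1 / 2) *\<^sub>R (fst (t *\<^sub>R z) + snd (t *\<^sub>R z))) powr p = t powr p * norm ((1 / 2) *\<^sub>R (fst z + snd z)) powr p"
      using t by (simp only: powr_mult)
    moreover have "norm (fst (t *\<^sub>R z)) powr p = t powr p * norm (fst z) powr p" "norm (snd (t *\<^sub>R z)) powr p = t powr p * norm (snd z) powr p"
      using t by (simp_all add: powr_mult)
    ultimately show "?D (t *\<^sub>R z) = t powr p * ?D z" unfolding norm_defect_def by (simp only:) (simp add: algebra_simps)
  next
    fix z :: "'a \<times> 'a"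
    show "?D z >= 0" using midpoint_norm_powr(1)[OF p, of "fst z" "snd z"] by (simp add: norm_defect_def)
    assume "?D z = 0"
    then have "fst z = snd z" by - (rule midpoint_norm_powr(2)[OF p], simp add: norm_defect_def)
    then show "?K z = 0" by simp
  qed (use p0 in auto)
  have "norm (a - b) powr p <= \<eta> * (norm a powr p + norm b powr p) + C * norm_defect p a b" for a b :: 'a
  proof -
    have "\<eta> / 2 powr p * norm (a, b) powr p <= \<eta> / 2 powr p * (2 powr p * (norm a powr p + norm b powr p))"
      using p0 by (intro mult_left_mono norm_Pair_powr_le) auto
    then show ?thesis using C(2)[of "(a, b)"] by simp
  qed
  with C(1) that show ?thesis by blast
qed

lemma mean_defect_nonneg:
  assumes q: "0 < q" "q < p"
  shows "mean_defect p q s t >= 0" and "mean_defect p q s t = 0 ==> \<bar>s\<bar> = \<bar>t\<bar>"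
proof -
  have r: "p / q > 1" using q by simp
  have e: "(\<bar>x\<bar> powr q) powr (p / q) = \<bar>x\<bar> powr p" for x :: real using q by (simp add: powr_powr)
  show "mean_defect p q s t >= 0"
    using power_mean(1)[OF r, of "\<bar>s\<bar> powr q" "\<bar>t\<bar> powr q"] by (simp add: mean_defect_def e)
  assume "mean_defect p q s t = 0"
  then have "\<bar>s\<bar> powr q = \<bar>t\<bar> powr q"
    by - (rule power_mean(2)[OF r], auto simp: mean_defect_def e)
  then show "\<bar>s\<bar> = \<bar>t\<bar>" by (rule powr_eq_imp_eq[of q, rotated -1]) (use q in auto)
qed

lemma continuous_on_mean_defect:
  assumes "0 < q" "q < p" shows "continuous_on UNIV (%z. mean_defect p q (fst z) (snd z))"
  unfolding mean_defect_def by (intro continuous_on_powr' continuous_intros) (use assms in auto)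

text \<open>The gap sees only absolute values, so the homogeneous argument is run for the difference
  of |s| and |t| and specialized to nonnegative s and t.\<close>

lemma mean_defect_dominates:
  assumes q: "0 < q" "q < p" and \<eta>: "\<eta> > 0"
  obtains C where "C >= 0"
    "!!s t. s >= 0 ==> t >= 0 ==> norm (s - t) powr p <= \<eta> * (norm s powr p + norm t powr p) + C * mean_defect p q s t"
proof -
  let ?D = "%z. mean_defect p q (fst z) (snd z)" and ?K = "%z::real \<times> real. \<bar>\<bar>fst z\<bar> - \<bar>snd z\<bar>\<bar> powr p"
  have p0: "0 < \<eta> / 2 powr p" "p > 0" using \<eta> q by auto
  obtain C where C: "C >= 0" "!!z. ?K z <= \<eta> / 2 powr p * norm z powr p + C * ?D z"
  proof (rule homogeneous_domination[where K = ?K and D = ?D and p = p and \<eta> = "\<eta> / 2 powr p"])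
    show "continuous_on UNIV ?K" by (intro continuous_on_powr' continuous_intros) (use q in auto)
    show "continuous_on UNIV ?D" by (rule continuous_on_mean_defect[OF q])
    fix t :: real and z :: "real \<times> real" assume t: "t >= 0"
    have "\<bar>\<bar>fst (t *\<^sub>R z)\<bar> - \<bar>snd (t *\<^sub>R z)\<bar>\<bar> = t * \<bar>\<bar>fst z\<bar> - \<bar>snd z\<bar>\<bar>"
      using t by (simp add: abs_mult right_diff_distrib[symmetric] del: right_diff_distrib)
    then show "?K (t *\<^sub>R z) = t powr p * ?K z" using t by (simp add: powr_mult)
    have one: "\<bar>t * x\<bar> powr e = t powr e * \<bar>x\<bar> powr e" for x e using t by (simp add: abs_mult powr_mult)
    have two: "((\<bar>t * x\<bar> powr q + \<bar>t * y\<bar> powr q) / 2) powr (p / q) = t powr p * ((\<bar>x\<bar> powr q + \<bar>y\<bar> powr q) / 2) powr (p / q)" for x y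
    proof -
      have "(\<bar>t * x\<bar> powr q + \<bar>t * y\<bar> powr q) / 2 = t powr q * ((\<bar>x\<bar> powr q + \<bar>y\<bar> powr q) / 2)"
        unfolding one by (simp add: distrib_left)
      then have "((\<bar>t * x\<bar> powr q + \<bar>t * y\<bar> powr q) / 2) powr (p / q) = (t powr q) powr (p / q) * ((\<bar>x\<bar> powr q + \<bar>y\<bar> powr q) / 2) powr (p / q)"
        by (simp only: powr_mult)
      also have "(t powr q) powr (p / q) = t powr p" using q by (simp add: powr_powr)
      finally show ?thesis .
    qed
    show "?D (t *\<^sub>R z) = t powr p * ?D z"
      unfolding mean_defect_def fst_scaleR snd_scaleR real_scaleR_def one[of _ p] two
      by (simp add: right_diff_distrib distrib_left)
  next
    fix z :: "real \<times> real"
    show "?D z >= 0" by (rule mean_defect_nonneg(1)[OF q])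
    assume "?D z = 0"
    then show "?K z = 0" using mean_defect_nonneg(2)[OF q] by simp
  qed (use p0 in auto)
  have "norm (s - t) powr p <= \<eta> * (norm s powr p + norm t powr p) + C * mean_defect p q s t" if st: "s >= 0" "t >= 0" for s t :: real
  proof -
    have "\<eta> / 2 powr p * norm (s, t) powr p <= \<eta> / 2 powr p * (2 powr p * (norm s powr p + norm t powr p))"
      using p0 by (intro mult_left_mono norm_Pair_powr_le) auto
    then show ?thesis using C(2)[of "(s, t)"] st by simp
  qed
  with C(1) that show ?thesis by blast
qed

text \<open>The integrals of the p-th powers are bounded, so \<eta> can be chosen to make its part
  of the domination at most e/2; this fixes C, and the gap then only has to be small relative to
  C.\<close>

lemma Cauchy_of_defect:
  fixes s :: "nat => 'a => 'b::{banach, second_countable_topology}"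
  assumes s: "!!n. in_Lp M p (s n)" and B: "!!n. (\<integral>x. norm (s n x) powr p \<partial>M) <= B" and p: "p > 0"
    and S: "!!n x. s n x \<in> S"
    and dom: "!!\<eta>. \<eta> > 0 ==> \<exists>C\<ge>0. \<forall>a\<in>S. \<forall>b\<in>S. norm (a - b) powr p <= \<eta> * (norm a powr p + norm b powr p) + C * D a b"
    and D: "!!m n. integrable M (%x. D (s m x) (s n x))"
    and lim: "!!e. e > 0 ==> \<exists>N. \<forall>m\<ge>N. \<forall>n\<ge>N. (\<integral>x. D (s m x) (s n x) \<partial>M) <= e"
    and e: "e > 0"
  shows "\<exists>N. \<forall>m\<ge>N. \<forall>n\<ge>N. (\<integral>x. norm (s m x - s n x) powr p \<partial>M) <= e"
proof -
  have B0: "B >= 0" by (rule order_trans[OF B_integral_nonneg B[of 0]]) simp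
  \<comment> \<open>Here \<open>B + 1\<close>, like \<open>C + 1\<close> below, keeps the
    denominator positive.\<close>
  define \<eta> where "\<eta> = e / (4 * (B + 1))"
  have \<eta>: "\<eta> > 0" using e B0 by (simp add: \<eta>_def)
  obtain C where C: "C >= 0" "!!a b. a \<in> S ==> b \<in> S ==> norm (a - b) powr p <= \<eta> * (norm a powr p + norm b powr p) + C * D a b"
    using dom[OF \<eta>] by blast
  have e2: "e / (2 * (C + 1)) > 0" using e C(1) by simp
  obtain N where N: "!!m n. m >= N ==> n >= N ==> (\<integral>x. D (s m x) (s n x) \<partial>M) <= e / (2 * (C + 1))"
    using lim[OF e2] by blast
  have "(\<integral>x. norm (s m x - s n x) powr p \<partial>M) <= e" if mn: "m >= N" "n >= N" for m n
  proof -
    note i = in_Lp_integrable[OF s]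
    have "(\<integral>x. norm (s m x - s n x) powr p \<partial>M) <= (\<integral>x. \<eta> * (norm (s m x) powr p + norm (s n x) powr p) + C * D (s m x) (s n x) \<partial>M)"
      by (intro B_integral_mono B_integrable_add integrable_mult_right i D C(2) S
          in_Lp_integrable[OF in_Lp_diff[OF s s]]) (use p in auto)
    also have "\<dots> = \<eta> * ((\<integral>x. norm (s m x) powr p \<partial>M) + (\<integral>x. norm (s n x) powr p \<partial>M)) + C * (\<integral>x. D (s m x) (s n x) \<partial>M)"
      using i D by simp
    also have "\<dots> <= \<eta> * (B + B) + C * (e / (2 * (C + 1)))"
      using \<eta> C(1) N[OF mn] B by (intro add_mono mult_left_mono) auto
    also have "\<eta> * (B + B) <= e / 2" using B0 e by (simp add: \<eta>_def field_simps)
    also have "C * (e / (2 * (C + 1))) <= e / 2" using C(1) e by (simp add: field_simps)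
    finally show ?thesis by simp
  qed
  then show ?thesis by blast
qed

text \<open>Hoelder's inequality with the weights \<open>\<alpha>, \<beta>\<close> normalized by \<open>\<alpha>\<^sup>q + \<beta>\<^sup>q = 2\<close>, and a power mean.\<close>

lemma hidden_convexity_pointwise:
  fixes \<alpha> \<beta> x y p q :: real
  assumes q: "1 < q" "q < p" and nn: "\<alpha> >= 0" "\<beta> >= 0" "x >= 0" "y >= 0" and ab: "\<alpha> powr q + \<beta> powr q = 2"
  shows "((\<alpha> powr (q - 1) * x + \<beta> powr (q - 1) * y) / 2) powr p <= (x powr p + y powr p) / 2"
proof (cases "x = 0 \<and> y = 0")
  case True then show ?thesis by simp
next
  case False
  \<comment> \<open>The q-mean of x and y. Dividing by it normalizes the pair as \<alpha> and
    \<beta> are, so the two Young bounds add up to exactly 2.\<close>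
  define \<rho> where "\<rho> = ((x powr q + y powr q) / 2) powr (1 / q)"
  have s: "x powr q + y powr q > 0" using False nn by (auto simp: add_pos_nonneg add_nonneg_pos)
  have \<rho>: "\<rho> > 0" using s by (simp add: \<rho>_def)
  have \<rho>q: "\<rho> powr q = (x powr q + y powr q) / 2" using q s by (simp add: \<rho>_def powr_powr)
  have yng: "\<alpha> powr (q - 1) * (x / \<rho>) <= (q - 1) / q * \<alpha> powr q + 1 / q * (x powr q / \<rho> powr q)"
    "\<beta> powr (q - 1) * (y / \<rho>) <= (q - 1) / q * \<beta> powr q + 1 / q * (y powr q / \<rho> powr q)"
    using young_powr(1)[of 1 q \<alpha> "x / \<rho>"] young_powr(1)[of 1 q \<beta> "y / \<rho>"] q nn \<rho> by (simp_all add: powr_divide)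
  have "(\<alpha> powr (q - 1) * x + \<beta> powr (q - 1) * y) / \<rho> \<le>
      (q - 1) / q * (\<alpha> powr q + \<beta> powr q) + 1 / q * ((x powr q + y powr q) / \<rho> powr q)"
    using add_mono[OF yng] by (simp add: algebra_simps add_divide_distrib)
  also have "(x powr q + y powr q) / \<rho> powr q = 2"
  proof -
    have "t / (t / 2) = 2" if "t > 0" for t :: real using that by simp
    from this[OF s] show ?thesis unfolding \<rho>q .
  qed
  also have "(q - 1) / q * (\<alpha> powr q + \<beta> powr q) + 1 / q * 2 = (q - 1) / q * 2 + 1 / q * 2" unfolding ab ..
  also have "\<dots> = 2" using q by (simp add: field_simps)
  finally have "(\<alpha> powr (q - 1) * x + \<beta> powr (q - 1) * y) / 2 <= \<rho>" using \<rho> by (simp add: pos_divide_le_eq)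
  then have "((\<alpha> powr (q - 1) * x + \<beta> powr (q - 1) * y) / 2) powr p <= \<rho> powr p" using q nn by (intro powr_mono2) auto
  also have "\<dots> = ((x powr q + y powr q) / 2) powr (p / q)" by (simp add: \<rho>_def powr_powr)
  also have "\<dots> <= ((x powr q) powr (p / q) + (y powr q) powr (p / q)) / 2" by (rule power_mean(1)) (use q in auto)
  also have "\<dots> = (x powr p + y powr p) / 2" using q by (simp add: powr_powr)
  finally show ?thesis .
qed

section \<open>Differentiation of power integrals\<close>

text \<open>Young's inequality is the tangent inequality of t^r; it replaces the mean value theorem
  and is valid up to 0.\<close>

lemma abs_powr_diff_le:
  fixes x y r :: real
  assumes "r > 1" "x >= 0" "y >= 0"
  shows "\<bar>x powr r - y powr r\<bar> <= r * max x y powr (r - 1) * \<bar>x - y\<bar>"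
proof -
  have *: "y powr r - x powr r <= r * max x y powr (r - 1) * \<bar>x - y\<bar>" if xy: "x >= 0" "y >= 0" for x y :: real
  proof -
    have "y powr (r - 1) * x <= (r - 1) / r * y powr r + 1 / r * x powr r"
      using young_powr(1)[of 1 r y x] assms(1) xy by simp
    then have "r * (y powr (r - 1) * x) <= r * ((r - 1) / r * y powr r + 1 / r * x powr r)"
      using assms(1) by (intro mult_left_mono) auto
    also have "\<dots> = (r - 1) * y powr r + x powr r" using assms(1) by (simp add: field_simps)
    finally have "r * (y powr (r - 1) * x) <= (r - 1) * y powr r + x powr r" .
    moreover have "y powr (r - 1) * y = y powr r" using xy powr_mult_base[of y "r - 1"] by (cases "y = 0") (auto simp: mult.commute)
    ultimately have "y powr r - x powr r <= r * y powr (r - 1) * (y - x)" by (simp add: algebra_simps)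
    also have "\<dots> <= r * y powr (r - 1) * \<bar>x - y\<bar>" using assms(1) by (intro mult_left_mono) auto
    also have "\<dots> <= r * max x y powr (r - 1) * \<bar>x - y\<bar>"
      using assms(1) xy by (intro mult_right_mono mult_left_mono powr_mono2) auto
    finally show ?thesis .
  qed
  show ?thesis using *[of x y] *[of y x] assms by (auto simp: abs_le_iff max.commute abs_minus_commute)
qed

text \<open>Away from 0 the norm is the power 1/2 of a quadratic polynomial in t. At g = 0 the
  difference quotient is of order |t|^(r-1) and tends to 0 because r > 1; the stated derivative is 0
  there as well, also for r < 2.\<close>

lemma norm_powr_has_derivative:
  fixes g k :: "'a::real_inner"
  assumes r: "r > 1"
  shows "((%t. norm (g + t *\<^sub>R k) powr r) has_real_derivative r * (norm g powr (r - 2) * (g \<bullet> k))) (at 0)"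
proof (cases "g = 0")
  case False
  have eq: "norm (g + t *\<^sub>R k) powr r = ((g + t *\<^sub>R k) \<bullet> (g + t *\<^sub>R k)) powr (r / 2)" for t
  proof -
    have "(g + t *\<^sub>R k) \<bullet> (g + t *\<^sub>R k) = norm (g + t *\<^sub>R k) powr 2" by (simp add: power2_norm_eq_inner)
    then show ?thesis by (simp only: powr_powr) simp
  qed
  have pos: "g \<bullet> g > 0" using False by simp
  have inner: "((%t. g \<bullet> g + 2 * t * (g \<bullet> k) + t * t * (k \<bullet> k)) has_real_derivative 2 * (g \<bullet> k)) (at 0)"
    by (auto intro!: derivative_eq_intros)
  have "((%t. (g \<bullet> g + 2 * t * (g \<bullet> k) + t * t * (k \<bullet> k)) powr (r / 2)) has_real_derivative
      (r / 2) * (g \<bullet> g) powr (r / 2 - 1) * (2 * (g \<bullet> k))) (at 0)"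
    using DERIV_fun_powr[OF inner, of "r / 2"] pos by simp
  moreover have "(g + t *\<^sub>R k) \<bullet> (g + t *\<^sub>R k) = g \<bullet> g + 2 * t * (g \<bullet> k) + t * t * (k \<bullet> k)" for t
    by (simp add: inner_add inner_commute algebra_simps)
  moreover have "(g \<bullet> g) powr (r / 2 - 1) = norm g powr (r - 2)"
  proof -
    have "g \<bullet> g = norm g powr 2" by (simp add: power2_norm_eq_inner)
    then have "(g \<bullet> g) powr (r / 2 - 1) = norm g powr (2 * (r / 2 - 1))" by (simp only: powr_powr)
    then show ?thesis by (simp add: right_diff_distrib)
  qed
  ultimately show ?thesis by (simp add: eq mult_ac)
next
  case True
  have "((%h::real. \<bar>h\<bar> powr (r - 1) * norm k powr r) \<longlongrightarrow> 0 powr (r - 1) * norm k powr r) (at 0)"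
    by (intro tendsto_mult_right tendsto_powr' tendsto_rabs_zero tendsto_ident_at tendsto_const) (use r in auto)
  then have z: "((%h::real. \<bar>h\<bar> powr (r - 1) * norm k powr r) \<longlongrightarrow> 0) (at 0)" by simp
  have "((%h. norm (h *\<^sub>R k) powr r / h) \<longlongrightarrow> 0) (at 0)"
  proof (rule Lim_null_comparison[OF _ z])
    show "\<forall>\<^sub>F h in at 0. norm (norm (h *\<^sub>R k) powr r / h) <= \<bar>h\<bar> powr (r - 1) * norm k powr r"
    proof (rule always_eventually, rule allI)
      fix h :: real
      show "norm (norm (h *\<^sub>R k) powr r / h) <= \<bar>h\<bar> powr (r - 1) * norm k powr r"
      proof (cases "h = 0")
        case False
        then have "\<bar>h\<bar> powr r = \<bar>h\<bar> powr (r - 1) * \<bar>h\<bar>" using powr_mult_base[of "\<bar>h\<bar>" "r - 1"] by (simp add: mult.commute)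
        then show ?thesis using False by (simp add: powr_mult abs_mult)
      qed simp
    qed
  qed
  then show ?thesis using True by (simp add: DERIV_def)
qed

text \<open>Only the steps 1/(n+1) are taken, enough for a one-sided first variation. The difference
  quotients are dominated by a multiple of (|g| + |k|)^r, integrable because r <= p.\<close>

lemma integral_powr_derivative:
  fixes g k :: "'a => 'b::euclidean_space"
  assumes M: "finite_measure M" and g: "in_Lp M p g" and k: "in_Lp M p k" and r: "1 < r" "r <= p"
    and c: "c \<in> borel_measurable M" "AE x in M. \<bar>c x\<bar> <= B"
  shows "(%n. ((\<integral>x. c x * norm (g x + (1 / real (Suc n)) *\<^sub>R k x) powr r \<partial>M) - (\<integral>x. c x * norm (g x) powr r \<partial>M)) * real (Suc n))
    \<longlonglongrightarrow> r * (\<integral>x. c x * (norm (g x) powr (r - 2) * (g x \<bullet> k x)) \<partial>M)"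
proof -
  note [measurable] = in_Lp_measurable[OF g] in_Lp_measurable[OF k] c(1)
  let ?t = "%n. 1 / real (Suc n)"
  let ?F = "%n x. (c x * norm (g x + ?t n *\<^sub>R k x) powr r - c x * norm (g x) powr r) * real (Suc n)"
  have p0: "p >= 0" using r by simp
  have ci: "integrable M (%x. c x * norm (f x) powr r)" if f: "in_Lp M p f" for f :: "'a => 'b"
  proof (rule B_integrable_bound)
    note [measurable] = in_Lp_measurable[OF f]
    show "integrable M (%x. B * norm (f x) powr r)" using integrable_powr_smaller[OF M f, of r] r by simp
    show "(%x. c x * norm (f x) powr r) \<in> borel_measurable M" by measurable
    show "AE x in M. norm (c x * norm (f x) powr r) <= norm (B * norm (f x) powr r)"
      using c(2) by eventually_elim (auto simp: abs_mult intro!: mult_right_mono)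
  qed
  have gk: "in_Lp M p (%x. g x + t *\<^sub>R k x)" for t by (intro in_Lp_add in_Lp_scale g k p0)
  have w: "in_Lp M p (%x. norm (g x) + norm (k x))" by (intro in_Lp_add in_Lp_norm g k p0)
  have "(%n. \<integral>x. ?F n x \<partial>M) \<longlonglongrightarrow> (\<integral>x. r * (c x * (norm (g x) powr (r - 2) * (g x \<bullet> k x))) \<partial>M)"
  proof (rule integral_dominated_convergence[where w = "%x. B * (r * norm (norm (g x) + norm (k x)) powr r)"])
    show "(%x. r * (c x * (norm (g x) powr (r - 2) * (g x \<bullet> k x)))) \<in> borel_measurable M" by measurable
    show "?F n \<in> borel_measurable M" for n by measurable
    show "integrable M (%x. B * (r * norm (norm (g x) + norm (k x)) powr r))"
      using integrable_powr_smaller[OF M w, of r] r by (intro integrable_mult_right) simp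
    show "AE x in M. (%n. ?F n x) \<longlonglongrightarrow> r * (c x * (norm (g x) powr (r - 2) * (g x \<bullet> k x)))"
    proof (rule AE_I2)
      fix x
      have "((%h. (norm (g x + h *\<^sub>R k x) powr r - norm (g x) powr r) / h) \<longlongrightarrow> r * (norm (g x) powr (r - 2) * (g x \<bullet> k x))) (at 0)"
        using norm_powr_has_derivative[OF r(1), of "g x" "k x"] by (simp add: DERIV_def)
      moreover have "filterlim ?t (at 0) sequentially"
        unfolding filterlim_at using LIMSEQ_Suc[OF lim_1_over_n] by auto
      ultimately have "(%n. (norm (g x + ?t n *\<^sub>R k x) powr r - norm (g x) powr r) / ?t n) \<longlonglongrightarrow> r * (norm (g x) powr (r - 2) * (g x \<bullet> k x))"
        by (rule filterlim_compose)
      then have "(%n. c x * ((norm (g x + ?t n *\<^sub>R k x) powr r - norm (g x) powr r) / ?t n)) \<longlonglongrightarrow> c x * (r * (norm (g x) powr (r - 2) * (g x \<bullet> k x)))"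
        by (rule tendsto_mult_left)
      then show "(%n. ?F n x) \<longlonglongrightarrow> r * (c x * (norm (g x) powr (r - 2) * (g x \<bullet> k x)))"
        by (simp add: algebra_simps)
    qed
    fix n
    show "AE x in M. norm (?F n x) <= B * (r * norm (norm (g x) + norm (k x)) powr r)"
      using c(2)
    proof eventually_elim
      case (elim x)
      let ?w = "norm (g x) + norm (k x)"
      have t: "0 < ?t n" "?t n <= 1" by auto
      have tk: "norm (?t n *\<^sub>R k x) = ?t n * norm (k x)" by simp
      have tk1: "?t n * norm (k x) <= norm (k x)" using mult_right_mono[OF t(2), of "norm (k x)"] by simp
      have le: "norm (g x + ?t n *\<^sub>R k x) <= ?w" using norm_triangle_ineq[of "g x" "?t n *\<^sub>R k x"] tk tk1 by linarith
      have d: "\<bar>norm (g x + ?t n *\<^sub>R k x) - norm (g x)\<bar> <= ?t n * norm (k x)"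
        using norm_triangle_ineq3[of "g x + ?t n *\<^sub>R k x" "g x"] tk by simp
      have "\<bar>norm (g x + ?t n *\<^sub>R k x) powr r - norm (g x) powr r\<bar> \<le>
          r * max (norm (g x + ?t n *\<^sub>R k x)) (norm (g x)) powr (r - 1) * \<bar>norm (g x + ?t n *\<^sub>R k x) - norm (g x)\<bar>"
        by (rule abs_powr_diff_le) (use r in auto)
      also have "\<dots> <= r * ?w powr (r - 1) * (?t n * ?w)"
      proof (rule mult_mono)
        show "r * max (norm (g x + ?t n *\<^sub>R k x)) (norm (g x)) powr (r - 1) <= r * ?w powr (r - 1)"
          using r le by (intro mult_left_mono powr_mono2) (auto simp: max_def)
        have "?t n * norm (k x) <= ?t n * ?w" using t by (intro mult_left_mono) auto
        then show "\<bar>norm (g x + ?t n *\<^sub>R k x) - norm (g x)\<bar> <= ?t n * ?w" using d by linarith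
      qed (use r in auto)
      also have "\<dots> = r * (?w powr (r - 1) * ?w) * ?t n" by simp
      also have "?w powr (r - 1) * ?w = ?w powr r"
        using powr_mult_base[of ?w "r - 1"] by (cases "?w = 0") (auto simp: mult.commute)
      finally have D: "\<bar>norm (g x + ?t n *\<^sub>R k x) powr r - norm (g x) powr r\<bar> <= r * ?w powr r * ?t n" .
      have "norm (?F n x) = \<bar>c x\<bar> * (\<bar>norm (g x + ?t n *\<^sub>R k x) powr r - norm (g x) powr r\<bar> * real (Suc n))"
        unfolding right_diff_distrib[symmetric] by (simp only: real_norm_def abs_mult abs_of_nat mult.assoc)
      also have "\<dots> <= B * (r * ?w powr r)"
      proof (rule mult_mono[OF elim])
        have "\<bar>norm (g x + ?t n *\<^sub>R k x) powr r - norm (g x) powr r\<bar> * real (Suc n) <= r * ?w powr r * ?t n * real (Suc n)"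
          using D by (rule mult_right_mono) simp
        then show "\<bar>norm (g x + ?t n *\<^sub>R k x) powr r - norm (g x) powr r\<bar> * real (Suc n) <= r * ?w powr r" by simp
      qed (use elim in auto)
      finally show ?case by simp
    qed
  qed
  moreover have "(\<integral>x. ?F n x \<partial>M) = ((\<integral>x. c x * norm (g x + ?t n *\<^sub>R k x) powr r \<partial>M) - (\<integral>x. c x * norm (g x) powr r \<partial>M)) * real (Suc n)" for n
    by (simp only: integral_mult_left_zero B_integral_diff[OF ci[OF gk] ci[OF g]])
  ultimately show ?thesis by simp
qed

section \<open>Existence of a minimizer\<close>

lemma tendsto_abs_powr:
  fixes f :: "'a => real"
  assumes "(f \<longlongrightarrow> c) F" "r > 0"
  shows "((%x. \<bar>f x\<bar> powr r) \<longlongrightarrow> \<bar>c\<bar> powr r) F"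
  by (rule tendsto_powr'[OF tendsto_rabs[OF assms(1)] tendsto_const]) (use assms(2) in auto)

lemma one_over_Suc_tendsto: "(%n. 1 / real (Suc n)) \<longlonglongrightarrow> 0"
  by (rule LIMSEQ_Suc[OF lim_1_over_n])

context elliptic_problem
begin

section \<open>Continuity, coercivity and negative values of the energy\<close>

definition ee :: "('a => real) => ('a => 'a) => real" where
  "ee u G = (1 / p) * hh u G - (1 / q) * aa u"

lemma hh_eq:
  assumes "in_Lp M p u" "in_Lp M p G"
  shows "hh u G = (\<integral>x. norm (G x) powr p \<partial>M) - l * (\<integral>x. \<bar>u x\<bar> powr p \<partial>M)"
proof -
  have i: "integrable M (%x. \<bar>u x\<bar> powr p)" using in_Lp_integrable[OF assms(1)] by simp
  show ?thesis unfolding hh_def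
    by (simp only: B_integral_diff[OF in_Lp_integrable[OF assms(2)] integrable_mult_right[OF i]] integral_mult_right_zero)
qed

lemma weighted_tendsto_dominated:
  fixes c w f :: "'a => real"
  assumes c: "c \<in> borel_measurable M" and s: "!!n. s n \<in> borel_measurable M" and f: "f \<in> borel_measurable M"
    and w: "integrable M (%x. c x * \<bar>w x\<bar> powr r)" and r: "r > 0"
    and lim: "AE x in M. (%n. s n x) \<longlonglongrightarrow> f x" and bd: "!!n. AE x in M. \<bar>s n x\<bar> <= \<bar>w x\<bar>"
  shows "(%n. \<integral>x. c x * \<bar>s n x\<bar> powr r \<partial>M) \<longlonglongrightarrow> (\<integral>x. c x * \<bar>f x\<bar> powr r \<partial>M)"
proof (rule integral_dominated_convergence[where w = "%x. norm (c x * \<bar>w x\<bar> powr r)"])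
  note [measurable] = c s f
  show "(%x. c x * \<bar>f x\<bar> powr r) \<in> borel_measurable M" by measurable
  show "(%x. c x * \<bar>s n x\<bar> powr r) \<in> borel_measurable M" for n by measurable
  show "integrable M (%x. norm (c x * \<bar>w x\<bar> powr r))" using w by (rule integrable_norm)
  show "AE x in M. (%n. c x * \<bar>s n x\<bar> powr r) \<longlonglongrightarrow> c x * \<bar>f x\<bar> powr r"
    using lim by eventually_elim (intro tendsto_mult_left tendsto_abs_powr r)
  show "AE x in M. norm (c x * \<bar>s n x\<bar> powr r) <= norm (c x * \<bar>w x\<bar> powr r)" for n
    using bd[of n] by eventually_elim (use r in \<open>auto simp: abs_mult intro!: mult_left_mono powr_mono2\<close>)
qed

text \<open>Convergence in Lp gives convergence almost everywhere only along subsequences, so the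
  claim is proved by contradiction, from a sequence converging to f whose values of
  \<open>aa\<close> stay away from \<open>aa f\<close>.\<close>

lemma aa_continuous:
  assumes f: "in_Lp M p f" and e: "e > 0"
  obtains d where "d > 0" "!!g. in_Lp M p g ==> (\<integral>x. norm (g x - f x) powr p \<partial>M) < d ==> \<bar>aa g - aa f\<bar> < e"
proof (rule ccontr)
  assume no: "\<not> thesis"
  have "\<exists>g. in_Lp M p g \<and> (\<integral>x. norm (g x - f x) powr p \<partial>M) < 1 / real (Suc n) \<and> \<not> \<bar>aa g - aa f\<bar> < e" for n
  proof (rule ccontr)
    assume "\<not> ?thesis"
    then have H: "!!g. in_Lp M p g ==> (\<integral>x. norm (g x - f x) powr p \<partial>M) < 1 / real (Suc n) ==> \<bar>aa g - aa f\<bar> < e" by blast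
    have pos: "0 < 1 / real (Suc n)" by simp
    have thesis by (rule that[OF pos]) (erule (1) H)
    with no show False by blast
  qed
  then have "\<exists>g. \<forall>n. in_Lp M p (g n) \<and> (\<integral>x. norm (g n x - f x) powr p \<partial>M) < 1 / real (Suc n) \<and> \<not> \<bar>aa (g n) - aa f\<bar> < e"
    by (intro choice allI)
  then obtain g where g: "!!n. in_Lp M p (g n)" "!!n. (\<integral>x. norm (g n x - f x) powr p \<partial>M) < 1 / real (Suc n)"
    "!!n. \<not> \<bar>aa (g n) - aa f\<bar> < e" by blast
  have lim: "Lp_lim M p g f"
    unfolding Lp_lim_def
    by (rule tendsto_sandwich[OF _ _ tendsto_const one_over_Suc_tendsto])
      (use g(2) in \<open>auto intro!: always_eventually B_integral_nonneg less_imp_le simp del: of_nat_Suc\<close>)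
  obtain r where r: "strict_mono r" "AE x in M. (%n. g (r n) x) \<longlonglongrightarrow> f x"
    by (rule Lp_lim_AE_subseq[OF g(1) f p_pos(1) lim])
  obtain A where A: "A > 0" "AE x in M. \<bar>a x\<bar> <= A" by (rule a_bounded)
  have gr: "AE x in M. \<bar>a x * \<bar>h x\<bar> powr q\<bar> <= (2 * A) * (1 + norm (h x) powr p)" for h :: "'a => real"
    using A(2)
  proof eventually_elim
    case (elim x)
    have "\<bar>h x\<bar> powr q <= 1 + \<bar>h x\<bar> powr p + 1"
      using powr_mult_powr_le[of "\<bar>h x\<bar>" 1 q 0 p] exponents by simp
    then have "\<bar>h x\<bar> powr q <= 2 * (1 + \<bar>h x\<bar> powr p)"
    proof -
      have "X <= 2 * (1 + Y)" if "X <= 1 + Y + 1" "Y >= 0" for X Y :: real using that by simp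
      from this[OF \<open>\<bar>h x\<bar> powr q <= 1 + \<bar>h x\<bar> powr p + 1\<close> powr_ge_zero] show ?thesis .
    qed
    then have "\<bar>a x\<bar> * \<bar>h x\<bar> powr q <= A * (2 * (1 + \<bar>h x\<bar> powr p))" using elim A(1) by (intro mult_mono) auto
    then show ?case by (simp add: abs_mult mult_ac)
  qed
  note [measurable] = a_measurable in_Lp_measurable[OF g(1)] in_Lp_measurable[OF f]
  have "(%n. \<integral>x. a x * \<bar>g (r n) x\<bar> powr q \<partial>M) \<longlonglongrightarrow> (\<integral>x. a x * \<bar>f x\<bar> powr q \<partial>M)"
  proof (rule integral_tendsto_Lp_growth[OF finite_M g(1) f p_pos(1) Lp_lim_subseq[OF lim r(1)] _ _ _ gr gr])
    show "AE x in M. (%n. a x * \<bar>g (r n) x\<bar> powr q) \<longlonglongrightarrow> a x * \<bar>f x\<bar> powr q"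
      using r(2) by eventually_elim (intro tendsto_mult_left tendsto_abs_powr exponents)
    show "0 <= 2 * A" using A(1) by simp
  qed measurable
  from LIMSEQ_D[OF this e] obtain n where "norm ((\<integral>x. a x * \<bar>g (r n) x\<bar> powr q \<partial>M) - (\<integral>x. a x * \<bar>f x\<bar> powr q \<partial>M)) < e" by blast
  then show False using g(3)[of "r n"] by (simp add: aa_def)
qed

text \<open>Half of the positive term -\<lambda>/p |u|^p absorbs the lower order term with |u|^q up
  to a constant. Thanks to \<lambda> < 0 no Poincare inequality enters, so the Neumann condition is
  covered.\<close>

lemma energy_coercive:
  obtains C where "!!u G. in_Lp M p u ==> in_Lp M p G ==> hh u G <= 2 * p * (ee u G + C)"
proof -
  obtain A where A: "A > 0" "AE x in M. \<bar>a x\<bar> <= A" by (rule a_bounded)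
  define \<kappa> where "\<kappa> = - l / (2 * p)"
  have \<kappa>: "\<kappa> > 0" using divide_neg_pos[of l "2 * p"] l_neg exponents by (simp add: \<kappa>_def)
  \<comment> \<open>The point where (A/q) t^q and \<kappa> t^p cross; beyond it the second
    dominates, and before it the first is at most \<open>c\<close>.\<close>
  define T where "T = (A / (q * \<kappa>)) powr (1 / (p - q))"
  define c where "c = A / q * T powr q"
  have T0: "A / (q * \<kappa>) > 0" using A \<kappa> exponents by simp
  have pt: "A / q * t powr q <= \<kappa> * t powr p + c" if t: "t >= 0" for t
  proof (cases "t <= T")
    case True
    have "A / q * t powr q <= c" unfolding c_def using True t A exponents by (intro mult_left_mono powr_mono2) auto
    moreover have "0 <= \<kappa> * t powr p" using \<kappa> by simp
    ultimately show ?thesis by linarith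
  next
    case False
    then have "T powr (p - q) <= t powr (p - q)" using exponents by (intro powr_mono2) (auto simp: T_def)
    moreover have "T powr (p - q) = A / (q * \<kappa>)" using A(1) \<kappa> exponents by (simp add: T_def powr_powr abs_mult)
    ultimately have "A / (q * \<kappa>) <= t powr (p - q)" by simp
    then have "A / q <= \<kappa> * t powr (p - q)" using \<kappa> exponents by (simp add: field_simps)
    then have "A / q * t powr q <= \<kappa> * t powr (p - q) * t powr q" by (intro mult_right_mono) auto
    also have "\<dots> = \<kappa> * t powr p" by (simp add: powr_add[symmetric])
    also have "\<dots> <= \<kappa> * t powr p + c" using A exponents by (simp add: c_def)
    finally show ?thesis .
  qed
  define m where "m = measure M (space M)"
  have const: "(\<integral>x. c \<partial>M) = c * m" by (simp add: m_def)
  have ic: "integrable M (%x. c)" by (rule finite_measure.integrable_const[OF finite_M])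
  have "hh u G <= 2 * p * (ee u G + c * m)" if uG: "in_Lp M p u" "in_Lp M p G" for u G
  proof -
    have iu: "integrable M (%x. \<bar>u x\<bar> powr p)" using in_Lp_integrable[OF uG(1)] by simp
    define X where "X = (\<integral>x. norm (G x) powr p \<partial>M)"
    define Y where "Y = (\<integral>x. \<bar>u x\<bar> powr p \<partial>M)"
    have X0: "X >= 0" unfolding X_def by (rule B_integral_nonneg) simp
    have "(1 / q) * aa u = (\<integral>x. (1 / q) * (a x * \<bar>u x\<bar> powr q) \<partial>M)" by (simp only: aa_def integral_mult_right_zero)
    also have "\<dots> <= (\<integral>x. \<kappa> * \<bar>u x\<bar> powr p + c \<partial>M)"
    proof (rule integral_mono_AE[OF integrable_mult_right[OF integrable_aa[OF uG(1)]] B_integrable_add[OF integrable_mult_right[OF iu] ic]])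
      show "AE x in M. (1 / q) * (a x * \<bar>u x\<bar> powr q) <= \<kappa> * \<bar>u x\<bar> powr p + c"
        using A(2)
      proof eventually_elim
        case (elim x)
        have "a x * \<bar>u x\<bar> powr q <= A * \<bar>u x\<bar> powr q" using elim by (intro mult_right_mono) auto
        then have "(1 / q) * (a x * \<bar>u x\<bar> powr q) <= (1 / q) * (A * \<bar>u x\<bar> powr q)" using exponents by (intro mult_left_mono) auto
        then show ?case using pt[of "\<bar>u x\<bar>"] by simp
      qed
    qed
    also have "\<dots> = \<kappa> * Y + c * m"
      by (simp only: B_integral_add[OF integrable_mult_right[OF iu] ic] const integral_mult_right_zero Y_def)
    finally have "ee u G + c * m >= (1 / p) * hh u G - \<kappa> * Y" by (simp add: ee_def)
    then have "2 * p * ((1 / p) * hh u G - \<kappa> * Y) <= 2 * p * (ee u G + c * m)" using exponents by (intro mult_left_mono) auto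
    moreover have "2 * p * ((1 / p) * hh u G - \<kappa> * Y) = 2 * hh u G + l * Y" using exponents by (simp add: \<kappa>_def field_simps)
    moreover have "hh u G = X - l * Y" unfolding X_def Y_def by (rule hh_eq[OF uG])
    ultimately show ?thesis using X0 by linarith
  qed
  then show ?thesis by (rule that)
qed

text \<open>On multiples t \<phi> of a cutoff supported in {a > 0} the energy is t^p H/p minus t^q
  times a positive constant, negative for small t because q < p.\<close>

lemma exists_negative_energy:
  assumes x0: "x0 \<in> P"
  shows "\<exists>\<phi> \<Phi>. sobX bc \<phi> \<Phi> \<and> ee \<phi> \<Phi> < 0"
proof -
  obtain \<phi> r \<kappa> K where \<phi>: "\<phi> \<in> test_functions P" "!!y. 0 <= \<phi> y" and r: "r > 0" "cball x0 r \<subseteq> P" and \<kappa>: "\<kappa> > 0"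
      "!!y. y \<in> ball x0 r ==> \<kappa> <= \<phi> y / (1 + \<phi> y)"
    and K: "!!y. norm (gradient \<phi> y) <= K * (\<phi> y / (1 + \<phi> y)) powr ((p - 1) / p)" "K >= 0"
    by (rule exists_cutoff[OF P_open x0 p_gt_1]) blast
  have X: "sobX bc \<phi> (gradient \<phi>)" by (rule sobX_test_function[OF test_functions_mono[OF \<phi>(1) P_subset]])
  note lX = sobXD[OF X]
  have aP: "a x > 0" if "\<phi> x ~= 0" for x
  proof -
    have "x \<in> closure {x. \<phi> x ~= 0}" using that closure_subset[of "{x. \<phi> x ~= 0}"] by blast
    then show ?thesis using test_functionsD(3)[OF \<phi>(1)] by (auto simp: P_def)
  qed
  have nn: "0 <= a x * \<bar>\<phi> x\<bar> powr q" for x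
  proof (cases "\<phi> x = 0")
    case False then show ?thesis using aP[OF False] by simp
  qed simp
  have "aa \<phi> ~= 0"
  proof
    assume "aa \<phi> = 0"
    then have "AE x in M. a x * \<bar>\<phi> x\<bar> powr q = 0"
      unfolding aa_def using integral_nonneg_eq_0_iff_AE[OF integrable_aa[OF lX(1)]] nn by simp
    then have "AE x in lborel. x \<notin> ball x0 r"
      unfolding AE_lebesgue_on_iff[OF \<Omega>_borel]
    proof eventually_elim
      case (elim x)
      show ?case
      proof
        assume xb: "x \<in> ball x0 r"
        then have "x \<in> P" using r(2) ball_subset_cball[of x0 r] by blast
        then have x: "x \<in> \<Omega>" "a x > 0" by (auto simp: P_def)
        have "\<phi> x ~= 0" using \<kappa>(1) \<kappa>(2)[OF xb] by auto
        then show False using elim x by simp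
      qed
    qed
    then have "ball x0 r \<in> null_sets lborel" by (subst AE_iff_null_sets) auto
    then have "negligible (ball x0 r)" by (simp add: negligible_iff_null_sets null_sets_completionI)
    then show False using open_not_negligible[of "ball x0 r"] r(1) by simp
  qed
  moreover have "aa \<phi> >= 0" unfolding aa_def by (rule B_integral_nonneg) (rule nn)
  ultimately have pos: "aa \<phi> > 0" by simp
  define h where "h = hh \<phi> (gradient \<phi>)"
  have h: "h >= 0" by (simp add: h_def hh_nonneg)
  \<comment> \<open>The value of t^(p-q). The summand 1 makes s h/p < aa \<phi> / q strict and
    covers h = 0.\<close>
  define s where "s = (aa \<phi> / q) / (h / p + 1)"
  have s: "s > 0" using pos h exponents by (simp add: s_def add_nonneg_pos)
  define t where "t = s powr (1 / (p - q))"
  have t: "t > 0" using s by (simp add: t_def)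
  have tpq: "t powr p = t powr q * s"
  proof -
    have "s = t powr (p - q)" using s exponents by (simp add: t_def powr_powr)
    then show ?thesis by (simp add: powr_add[symmetric])
  qed
  have "hh (%x. t * \<phi> x) (%x. t *\<^sub>R gradient \<phi> x) = (\<integral>x. t powr p * (norm (gradient \<phi> x) powr p - l * \<bar>\<phi> x\<bar> powr p) \<partial>M)"
    unfolding hh_def using t by (intro B_integral_cong) (auto simp: abs_mult powr_mult algebra_simps)
  then have H: "hh (%x. t * \<phi> x) (%x. t *\<^sub>R gradient \<phi> x) = t powr p * h" by (simp only: integral_mult_right_zero h_def hh_def)
  have "aa (%x. t * \<phi> x) = (\<integral>x. t powr q * (a x * \<bar>\<phi> x\<bar> powr q) \<partial>M)"
    unfolding aa_def using t by (intro B_integral_cong) (auto simp: abs_mult powr_mult algebra_simps)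
  then have A: "aa (%x. t * \<phi> x) = t powr q * aa \<phi>" by (simp only: integral_mult_right_zero aa_def)
  have "s * (h / p) < s * (h / p + 1)" using s by (intro mult_strict_left_mono) auto
  also have "\<dots> = aa \<phi> / q" using h exponents by (simp add: s_def add_nonneg_eq_0_iff)
  finally have "t powr q * (s * (h / p) - aa \<phi> / q) < 0" using t by (intro mult_pos_neg) auto
  then have "ee (%x. t * \<phi> x) (%x. t *\<^sub>R gradient \<phi> x) < 0" unfolding ee_def H A tpq by (simp add: algebra_simps)
  moreover have "sobX bc (%x. t * \<phi> x) (%x. t *\<^sub>R gradient \<phi> x)" using sobX_linear[OF X X, of t 0] by simp
  ultimately show ?thesis by blast
qed

section \<open>Strong convergence of minimizing sequences\<close>

text \<open>The infimum runs over the whole energy space, including functions that change sign, so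
  that every variation of a minimizer is a competitor.\<close>

definition min_energy :: real where
  "min_energy = Inf {ee u G |u G. sobX bc u G}"

lemma min_energy_le: assumes "sobX bc u G" shows "min_energy <= ee u G"
proof -
  obtain C where C: "!!u G. in_Lp M p u ==> in_Lp M p G ==> hh u G <= 2 * p * (ee u G + C)" by (rule energy_coercive) blast
  have "bdd_below {ee u G |u G. sobX bc u G}"
  proof (rule bdd_belowI[where m = "- C"])
    fix e assume "e \<in> {ee u G |u G. sobX bc u G}"
    then obtain u G where e: "e = ee u G" "sobX bc u G" by blast
    have "0 <= 2 * p * (e + C)" unfolding e(1) by (rule order_trans[OF hh_nonneg C[OF sobXD[OF e(2)]]])
    then show "- C <= e" using exponents by (simp add: zero_le_mult_iff)
  qed
  then show ?thesis unfolding min_energy_def using assms by (intro cInf_lower) auto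
qed

text \<open>The smoothed absolute value of w increases neither |w| nor the norm of its gradient, so
  H does not increase, again by \<lambda> < 0; the integral of a |w|^q is recovered only in the
  limit, which accounts for e.\<close>

lemma exists_nonneg_of_energy_le:
  assumes W: "sobX bc w W" and e: "e > 0"
  shows "\<exists>v V. sobX bc v V \<and> (\<forall>x. v x >= 0) \<and> ee v V <= ee w W + e"
proof -
  let ?\<epsilon> = "%k. 1 / real (Suc k)"
  define v where "v k x = sqrt ((w x)\<^sup>2 + (?\<epsilon> k)\<^sup>2) - ?\<epsilon> k" for k x
  define V where "V k x = (w x / sqrt ((w x)\<^sup>2 + (?\<epsilon> k)\<^sup>2)) *\<^sub>R W x" for k x
  have \<epsilon>: "?\<epsilon> k > 0" for k by simp
  have X: "sobX bc (v k) (V k)" for k unfolding v_def[abs_def] V_def[abs_def] by (rule sobX_smooth_abs[OF W \<epsilon>])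
  note lW = sobXD[OF W] and lX = sobXD[OF X]
  have v0: "v k x >= 0" for k x using smooth_abs_bounds(4)[OF \<epsilon>] by (simp add: v_def)
  have v1: "v k x <= \<bar>w x\<bar>" for k x using smooth_abs_bounds(3)[OF \<epsilon>, of "w x" k] by (simp add: v_def)
  have V1: "norm (V k x) <= norm (W x)" for k x
    using mult_right_mono[OF smooth_abs_bounds(5)[OF \<epsilon>, of "w x" k], of "norm (W x)"] by (simp add: V_def)
  have H: "hh (v k) (V k) <= hh w W" for k
    unfolding hh_def
  proof (rule integral_mono_AE[OF integrable_hh[OF lX] integrable_hh[OF lW]], rule AE_I2)
    fix x
    have "norm (V k x) powr p <= norm (W x) powr p" using V1 exponents by (intro powr_mono2) auto
    moreover have "\<bar>v k x\<bar> powr p <= \<bar>w x\<bar> powr p" using v0[of k x] v1[of k x] exponents by (intro powr_mono2) auto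
    then have "l * \<bar>w x\<bar> powr p <= l * \<bar>v k x\<bar> powr p" using l_neg by (intro mult_left_mono_neg) auto
    ultimately show "norm (V k x) powr p - l * \<bar>v k x\<bar> powr p <= norm (W x) powr p - l * \<bar>w x\<bar> powr p" by linarith
  qed
  have "(%k. \<integral>x. a x * \<bar>v k x\<bar> powr q \<partial>M) \<longlonglongrightarrow> (\<integral>x. a x * \<bar>\<bar>w x\<bar>\<bar> powr q \<partial>M)"
  proof (rule weighted_tendsto_dominated[OF a_measurable in_Lp_measurable[OF lX(1)] _ integrable_aa[OF lW(1)]])
    show "(%x. \<bar>w x\<bar>) \<in> borel_measurable M" using in_Lp_measurable[OF lW(1)] by measurable
    show "q > 0" using exponents by simp
    show "AE x in M. \<bar>v n x\<bar> <= \<bar>w x\<bar>" for n using v0 v1 by (intro AE_I2) (simp add: abs_of_nonneg)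
    have "(%k. v k x) \<longlonglongrightarrow> sqrt ((w x)\<^sup>2 + 0\<^sup>2) - 0" for x
      unfolding v_def by (intro tendsto_intros one_over_Suc_tendsto)
    then show "AE x in M. (%k. v k x) \<longlonglongrightarrow> \<bar>w x\<bar>" by simp
  qed
  then have "(%k. aa (v k)) \<longlonglongrightarrow> aa w" by (simp add: aa_def)
  from LIMSEQ_D[OF this, of "q * e"] obtain k where k: "\<bar>aa (v k) - aa w\<bar> < q * e" using e exponents by auto
  have "(1 / q) * (aa w - aa (v k)) <= (1 / q) * (q * e)" using k exponents by (intro mult_left_mono) auto
  moreover have "(1 / p) * hh (v k) (V k) <= (1 / p) * hh w W" using H exponents by (intro mult_left_mono) auto
  ultimately have "ee (v k) (V k) <= ee w W + e" using exponents by (simp add: ee_def right_diff_distrib)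
  with X v0 show ?thesis by blast
qed

lemma integrable_power_mean:
  assumes u: "in_Lp M p u" and v: "in_Lp M p v"
  shows "integrable M (%x. ((\<bar>u x\<bar> powr q + \<bar>v x\<bar> powr q) / 2) powr (p / q))"
proof (rule B_integrable_bound)
  note [measurable] = in_Lp_measurable[OF u] in_Lp_measurable[OF v]
  show "integrable M (%x. (\<bar>u x\<bar> powr p + \<bar>v x\<bar> powr p) / 2)"
    using in_Lp_integrable[OF u] in_Lp_integrable[OF v] by simp
  show "(%x. ((\<bar>u x\<bar> powr q + \<bar>v x\<bar> powr q) / 2) powr (p / q)) \<in> borel_measurable M" by measurable
  show "AE x in M. norm (((\<bar>u x\<bar> powr q + \<bar>v x\<bar> powr q) / 2) powr (p / q)) <= norm ((\<bar>u x\<bar> powr p + \<bar>v x\<bar> powr p) / 2)"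
  proof (rule AE_I2)
    fix x
    show "norm (((\<bar>u x\<bar> powr q + \<bar>v x\<bar> powr q) / 2) powr (p / q)) <= norm ((\<bar>u x\<bar> powr p + \<bar>v x\<bar> powr p) / 2)"
      using mean_defect_nonneg(1)[of q p "u x" "v x"] exponents q_less_p by (simp add: mean_defect_def)
  qed
qed

text \<open>The energy is convex along \<open>((u\<^sup>q + v\<^sup>q)/2)\<^sup>1\<^sup>/\<^sup>q\<close>; the shift by \<open>\<epsilon>\<close> makes the nonlinearity smooth.\<close>

lemma hidden_convexity:
  assumes u: "sobX bc u G" and v: "sobX bc v V" and nn: "!!x. u x >= 0" "!!x. v x >= 0"
  shows "- l / p * (\<integral>x. mean_defect p q (u x) (v x) \<partial>M) <= (ee u G + ee v V) / 2 - min_energy"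
proof -
  note lu = sobXD[OF u] and lv = sobXD[OF v]
  note iG = in_Lp_integrable[OF lu(2)] and iV = in_Lp_integrable[OF lv(2)]
  have iu: "integrable M (%x. \<bar>u x\<bar> powr p)" and iv: "integrable M (%x. \<bar>v x\<bar> powr p)"
    using in_Lp_integrable[OF lu(1)] in_Lp_integrable[OF lv(1)] by auto
  note [measurable] = in_Lp_measurable[OF lu(1)] in_Lp_measurable[OF lv(1)]
  define R where "R e s t = ((s + e) powr q + (t + e) powr q) / 2" for e s t :: real
  \<comment> \<open>Subtracting e makes the shifted q-mean vanish at u = v = 0, as the Dirichlet
    condition demands.\<close>
  define F where "F e x = R e (u x) (v x) powr (1 / q) - e" for e x
  define F0 where "F0 x = R 0 (u x) (v x) powr (1 / q)" for x
  have step: "min_energy <= (1 / p) * (((\<integral>x. norm (G x) powr p \<partial>M) + (\<integral>x. norm (V x) powr p \<partial>M)) / 2 - l * (\<integral>x. \<bar>F e x\<bar> powr p \<partial>M)) - (1 / q) * aa (F e)"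
    and F: "!!x. \<bar>F e x\<bar> <= \<bar>u x + v x\<bar>" and Fm: "F e \<in> borel_measurable M" if e: "e > 0" for e
  proof -
    define C where "C = {z::real \<times> real. fst z >= 0 \<and> snd z >= 0}"
    define f where "f z = R e (fst z) (snd z) powr (1 / q) - e" for z
    define f1 where "f1 s t = (1 / 2) * ((s + e) powr (q - 1) * R e s t powr (1 / q - 1))" for s t
    define f' where "f' z = (f1 (fst z) (snd z), f1 (snd z) (fst z))" for z
    have Rsym: "R e s t = R e t s" for s t by (simp add: R_def add.commute)
    have Rpos: "R e s t > 0" if "s >= 0" "t >= 0" for s t
      using that e by (simp add: R_def add_pos_pos)
    \<comment> \<open>The partial derivatives of the shifted q-mean are \<alpha>^(q-1)/2, and the
      weights of the two arguments satisfy the normalization \<alpha>^q + \<beta>^q = 2 of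
      \<open>hidden_convexity_pointwise\<close>.\<close>
    define \<alpha> where "\<alpha> s t = (s + e) / R e s t powr (1 / q)" for s t
    have al: "\<alpha> s t >= 0" "\<alpha> s t powr q + \<alpha> t s powr q = 2" "f1 s t = \<alpha> s t powr (q - 1) / 2" if st: "s >= 0" "t >= 0" for s t
    proof -
      have Rq: "(R e s t powr (1 / q)) powr q = R e s t" using Rpos[OF st] exponents by (simp add: powr_powr)
      show "\<alpha> s t >= 0" using st e by (simp add: \<alpha>_def)
      have "((s + e) / R e s t powr (1 / q)) powr q = (s + e) powr q / R e s t"
        "((t + e) / R e s t powr (1 / q)) powr q = (t + e) powr q / R e s t"
        by (subst powr_divide, use st e in \<open>auto simp: Rq\<close>)+
      then have "\<alpha> s t powr q + \<alpha> t s powr q = ((s + e) powr q + (t + e) powr q) / R e s t"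
        unfolding \<alpha>_def Rsym[of t s] by (simp only: add_divide_distrib)
      also have "(s + e) powr q + (t + e) powr q = 2 * R e s t" by (simp add: R_def)
      finally show "\<alpha> s t powr q + \<alpha> t s powr q = 2" using Rpos[OF st] by simp
      have "(R e s t powr (1 / q)) powr (q - 1) = R e s t powr (1 - 1 / q)"
        using exponents by (simp add: powr_powr right_diff_distrib)
      then show "f1 s t = \<alpha> s t powr (q - 1) / 2"
        using st e by (simp add: f1_def \<alpha>_def powr_divide powr_minus_divide[of _ "1 - 1 / q", simplified])
    qed
    have f1b: "0 <= f1 s t" "f1 s t <= 1" if st: "s >= 0" "t >= 0" for s t
    proof -
      show "0 <= f1 s t" by (simp add: f1_def)
      have "\<alpha> s t powr q <= 2" using al(2)[OF st] powr_ge_zero[of "\<alpha> t s" q] by linarith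
      then have "\<alpha> s t powr (q - 1) <= 2"
      proof (cases "\<alpha> s t <= 1")
        case True
        have "\<alpha> s t powr (q - 1) <= 1 powr (q - 1)" using True al(1)[OF st] exponents by (intro powr_mono2) auto
        then show ?thesis by simp
      next
        case False
        then have "\<alpha> s t powr (q - 1) <= \<alpha> s t powr q" by (intro powr_mono) auto
        then show ?thesis using \<open>\<alpha> s t powr q <= 2\<close> by linarith
      qed
      then show "f1 s t <= 1" using al(3)[OF st] by simp
    qed
    have X: "sobX bc (%x. f (u x, v x)) (%x. fst (f' (u x, v x)) *\<^sub>R G x + snd (f' (u x, v x)) *\<^sub>R V x)"
    proof (rule sobX_chain_nonneg[OF u v, where L = 2])
      show "AE x in M. u x >= 0" "AE x in M. v x >= 0" using nn by auto
      show "(f has_derivative (%d. f' z \<bullet> d)) (at z within {z. fst z >= 0 \<and> snd z >= 0})" if z: "z \<in> {z. fst z >= 0 \<and> snd z >= 0}" for z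
      proof -
        have p1: "fst z + e > 0" "snd z + e > 0" "R e (fst z) (snd z) > 0" using z e Rpos by auto
        let ?S = "{z::real \<times> real. fst z >= 0 \<and> snd z >= 0}"
        have d1: "((%z. (fst z + e) powr q) has_derivative (%d. fst d * (q * (fst z + e) powr (q - 1)))) (at z within ?S)"
          by (rule DERIV_compose_FDERIV[where g = "%z. fst z + e", OF has_real_derivative_powr[OF p1(1)]]) (auto intro!: derivative_eq_intros)
        have d2: "((%z. (snd z + e) powr q) has_derivative (%d. snd d * (q * (snd z + e) powr (q - 1)))) (at z within ?S)"
          by (rule DERIV_compose_FDERIV[where g = "%z. snd z + e", OF has_real_derivative_powr[OF p1(2)]]) (auto intro!: derivative_eq_intros)
        have d3: "((%z. R e (fst z) (snd z)) has_derivative (%d. (1 / 2) * (fst d * (q * (fst z + e) powr (q - 1)) + snd d * (q * (snd z + e) powr (q - 1))))) (at z within ?S)"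
          unfolding R_def using has_derivative_mult_right[OF has_derivative_add[OF d1 d2], of "1 / 2"] by simp
        have d4: "((%z. R e (fst z) (snd z) powr (1 / q)) has_derivative
            (%d. ((1 / 2) * (fst d * (q * (fst z + e) powr (q - 1)) + snd d * (q * (snd z + e) powr (q - 1)))) * (1 / q * R e (fst z) (snd z) powr (1 / q - 1)))) (at z within ?S)"
          by (rule DERIV_compose_FDERIV[where g = "%z. R e (fst z) (snd z)", OF has_real_derivative_powr[OF p1(3)] d3])
        have eq: "((1 / 2) * (fst d * (q * (fst z + e) powr (q - 1)) + snd d * (q * (snd z + e) powr (q - 1)))) * (1 / q * R e (fst z) (snd z) powr (1 / q - 1)) = f' z \<bullet> d" for d
          using exponents by (simp add: f'_def f1_def inner_prod_def Rsym[of "snd z" "fst z"] field_simps)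
        show ?thesis unfolding f_def[abs_def] using has_derivative_diff[OF d4 has_derivative_const[of e]] unfolding eq by simp
      qed
      show "norm (f' z) <= 2" if z: "z \<in> {z. fst z >= 0 \<and> snd z >= 0}" for z
      proof -
        have "norm (f' z) <= \<bar>f1 (fst z) (snd z)\<bar> + \<bar>f1 (snd z) (fst z)\<bar>"
          unfolding f'_def norm_prod_def by (simp add: sqrt_sum_squares_le_sum_abs)
        then show ?thesis using f1b[of "fst z" "snd z"] f1b[of "snd z" "fst z"] z by auto
      qed
      have ct: "continuous_on {z. fst z >= 0 \<and> snd z >= 0} (%z::real \<times> real. (fst z + e) powr (q - 1))"
        "continuous_on {z. fst z >= 0 \<and> snd z >= 0} (%z::real \<times> real. (snd z + e) powr (q - 1))"
        "continuous_on {z. fst z >= 0 \<and> snd z >= 0} (%z::real \<times> real. (fst z + e) powr q)"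
        "continuous_on {z. fst z >= 0 \<and> snd z >= 0} (%z::real \<times> real. (snd z + e) powr q)"
        using e by (auto intro!: continuous_intros)
      have "continuous_on {z. fst z >= 0 \<and> snd z >= 0} (%z. R e (fst z) (snd z))"
        unfolding R_def by (intro continuous_on_divide continuous_on_add ct continuous_on_const) simp
      then have cR: "continuous_on {z. fst z >= 0 \<and> snd z >= 0} (%z. R e (fst z) (snd z) powr (1 / q - 1))"
        by (rule continuous_on_powr[OF _ continuous_on_const]) (use Rpos in force)
      show "continuous_on {z. fst z >= 0 \<and> snd z >= 0} f'"
        unfolding f'_def f1_def Rsym[of "snd _" "fst _"] by (intro continuous_on_Pair continuous_on_mult continuous_on_const ct cR)
      show "f \<in> borel_measurable borel" unfolding f_def[abs_def] R_def borel_prod[symmetric] by measurable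
      have "(%z. f1 (fst z) (snd z)) \<in> borel_measurable borel" "(%z. f1 (snd z) (fst z)) \<in> borel_measurable borel"
        unfolding f1_def R_def borel_prod[symmetric] by measurable
      then show "f' \<in> borel_measurable borel" unfolding f'_def[abs_def] by (intro borel_measurable_Pair)
      show "smooth_on UNIV (%x::'a. f (\<phi> x, \<psi> x))"
        if s: "smooth_on UNIV \<phi>" "smooth_on UNIV \<psi>" "!!x. \<phi> x >= 0" "!!x. \<psi> x >= 0" for \<phi> \<psi>
      proof -
        have "\<phi> x + e > 0" "\<psi> x + e > 0" "(1 / 2) * ((\<phi> x + e) powr q + (\<psi> x + e) powr q) > 0" for x
          using s(3,4)[of x] e by (auto intro: add_pos_pos add_nonneg_pos)
        then have "smooth_on UNIV (%x. ((1 / 2) * ((\<phi> x + e) powr q + (\<psi> x + e) powr q)) powr (1 / q) + (- e))"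
          by (intro smooth_on_add smooth_on_powr smooth_on_mult smooth_on_const s(1,2))
        then show ?thesis by (simp add: f_def R_def)
      qed
      show "f (0, 0) = 0" using e exponents by (simp add: f_def R_def powr_powr)
    qed
    have fF: "(%x. f (u x, v x)) = F e" by (simp add: fun_eq_iff f_def F_def)
    let ?W = "%x. f1 (u x) (v x) *\<^sub>R G x + f1 (v x) (u x) *\<^sub>R V x"
    have XF: "sobX bc (F e) ?W" using X unfolding fF by (simp add: f'_def)
    note lF = sobXD[OF XF]
    show "F e \<in> borel_measurable M" by (rule in_Lp_measurable[OF lF(1)])
    show "\<bar>F e x\<bar> <= \<bar>u x + v x\<bar>" for x
    proof -
      have uv: "u x >= 0" "v x >= 0" using nn by auto
      have "e powr q <= R e (u x) (v x)"
      proof -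
        have "e powr q <= (u x + e) powr q" "e powr q <= (v x + e) powr q" using uv e exponents by (auto intro!: powr_mono2)
        then show ?thesis by (simp add: R_def)
      qed
      then have "(e powr q) powr (1 / q) <= R e (u x) (v x) powr (1 / q)" using exponents by (intro powr_mono2) auto
      then have lo: "F e x >= 0" using e exponents by (simp add: F_def powr_powr)
      have "R e (u x) (v x) <= (u x + v x + e) powr q"
      proof -
        have "(u x + e) powr q <= (u x + v x + e) powr q" "(v x + e) powr q <= (u x + v x + e) powr q" using uv e exponents by (auto intro!: powr_mono2)
        then show ?thesis by (simp add: R_def)
      qed
      then have "R e (u x) (v x) powr (1 / q) <= ((u x + v x + e) powr q) powr (1 / q)" using exponents Rpos[OF uv] by (intro powr_mono2) auto
      then have "F e x <= u x + v x" using uv e exponents by (simp add: F_def powr_powr)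
      then show ?thesis using lo by linarith
    qed
    have "(\<integral>x. norm (?W x) powr p \<partial>M) <= (\<integral>x. (norm (G x) powr p + norm (V x) powr p) / 2 \<partial>M)"
    proof (rule B_integral_mono[OF in_Lp_integrable[OF lF(2)]])
      show "integrable M (%x. (norm (G x) powr p + norm (V x) powr p) / 2)" using iG iV by simp
      fix x
      have uv: "u x >= 0" "v x >= 0" using nn by auto
      have "norm (?W x) <= f1 (u x) (v x) * norm (G x) + f1 (v x) (u x) * norm (V x)"
        using norm_triangle_ineq[of "f1 (u x) (v x) *\<^sub>R G x" "f1 (v x) (u x) *\<^sub>R V x"] f1b(1)[OF uv] f1b(1)[OF uv(2,1)] by simp
      also have "\<dots> = (\<alpha> (u x) (v x) powr (q - 1) * norm (G x) + \<alpha> (v x) (u x) powr (q - 1) * norm (V x)) / 2"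
        unfolding al(3)[OF uv] al(3)[OF uv(2,1)] by (simp add: add_divide_distrib)
      finally have "norm (?W x) powr p <= ((\<alpha> (u x) (v x) powr (q - 1) * norm (G x) + \<alpha> (v x) (u x) powr (q - 1) * norm (V x)) / 2) powr p"
        using exponents by (intro powr_mono2) auto
      also have "\<dots> <= (norm (G x) powr p + norm (V x) powr p) / 2"
        by (rule hidden_convexity_pointwise[OF q_gt_1 q_less_p al(1)[OF uv] al(1)[OF uv(2,1)] norm_ge_zero norm_ge_zero al(2)[OF uv]])
      finally show "norm (?W x) powr p <= (norm (G x) powr p + norm (V x) powr p) / 2" .
    qed
    also have "\<dots> = ((\<integral>x. norm (G x) powr p \<partial>M) + (\<integral>x. norm (V x) powr p \<partial>M)) / 2" using iG iV by simp
    finally have "hh (F e) ?W <= ((\<integral>x. norm (G x) powr p \<partial>M) + (\<integral>x. norm (V x) powr p \<partial>M)) / 2 - l * (\<integral>x. \<bar>F e x\<bar> powr p \<partial>M)"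
      unfolding hh_eq[OF lF] by simp
    then have "(1 / p) * hh (F e) ?W <= (1 / p) * (((\<integral>x. norm (G x) powr p \<partial>M) + (\<integral>x. norm (V x) powr p \<partial>M)) / 2 - l * (\<integral>x. \<bar>F e x\<bar> powr p \<partial>M))"
      using exponents by (intro mult_left_mono) auto
    then show "min_energy <= (1 / p) * (((\<integral>x. norm (G x) powr p \<partial>M) + (\<integral>x. norm (V x) powr p \<partial>M)) / 2 - l * (\<integral>x. \<bar>F e x\<bar> powr p \<partial>M)) - (1 / q) * aa (F e)"
      using min_energy_le[OF XF] unfolding ee_def by linarith
  qed
  let ?\<epsilon> = "%k. 1 / real (Suc k)"
  have \<epsilon>: "?\<epsilon> k > 0" for k by simp
  have w: "in_Lp M p (%x. u x + v x)" by (rule in_Lp_add[OF lu(1) lv(1) exponents(6)])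
  have F0m: "F0 \<in> borel_measurable M" unfolding F0_def[abs_def] R_def by measurable
  have lim: "(%k. F (?\<epsilon> k) x) \<longlonglongrightarrow> F0 x" for x
  proof -
    have 1: "(%k. (s + ?\<epsilon> k) powr q) \<longlonglongrightarrow> (s + 0) powr q" if "s >= 0" for s
      by (rule tendsto_powr'[OF tendsto_add[OF tendsto_const one_over_Suc_tendsto] tendsto_const])
        (use that exponents in \<open>auto intro!: always_eventually\<close>)
    have 2: "(%k. R (?\<epsilon> k) (u x) (v x)) \<longlonglongrightarrow> R 0 (u x) (v x)"
      unfolding R_def by (intro tendsto_divide tendsto_add 1 tendsto_const nn) simp
    have "(%k. R (?\<epsilon> k) (u x) (v x) powr (1 / q)) \<longlonglongrightarrow> R 0 (u x) (v x) powr (1 / q)"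
      by (rule tendsto_powr'[OF 2 tendsto_const]) (use exponents in \<open>auto intro!: always_eventually simp: R_def\<close>)
    from tendsto_diff[OF this one_over_Suc_tendsto] show ?thesis by (simp add: F_def F0_def)
  qed
  have l1: "(%k. \<integral>x. \<bar>F (?\<epsilon> k) x\<bar> powr p \<partial>M) \<longlonglongrightarrow> (\<integral>x. \<bar>F0 x\<bar> powr p \<partial>M)"
    using weighted_tendsto_dominated[of "%x. 1" "%k. F (?\<epsilon> k)" F0 "%x. u x + v x" p] Fm[OF \<epsilon>] F0m in_Lp_integrable[OF w] exponents lim F[OF \<epsilon>]
    by simp
  have l2: "(%k. aa (F (?\<epsilon> k))) \<longlonglongrightarrow> aa F0"
    unfolding aa_def
    by (rule weighted_tendsto_dominated[OF a_measurable Fm[OF \<epsilon>] F0m integrable_aa[OF w]]) (use exponents lim F[OF \<epsilon>] in auto)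
  have "(%k. (1 / p) * (((\<integral>x. norm (G x) powr p \<partial>M) + (\<integral>x. norm (V x) powr p \<partial>M)) / 2 - l * (\<integral>x. \<bar>F (?\<epsilon> k) x\<bar> powr p \<partial>M)) - (1 / q) * aa (F (?\<epsilon> k)))
    \<longlonglongrightarrow> (1 / p) * (((\<integral>x. norm (G x) powr p \<partial>M) + (\<integral>x. norm (V x) powr p \<partial>M)) / 2 - l * (\<integral>x. \<bar>F0 x\<bar> powr p \<partial>M)) - (1 / q) * aa F0"
    by (intro tendsto_diff tendsto_mult_left tendsto_const l1 l2)
  then have le: "min_energy <= (1 / p) * (((\<integral>x. norm (G x) powr p \<partial>M) + (\<integral>x. norm (V x) powr p \<partial>M)) / 2 - l * (\<integral>x. \<bar>F0 x\<bar> powr p \<partial>M)) - (1 / q) * aa F0"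
    by (rule LIMSEQ_le_const) (use step[OF \<epsilon>] in blast)
  \<comment> \<open>The q-th power of \<open>F0\<close> is the mean of the q-th powers, so the term
    with a is exactly averaged, whatever the sign of a; the p-th power loses exactly the mean
    defect.\<close>
  have F0q: "\<bar>F0 x\<bar> powr q = (\<bar>u x\<bar> powr q + \<bar>v x\<bar> powr q) / 2" for x
    using nn[of x] exponents by (simp add: F0_def R_def powr_powr)
  have F0p: "\<bar>F0 x\<bar> powr p = ((\<bar>u x\<bar> powr q + \<bar>v x\<bar> powr q) / 2) powr (p / q)" for x
    using nn[of x] exponents by (simp add: F0_def R_def powr_powr)
  have "aa F0 = (\<integral>x. (a x * \<bar>u x\<bar> powr q + a x * \<bar>v x\<bar> powr q) / 2 \<partial>M)"
    unfolding aa_def F0q by (simp add: distrib_left)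
  then have A: "aa F0 = (aa u + aa v) / 2" using integrable_aa[OF lu(1)] integrable_aa[OF lv(1)] by (simp add: aa_def)
  have D: "(\<integral>x. mean_defect p q (u x) (v x) \<partial>M) = ((\<integral>x. \<bar>u x\<bar> powr p \<partial>M) + (\<integral>x. \<bar>v x\<bar> powr p \<partial>M)) / 2 - (\<integral>x. \<bar>F0 x\<bar> powr p \<partial>M)"
    unfolding mean_defect_def F0p using iu iv integrable_power_mean[OF lu(1) lv(1)] by simp
  show ?thesis
    using le unfolding D A ee_def hh_eq[OF lu] hh_eq[OF lv] by (simp add: algebra_simps diff_divide_distrib add_divide_distrib)
qed

lemma sobX_zero: "\<exists>w W. sobX bc w W"
proof -
  have "(%x. 0) \<in> test_functions \<Omega>" by (simp add: test_functions_def smooth_on_const)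
  then show ?thesis using sobX_test_function by blast
qed

lemma mean_le:
  fixes x y c r :: real
  assumes "x <= c + r" "y <= c + r" shows "(x + y) / 2 - c <= r"
  using assms by argo

lemma mean_diff_le:
  fixes x y w c d :: real
  assumes "\<bar>w - c\<bar> < d" "\<bar>x - c\<bar> < d" "\<bar>y - c\<bar> < d" shows "(x + y) / 2 - w <= 2 * d"
proof -
  have "c - d < w" "x < c + d" "y < c + d" using assms by (auto simp: abs_less_iff)
  then show ?thesis by argo
qed

text \<open>The functions are Cauchy because their mean defect is bounded by the excess of their
  energies over the infimum. The gradients are treated afterwards with ordinary midpoints: the
  energy need not be convex along these, but its only nonconvex term is continuous in Lp, where the
  functions already converge. Strong limits then pass through the energy.\<close>

lemma exists_minimizer: "\<exists>u G. sobX bc u G \<and> (AE x in M. u x >= 0) \<and> ee u G <= min_energy"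
proof -
  have "\<exists>z. sobX bc (fst z) (snd z) \<and> (\<forall>x. fst z x >= 0) \<and> ee (fst z) (snd z) <= min_energy + 1 / real (Suc n)" for n
  proof -
    let ?e = "1 / real (Suc n) / 2"
    have e: "?e > 0" by simp
    have ne: "{ee u G |u G. sobX bc u G} ~= {}" using sobX_zero by blast
    have "Inf {ee u G |u G. sobX bc u G} < min_energy + ?e" using e unfolding min_energy_def by linarith
    then obtain w W where w: "sobX bc w W" "ee w W < min_energy + ?e" using cInf_lessD[OF ne] by blast
    obtain v V where v: "sobX bc v V" "\<forall>x. v x >= 0" "ee v V <= ee w W + ?e" using exists_nonneg_of_energy_le[OF w(1) e] by blast
    have "ee v V <= min_energy + 1 / real (Suc n)" using v(3) w(2) by linarith
    then show ?thesis using v(1,2) by (intro exI[of _ "(v, V)"]) simp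
  qed
  then have "\<exists>z. \<forall>n. sobX bc (fst (z n)) (snd (z n)) \<and> (\<forall>x. fst (z n) x >= 0) \<and> ee (fst (z n)) (snd (z n)) <= min_energy + 1 / real (Suc n)"
    by (intro choice allI)
  then obtain z where z: "!!n. sobX bc (fst (z n)) (snd (z n))" "!!n x. fst (z n) x >= 0"
    "!!n. ee (fst (z n)) (snd (z n)) <= min_energy + 1 / real (Suc n)" by blast
  define u where "u n = fst (z n)" for n
  define G where "G n = snd (z n)" for n
  have X: "sobX bc (u n) (G n)" and nn: "u n x >= 0" and E: "ee (u n) (G n) <= min_energy + 1 / real (Suc n)" for n x
    using z by (auto simp: u_def G_def)
  have lu: "in_Lp M p (u n)" and lG: "in_Lp M p (G n)" for n using sobXD[OF X] by auto
  have iu: "integrable M (%x. \<bar>u n x\<bar> powr p)" and iG: "integrable M (%x. norm (G n x) powr p)" for n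
    using in_Lp_integrable[OF lu] in_Lp_integrable[OF lG] by auto
  have EN: "ee (u n) (G n) <= min_energy + 1 / real (Suc N)" if "n >= N" for n N
  proof -
    have "1 / real (Suc n) <= 1 / real (Suc N)" using that by (intro divide_left_mono) auto
    then show ?thesis using E[of n] by linarith
  qed
  obtain C where C: "!!u G. in_Lp M p u ==> in_Lp M p G ==> hh u G <= 2 * p * (ee u G + C)" by (rule energy_coercive) blast
  \<comment> \<open>All energies are at most the infimum plus 1, the case N = 0 of
    \<open>EN\<close>, so coercivity bounds H uniformly.\<close>
  define B where "B = 2 * p * (min_energy + 1 + C)"
  have hB: "hh (u n) (G n) <= B" for n
  proof -
    have "2 * p * (ee (u n) (G n) + C) <= B" unfolding B_def using EN[of 0 n] exponents by (intro mult_left_mono) auto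
    then show ?thesis using C[OF lu[of n] lG[of n]] by linarith
  qed
  have X0: "0 <= (\<integral>x. norm (G n x) powr p \<partial>M)" and Y0: "0 <= (\<integral>x. \<bar>u n x\<bar> powr p \<partial>M)" for n
    by (auto intro: B_integral_nonneg)
  have lY: "l * (\<integral>x. \<bar>u n x\<bar> powr p \<partial>M) <= 0" for n using l_neg Y0[of n] by (simp add: mult_nonpos_nonneg)
  have GB: "(\<integral>x. norm (G n x) powr p \<partial>M) <= B" for n using hB[of n] lY[of n] unfolding hh_eq[OF lu lG] by linarith
  have uB: "(\<integral>x. norm (u n x) powr p \<partial>M) <= B / (- l)" for n
  proof -
    have "- (l * (\<integral>x. \<bar>u n x\<bar> powr p \<partial>M)) <= B" using hB[of n] X0[of n] unfolding hh_eq[OF lu lG] by linarith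
    then have "(\<integral>x. \<bar>u n x\<bar> powr p \<partial>M) * (- l) <= B" by (simp only: mult_minus_right mult.commute)
    then have "(\<integral>x. \<bar>u n x\<bar> powr p \<partial>M) <= B / (- l)" using l_neg by (subst pos_le_divide_eq) auto
    then show ?thesis by simp
  qed
  have small: "\<exists>N. 1 / real (Suc N) < e" if "e > 0" for e
    using reals_Archimedean[OF that] by (simp add: inverse_eq_divide)
  obtain U where U: "in_Lp M p U" "Lp_lim M p u U"
  proof (rule Lp_complete[OF lu p_pos(1)])
    fix e :: real assume e: "e > 0"
    show "\<exists>N. \<forall>m\<ge>N. \<forall>n\<ge>N. (\<integral>x. norm (u m x - u n x) powr p \<partial>M) <= e"
    proof (rule Cauchy_of_defect[OF lu uB p_pos(1) _ _ _ _ e, where S = "{0..}" and D = "mean_defect p q"])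
      show "u n x \<in> {0..}" for n x using nn by simp
      show "\<exists>C\<ge>0. \<forall>a\<in>{0..}. \<forall>b\<in>{0..}. norm (a - b) powr p <= \<eta> * (norm a powr p + norm b powr p) + C * mean_defect p q a b" if \<eta>: "\<eta> > 0" for \<eta>
      proof -
        obtain C where "C >= 0" "!!s t. s >= 0 ==> t >= 0 ==> norm (s - t) powr p <= \<eta> * (norm s powr p + norm t powr p) + C * mean_defect p q s t"
          by (rule mean_defect_dominates[OF exponents(2) q_less_p \<eta>]) blast
        then show ?thesis by (intro exI[of _ C]) auto
      qed
      show "integrable M (%x. mean_defect p q (u m x) (u n x))" for m n
        unfolding mean_defect_def using iu integrable_power_mean[OF lu lu] by simp
      fix e' :: real assume e': "e' > 0"
      have "- l / p * e' > 0" using l_neg e' exponents by (intro mult_pos_pos divide_pos_pos) auto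
      then obtain N where N: "1 / real (Suc N) < - l / p * e'" using small by blast
      have "(\<integral>x. mean_defect p q (u m x) (u n x) \<partial>M) <= e'" if mn: "m >= N" "n >= N" for m n
      proof -
        have "- l / p * (\<integral>x. mean_defect p q (u m x) (u n x) \<partial>M) <= (ee (u m) (G m) + ee (u n) (G n)) / 2 - min_energy"
          by (rule hidden_convexity[OF X X nn nn])
        also have "\<dots> <= 1 / real (Suc N)" by (rule mean_le[OF EN[OF mn(1)] EN[OF mn(2)]])
        finally have "- l / p * (\<integral>x. mean_defect p q (u m x) (u n x) \<partial>M) <= - l / p * e'" using N by linarith
        moreover have "- l / p > 0" using l_neg exponents by (intro divide_pos_pos) auto
        ultimately show ?thesis by (rule mult_left_le_imp_le)
      qed
      then show "\<exists>N. \<forall>m\<ge>N. \<forall>n\<ge>N. (\<integral>x. mean_defect p q (u m x) (u n x) \<partial>M) <= e'" by blast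
    qed
  qed
  obtain H where H: "in_Lp M p H" "Lp_lim M p G H"
  proof (rule Lp_complete[OF lG p_pos(1)])
    fix e :: real assume e: "e > 0"
    show "\<exists>N. \<forall>m\<ge>N. \<forall>n\<ge>N. (\<integral>x. norm (G m x - G n x) powr p \<partial>M) <= e"
    proof (rule Cauchy_of_defect[OF lG GB p_pos(1) _ _ _ _ e, where S = UNIV and D = "norm_defect p"])
      show "\<exists>C\<ge>0. \<forall>a\<in>UNIV. \<forall>b\<in>UNIV. norm (a - b :: 'a) powr p <= \<eta> * (norm a powr p + norm b powr p) + C * norm_defect p a b" if \<eta>: "\<eta> > 0" for \<eta>
      proof -
        obtain C where "C >= 0" "!!a b :: 'a. norm (a - b) powr p <= \<eta> * (norm a powr p + norm b powr p) + C * norm_defect p a b"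
          by (rule norm_defect_dominates[OF p_gt_1 \<eta>]) blast
        then show ?thesis by (intro exI[of _ C]) auto
      qed
      have lW: "in_Lp M p (%x. (1 / 2) *\<^sub>R (G m x + G n x))" for m n by (intro in_Lp_scale in_Lp_add lG exponents)
      have lw: "in_Lp M p (%x. (1 / 2) *\<^sub>R (u m x + u n x))" for m n by (intro in_Lp_scale in_Lp_add lu exponents)
      note iW = in_Lp_integrable[OF lW]
      show iD: "integrable M (%x. norm_defect p (G m x) (G n x))" for m n
        unfolding norm_defect_def by (intro B_integrable_diff integrable_divide B_integrable_add iG iW)
      fix e' :: real assume e': "e' > 0"
      \<comment> \<open>With this \<delta> the error from the term with a, which is (1/q) 2
        \<delta>, equals e'/(2 p); \<open>N2\<close> keeps the energy excess below the same amount,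
        and the two add up to e'/p.\<close>
      define \<delta> where "\<delta> = q * (e' / (4 * p))"
      have \<delta>: "\<delta> > 0" using e' exponents by (simp add: \<delta>_def)
      obtain d where d: "d > 0" "!!g. in_Lp M p g ==> (\<integral>x. norm (g x - U x) powr p \<partial>M) < d ==> \<bar>aa g - aa U\<bar> < \<delta>"
        by (rule aa_continuous[OF U(1) \<delta>]) blast
      obtain N1 where N1: "!!n. n >= N1 ==> (\<integral>x. norm (u n x - U x) powr p \<partial>M) < d"
        using order_tendstoD(2)[OF U(2)[unfolded Lp_lim_def] d(1)] by (auto simp: eventually_sequentially)
      have e2: "e' / (2 * p) > 0" using e' exponents by simp
      obtain N2 where N2: "1 / real (Suc N2) < e' / (2 * p)" using small[OF e2] by blast
      have "(\<integral>x. norm_defect p (G m x) (G n x) \<partial>M) <= e'" if mn: "m >= max N1 N2" "n >= max N1 N2" for m n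
      proof -
        let ?w = "%x. (1 / 2) *\<^sub>R (u m x + u n x)" and ?W = "%x. (1 / 2) *\<^sub>R (G m x + G n x)"
        let ?D = "\<integral>x. norm_defect p (G m x) (G n x) \<partial>M"
        have dU: "integrable M (%x. norm (u k x - U x) powr p)" for k by (rule in_Lp_integrable[OF in_Lp_diff[OF lu U(1) exponents(6)]])
        have "(\<integral>x. norm (?w x - U x) powr p \<partial>M) <= (\<integral>x. (norm (u m x - U x) powr p + norm (u n x - U x) powr p) / 2 \<partial>M)"
        proof (rule B_integral_mono[OF in_Lp_integrable[OF in_Lp_diff[OF lw U(1) exponents(6)]]])
          show "integrable M (%x. (norm (u m x - U x) powr p + norm (u n x - U x) powr p) / 2)" using dU by simp
          fix x
          have "?w x - U x = (1 / 2) *\<^sub>R ((u m x - U x) + (u n x - U x))" by (simp add: field_simps)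
          then show "norm (?w x - U x) powr p <= (norm (u m x - U x) powr p + norm (u n x - U x) powr p) / 2"
            using midpoint_norm_powr(1)[OF p_gt_1, of "u m x - U x" "u n x - U x"] by (simp only:)
        qed
        also have "\<dots> = ((\<integral>x. norm (u m x - U x) powr p \<partial>M) + (\<integral>x. norm (u n x - U x) powr p \<partial>M)) / 2"
          by (simp only: integral_divide_zero B_integral_add[OF dU dU])
        also have "\<dots> < d" using N1[of m] N1[of n] mn by simp
        finally have "\<bar>aa ?w - aa U\<bar> < \<delta>" by (rule d(2)[OF lw])
        moreover have "\<bar>aa (u m) - aa U\<bar> < \<delta>" "\<bar>aa (u n) - aa U\<bar> < \<delta>" using d(2)[OF lu] N1 mn by auto
        ultimately have "(aa (u m) + aa (u n)) / 2 - aa ?w <= 2 * \<delta>" by (rule mean_diff_le)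
        then have "(1 / q) * ((aa (u m) + aa (u n)) / 2 - aa ?w) <= (1 / q) * (2 * \<delta>)" using exponents by (intro mult_left_mono) auto
        also have "\<dots> = e' / (2 * p)" using exponents by (simp add: \<delta>_def)
        finally have a1: "(1 / q) * ((aa (u m) + aa (u n)) / 2 - aa ?w) <= e' / (2 * p)" .
        have WD: "(\<integral>x. norm (?W x) powr p \<partial>M) = ((\<integral>x. norm (G m x) powr p \<partial>M) + (\<integral>x. norm (G n x) powr p \<partial>M)) / 2 - ?D"
        proof -
          have "(\<integral>x. norm (?W x) powr p \<partial>M) + ?D = (\<integral>x. norm (?W x) powr p + norm_defect p (G m x) (G n x) \<partial>M)"
            by (rule B_integral_add[OF iW iD, symmetric])
          also have "\<dots> = (\<integral>x. (norm (G m x) powr p + norm (G n x) powr p) / 2 \<partial>M)" by (simp only: norm_defect_def) simp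
          also have "\<dots> = ((\<integral>x. norm (G m x) powr p \<partial>M) + (\<integral>x. norm (G n x) powr p \<partial>M)) / 2"
            by (simp only: integral_divide_zero B_integral_add[OF iG iG])
          finally show ?thesis by linarith
        qed
        have "(\<integral>x. \<bar>?w x\<bar> powr p \<partial>M) <= (\<integral>x. (\<bar>u m x\<bar> powr p + \<bar>u n x\<bar> powr p) / 2 \<partial>M)"
        proof (rule B_integral_mono)
          show "integrable M (%x. \<bar>?w x\<bar> powr p)" using in_Lp_integrable[OF lw[of m n]] by simp
          show "integrable M (%x. (\<bar>u m x\<bar> powr p + \<bar>u n x\<bar> powr p) / 2)" using iu by simp
          show "\<bar>?w x\<bar> powr p <= (\<bar>u m x\<bar> powr p + \<bar>u n x\<bar> powr p) / 2" for x
            using midpoint_norm_powr(1)[OF p_gt_1, of "u m x" "u n x"] unfolding real_norm_def .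
        qed
        also have "\<dots> = ((\<integral>x. \<bar>u m x\<bar> powr p \<partial>M) + (\<integral>x. \<bar>u n x\<bar> powr p \<partial>M)) / 2"
          by (simp only: integral_divide_zero B_integral_add[OF iu iu])
        finally have "l * (((\<integral>x. \<bar>u m x\<bar> powr p \<partial>M) + (\<integral>x. \<bar>u n x\<bar> powr p \<partial>M)) / 2) <= l * (\<integral>x. \<bar>?w x\<bar> powr p \<partial>M)"
          using l_neg by (intro mult_left_mono_neg) auto
        then have hw: "hh ?w ?W <= (hh (u m) (G m) + hh (u n) (G n)) / 2 - ?D"
          unfolding hh_eq[OF lw lW] hh_eq[OF lu lG] WD by (simp add: distrib_left add_divide_distrib diff_divide_distrib)
        have "sobX bc ?w ?W" using sobX_linear[OF X[of m] X[of n], of "1 / 2" "1 / 2"] by (simp add: algebra_simps)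
        then have "min_energy <= ee ?w ?W" by (rule min_energy_le)
        also have "\<dots> <= (1 / p) * ((hh (u m) (G m) + hh (u n) (G n)) / 2 - ?D) - (1 / q) * aa ?w"
          unfolding ee_def using hw exponents by (intro diff_right_mono mult_left_mono) auto
        also have "\<dots> = (ee (u m) (G m) + ee (u n) (G n)) / 2 - (1 / p) * ?D + (1 / q) * ((aa (u m) + aa (u n)) / 2 - aa ?w)"
          unfolding ee_def by (simp add: algebra_simps add_divide_distrib diff_divide_distrib)
        finally have "(1 / p) * ?D <= (ee (u m) (G m) + ee (u n) (G n)) / 2 - min_energy + e' / (2 * p)" using a1 by linarith
        also have "\<dots> <= e' / (2 * p) + e' / (2 * p)"
        proof -
          have m2: "m >= N2" "n >= N2" using mn by auto
          show ?thesis using mean_le[OF EN[OF m2(1)] EN[OF m2(2)]] N2 by linarith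
        qed
        also have "\<dots> = (1 / p) * e'" by simp
        finally show ?thesis by (rule mult_left_le_imp_le) (use exponents in simp)
      qed
      then show "\<exists>N. \<forall>m\<ge>N. \<forall>n\<ge>N. (\<integral>x. norm_defect p (G m x) (G n x) \<partial>M) <= e'" by blast
    qed simp
  qed
  have XU: "sobX bc U H" by (rule sobX_limit[OF X U(1) H(1) U(2) H(2)])
  obtain r1 where r1: "strict_mono r1" "AE x in M. (%n. u (r1 n) x) \<longlonglongrightarrow> U x"
    by (rule Lp_lim_AE_subseq[OF lu U(1) p_pos(1) U(2)])
  obtain r2 where r2: "strict_mono r2" "AE x in M. (%n. G (r1 (r2 n)) x) \<longlonglongrightarrow> H x"
    by (rule Lp_lim_AE_subseq[OF lG H(1) p_pos(1) Lp_lim_subseq[OF H(2) r1(1)]])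
  define r where "r n = r1 (r2 n)" for n
  have r: "strict_mono r" using r1(1) r2(1) by (auto simp: r_def strict_mono_def)
  have rH: "AE x in M. (%n. G (r n) x) \<longlonglongrightarrow> H x" using r2(2) by (simp add: r_def)
  have rU: "AE x in M. (%n. u (r n) x) \<longlonglongrightarrow> U x"
    using r1(2) by eventually_elim (unfold r_def, rule LIMSEQ_subseq_LIMSEQ[OF _ r2(1), unfolded o_def])
  note [measurable] = in_Lp_measurable[OF lu] in_Lp_measurable[OF lG] in_Lp_measurable[OF U(1)] in_Lp_measurable[OF H(1)]
  have t1: "(%n. \<integral>x. \<bar>u (r n) x\<bar> powr p \<partial>M) \<longlonglongrightarrow> (\<integral>x. \<bar>U x\<bar> powr p \<partial>M)"
  proof (rule integral_tendsto_Lp_growth[OF finite_M lu U(1) p_pos(1) Lp_lim_subseq[OF U(2) r], where C = 1])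
    show "AE x in M. (%n. \<bar>u (r n) x\<bar> powr p) \<longlonglongrightarrow> \<bar>U x\<bar> powr p"
      using rU by eventually_elim (intro tendsto_abs_powr exponents)
  qed auto
  have t2: "(%n. \<integral>x. norm (G (r n) x) powr p \<partial>M) \<longlonglongrightarrow> (\<integral>x. norm (H x) powr p \<partial>M)"
  proof (rule integral_tendsto_Lp_growth[OF finite_M lG H(1) p_pos(1) Lp_lim_subseq[OF H(2) r], where C = 1])
    show "AE x in M. (%n. norm (G (r n) x) powr p) \<longlonglongrightarrow> norm (H x) powr p"
      using rH
    proof eventually_elim
      case (elim x)
      from tendsto_abs_powr[OF tendsto_norm[OF elim] exponents(3)] show ?case by simp
    qed
  qed auto
  have t3: "(%n. aa (u (r n))) \<longlonglongrightarrow> aa U"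
  proof (rule LIMSEQ_I)
    fix e :: real assume e: "e > 0"
    obtain d where d: "d > 0" "!!g. in_Lp M p g ==> (\<integral>x. norm (g x - U x) powr p \<partial>M) < d ==> \<bar>aa g - aa U\<bar> < e"
      by (rule aa_continuous[OF U(1) e]) blast
    obtain N where "!!n. n >= N ==> (\<integral>x. norm (u (r n) x - U x) powr p \<partial>M) < d"
      using order_tendstoD(2)[OF Lp_lim_subseq[OF U(2) r, unfolded Lp_lim_def] d(1)] by (auto simp: eventually_sequentially)
    then show "\<exists>N. \<forall>n\<ge>N. norm (aa (u (r n)) - aa U) < e" using d(2)[OF lu] by auto
  qed
  have "(%n. ee (u (r n)) (G (r n))) \<longlonglongrightarrow> ee U H"
    unfolding ee_def hh_eq[OF lu lG] hh_eq[OF U(1) H(1)] by (intro tendsto_diff tendsto_mult_left t1 t2 t3)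
  moreover have "(%n. min_energy + 1 / real (Suc n)) \<longlonglongrightarrow> min_energy + 0"
    by (intro tendsto_add tendsto_const one_over_Suc_tendsto)
  moreover have "ee (u (r n)) (G (r n)) <= min_energy + 1 / real (Suc n)" for n
    by (rule EN[OF seq_suble[OF r]])
  ultimately have "ee U H <= min_energy + 0" by (intro LIMSEQ_le[of "%n. ee (u (r n)) (G (r n))"]) auto
  moreover have "AE x in M. U x >= 0" using rU by eventually_elim (rule LIMSEQ_le_const, use nn in auto)
  ultimately show ?thesis using XU by auto
qed

section \<open>The Euler-Lagrange equation\<close>

text \<open>One-sided derivatives suffice: minimality makes them nonnegative in every direction, and
  the directions \<phi> and -\<phi> together give the weak equation.\<close>

lemma minimizer_solution:
  assumes X: "sobX bc u G" and nn: "AE x in M. u x >= 0" and min: "ee u G <= min_energy"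
  shows "solution u G"
proof -
  note lX = sobXD[OF X]
  define D where "D \<phi> \<Phi> = (\<integral>x. norm (G x) powr (p - 2) * (G x \<bullet> \<Phi> x) \<partial>M) - l * (\<integral>x. norm (u x) powr (p - 2) * (u x \<bullet> \<phi> x) \<partial>M)
      - (\<integral>x. a x * (norm (u x) powr (q - 2) * (u x \<bullet> \<phi> x)) \<partial>M)" for \<phi> \<Phi>
  have D0: "D \<phi> \<Phi> >= 0" if Y: "sobX bc \<phi> \<Phi>" for \<phi> \<Phi>
  proof -
    note lY = sobXD[OF Y]
    obtain A where A: "A > 0" "AE x in M. \<bar>a x\<bar> <= A" by (rule a_bounded)
    let ?t = "%n. 1 / real (Suc n)"
    have d1: "(%n. ((\<integral>x. norm (G x + ?t n *\<^sub>R \<Phi> x) powr p \<partial>M) - (\<integral>x. norm (G x) powr p \<partial>M)) * real (Suc n))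
        \<longlonglongrightarrow> p * (\<integral>x. norm (G x) powr (p - 2) * (G x \<bullet> \<Phi> x) \<partial>M)"
      using integral_powr_derivative[OF finite_M lX(2) lY(2) p_gt_1 order_refl, of "%x. 1" 1] by (simp del: of_nat_Suc)
    have d2: "(%n. ((\<integral>x. norm (u x + ?t n *\<^sub>R \<phi> x) powr p \<partial>M) - (\<integral>x. norm (u x) powr p \<partial>M)) * real (Suc n))
        \<longlonglongrightarrow> p * (\<integral>x. norm (u x) powr (p - 2) * (u x \<bullet> \<phi> x) \<partial>M)"
      using integral_powr_derivative[OF finite_M lX(1) lY(1) p_gt_1 order_refl, of "%x. 1" 1] by (simp del: of_nat_Suc)
    have d3: "(%n. ((\<integral>x. a x * norm (u x + ?t n *\<^sub>R \<phi> x) powr q \<partial>M) - (\<integral>x. a x * norm (u x) powr q \<partial>M)) * real (Suc n))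
        \<longlonglongrightarrow> q * (\<integral>x. a x * (norm (u x) powr (q - 2) * (u x \<bullet> \<phi> x)) \<partial>M)"
      by (rule integral_powr_derivative[OF finite_M lX(1) lY(1) q_gt_1 less_imp_le[OF q_less_p] a_measurable A(2)])
    define u' where "u' n x = u x + ?t n *\<^sub>R \<phi> x" for n x
    define G' where "G' n x = G x + ?t n *\<^sub>R \<Phi> x" for n x
    have X': "sobX bc (u' n) (G' n)" for n
      using sobX_linear[OF X Y, of 1 "?t n"] by (simp add: u'_def[abs_def] G'_def[abs_def] del: of_nat_Suc)
    have lim: "(%n. (1 / p) * (((\<integral>x. norm (G' n x) powr p \<partial>M) - (\<integral>x. norm (G x) powr p \<partial>M)) * real (Suc n)
          - l * (((\<integral>x. norm (u' n x) powr p \<partial>M) - (\<integral>x. norm (u x) powr p \<partial>M)) * real (Suc n)))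
          - (1 / q) * (((\<integral>x. a x * norm (u' n x) powr q \<partial>M) - (\<integral>x. a x * norm (u x) powr q \<partial>M)) * real (Suc n)))
        \<longlonglongrightarrow> (1 / p) * (p * (\<integral>x. norm (G x) powr (p - 2) * (G x \<bullet> \<Phi> x) \<partial>M) - l * (p * (\<integral>x. norm (u x) powr (p - 2) * (u x \<bullet> \<phi> x) \<partial>M)))
          - (1 / q) * (q * (\<integral>x. a x * (norm (u x) powr (q - 2) * (u x \<bullet> \<phi> x)) \<partial>M))"
      unfolding u'_def G'_def by (intro tendsto_diff tendsto_mult_left d1 d2 d3)
    have "0 <= (1 / p) * (((\<integral>x. norm (G' n x) powr p \<partial>M) - (\<integral>x. norm (G x) powr p \<partial>M)) * real (Suc n)
          - l * (((\<integral>x. norm (u' n x) powr p \<partial>M) - (\<integral>x. norm (u x) powr p \<partial>M)) * real (Suc n)))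
          - (1 / q) * (((\<integral>x. a x * norm (u' n x) powr q \<partial>M) - (\<integral>x. a x * norm (u x) powr q \<partial>M)) * real (Suc n))" for n
    proof -
      have "0 <= (ee (u' n) (G' n) - ee u G) * real (Suc n)"
        using min_energy_le[OF X', of n] min by (intro mult_nonneg_nonneg) auto
      also have "\<dots> = (1 / p) * (((\<integral>x. norm (G' n x) powr p \<partial>M) - (\<integral>x. norm (G x) powr p \<partial>M)) * real (Suc n)
          - l * (((\<integral>x. norm (u' n x) powr p \<partial>M) - (\<integral>x. norm (u x) powr p \<partial>M)) * real (Suc n)))
          - (1 / q) * (((\<integral>x. a x * norm (u' n x) powr q \<partial>M) - (\<integral>x. a x * norm (u x) powr q \<partial>M)) * real (Suc n))"
        unfolding ee_def hh_eq[OF sobXD[OF X']] hh_eq[OF lX] aa_def real_norm_def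
        by (simp add: algebra_simps diff_divide_distrib add_divide_distrib del: of_nat_Suc)
      finally show ?thesis .
    qed
    from LIMSEQ_le_const[OF lim] this
    have "0 <= (1 / p) * (p * (\<integral>x. norm (G x) powr (p - 2) * (G x \<bullet> \<Phi> x) \<partial>M) - l * (p * (\<integral>x. norm (u x) powr (p - 2) * (u x \<bullet> \<phi> x) \<partial>M)))
          - (1 / q) * (q * (\<integral>x. a x * (norm (u x) powr (q - 2) * (u x \<bullet> \<phi> x)) \<partial>M))" by blast
    also have "\<dots> = D \<phi> \<Phi>" using exponents unfolding D_def by (simp add: right_diff_distrib)
    finally show ?thesis .
  qed
  have weak: "(\<integral>x. norm (G x) powr (p - 2) * (G x \<bullet> \<Phi> x) \<partial>M) = (\<integral>x. (l * u x powr (p - 1) + a x * u x powr (q - 1)) * \<phi> x \<partial>M)"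
    if Y: "sobX bc \<phi> \<Phi>" for \<phi> \<Phi>
  proof -
    note lY = sobXD[OF Y]
    have "sobX bc (%x. - \<phi> x) (%x. - \<Phi> x)" using sobX_linear[OF Y Y, of "-1" 0] by simp
    from D0[OF this] have "D \<phi> \<Phi> <= 0" by (simp add: D_def)
    with D0[OF Y] have D: "D \<phi> \<Phi> = 0" by linarith
    have pw: "norm t powr (s - 2) * (t \<bullet> z) = t powr (s - 1) * z" if "t >= 0" for s t z :: real
    proof (cases "t = 0")
      case False
      then have "t powr (s - 1) = t powr (s - 2) * t" using that powr_add[of t "s - 2" 1] by simp
      then show ?thesis using that by simp
    qed simp
    have i: "integrable M (%x. u x powr (p - 1) * \<phi> x)" "integrable M (%x. a x * (u x powr (q - 1) * \<phi> x))"
      using exponents by (auto intro!: integrable_a_mult integrable_powr_mult[OF lX(1) lY(1) nn])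
    have "(\<integral>x. norm (u x) powr (p - 2) * (u x \<bullet> \<phi> x) \<partial>M) = (\<integral>x. u x powr (p - 1) * \<phi> x \<partial>M)"
      by (rule integral_cong_AE_M) (use nn in eventually_elim, rule pw)
    moreover have "(\<integral>x. a x * (norm (u x) powr (q - 2) * (u x \<bullet> \<phi> x)) \<partial>M) = (\<integral>x. a x * (u x powr (q - 1) * \<phi> x) \<partial>M)"
      by (rule integral_cong_AE_M) (use nn in eventually_elim, simp only: pw)
    moreover have "(\<integral>x. (l * u x powr (p - 1) + a x * u x powr (q - 1)) * \<phi> x \<partial>M) =
        l * (\<integral>x. u x powr (p - 1) * \<phi> x \<partial>M) + (\<integral>x. a x * (u x powr (q - 1) * \<phi> x) \<partial>M)"
      by (simp only: distrib_right mult.assoc B_integral_add[OF integrable_mult_right[OF i(1)] i(2)] integral_mult_right_zero)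
    ultimately show ?thesis using D unfolding D_def by simp
  qed
  show ?thesis unfolding solution_def using X nn weak by blast
qed

lemma exists_solution_negative_energy:
  assumes "P ~= {}" shows "\<exists>u G. solution u G \<and> ee u G < 0"
proof -
  obtain x0 where "x0 \<in> P" using assms by blast
  then obtain \<phi> \<Phi> where \<phi>: "sobX bc \<phi> \<Phi>" "ee \<phi> \<Phi> < 0" using exists_negative_energy by blast
  obtain u G where u: "sobX bc u G" "AE x in M. u x >= 0" "ee u G <= min_energy" using exists_minimizer by blast
  have "ee u G < 0" using u(3) min_energy_le[OF \<phi>(1)] \<phi>(2) by linarith
  then show ?thesis using minimizer_solution[OF u] by blast
qed

end

section \<open>Solutions and ground states\<close>

context elliptic_problem
begin

lemma is_solution_imp_solution:
  assumes u: "is_solution bc \<Omega> p q l a u" shows "solution u (weak_gradient \<Omega> u)"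
  unfolding solution_def
proof (intro conjI allI impI)
  show "sobX bc u (weak_gradient \<Omega> u)" using u by (intro energy_space_imp_sobX) (simp add: is_solution_def)
  show "AE x in M. u x >= 0" using u by (simp add: is_solution_def)
  fix \<phi> \<Phi> assume \<phi>: "sobX bc \<phi> \<Phi>"
  note e = sobX_imp_energy_space[OF \<phi>]
  have "(\<integral>x. norm (weak_gradient \<Omega> u x) powr (p - 2) * (weak_gradient \<Omega> u x \<bullet> \<Phi> x) \<partial>M) =
      (\<integral>x. norm (weak_gradient \<Omega> u x) powr (p - 2) * (weak_gradient \<Omega> u x \<bullet> weak_gradient \<Omega> \<phi> x) \<partial>M)"
    by (rule integral_cong_AE_M) (use e(2) in eventually_elim, simp)
  also have "\<dots> = (\<integral>x. (l * u x powr (p - 1) + a x * u x powr (q - 1)) * \<phi> x \<partial>M)"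
    using u e(1) unfolding is_solution_def by blast
  finally show "(\<integral>x. norm (weak_gradient \<Omega> u x) powr (p - 2) * (weak_gradient \<Omega> u x \<bullet> \<Phi> x) \<partial>M) =
      (\<integral>x. (l * u x powr (p - 1) + a x * u x powr (q - 1)) * \<phi> x \<partial>M)" .
qed

lemma solution_imp_is_solution:
  assumes u: "solution u G" shows "is_solution bc \<Omega> p q l a u"
  unfolding is_solution_def
proof (intro conjI ballI)
  have X: "sobX bc u G" using u by (simp add: solution_def)
  note e = sobX_imp_energy_space[OF X]
  show "u \<in> energy_space bc \<Omega> p" by (rule e(1))
  show "AE x in M. u x >= 0" using u by (simp add: solution_def)
  fix \<phi> assume "\<phi> \<in> energy_space bc \<Omega> p"
  then have \<phi>: "sobX bc \<phi> (weak_gradient \<Omega> \<phi>)" by (rule energy_space_imp_sobX)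
  have "(\<integral>x. norm (weak_gradient \<Omega> u x) powr (p - 2) * (weak_gradient \<Omega> u x \<bullet> weak_gradient \<Omega> \<phi> x) \<partial>M) =
      (\<integral>x. norm (G x) powr (p - 2) * (G x \<bullet> weak_gradient \<Omega> \<phi> x) \<partial>M)"
    by (rule integral_cong_AE_M) (use e(2) in eventually_elim, simp)
  also have "\<dots> = (\<integral>x. (l * u x powr (p - 1) + a x * u x powr (q - 1)) * \<phi> x \<partial>M)"
    using u \<phi> unfolding solution_def by blast
  finally show "(\<integral>x. norm (weak_gradient \<Omega> u x) powr (p - 2) * (weak_gradient \<Omega> u x \<bullet> weak_gradient \<Omega> \<phi> x) \<partial>M) =
      (\<integral>x. (l * u x powr (p - 1) + a x * u x powr (q - 1)) * \<phi> x \<partial>M)" .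
qed

lemma energy_eq_ee:
  assumes X: "sobX bc u G" shows "energy \<Omega> p q l a u = ee u G"
proof -
  note lX = sobXD[OF X]
  have i: "integrable M (%x. norm (G x) powr p - l * \<bar>u x\<bar> powr p)" by (rule integrable_hh[OF lX])
  have "energy \<Omega> p q l a u = (\<integral>x. (1 / p) * (norm (G x) powr p - l * \<bar>u x\<bar> powr p) - (1 / q) * (a x * \<bar>u x\<bar> powr q) \<partial>M)"
    unfolding energy_def
    by (rule integral_cong_AE_M) (use sobX_imp_energy_space(2)[OF X] in eventually_elim, simp add: diff_divide_distrib)
  also have "\<dots> = ee u G"
    unfolding ee_def hh_def aa_def
    by (simp only: B_integral_diff[OF integrable_mult_right[OF i] integrable_mult_right[OF integrable_aa[OF lX(1)]]] integral_mult_right_zero)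
  finally show ?thesis .
qed

lemma ee_solution:
  assumes "solution u G" shows "ee u G = - (1 / q - 1 / p) * hh u G"
  unfolding ee_def solution_hh_eq_aa[OF assms, symmetric] by (simp add: algebra_simps)

lemma exponent_gap: "1 / q - 1 / p > 0"
  using q_less_p exponents by (simp add: frac_less2)

lemma ground_state_hh_maximal:
  assumes U: "ground_state_solution bc \<Omega> p q l a U" and u: "solution u G"
  shows "hh u G <= hh U (weak_gradient \<Omega> U)"
proof -
  have sU: "solution U (weak_gradient \<Omega> U)" using U is_solution_imp_solution by (simp add: ground_state_solution_def)
  have "energy \<Omega> p q l a U <= energy \<Omega> p q l a u"
    using U solution_imp_is_solution[OF u] by (simp add: ground_state_solution_def)
  moreover have "energy \<Omega> p q l a U = ee U (weak_gradient \<Omega> U)" "energy \<Omega> p q l a u = ee u G"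
    using sU u by (auto intro!: energy_eq_ee simp: solution_def)
  ultimately have "(1 / q - 1 / p) * hh u G <= (1 / q - 1 / p) * hh U (weak_gradient \<Omega> U)"
    unfolding ee_solution[OF sU] ee_solution[OF u] by linarith
  then show ?thesis using exponent_gap by (rule mult_left_le_imp_le)
qed

lemma eq_ground_state:
  assumes U: "ground_state_solution bc \<Omega> p q l a U" and u: "is_solution bc \<Omega> p q l a u"
    and z: "AE x in M. u x = 0 --> a x <= 0"
  shows "AE x in M. u x = U x"
proof -
  have sU: "solution U (weak_gradient \<Omega> U)" using U is_solution_imp_solution by (simp add: ground_state_solution_def)
  note su = is_solution_imp_solution[OF u]
  have "hh U (weak_gradient \<Omega> U) = hh u (weak_gradient \<Omega> u)"
    by (rule antisym[OF comparison(1)[OF su sU z] ground_state_hh_maximal[OF U su]])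
  then show ?thesis by (rule comparison(2)[OF su sU z])
qed

text \<open>A ground state is minimal among solutions only, so a solution of negative energy has to
  be exhibited. It has H > 0, and maximality of H at U then excludes U = 0.\<close>

lemma ground_state_nontrivial:
  assumes U: "ground_state_solution bc \<Omega> p q l a U" and P: "P ~= {}"
  shows "nontrivial_solution bc \<Omega> p q l a U"
proof -
  have sU: "solution U (weak_gradient \<Omega> U)" using U is_solution_imp_solution by (simp add: ground_state_solution_def)
  obtain u G where u: "solution u G" "ee u G < 0" using exists_solution_negative_energy[OF P] by blast
  have "(1 / q - 1 / p) * hh u G > 0" using u(2) unfolding ee_solution[OF u(1)] by linarith
  then have "hh u G > 0" using exponent_gap by (simp add: zero_less_mult_iff)
  then have "aa U > 0" using ground_state_hh_maximal[OF U u(1)] solution_hh_eq_aa[OF sU] by linarith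
  moreover have "aa U = 0" if z: "AE x in M. U x = 0"
  proof -
    have "aa U = (\<integral>x. 0 \<partial>M)" unfolding aa_def by (rule integral_cong_AE_M) (use z in eventually_elim, simp)
    then show ?thesis by simp
  qed
  ultimately show ?thesis using U by (auto simp: nontrivial_solution_def ground_state_solution_def)
qed

text \<open>The continuous representative is positive at every point of \<Omega>, so u = 0 holds at
  most on a null set and the implication is vacuous elsewhere.\<close>

lemma positive_solution_nonzero:
  assumes "positive_solution bc \<Omega> p q l a u"
  shows "is_solution bc \<Omega> p q l a u" "AE x in M. u x = 0 --> a x <= 0"
proof -
  obtain w where w: "is_solution bc \<Omega> p q l a u" "AE x in M. u x = w x" "\<forall>x\<in>\<Omega>. w x > 0"
    using assms by (auto simp: positive_solution_def)
  show "is_solution bc \<Omega> p q l a u" by (rule w(1))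
  have "AE x in M. x \<in> \<Omega>" by (rule AE_I2) simp
  with w(2) show "AE x in M. u x = 0 --> a x <= 0" by eventually_elim (use w(3) in force)
qed

end

theorem corollary1p2:
  fixes \<Omega> :: "'a::euclidean_space set"
    and bc :: boundary_condition
    and p q l :: real
    and a U :: "'a \<Rightarrow> real"
  assumes "smooth_bounded_domain \<Omega>"
    and "1 < q" and "q < p"
    and "continuous_on (closure \<Omega>) a"
    and "\<exists>x\<in>\<Omega>. a x > 0" and "\<exists>x\<in>\<Omega>. a x < 0"
    and "l < 0"
    and "ground_state_solution bc \<Omega> p q l a U"
  shows
    "(\<forall>u v. positive_solution bc \<Omega> p q l a u \<and> positive_solution bc \<Omega> p q l a v \<longrightarrow>
        (AE x in lebesgue_on \<Omega>. u x = v x)) \<and>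
     (\<forall>u. positive_solution bc \<Omega> p q l a u \<longrightarrow> (AE x in lebesgue_on \<Omega>. u x = U x)) \<and>
     (connected {x\<in>\<Omega>. a x > 0} \<longrightarrow>
        nontrivial_solution bc \<Omega> p q l a U \<and>
        (\<forall>u. nontrivial_solution bc \<Omega> p q l a u \<longrightarrow> (AE x in lebesgue_on \<Omega>. u x = U x)))"
proof -
  interpret elliptic_problem \<Omega> p q l a bc
    by unfold_locales (use assms in \<open>auto simp: smooth_bounded_domain_def\<close>)
  note U = assms(8)
  have pos: "AE x in lebesgue_on \<Omega>. u x = U x" if "positive_solution bc \<Omega> p q l a u" for u
    by (rule eq_ground_state[OF U positive_solution_nonzero[OF that]])
  have "AE x in lebesgue_on \<Omega>. u x = v x"
    if "positive_solution bc \<Omega> p q l a u" "positive_solution bc \<Omega> p q l a v" for u v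
    using pos[OF that(1)] pos[OF that(2)] by eventually_elim simp
  moreover have "nontrivial_solution bc \<Omega> p q l a U"
    using assms(5) by (intro ground_state_nontrivial[OF U]) (auto simp: P_def)
  moreover have "AE x in lebesgue_on \<Omega>. u x = U x"
    if con: "connected {x\<in>\<Omega>. a x > 0}" and u: "nontrivial_solution bc \<Omega> p q l a u" for u
  proof (rule eq_ground_state[OF U])
    show s: "is_solution bc \<Omega> p q l a u" using u by (simp add: nontrivial_solution_def)
    show "AE x in lebesgue_on \<Omega>. u x = 0 --> a x <= 0"
      by (rule connected_imp_positive[OF is_solution_imp_solution[OF s]])
        (use u con in \<open>auto simp: nontrivial_solution_def P_def\<close>)
  qed
  ultimately show ?thesis using pos by blast
qed

end
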